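(* Let $S=\{S_t;t\ge 0\}$ be a driftless subordinator with $S_0=0$ such that $S_t$ has a bounded density $\bar p(t,\cdot)$ for each $t>0$ and whose Lévy measure $\nu$ is infinite; put $w(x)=\nu(x,\infty)$ for $x>0$ and $E_t=\inf\{s>0:S_s>t\}$. Let $\{P^0_t;t\ge0\}$ be a uniformly bounded and strongly continuous semigroup in a Banach space $(\mathbb B,\|\cdot\|)$ (of functions on a locally compact separable metric space $E$), with infinitesimal generator $(\mathcal L,\mathcal D(\mathcal L))$. Let $T_0\in(0,\infty)$, $g\in\mathcal D(\mathcal L)$, and let $f(t,x)$ be a function on $(0,T_0]\times E$ such that for a.e. $t\in(0,T_0]$, $f(t,\cdot)\in\mathcal D(\mathcal L)$, and $$\int_0^{T_0}\|\mathcal L f(t,\cdot)\|\,dt<\infty,\qquad \|f(t,\cdot)\|\le K<\infty\ \text{ for a.e. } t\in(0,T_0].$$ Then the function $$u(t,x):=\mathbb E\left[P^0_{E_t}g(x)\right]+\mathbb E\left[\int_0^\infty \mathbf 1_{\{S_r<t\}}P^0_rf(t-S_r,\cdot)(x)\,dr\right]=\mathbb E\left[P^0_{E_t}g(x)\right]+\int_{s=0}^t\int_{r=0}^\infty P^0_rf(s,\cdot)(x)\,\bar p(r,t-s)\,dr\,ds$$ is the unique (strong) solution of $\partial^w_tu(t,x)=\mathcal Lu(t,x)+f(t,x)$ on $(0,T_0]\times E$ with $u(0,x)=g(x)$ in the following sense (that is, $u$ satisfies (i)--(iii), and any function satisfying (i)--(iii) coincides with $u(t,\cdot)$ in $\mathbb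 B$ for every $t\in(0,T_0]$): (i) $u(t,\cdot)$ is well defined as an element of $\mathbb B$ for each $t\in(0,T_0]$, $\sup_{t\in(0,T_0]}\|u(t,\cdot)\|<\infty$, $t\mapsto u(t,\cdot)$ is continuous in $(\mathbb B,\|\cdot\|)$, and $\lim_{t\to0}\|u(t,\cdot)-g\|=0$. (ii) For a.e. $t\in(0,T_0]$, $u(t,\cdot)\in\mathcal D(\mathcal L)$, so that $\mathcal Lu(t,\cdot)$ exists in $\mathbb B$, and $\int_0^{T_0}\|\mathcal Lu(t,\cdot)\|\,dt<\infty$. (iii) For every $T\in(0,T_0]$, $\int_0^Tw(T-t)(u(t,\cdot)-g(\cdot))\,dt$ is absolutely convergent in $(\mathbb B,\|\cdot\|)$ and $$\int_0^Tw(T-t)\left(u(t,\cdot)-g(\cdot)\right)dt=\int_0^T\left(f(t,\cdot)+\mathcal Lu(t,\cdot)\right)dt\quad\text{in }\mathbb B.$$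
   Context: A driftless subordinator $S$ is a nondecreasing Lévy process with $\mathbb E[e^{-\lambda S_t}]=e^{-t\phi(\lambda)}$, $\phi(\lambda)=\int_0^\infty(1-e^{-\lambda x})\,\nu(dx)$, where the Lévy measure $\nu$ on $(0,\infty)$ satisfies $\int_0^\infty\min\{1,x\}\,\nu(dx)<\infty$. $\nu$ infinite means $\nu(0,\infty)=\infty$; equivalently $w$ is unbounded. $\bar p(r,\cdot)$ is the density of $S_r$, jointly measurable in $(r,t)$. $E_t$ is the inverse subordinator. The semigroup is uniformly bounded if $\sup_{t>0}\|P_t^0\|<\infty$ (operator norm). The generalized time fractional derivative with weight $w$ is formally $\partial^w_tf(t)=\frac{d}{dt}\int_0^tw(t-s)(f(s)-f(0))\,ds$; the precise meaning of the equation is given by (i)--(iii). Integrals of $\mathbb B$-valued functions are Bochner integrals, and the functions $t\mapsto f(t,\cdot)$ and $t\mapsto\mathcal Lf(t,\cdot)$ (and likewise for candidate solutions) are understood to be strongly measurable; "absolutely convergent" means that the integral of the norm is finite. *)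

theory Defs
  imports "HOL-Probability.Probability"
begin

section \<open>Bochner integral in an arbitrary Banach space\<close>

text \<open>
  The library's \<^const>\<open>has_bochner_integral\<close>, \<^const>\<open>integrable\<close> and \<^const>\<open>lebesgue_integral\<close>
  are restricted to second countable (i.e. separable) spaces. Here the values may lie in a
  non-separable Banach space, so Borel measurability is replaced by strong measurability:
  almost everywhere limit of simple functions. The construction is otherwise the library's, and
  lemma \<open>bochner_integral_eq_lebesgue_integral\<close> below shows that the two agree where both apply.
\<close>

definition strongly_measurable :: "'a measure \<Rightarrow> ('a \<Rightarrow> 'b::real_normed_vector) \<Rightarrow> bool" where
  "strongly_measurable M f \<longleftrightarrow>
     (\<exists>s. (\<forall>i::nat. simple_function M (s i)) \<and> (AE x in M. (\<lambda>i. s i x) \<longlonglongrightarrow> f x))"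

text \<open>
  The functions below may be non-measurable on a null set; \<^const>\<open>nn_integral\<close> is insensitive to
  this by \<open>nn_integral_cong_AE\<close>.
\<close>

definition bochner_integrable :: "'a measure \<Rightarrow> ('a \<Rightarrow> 'b::real_normed_vector) \<Rightarrow> bool" where
  "bochner_integrable M f \<longleftrightarrow> strongly_measurable M f \<and> (\<integral>\<^sup>+x. ennreal (norm (f x)) \<partial>M) < \<infinity>"

definition bochner_integral :: "'a measure \<Rightarrow> ('a \<Rightarrow> 'b::real_normed_vector) \<Rightarrow> 'b" where
  "bochner_integral M f =
     (if bochner_integrable M f
      then THE I. \<exists>s. (\<forall>i::nat. Bochner_Integration.simple_bochner_integrable M (s i)) \<and>
                      (\<lambda>i. \<integral>\<^sup>+x. ennreal (norm (f x - s i x)) \<partial>M) \<longlonglongrightarrow> 0 \<and>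
                      (\<lambda>i. Bochner_Integration.simple_bochner_integral M (s i)) \<longlonglongrightarrow> I
      else 0)"

abbreviation set_strongly_measurable ::
    "'a measure \<Rightarrow> 'a set \<Rightarrow> ('a \<Rightarrow> 'b::real_normed_vector) \<Rightarrow> bool" where
  "set_strongly_measurable M A f \<equiv> strongly_measurable M (\<lambda>x. indicat_real A x *\<^sub>R f x)"

abbreviation set_bochner_integrable ::
    "'a measure \<Rightarrow> 'a set \<Rightarrow> ('a \<Rightarrow> 'b::real_normed_vector) \<Rightarrow> bool" where
  "set_bochner_integrable M A f \<equiv> bochner_integrable M (\<lambda>x. indicat_real A x *\<^sub>R f x)"

abbreviation set_bochner_integral ::
    "'a measure \<Rightarrow> 'a set \<Rightarrow> ('a \<Rightarrow> 'b::real_normed_vector) \<Rightarrow> 'b" where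
  "set_bochner_integral M A f \<equiv> bochner_integral M (\<lambda>x. indicat_real A x *\<^sub>R f x)"

lemma integrable_imp_bochner_integrable:
  fixes f :: "'a \<Rightarrow> 'b::{banach, second_countable_topology}"
  assumes "integrable M f"
  shows "bochner_integrable M f"
proof -
  have f: "f \<in> borel_measurable M" "(\<integral>\<^sup>+x. ennreal (norm (f x)) \<partial>M) < \<infinity>"
    using assms by (auto simp: integrable_iff_bounded)
  obtain s where s: "\<And>i. simple_function M (s i)" "\<And>x. x \<in> space M \<Longrightarrow> (\<lambda>i. s i x) \<longlonglongrightarrow> f x"
    using borel_measurable_implies_sequence_metric[OF f(1), of 0] by blast
  then have "strongly_measurable M f"
    unfolding strongly_measurable_def by (intro exI[of _ s]) auto
  then show ?thesis
    using f(2) by (simp add: bochner_integrable_def)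
qed

lemma bochner_integral_eq_lebesgue_integral:
  fixes f :: "'a \<Rightarrow> 'b::{banach, second_countable_topology}"
  assumes f: "integrable M f"
  shows "bochner_integral M f = integral\<^sup>L M f"
proof -
  let ?P = "\<lambda>I. \<exists>s. (\<forall>i::nat. Bochner_Integration.simple_bochner_integrable M (s i)) \<and>
                      (\<lambda>i. \<integral>\<^sup>+x. ennreal (norm (f x - s i x)) \<partial>M) \<longlonglongrightarrow> 0 \<and>
                      (\<lambda>i. Bochner_Integration.simple_bochner_integral M (s i)) \<longlonglongrightarrow> I"
  have meas: "f \<in> borel_measurable M"
    using f by auto
  have P_iff: "?P I \<longleftrightarrow> has_bochner_integral M f I" for I
    using meas by (subst has_bochner_integral.simps) auto
  have "(THE I. ?P I) = integral\<^sup>L M f"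
    unfolding P_iff
  proof (rule the_equality)
    show "has_bochner_integral M f (integral\<^sup>L M f)"
      using f by (rule has_bochner_integral_integrable)
    show "I = integral\<^sup>L M f" if "has_bochner_integral M f I" for I
      using that by (rule has_bochner_integral_integral_eq[symmetric])
  qed
  then show ?thesis
    using integrable_imp_bochner_integrable[OF f] by (simp add: bochner_integral_def)
qed

section \<open>Subordinators\<close>

text \<open>
  Processes are indexed by \<^typ>\<open>real\<close>, only the times \<open>t \<ge> 0\<close> being relevant. Stochastic
  continuity follows from right-continuity and stationarity.
\<close>

locale levy_process = prob_space M for M :: "'a measure" +
  fixes X :: "real \<Rightarrow> 'a \<Rightarrow> real"
  assumes measurable_X: "\<And>t. 0 \<le> t \<Longrightarrow> random_variable borel (X t)"
    and start: "AE \<omega> in M. X 0 \<omega> = 0"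
    and independent_increments:
      "\<And>(n::nat) (t::nat \<Rightarrow> real). 0 \<le> t 0 \<Longrightarrow> (\<And>i. i < n \<Longrightarrow> t i \<le> t (Suc i)) \<Longrightarrow>
         indep_vars (\<lambda>_. borel) (\<lambda>i \<omega>. X (t (Suc i)) \<omega> - X (t i) \<omega>) {..<n}"
    and stationary_increments:
      "\<And>s t. 0 \<le> s \<Longrightarrow> 0 \<le> t \<Longrightarrow> distr M borel (\<lambda>\<omega>. X (s + t) \<omega> - X s \<omega>) = distr M borel (X t)"
    and cadlag:
      "AE \<omega> in M. (\<forall>t\<ge>0. continuous (at_right t) (\<lambda>s. X s \<omega>)) \<and>
                  (\<forall>t>0. \<exists>l. ((\<lambda>s. X s \<omega>) \<longlongrightarrow> l) (at_left t))"

definition laplace_exponent :: "real measure \<Rightarrow> real \<Rightarrow> real" where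
  "laplace_exponent \<nu> \<theta> = (\<integral>x. (1 - exp (- \<theta> * x)) \<partial>\<nu>)"

text \<open>The Levy measure on \<open>(0,\<infinity>)\<close> is a Borel measure on \<^typ>\<open>real\<close> that does not charge \<open>(-\<infinity>,0]\<close>.\<close>

locale driftless_subordinator = levy_process M S for M :: "'a measure" and S +
  fixes \<nu> :: "real measure"
  assumes levy_measure_sets: "sets \<nu> = sets borel"
    and levy_measure_support: "emeasure \<nu> {..0} = 0"
    and levy_measure_min: "(\<integral>\<^sup>+x. ennreal (min 1 x) \<partial>\<nu>) < \<infinity>"
    and nondecreasing: "AE \<omega> in M. mono_on {0..} (\<lambda>t. S t \<omega>)"
    and laplace_transform:
      "\<And>t \<theta>. 0 \<le> t \<Longrightarrow> 0 < \<theta> \<Longrightarrow>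
         expectation (\<lambda>\<omega>. exp (- \<theta> * S t \<omega>)) = exp (- t * laplace_exponent \<nu> \<theta>)"

definition levy_tail :: "real measure \<Rightarrow> real \<Rightarrow> real" where
  "levy_tail \<nu> x = measure \<nu> {x<..}"

definition inverse_subordinator :: "(real \<Rightarrow> 'a \<Rightarrow> real) \<Rightarrow> real \<Rightarrow> 'a \<Rightarrow> real" where
  "inverse_subordinator S t \<omega> = Inf {s. 0 < s \<and> S s \<omega> > t}"

section \<open>Strongly continuous semigroups\<close>

locale C0_semigroup =
  fixes P :: "real \<Rightarrow> 'b::banach \<Rightarrow>\<^sub>L 'b"
  assumes semigroup_zero: "P 0 = id_blinfun"
    and semigroup_add: "\<And>s t. 0 \<le> s \<Longrightarrow> 0 \<le> t \<Longrightarrow> P (s + t) = P s o\<^sub>L P t"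
    and strongly_continuous: "\<And>x. ((\<lambda>t. P t x) \<longlongrightarrow> x) (at_right 0)"

definition generator_dom :: "(real \<Rightarrow> 'b::banach \<Rightarrow>\<^sub>L 'b) \<Rightarrow> 'b set" where
  "generator_dom P = {x. \<exists>y. ((\<lambda>h. (1 / h) *\<^sub>R (P h x - x)) \<longlongrightarrow> y) (at_right 0)}"

definition generator :: "(real \<Rightarrow> 'b::banach \<Rightarrow>\<^sub>L 'b) \<Rightarrow> 'b \<Rightarrow> 'b" where
  "generator P x = Lim (at_right 0) (\<lambda>h. (1 / h) *\<^sub>R (P h x - x))"

section \<open>Strong solutions of the time fractional equation\<close>

text \<open>
  \<open>strong_solution w P T\<^sub>0 g f v\<close>: \<open>v\<close> solves \<open>\<partial>\<^sup>w\<^sub>t v = \<L> v + f\<close> on \<open>(0,T\<^sub>0]\<close> with \<open>v(0) = g\<close>, where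
  \<open>\<L>\<close> is the generator of \<open>P\<close>. Only the values of \<open>v\<close> on \<open>(0,T\<^sub>0]\<close> matter. Absolute convergence of
  an integral is \<^const>\<open>bochner_integrable\<close>.
\<close>

definition strong_solution ::
  "(real \<Rightarrow> real) \<Rightarrow> (real \<Rightarrow> 'b::banach \<Rightarrow>\<^sub>L 'b) \<Rightarrow> real \<Rightarrow> 'b \<Rightarrow> (real \<Rightarrow> 'b) \<Rightarrow> (real \<Rightarrow> 'b) \<Rightarrow> bool" where
  "strong_solution w P T\<^sub>0 g f v \<longleftrightarrow>
     (bounded (v ` {0<..T\<^sub>0}) \<and> continuous_on {0<..T\<^sub>0} v \<and>
      ((\<lambda>t. norm (v t - g)) \<longlongrightarrow> 0) (at_right 0)) \<and>
     ((AE t in lborel. t \<in> {0<..T\<^sub>0} \<longrightarrow> v t \<in> generator_dom P) \<and>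
      set_bochner_integrable lborel {0<..T\<^sub>0} (\<lambda>t. generator P (v t))) \<and>
     (\<forall>T\<in>{0<..T\<^sub>0}.
        set_bochner_integrable lborel {0<..<T} (\<lambda>t. w (T - t) *\<^sub>R (v t - g)) \<and>
        set_bochner_integral lborel {0<..<T} (\<lambda>t. w (T - t) *\<^sub>R (v t - g)) =
        set_bochner_integral lborel {0<..<T} (\<lambda>t. f t + generator P (v t)))"

end

theory Submission
  imports Defs
begin

text \<open>
  Let \<open>G t = \<integral> p r t P r dr\<close> be the potential kernel of the subordinate semigroup and
  \<open>Q t x = \<E>[P (E t) x]\<close>, so that \<open>u = Q g + G * f\<close>. Uniqueness of Laplace transforms identifies the
  density of \<open>E t\<close> with the convolution of \<open>w\<close> with \<open>p r\<close> for almost every \<open>t\<close>, which gives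
  \<open>w * G = Q\<close>. Evaluating \<open>P r x - x = \<integral>s\<le>r. P s (L x) ds\<close> at \<open>r = E t\<close> and taking expectations gives
  \<open>1 * G (L x) = Q x - x\<close> on the domain of the generator \<open>L\<close>. Hence \<open>u - g = G * (f + L g)\<close>, and
  convolving with \<open>w\<close> and using both identities yields the equation
  \<open>w * (u - g) = 1 * (f + L u)\<close>. Conversely the difference \<open>d\<close> of two solutions satisfies
  \<open>w * d = 1 * L d\<close>; convolving with \<open>G\<close> gives \<open>Q * d = Q * d - 1 * d\<close>, so \<open>1 * d = 0\<close> and \<open>d = 0\<close>.
\<close>

section \<open>Pointwise limits of simple functions\<close>

text \<open>The Banach space may be non-separable, and the potential density \<open>q\<close> of the
  subordinator may be infinite at some times. Hence integrals are built from limits of simple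
  functions, and the kernel identity \<open>w * G = Q\<close> is obtained only for almost every
  time. It is applied to vectors \<open>h s\<close> that vary with the integration variable, so its
  null set must not depend on the vector; this works because the null set comes from the law of
  \<open>E \<tau>\<close> alone. The scalar origin of the identity is a cancellation of Laplace
  transforms: with \<phi> the Laplace exponent, \<open>w\<close> has transform
  \<open>\<phi>(\<theta>) / \<theta>\<close>, \<open>q\<close> has
  \<open>1 / \<phi>(\<theta>)\<close>, and the product \<open>1 / \<theta>\<close> belongs to the
  constant one. The interchanges of integrals with \<open>G\<close> rest on local integrability of
  \<open>q\<close> and on \<open>w * q \<le> 1\<close> almost everywhere. The laws of
  \<open>S\<close> reach \<open>E\<close> because, up to null sets, \<open>{E t < r}\<close> lies in
  \<open>{t < S r}\<close> and \<open>{t < S r}\<close> lies in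
  \<open>{E t \<le> r}\<close>.\<close>

text \<open>The everywhere version of \<open>strongly_measurable\<close>. Unlike the latter it is stable under composition
  with measurable maps, also if preimages of null sets are not null.\<close>

definition ps_measurable :: "'a measure \<Rightarrow> ('a \<Rightarrow> 'b::metric_space) \<Rightarrow> bool" where
  "ps_measurable M f \<longleftrightarrow>
     (\<exists>s. (\<forall>i::nat. simple_function M (s i)) \<and> (\<forall>x\<in>space M. (\<lambda>i. s i x) \<longlonglongrightarrow> f x))"

lemma ps_measurable_borel:
  assumes "ps_measurable M f"
  shows "f \<in> borel_measurable M"
proof -
  obtain s where s: "\<And>i. simple_function M (s i)" "\<And>x. x \<in> space M \<Longrightarrow> (\<lambda>i::nat. s i x) \<longlonglongrightarrow> f x"
    using assms unfolding ps_measurable_def by blast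
  show ?thesis
    by (rule borel_measurable_LIMSEQ_metric[OF borel_measurable_simple_function[OF s(1)] s(2)])
qed

text \<open>The values of all approximating simple functions form a countable set. With the converse
  \<open>ps_measurableI_separable\<close> this is a Pettis-type characterisation, by which closure
  under limits needs no diagonal sequence.\<close>

lemma ps_measurable_separable:
  assumes "ps_measurable M f"
  obtains D where "countable D" "f ` space M \<subseteq> closure D"
proof -
  obtain s where s: "\<And>i. simple_function M (s i)" "\<And>x. x \<in> space M \<Longrightarrow> (\<lambda>i::nat. s i x) \<longlonglongrightarrow> f x"
    using assms unfolding ps_measurable_def by blast
  show ?thesis
  proof
    show "countable (\<Union>i. s i ` space M)"
      using s(1) by (auto intro: countable_finite simp: simple_function_def)
    show "f ` space M \<subseteq> closure (\<Union>i. s i ` space M)"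
    proof
      fix y assume "y \<in> f ` space M"
      then obtain x where x: "x \<in> space M" "y = f x" by auto
      have "s i x \<in> (\<Union>i. s i ` space M)" for i
        using x(1) by auto
      then show "y \<in> closure (\<Union>i. s i ` space M)"
        unfolding closure_sequential using s(2)[OF x(1)] x(2) by (intro exI[of _ "\<lambda>i. s i x"]) blast
    qed
  qed
qed

text \<open>Each value is approximated by the nearest among the first finitely many members of an
  enumeration of \<open>D\<close>. Only the range has to be separable, not the whole space.\<close>

lemma ps_measurableI_separable:
  assumes f[measurable]: "f \<in> borel_measurable M" and D: "countable D" "f ` space M \<subseteq> closure D"
  shows "ps_measurable M f"
proof (cases "space M = {}")
  case True
  then show ?thesis
    unfolding ps_measurable_def by (intro exI[of _ "\<lambda>_ _. undefined"]) auto
next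
  case False
  then have ne: "D \<noteq> {}"
    using D(2) by auto
  define d where "d = from_nat_into D"
  have d: "range d = D"
    unfolding d_def using ne D(1) by (rule range_from_nat_into)
  \<comment> \<open>\<open>m i x\<close> is the least distance from \<open>f x\<close> to
    \<open>d 0, ..., d i\<close>, and \<open>s i x\<close> is the first member that attains it.
    Carrying the minimum along in a recursion makes measurability a plain induction.\<close>
  define m where "m = rec_nat (\<lambda>x. dist (f x) (d 0)) (\<lambda>i r x. min (r x) (dist (f x) (d (Suc i))))"
  define s where "s = rec_nat (\<lambda>x. d 0) (\<lambda>i r x. if dist (f x) (d (Suc i)) < m i x then d (Suc i) else r x)"
  have [simp]: "m 0 x = dist (f x) (d 0)" "m (Suc i) x = min (m i x) (dist (f x) (d (Suc i)))" for i x
    by (simp_all add: m_def)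
  have [simp]: "s 0 x = d 0" "s (Suc i) x = (if dist (f x) (d (Suc i)) < m i x then d (Suc i) else s i x)" for i x
    by (simp_all add: s_def)
  have dist_meas[measurable]: "(\<lambda>x. dist (f x) c) \<in> borel_measurable M" for c
    by (rule measurable_compose[OF f]) (intro borel_measurable_continuous_onI continuous_intros)
  have m_meas[measurable]: "(\<lambda>x. m i x) \<in> borel_measurable M" for i
    by (induction i) simp_all
  have m: "m i x = dist (f x) (s i x)" for i x
    by (induction i) auto
  have m_le: "j \<le> i \<Longrightarrow> m i x \<le> dist (f x) (d j)" for i j x
  proof (induction i)
    case (Suc i)
    then show ?case by (cases "j = Suc i") (auto simp: min.coboundedI1)
  qed simp
  have "simple_function M (s i)" for i
  proof (induction i)
    case 0
    have "s 0 = (\<lambda>_. d 0)" by auto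
    then show ?case by simp
  next
    case (Suc i)
    have "simple_function M (\<lambda>x. if dist (f x) (d (Suc i)) < m i x then d (Suc i) else s i x)"
      using Suc by (intro simple_function_If) auto
    also have "(\<lambda>x. if dist (f x) (d (Suc i)) < m i x then d (Suc i) else s i x) = s (Suc i)"
      by (rule ext) simp
    finally show ?case .
  qed
  moreover have "(\<lambda>i. s i x) \<longlonglongrightarrow> f x" if x: "x \<in> space M" for x
  proof (rule tendstoI)
    fix e :: real assume "0 < e"
    then obtain y where "y \<in> D" "dist y (f x) < e"
      using D(2) x by (auto simp: closure_approachable subset_eq)
    then obtain j where "dist (d j) (f x) < e"
      using d by auto
    then have "dist (s i x) (f x) < e" if "j \<le> i" for i
      using m_le[OF that, of x] m[of i x] by (simp add: dist_commute)
    then show "\<forall>\<^sub>F i in sequentially. dist (s i x) (f x) < e"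
      by (auto simp: eventually_sequentially)
  qed
  ultimately show ?thesis
    unfolding ps_measurable_def by blast
qed

lemma ps_measurable_simple: "simple_function M f \<Longrightarrow> ps_measurable M f"
  unfolding ps_measurable_def by (intro exI[of _ "\<lambda>_. f"]) auto

lemma ps_measurable_const: "ps_measurable M (\<lambda>_. c)"
  by (simp add: ps_measurable_simple)

lemma ps_measurable_cong:
  "(\<And>x. x \<in> space M \<Longrightarrow> f x = g x) \<Longrightarrow> ps_measurable M f \<longleftrightarrow> ps_measurable M g"
  unfolding ps_measurable_def by simp

lemma ps_measurable_cong_sets:
  assumes "sets M = sets N" shows "ps_measurable M f \<longleftrightarrow> ps_measurable N f"
  using sets_eq_imp_space_eq[OF assms] assms
  by (simp add: ps_measurable_def simple_function_def)

text \<open>Countable sets whose closures contain the ranges of the \<open>u i\<close> have a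
  countable union, and its closure contains the limits; Borel measurability passes to pointwise
  limits as well.\<close>

lemma ps_measurable_LIMSEQ:
  assumes u: "\<And>i::nat. ps_measurable M (u i)" and lim: "\<And>x. x \<in> space M \<Longrightarrow> (\<lambda>i. u i x) \<longlonglongrightarrow> f x"
  shows "ps_measurable M f"
proof -
  have "\<exists>D. countable D \<and> u i ` space M \<subseteq> closure D" for i
    by (rule ps_measurable_separable[OF u[of i]]) blast
  then obtain D where D: "\<And>i. countable (D i)" "\<And>i. u i ` space M \<subseteq> closure (D i)"
    by metis
  have "f x \<in> closure (\<Union>i. D i)" if x: "x \<in> space M" for x
  proof (rule closed_sequentially[OF closed_closure _ lim[OF x]])
    fix i
    have "closure (D i) \<subseteq> closure (\<Union>i. D i)"
      by (intro closure_mono) auto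
    then show "u i x \<in> closure (\<Union>i. D i)"
      using D(2)[of i] x by auto
  qed
  then have "f ` space M \<subseteq> closure (\<Union>i. D i)" by blast
  moreover have "countable (\<Union>i. D i)"
    using D(1) by blast
  moreover have "f \<in> borel_measurable M"
    by (rule borel_measurable_LIMSEQ_metric[OF ps_measurable_borel[OF u] lim])
  ultimately show ?thesis
    using ps_measurableI_separable by blast
qed

lemma ps_measurable_compose:
  assumes f: "ps_measurable M f" and g: "g \<in> measurable N M"
  shows "ps_measurable N (\<lambda>x. f (g x))"
proof -
  obtain s where s: "\<And>i. simple_function M (s i)" "\<And>x. x \<in> space M \<Longrightarrow> (\<lambda>i::nat. s i x) \<longlonglongrightarrow> f x"
    using f unfolding ps_measurable_def by blast
  have "simple_function N (\<lambda>x. s i (g x))" for i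
    using simple_function_comp[OF g s(1)] by (simp add: comp_def)
  then show ?thesis
    unfolding ps_measurable_def using s(2) measurable_space[OF g]
    by (intro exI[of _ "\<lambda>i x. s i (g x)"]) auto
qed

lemma ps_measurable_continuous:
  assumes f: "ps_measurable M f" and h: "continuous_on UNIV h"
  shows "ps_measurable M (\<lambda>x. h (f x))"
proof -
  obtain s where s: "\<And>i. simple_function M (s i)" "\<And>x. x \<in> space M \<Longrightarrow> (\<lambda>i::nat. s i x) \<longlonglongrightarrow> f x"
    using f unfolding ps_measurable_def by blast
  have "(\<lambda>i. h (s i x)) \<longlonglongrightarrow> h (f x)" if "x \<in> space M" for x
    using continuous_on_tendsto_compose[OF h s(2)[OF that]] by simp
  then show ?thesis
    unfolding ps_measurable_def using simple_function_compose1[OF s(1), of h]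
    by (intro exI[of _ "\<lambda>i x. h (s i x)"]) auto
qed

text \<open>On a non-separable space the Borel sets of a product need not be generated by
  rectangles, so sums of Borel functions may fail to be Borel. Pairs of simple functions are simple,
  which avoids the problem.\<close>

lemma ps_measurable_Pair:
  assumes f: "ps_measurable M f" and g: "ps_measurable M g"
  shows "ps_measurable M (\<lambda>x. (f x, g x))"
proof -
  obtain s where s: "\<And>i. simple_function M (s i)" "\<And>x. x \<in> space M \<Longrightarrow> (\<lambda>i::nat. s i x) \<longlonglongrightarrow> f x"
    using f unfolding ps_measurable_def by blast
  obtain t where t: "\<And>i. simple_function M (t i)" "\<And>x. x \<in> space M \<Longrightarrow> (\<lambda>i::nat. t i x) \<longlonglongrightarrow> g x"
    using g unfolding ps_measurable_def by blast
  show ?thesis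
    unfolding ps_measurable_def using s t
    by (intro exI[of _ "\<lambda>i x. (s i x, t i x)"]) (auto intro!: tendsto_Pair)
qed

lemma ps_measurable_continuous2:
  assumes "ps_measurable M f" "ps_measurable M g" and h: "continuous_on UNIV (\<lambda>(x, y). h x y)"
  shows "ps_measurable M (\<lambda>x. h (f x) (g x))"
  using ps_measurable_continuous[OF ps_measurable_Pair[OF assms(1,2)] h] by simp

lemma ps_measurable_add:
  fixes f g :: "_ \<Rightarrow> 'b::real_normed_vector"
  shows "ps_measurable M f \<Longrightarrow> ps_measurable M g \<Longrightarrow> ps_measurable M (\<lambda>x. f x + g x)"
  by (rule ps_measurable_continuous2[where h = "(+)"]) (auto simp: case_prod_beta intro!: continuous_intros)

lemma ps_measurable_diff:
  fixes f g :: "_ \<Rightarrow> 'b::real_normed_vector"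
  shows "ps_measurable M f \<Longrightarrow> ps_measurable M g \<Longrightarrow> ps_measurable M (\<lambda>x. f x - g x)"
  by (rule ps_measurable_continuous2[where h = "(-)"]) (auto simp: case_prod_beta intro!: continuous_intros)

lemma ps_measurable_sum:
  fixes f :: "_ \<Rightarrow> _ \<Rightarrow> 'b::real_normed_vector"
  shows "(\<And>i. i \<in> I \<Longrightarrow> ps_measurable M (f i)) \<Longrightarrow> ps_measurable M (\<lambda>x. \<Sum>i\<in>I. f i x)"
  by (induction I rule: infinite_finite_induct) (auto intro: ps_measurable_add ps_measurable_const)

lemma ps_measurable_second_countable:
  fixes f :: "'a \<Rightarrow> 'b::{metric_space, second_countable_topology}"
  assumes "f \<in> borel_measurable M"
  shows "ps_measurable M f"
  using borel_measurable_implies_sequence_metric[OF assms, of undefined]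
  unfolding ps_measurable_def by blast

lemma ps_measurable_scaleR:
  fixes g :: "_ \<Rightarrow> 'b::real_normed_vector"
  shows "f \<in> borel_measurable M \<Longrightarrow> ps_measurable M g \<Longrightarrow> ps_measurable M (\<lambda>x. f x *\<^sub>R g x)"
  by (rule ps_measurable_continuous2[where h = "(*\<^sub>R)"])
     (auto simp: case_prod_beta intro!: continuous_intros ps_measurable_second_countable)

lemma ps_measurable_norm:
  fixes f :: "_ \<Rightarrow> 'b::real_normed_vector"
  assumes "ps_measurable M f"
  shows "(\<lambda>x. norm (f x)) \<in> borel_measurable M"
  by (rule measurable_compose[OF ps_measurable_borel[OF assms]])
     (intro borel_measurable_continuous_onI continuous_intros)

text \<open>The approximants are set to 0 wherever their norm exceeds \<open>2 * norm (f x)\<close>.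
  If \<open>f x \<noteq> 0\<close>, the factor 2 leaves strict room and the cut is eventually
  inactive; if \<open>f x = 0\<close>, it forces the value 0. The bound lets integrability pass from
  \<open>f\<close> to the approximants.\<close>

lemma ps_measurable_dominated:
  fixes f :: "_ \<Rightarrow> 'b::real_normed_vector"
  assumes "ps_measurable M f"
  obtains s where "\<And>i::nat. simple_function M (s i)" "\<And>x. x \<in> space M \<Longrightarrow> (\<lambda>i. s i x) \<longlonglongrightarrow> f x"
    "\<And>i x. x \<in> space M \<Longrightarrow> norm (s i x) \<le> 2 * norm (f x)"
proof -
  note [measurable] = ps_measurable_norm[OF assms]
  obtain s where s: "\<And>i. simple_function M (s i)" "\<And>x. x \<in> space M \<Longrightarrow> (\<lambda>i::nat. s i x) \<longlonglongrightarrow> f x"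
    using assms unfolding ps_measurable_def by blast
  have [measurable]: "(\<lambda>x. norm (s i x)) \<in> borel_measurable M" for i
    using ps_measurable_norm[OF ps_measurable_simple[OF s(1)]] .
  define t where "t i x = (if norm (s i x) \<le> 2 * norm (f x) then s i x else 0)" for i x
  have "simple_function M (t i)" for i
    unfolding t_def by (intro simple_function_If s simple_function_const) measurable
  moreover have "(\<lambda>i. t i x) \<longlonglongrightarrow> f x" if x: "x \<in> space M" for x
  proof (cases "f x = 0")
    case True
    then have "t i x = 0" for i by (auto simp: t_def)
    then show ?thesis using True by simp
  next
    case False
    then have "norm (f x) < 2 * norm (f x)" by simp
    from order_tendstoD(2)[OF tendsto_norm[OF s(2)[OF x]] this]
    have "\<forall>\<^sub>F i in sequentially. t i x = s i x"
      by eventually_elim (auto simp: t_def)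
    then show ?thesis
      using s(2)[OF x] by (simp add: filterlim_cong)
  qed
  moreover have "norm (t i x) \<le> 2 * norm (f x)" for i x
    by (auto simp: t_def)
  ultimately show ?thesis by (intro that)
qed

text \<open>Only the orbits \<open>P x y\<close> are assumed measurable, as measurability in
  operator norm is not to be expected of a strongly continuous semigroup. For simple
  \<open>f\<close> the value is a finite sum of orbits over the level sets of \<open>f\<close>;
  continuity of each \<open>P x\<close> handles the limit.\<close>

lemma ps_measurable_blinfun_apply:
  fixes P :: "'a \<Rightarrow> 'b::real_normed_vector \<Rightarrow>\<^sub>L 'c::real_normed_vector"
  assumes P: "\<And>y. ps_measurable M (\<lambda>x. P x y)" and f: "ps_measurable M f"
  shows "ps_measurable M (\<lambda>x. P x (f x))"
proof -
  obtain s where s: "\<And>i. simple_function M (s i)" "\<And>x. x \<in> space M \<Longrightarrow> (\<lambda>i::nat. s i x) \<longlonglongrightarrow> f x"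
    using f unfolding ps_measurable_def by blast
  have "ps_measurable M (\<lambda>x. P x (s i x))" for i
  proof -
    have fin: "finite (s i ` space M)" using s(1) by (auto simp: simple_function_def)
    have "ps_measurable M (\<lambda>x. \<Sum>y\<in>s i ` space M. indicat_real (s i -` {y} \<inter> space M) x *\<^sub>R P x y)"
      using s(1) by (intro ps_measurable_sum ps_measurable_scaleR P borel_measurable_indicator) (auto simp: simple_function_def)
    also have "?this \<longleftrightarrow> ?thesis"
    proof (rule ps_measurable_cong)
      fix x assume x: "x \<in> space M"
      have "(\<Sum>y\<in>s i ` space M. indicat_real (s i -` {y} \<inter> space M) x *\<^sub>R P x y) =
        (\<Sum>y\<in>s i ` space M. if y = s i x then P x y else 0)"
        using x by (intro sum.cong) (auto simp: indicator_def)
      also have "\<dots> = P x (s i x)"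
        using fin x by (subst sum.delta) auto
      finally show "(\<Sum>y\<in>s i ` space M. indicat_real (s i -` {y} \<inter> space M) x *\<^sub>R P x y) = P x (s i x)" .
    qed
    finally show ?thesis .
  qed
  then show ?thesis
    by (rule ps_measurable_LIMSEQ) (auto intro!: tendsto_intros s(2))
qed

section \<open>Linearity of the Bochner integral\<close>

text \<open>The exceptional set is enlarged to a measurable null set on which the function is
  redefined as 0. Proofs can thus use the everywhere notion while the definitions speak of the
  almost everywhere one.\<close>

lemma strongly_measurable_iff_ps:
  "strongly_measurable M f \<longleftrightarrow> (\<exists>f'. ps_measurable M f' \<and> (AE x in M. f x = f' x))"
proof
  assume "strongly_measurable M f"
  then obtain s where s: "\<And>i. simple_function M (s i)" "AE x in M. (\<lambda>i::nat. s i x) \<longlonglongrightarrow> f x"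
    unfolding strongly_measurable_def by blast
  from AE_E[OF s(2)] obtain N where N: "{x \<in> space M. \<not> (\<lambda>i. s i x) \<longlonglongrightarrow> f x} \<subseteq> N" "emeasure M N = 0" "N \<in> sets M"
    by blast
  define f' where "f' x = (if x \<in> N then 0 else f x)" for x
  have "ps_measurable M f'"
    unfolding ps_measurable_def
  proof (intro exI[of _ "\<lambda>i x. if x \<in> N then 0 else s i x"] conjI allI ballI)
    show "simple_function M (\<lambda>x. if x \<in> N then 0 else s i x)" for i
      using N(3) s(1) by (intro simple_function_If simple_function_const) auto
    show "(\<lambda>i. if x \<in> N then 0 else s i x) \<longlonglongrightarrow> f' x" if "x \<in> space M" for x
      using N(1) that by (auto simp: f'_def)
  qed
  moreover have "AE x in M. f x = f' x"
    using N(2,3) by (intro AE_I[of _ _ N]) (auto simp: f'_def)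
  ultimately show "\<exists>f'. ps_measurable M f' \<and> (AE x in M. f x = f' x)"
    by blast
next
  assume "\<exists>f'. ps_measurable M f' \<and> (AE x in M. f x = f' x)"
  then obtain f' where f': "ps_measurable M f'" "AE x in M. f x = f' x" by blast
  from f'(1) obtain s where s: "\<And>i. simple_function M (s i)" "\<And>x. x \<in> space M \<Longrightarrow> (\<lambda>i::nat. s i x) \<longlonglongrightarrow> f' x"
    unfolding ps_measurable_def by blast
  have "AE x in M. (\<lambda>i. s i x) \<longlonglongrightarrow> f x"
    using f'(2) AE_space by eventually_elim (simp add: s(2))
  then show "strongly_measurable M f"
    unfolding strongly_measurable_def using s(1) by blast
qed

lemma ps_imp_strongly_measurable: "ps_measurable M f \<Longrightarrow> strongly_measurable M f"
  unfolding strongly_measurable_iff_ps by blast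

lemma strongly_measurable_cong_AE:
  assumes "AE x in M. f x = g x"
  shows "strongly_measurable M f \<longleftrightarrow> strongly_measurable M g"
proof -
  have "(AE x in M. f x = h x) \<longleftrightarrow> (AE x in M. g x = h x)" for h
    using assms by (intro iffI; elim AE_mp; intro AE_I2) auto
  then show ?thesis
    unfolding strongly_measurable_iff_ps by simp
qed

text \<open>The countably many representatives and the limit relation share one measurable null set,
  off which the everywhere version applies.\<close>

lemma strongly_measurable_LIMSEQ:
  assumes u: "\<And>i::nat. strongly_measurable M (u i)" and lim: "AE x in M. (\<lambda>i. u i x) \<longlonglongrightarrow> f x"
  shows "strongly_measurable M f"
proof -
  obtain v where v: "\<And>i. ps_measurable M (v i)" "\<And>i. AE x in M. u i x = v i x"
    using u unfolding strongly_measurable_iff_ps by metis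
  have "AE x in M. \<forall>i. u i x = v i x"
    using v(2) by (simp add: AE_all_countable)
  with lim have "AE x in M. (\<lambda>i. v i x) \<longlonglongrightarrow> f x"
    by eventually_elim simp
  from AE_E[OF this] obtain N where N: "{x \<in> space M. \<not> (\<lambda>i. v i x) \<longlonglongrightarrow> f x} \<subseteq> N" "emeasure M N = 0" "N \<in> sets M"
    by blast
  have "ps_measurable M (\<lambda>x. indicat_real (space M - N) x *\<^sub>R f x)"
  proof (rule ps_measurable_LIMSEQ)
    show "ps_measurable M (\<lambda>x. indicat_real (space M - N) x *\<^sub>R v i x)" for i
      using N(3) v(1) by (intro ps_measurable_scaleR borel_measurable_indicator) auto
    show "(\<lambda>i. indicat_real (space M - N) x *\<^sub>R v i x) \<longlonglongrightarrow> indicat_real (space M - N) x *\<^sub>R f x" if "x \<in> space M" for x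
      using N(1) that by (cases "x \<in> N") auto
  qed
  moreover have "AE x in M. f x = indicat_real (space M - N) x *\<^sub>R f x"
    using N(2,3) by (intro AE_I[of _ _ N]) (auto simp: indicator_def)
  ultimately show ?thesis
    unfolding strongly_measurable_iff_ps by blast
qed

lemma bochner_integrable_cong_AE:
  assumes "AE x in M. f x = g x"
  shows "bochner_integrable M f \<longleftrightarrow> bochner_integrable M g"
proof -
  have "(\<integral>\<^sup>+x. ennreal (norm (f x)) \<partial>M) = (\<integral>\<^sup>+x. ennreal (norm (g x)) \<partial>M)"
    using assms by (intro nn_integral_cong_AE) auto
  then show ?thesis
    unfolding bochner_integrable_def using strongly_measurable_cong_AE[OF assms] by simp
qed

lemma bochner_integral_cong_AE:
  assumes "AE x in M. f x = g x"
  shows "bochner_integral M f = bochner_integral M g"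
proof -
  have "(\<integral>\<^sup>+x. ennreal (norm (f x - s x)) \<partial>M) = (\<integral>\<^sup>+x. ennreal (norm (g x - s x)) \<partial>M)" for s
    using assms by (intro nn_integral_cong_AE) auto
  then show ?thesis
    unfolding bochner_integral_def using bochner_integrable_cong_AE[OF assms] by simp
qed

lemma bochner_integral_cong:
  "(\<And>x. x \<in> space M \<Longrightarrow> f x = g x) \<Longrightarrow> bochner_integral M f = bochner_integral M g"
  by (intro bochner_integral_cong_AE AE_I2)

lemma bochner_integrableE_ps:
  assumes "bochner_integrable M f"
  obtains f' where "ps_measurable M f'" "AE x in M. f x = f' x"
    "(\<integral>\<^sup>+x. ennreal (norm (f' x)) \<partial>M) < \<infinity>" "bochner_integrable M f'" "bochner_integral M f' = bochner_integral M f"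
proof -
  obtain f' where f': "ps_measurable M f'" "AE x in M. f x = f' x"
    using assms unfolding bochner_integrable_def strongly_measurable_iff_ps by blast
  have "bochner_integrable M f'"
    using assms bochner_integrable_cong_AE[OF f'(2)] by simp
  then show ?thesis
    using that[OF f'] bochner_integral_cong_AE[OF f'(2)] by (auto simp: bochner_integrable_def)
qed

lemma bochner_integrableI_ps:
  "ps_measurable M f \<Longrightarrow> (\<integral>\<^sup>+x. ennreal (norm (f x)) \<partial>M) < \<infinity> \<Longrightarrow> bochner_integrable M f"
  by (simp add: bochner_integrable_def ps_imp_strongly_measurable)

section \<open>Existence and uniqueness of the limit that defines the integral\<close>

lemma ennreal_le_add: "a \<le> b + c \<Longrightarrow> 0 \<le> b \<Longrightarrow> 0 \<le> c \<Longrightarrow> ennreal a \<le> ennreal b + ennreal c"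
  by (simp add: ennreal_leI flip: ennreal_plus)

text \<open>Triangle inequality through \<open>f\<close>. Applied to two approximations of the same
  \<open>f\<close> it yields both uniqueness of the limit of the integrals and their Cauchy
  property.\<close>

lemma simple_bochner_integral_norm_diff_le:
  assumes f: "ps_measurable M f"
  assumes s: "Bochner_Integration.simple_bochner_integrable M s" and t: "Bochner_Integration.simple_bochner_integrable M t"
  shows "ennreal (norm (Bochner_Integration.simple_bochner_integral M s - Bochner_Integration.simple_bochner_integral M t)) \<le>
    (\<integral>\<^sup>+ x. norm (f x - s x) \<partial>M) + (\<integral>\<^sup>+ x. norm (f x - t x) \<partial>M)"
    (is "ennreal (norm (?s - ?t)) \<le> ?S + ?T")
proof -
  have sf: "simple_function M s" "simple_function M t"
    using s t by (auto elim: Bochner_Integration.simple_bochner_integrable.cases)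
  have [measurable]: "(\<lambda>x. norm (f x - s x)) \<in> borel_measurable M" "(\<lambda>x. norm (f x - t x)) \<in> borel_measurable M"
    by (intro ps_measurable_norm ps_measurable_diff f ps_measurable_simple sf)+
  have "ennreal (norm (?s - ?t)) = norm (Bochner_Integration.simple_bochner_integral M (\<lambda>x. s x - t x))"
    using s t by (subst simple_bochner_integral_diff) auto
  also have "\<dots> \<le> Bochner_Integration.simple_bochner_integral M (\<lambda>x. norm (s x - t x))"
    using simple_bochner_integrable_compose2[of "(-)" M "s" "t"] s t
    by (auto intro!: simple_bochner_integral_norm_bound)
  also have "\<dots> = (\<integral>\<^sup>+x. norm (s x - t x) \<partial>M)"
    using simple_bochner_integrable_compose2[of "\<lambda>x y. norm (x - y)" M "s" "t"] s t
    by (auto intro!: simple_bochner_integral_eq_nn_integral)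
  also have "\<dots> \<le> (\<integral>\<^sup>+x. ennreal (norm (f x - s x)) + ennreal (norm (f x - t x)) \<partial>M)"
  proof (rule nn_integral_mono)
    fix x
    have "norm (s x - t x) \<le> norm (f x - s x) + norm (f x - t x)"
      using norm_triangle_ineq4[of "f x - t x" "f x - s x"] by simp
    then show "ennreal (norm (s x - t x)) \<le> ennreal (norm (f x - s x)) + ennreal (norm (f x - t x))"
      by (intro ennreal_le_add norm_ge_zero)
  qed
  also have "\<dots> = ?S + ?T"
   by (rule nn_integral_add) auto
  finally show ?thesis .
qed

text \<open>The integrals of two approximating sequences have vanishing distance, so the definite
  description in \<open>bochner_integral\<close> denotes. Integrals are evaluated from an
  approximation by this rule.\<close>

lemma bochner_integral_eqI:
  fixes f :: "'a \<Rightarrow> 'b::real_normed_vector"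
  assumes f: "ps_measurable M f" and fin: "(\<integral>\<^sup>+x. ennreal (norm (f x)) \<partial>M) < \<infinity>"
    and s: "\<And>i. Bochner_Integration.simple_bochner_integrable M (s i)" "(\<lambda>i. \<integral>\<^sup>+x. ennreal (norm (f x - s i x)) \<partial>M) \<longlonglongrightarrow> 0"
      "(\<lambda>i. Bochner_Integration.simple_bochner_integral M (s i)) \<longlonglongrightarrow> I"
  shows "bochner_integral M f = I"
proof -
  have "(THE I. \<exists>s. (\<forall>i::nat. Bochner_Integration.simple_bochner_integrable M (s i)) \<and>
                      (\<lambda>i. \<integral>\<^sup>+x. ennreal (norm (f x - s i x)) \<partial>M) \<longlonglongrightarrow> 0 \<and>
                      (\<lambda>i. Bochner_Integration.simple_bochner_integral M (s i)) \<longlonglongrightarrow> I) = I"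
  proof (rule the_equality)
    show "\<exists>s. (\<forall>i::nat. Bochner_Integration.simple_bochner_integrable M (s i)) \<and>
                      (\<lambda>i. \<integral>\<^sup>+x. ennreal (norm (f x - s i x)) \<partial>M) \<longlonglongrightarrow> 0 \<and>
                      (\<lambda>i. Bochner_Integration.simple_bochner_integral M (s i)) \<longlonglongrightarrow> I"
      using s by blast
  next
    fix J assume "\<exists>s. (\<forall>i::nat. Bochner_Integration.simple_bochner_integrable M (s i)) \<and>
                      (\<lambda>i. \<integral>\<^sup>+x. ennreal (norm (f x - s i x)) \<partial>M) \<longlonglongrightarrow> 0 \<and>
                      (\<lambda>i. Bochner_Integration.simple_bochner_integral M (s i)) \<longlonglongrightarrow> J"
    then obtain t where t: "\<And>i::nat. Bochner_Integration.simple_bochner_integrable M (t i)"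
      "(\<lambda>i. \<integral>\<^sup>+x. ennreal (norm (f x - t i x)) \<partial>M) \<longlonglongrightarrow> 0"
      "(\<lambda>i. Bochner_Integration.simple_bochner_integral M (t i)) \<longlonglongrightarrow> J" by blast
    have "(\<lambda>i. (\<integral>\<^sup>+x. ennreal (norm (f x - t i x)) \<partial>M) + (\<integral>\<^sup>+x. ennreal (norm (f x - s i x)) \<partial>M)) \<longlonglongrightarrow> 0 + 0"
      by (intro tendsto_add t s)
    then have *: "(\<lambda>i. (\<integral>\<^sup>+x. ennreal (norm (f x - t i x)) \<partial>M) + (\<integral>\<^sup>+x. ennreal (norm (f x - s i x)) \<partial>M)) \<longlonglongrightarrow> 0"
      by simp
    have "(\<lambda>i. ennreal (norm (Bochner_Integration.simple_bochner_integral M (t i) - Bochner_Integration.simple_bochner_integral M (s i)))) \<longlonglongrightarrow> 0"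
      by (rule tendsto_sandwich[OF _ _ tendsto_const *])
         (auto intro!: always_eventually simple_bochner_integral_norm_diff_le f s t)
    moreover have "(\<lambda>i. ennreal (norm (Bochner_Integration.simple_bochner_integral M (t i) - Bochner_Integration.simple_bochner_integral M (s i)))) \<longlonglongrightarrow> ennreal (norm (J - I))"
      by (intro tendsto_ennrealI tendsto_norm tendsto_diff t s)
    ultimately have "ennreal (norm (J - I)) = 0"
      using LIMSEQ_unique by blast
    then show "J = I" by simp
  qed
  then show ?thesis
    using bochner_integrableI_ps[OF f fin] by (simp add: bochner_integral_def)
qed

text \<open>The limit inherits the bound \<open>w\<close>, so the differences are dominated by
  \<open>2 * w\<close>.\<close>

lemma nn_integral_dominated_diff:
  fixes f :: "'a \<Rightarrow> 'b::real_normed_vector"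
  assumes f: "ps_measurable M f" and F: "\<And>i::nat. ps_measurable M (F i)"
    and w: "w \<in> borel_measurable M" "(\<integral>\<^sup>+x. w x \<partial>M) < \<infinity>"
    and bound: "\<And>i. AE x in M. ennreal (norm (F i x)) \<le> w x" and lim: "AE x in M. (\<lambda>i. F i x) \<longlonglongrightarrow> f x"
  shows "(\<lambda>i. \<integral>\<^sup>+x. ennreal (norm (f x - F i x)) \<partial>M) \<longlonglongrightarrow> 0"
proof -
  have all: "AE x in M. \<forall>i. ennreal (norm (F i x)) \<le> w x"
    using bound by (simp add: AE_all_countable)
  have f_le: "AE x in M. ennreal (norm (f x)) \<le> w x"
    using lim all
  proof eventually_elim
    case (elim x)
    have "(\<lambda>i. ennreal (norm (F i x))) \<longlonglongrightarrow> ennreal (norm (f x))"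
      using elim(1) by (intro tendsto_ennrealI tendsto_norm)
    from LIMSEQ_le_const2[OF this] elim(2) show ?case
      by blast
  qed
  have "(\<lambda>i. \<integral>\<^sup>+x. ennreal (norm (f x - F i x)) \<partial>M) \<longlonglongrightarrow> (\<integral>\<^sup>+x. 0 \<partial>M)"
  proof (rule nn_integral_dominated_convergence[where w = "\<lambda>x. 2 * w x"])
    show "(\<lambda>x. ennreal (norm (f x - F i x))) \<in> borel_measurable M" for i
      by (intro measurable_compose[OF ps_measurable_norm[OF ps_measurable_diff[OF f F]]] measurable_ennreal)
    show "AE x in M. ennreal (norm (f x - F i x)) \<le> 2 * w x" for i
      using f_le bound[of i]
    proof eventually_elim
      case (elim x)
      have "ennreal (norm (f x - F i x)) \<le> ennreal (norm (f x)) + ennreal (norm (F i x))"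
        by (intro ennreal_le_add norm_ge_zero norm_triangle_ineq4)
      also have "\<dots> \<le> w x + w x"
        using elim by (intro add_mono)
      finally show ?case by (simp add: mult_2)
    qed
    show "AE x in M. (\<lambda>i. ennreal (norm (f x - F i x))) \<longlonglongrightarrow> 0"
      using lim
    proof eventually_elim
      case (elim x)
      have "(\<lambda>i. ennreal (norm (f x - F i x))) \<longlonglongrightarrow> ennreal (norm (f x - f x))"
        by (intro tendsto_ennrealI tendsto_norm tendsto_diff tendsto_const elim)
      then show ?case by simp
    qed
    show "(\<integral>\<^sup>+x. 2 * w x \<partial>M) < \<infinity>"
      using w by (simp add: nn_integral_cmult ennreal_mult_less_top)
  qed (use w in auto)
  then show ?thesis by simp
qed

text \<open>Completeness of the space enters here: the integrals of the dominated approximants form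
  a Cauchy sequence because the approximants converge in \<open>L1\<close>.\<close>

lemma bochner_integral_approx:
  fixes f :: "'a \<Rightarrow> 'b::banach"
  assumes f: "ps_measurable M f" and fin: "(\<integral>\<^sup>+x. ennreal (norm (f x)) \<partial>M) < \<infinity>"
    and s: "\<And>i. simple_function M (s i)" "\<And>x. x \<in> space M \<Longrightarrow> (\<lambda>i::nat. s i x) \<longlonglongrightarrow> f x"
    "\<And>i x. x \<in> space M \<Longrightarrow> norm (s i x) \<le> 2 * norm (f x)"
  shows "Bochner_Integration.simple_bochner_integrable M (s i)"
    and "(\<lambda>i. \<integral>\<^sup>+x. ennreal (norm (f x - s i x)) \<partial>M) \<longlonglongrightarrow> 0"
    and "(\<lambda>i. Bochner_Integration.simple_bochner_integral M (s i)) \<longlonglongrightarrow> bochner_integral M f"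
proof -
  have fm: "(\<lambda>x. ennreal (norm (f x))) \<in> borel_measurable M"
    using ps_measurable_norm[OF f] by simp
  have bd: "ennreal (norm (s i x)) \<le> 2 * ennreal (norm (f x))" if "x \<in> space M" for i x
    using ennreal_leI[OF s(3)[OF that, of i]] by (simp add: ennreal_mult)
  have fin2: "(\<integral>\<^sup>+x. 2 * ennreal (norm (f x)) \<partial>M) < \<infinity>"
    using fin fm by (simp add: nn_integral_cmult ennreal_mult_less_top)
  show sbi: "Bochner_Integration.simple_bochner_integrable M (s i)" for i
  proof (rule simple_bochner_integrableI_bounded[OF s(1)])
    have "(\<integral>\<^sup>+x. ennreal (norm (s i x)) \<partial>M) \<le> (\<integral>\<^sup>+x. 2 * ennreal (norm (f x)) \<partial>M)"
      by (intro nn_integral_mono bd)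
    then show "(\<integral>\<^sup>+x. ennreal (norm (s i x)) \<partial>M) < \<infinity>"
      using fin2 by (rule order.strict_trans1)
  qed
  show L1: "(\<lambda>i. \<integral>\<^sup>+x. ennreal (norm (f x - s i x)) \<partial>M) \<longlonglongrightarrow> 0"
    using fm fin2 bd s(2)
    by (intro nn_integral_dominated_diff[where w = "\<lambda>x. 2 * ennreal (norm (f x))"] f ps_measurable_simple s(1)) auto
  let ?I = "\<lambda>i. Bochner_Integration.simple_bochner_integral M (s i)"
  have "Cauchy ?I"
  proof (rule metric_CauchyI)
    fix e :: real assume "0 < e"
    then have "0 < ennreal (e / 2)" by simp
    from order_tendstoD(2)[OF L1 this] obtain n where
      n: "\<And>i. n \<le> i \<Longrightarrow> (\<integral>\<^sup>+x. ennreal (norm (f x - s i x)) \<partial>M) < ennreal (e / 2)"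
      unfolding eventually_sequentially by blast
    show "\<exists>n. \<forall>i\<ge>n. \<forall>j\<ge>n. dist (?I i) (?I j) < e"
    proof (intro exI allI impI)
      fix i j assume "n \<le> i" "n \<le> j"
      have "ennreal (norm (?I i - ?I j)) \<le> (\<integral>\<^sup>+x. ennreal (norm (f x - s i x)) \<partial>M) + (\<integral>\<^sup>+x. ennreal (norm (f x - s j x)) \<partial>M)"
        by (rule simple_bochner_integral_norm_diff_le[OF f sbi sbi])
      also have "\<dots> < ennreal (e / 2) + ennreal (e / 2)"
        using n[OF \<open>n \<le> i\<close>] n[OF \<open>n \<le> j\<close>] by (rule add_strict_mono)
      also have "\<dots> = ennreal e"
        using \<open>0 < e\<close> by (subst ennreal_plus[symmetric]) auto
      finally show "dist (?I i) (?I j) < e"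
        using \<open>0 < e\<close> by (simp add: dist_norm ennreal_less_iff)
    qed
  qed
  then obtain I where "?I \<longlonglongrightarrow> I"
    using convergent_eq_Cauchy by blast
  then show "?I \<longlonglongrightarrow> bochner_integral M f"
    using bochner_integral_eqI[OF f fin sbi L1] by simp
qed

text \<open>If \<open>f\<close> is not integrable, the left side is 0 by the default in the
  definition, so the bound holds for every \<open>f\<close>.\<close>

lemma norm_bochner_integral_le:
  fixes f :: "'a \<Rightarrow> 'b::banach"
  shows "ennreal (norm (bochner_integral M f)) \<le> (\<integral>\<^sup>+x. ennreal (norm (f x)) \<partial>M)"
proof (cases "bochner_integrable M f")
  case False
  then show ?thesis by (simp add: bochner_integral_def)
next
  case True
  then obtain f' where f': "ps_measurable M f'" "AE x in M. f x = f' x"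
    "(\<integral>\<^sup>+x. ennreal (norm (f' x)) \<partial>M) < \<infinity>" "bochner_integral M f' = bochner_integral M f"
    by (rule bochner_integrableE_ps)
  obtain s where s: "\<And>i::nat. simple_function M (s i)" "\<And>x. x \<in> space M \<Longrightarrow> (\<lambda>i. s i x) \<longlonglongrightarrow> f' x"
    "\<And>i x. x \<in> space M \<Longrightarrow> norm (s i x) \<le> 2 * norm (f' x)"
    using ps_measurable_dominated[OF f'(1)] by blast
  note a = bochner_integral_approx[OF f'(1,3) s]
  have fm: "(\<lambda>x. ennreal (norm (f' x))) \<in> borel_measurable M"
    using ps_measurable_norm[OF f'(1)] by simp
  have dm: "(\<lambda>x. ennreal (norm (f' x - s i x))) \<in> borel_measurable M" for i
    using ps_measurable_norm[OF ps_measurable_diff[OF f'(1) ps_measurable_simple[OF s(1)]]] by simp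
  have "ennreal (norm (bochner_integral M f')) \<le> (\<integral>\<^sup>+x. ennreal (norm (f' x)) \<partial>M) + 0"
  proof (rule LIMSEQ_le)
    show "(\<lambda>i. ennreal (norm (Bochner_Integration.simple_bochner_integral M (s i)))) \<longlonglongrightarrow> ennreal (norm (bochner_integral M f'))"
      by (intro tendsto_ennrealI tendsto_norm a(3))
    show "(\<lambda>i. (\<integral>\<^sup>+x. ennreal (norm (f' x)) \<partial>M) + (\<integral>\<^sup>+x. ennreal (norm (f' x - s i x)) \<partial>M)) \<longlonglongrightarrow> (\<integral>\<^sup>+x. ennreal (norm (f' x)) \<partial>M) + 0"
      by (intro tendsto_add tendsto_const a(2))
    have "ennreal (norm (Bochner_Integration.simple_bochner_integral M (s i))) \<le>
      (\<integral>\<^sup>+x. ennreal (norm (f' x)) \<partial>M) + (\<integral>\<^sup>+x. ennreal (norm (f' x - s i x)) \<partial>M)" for i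
    proof -
      have "ennreal (norm (Bochner_Integration.simple_bochner_integral M (s i))) \<le> ennreal (Bochner_Integration.simple_bochner_integral M (\<lambda>x. norm (s i x)))"
        by (intro ennreal_leI simple_bochner_integral_norm_bound a(1))
      also have "\<dots> = (\<integral>\<^sup>+x. ennreal (norm (s i x)) \<partial>M)"
        using simple_bochner_integrable_compose2[of "\<lambda>x y. norm x" M "s i" "s i"] a(1)
        by (intro simple_bochner_integral_eq_nn_integral) auto
      also have "\<dots> \<le> (\<integral>\<^sup>+x. ennreal (norm (f' x)) + ennreal (norm (f' x - s i x)) \<partial>M)"
      proof (rule nn_integral_mono)
        fix x
        have "norm (s i x) \<le> norm (f' x) + norm (f' x - s i x)"
          using norm_triangle_ineq4[of "f' x" "f' x - s i x"] by simp
        then show "ennreal (norm (s i x)) \<le> ennreal (norm (f' x)) + ennreal (norm (f' x - s i x))"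
          by (intro ennreal_le_add norm_ge_zero)
      qed
      also have "\<dots> = (\<integral>\<^sup>+x. ennreal (norm (f' x)) \<partial>M) + (\<integral>\<^sup>+x. ennreal (norm (f' x - s i x)) \<partial>M)"
        by (rule nn_integral_add[OF fm dm])
      finally show ?thesis .
    qed
    then show "\<exists>N. \<forall>n\<ge>N. ennreal (norm (Bochner_Integration.simple_bochner_integral M (s n))) \<le>
      (\<integral>\<^sup>+x. ennreal (norm (f' x)) \<partial>M) + (\<integral>\<^sup>+x. ennreal (norm (f' x - s n x)) \<partial>M)"
      by blast
  qed
  also have "(\<integral>\<^sup>+x. ennreal (norm (f' x)) \<partial>M) = (\<integral>\<^sup>+x. ennreal (norm (f x)) \<partial>M)"
    using f'(2) by (intro nn_integral_cong_AE) auto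
  finally show ?thesis using f'(4) by simp
qed

section \<open>Linearity, bounded operators and dominated convergence\<close>

lemma
  fixes f g :: "'a \<Rightarrow> 'b::banach"
  assumes "bochner_integrable M f" "bochner_integrable M g"
  shows bochner_integrable_add: "bochner_integrable M (\<lambda>x. f x + g x)"
    and bochner_integral_add: "bochner_integral M (\<lambda>x. f x + g x) = bochner_integral M f + bochner_integral M g"
proof -
  obtain f' where f': "ps_measurable M f'" "AE x in M. f x = f' x"
    "(\<integral>\<^sup>+x. ennreal (norm (f' x)) \<partial>M) < \<infinity>" "bochner_integral M f' = bochner_integral M f"
    using bochner_integrableE_ps[OF assms(1)] by blast
  obtain g' where g': "ps_measurable M g'" "AE x in M. g x = g' x"
    "(\<integral>\<^sup>+x. ennreal (norm (g' x)) \<partial>M) < \<infinity>" "bochner_integral M g' = bochner_integral M g"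
    using bochner_integrableE_ps[OF assms(2)] by blast
  note [measurable] = ps_measurable_norm[OF f'(1)] ps_measurable_norm[OF g'(1)]
  have fg: "ps_measurable M (\<lambda>x. f' x + g' x)"
    by (intro ps_measurable_add f' g')
  have "(\<integral>\<^sup>+x. ennreal (norm (f' x + g' x)) \<partial>M) \<le> (\<integral>\<^sup>+x. ennreal (norm (f' x)) + ennreal (norm (g' x)) \<partial>M)"
    by (intro nn_integral_mono ennreal_le_add norm_ge_zero norm_triangle_ineq)
  also have "\<dots> < \<infinity>"
    using f'(3) g'(3) by (subst nn_integral_add) auto
  finally have fin: "(\<integral>\<^sup>+x. ennreal (norm (f' x + g' x)) \<partial>M) < \<infinity>" .
  have AE: "AE x in M. f x + g x = f' x + g' x"
    using f'(2) g'(2) by eventually_elim simp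
  show "bochner_integrable M (\<lambda>x. f x + g x)"
    using bochner_integrable_cong_AE[OF AE] bochner_integrableI_ps[OF fg fin] by simp
  obtain s where s: "\<And>i::nat. simple_function M (s i)" "\<And>x. x \<in> space M \<Longrightarrow> (\<lambda>i. s i x) \<longlonglongrightarrow> f' x"
    "\<And>i x. x \<in> space M \<Longrightarrow> norm (s i x) \<le> 2 * norm (f' x)"
    using ps_measurable_dominated[OF f'(1)] by blast
  obtain t where t: "\<And>i::nat. simple_function M (t i)" "\<And>x. x \<in> space M \<Longrightarrow> (\<lambda>i. t i x) \<longlonglongrightarrow> g' x"
    "\<And>i x. x \<in> space M \<Longrightarrow> norm (t i x) \<le> 2 * norm (g' x)"
    using ps_measurable_dominated[OF g'(1)] by blast
  note a = bochner_integral_approx[OF f'(1,3) s] and b = bochner_integral_approx[OF g'(1,3) t]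
  have "bochner_integral M (\<lambda>x. f' x + g' x) = bochner_integral M f' + bochner_integral M g'"
  proof (rule bochner_integral_eqI[OF fg fin])
    show "Bochner_Integration.simple_bochner_integrable M (\<lambda>x. s i x + t i x)" for i
      by (rule simple_bochner_integrable_compose2[where p = "(+)", OF _ a(1) b(1)]) simp
    show "(\<lambda>i. Bochner_Integration.simple_bochner_integral M (\<lambda>x. s i x + t i x)) \<longlonglongrightarrow> bochner_integral M f' + bochner_integral M g'"
      using a(1,3) b(1,3) by (simp add: simple_bochner_integral_add tendsto_add)
    have sum0: "(\<lambda>i. (\<integral>\<^sup>+x. ennreal (norm (f' x - s i x)) \<partial>M) + (\<integral>\<^sup>+x. ennreal (norm (g' x - t i x)) \<partial>M)) \<longlonglongrightarrow> 0"
      using tendsto_add[OF a(2) b(2)] by simp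
    have "(\<integral>\<^sup>+x. ennreal (norm (f' x + g' x - (s i x + t i x))) \<partial>M) \<le>
       (\<integral>\<^sup>+x. ennreal (norm (f' x - s i x)) \<partial>M) + (\<integral>\<^sup>+x. ennreal (norm (g' x - t i x)) \<partial>M)" for i
    proof -
      have [measurable]: "(\<lambda>x. norm (f' x - s i x)) \<in> borel_measurable M" "(\<lambda>x. norm (g' x - t i x)) \<in> borel_measurable M"
        by (intro ps_measurable_norm ps_measurable_diff f' g' ps_measurable_simple s t)+
      have "(\<integral>\<^sup>+x. ennreal (norm (f' x + g' x - (s i x + t i x))) \<partial>M) \<le>
         (\<integral>\<^sup>+x. ennreal (norm (f' x - s i x)) + ennreal (norm (g' x - t i x)) \<partial>M)"
        by (intro nn_integral_mono ennreal_le_add norm_ge_zero norm_diff_triangle_ineq)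
      then show ?thesis by (subst (asm) nn_integral_add) auto
    qed
    then show "(\<lambda>i. \<integral>\<^sup>+x. ennreal (norm (f' x + g' x - (s i x + t i x))) \<partial>M) \<longlonglongrightarrow> 0"
      by (intro tendsto_sandwich[OF _ _ tendsto_const sum0]) auto
  qed
  then show "bochner_integral M (\<lambda>x. f x + g x) = bochner_integral M f + bochner_integral M g"
    using bochner_integral_cong_AE[OF AE] f'(4) g'(4) by simp
qed

text \<open>Applying \<open>T\<close> to the approximants keeps them simple, and the operator bound
  keeps the \<open>L1\<close> convergence. Negation, scalar multiples and the semigroup operators
  are all instances.\<close>

lemma
  fixes f :: "'a \<Rightarrow> 'b::banach" and T :: "'b \<Rightarrow> 'c::banach"
  assumes T: "bounded_linear T" and f: "bochner_integrable M f"
  shows bochner_integrable_bounded_linear: "bochner_integrable M (\<lambda>x. T (f x))"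
    and bochner_integral_bounded_linear: "bochner_integral M (\<lambda>x. T (f x)) = T (bochner_integral M f)"
proof -
  interpret T: bounded_linear T by fact
  obtain K where K: "K > 0" "\<And>x. norm (T x) \<le> norm x * K"
    using T.pos_bounded by blast
  have K': "ennreal (norm (T x)) \<le> ennreal K * ennreal (norm x)" for x
    using K(1) K(2)[of x] by (simp add: ennreal_mult[symmetric] mult.commute)
  obtain f' where f': "ps_measurable M f'" "AE x in M. f x = f' x"
    "(\<integral>\<^sup>+x. ennreal (norm (f' x)) \<partial>M) < \<infinity>" "bochner_integral M f' = bochner_integral M f"
    using bochner_integrableE_ps[OF f] by blast
  note [measurable] = ps_measurable_norm[OF f'(1)]
  have Tf: "ps_measurable M (\<lambda>x. T (f' x))"
    by (intro ps_measurable_continuous[OF f'(1)] T.continuous_on continuous_on_id)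
  have "(\<integral>\<^sup>+x. ennreal (norm (T (f' x))) \<partial>M) \<le> (\<integral>\<^sup>+x. ennreal K * ennreal (norm (f' x)) \<partial>M)"
    by (intro nn_integral_mono K')
  also have "\<dots> < \<infinity>"
    using f'(3) by (subst nn_integral_cmult) (auto simp: ennreal_mult_less_top)
  finally have fin: "(\<integral>\<^sup>+x. ennreal (norm (T (f' x))) \<partial>M) < \<infinity>" .
  have AE: "AE x in M. T (f x) = T (f' x)"
    using f'(2) by eventually_elim simp
  show "bochner_integrable M (\<lambda>x. T (f x))"
    using bochner_integrable_cong_AE[OF AE] bochner_integrableI_ps[OF Tf fin] by simp
  obtain s where s: "\<And>i::nat. simple_function M (s i)" "\<And>x. x \<in> space M \<Longrightarrow> (\<lambda>i. s i x) \<longlonglongrightarrow> f' x"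
    "\<And>i x. x \<in> space M \<Longrightarrow> norm (s i x) \<le> 2 * norm (f' x)"
    using ps_measurable_dominated[OF f'(1)] by blast
  note a = bochner_integral_approx[OF f'(1,3) s]
  have "bochner_integral M (\<lambda>x. T (f' x)) = T (bochner_integral M f')"
  proof (rule bochner_integral_eqI[OF Tf fin])
    show "Bochner_Integration.simple_bochner_integrable M (\<lambda>x. T (s i x))" for i
      by (rule simple_bochner_integrable_compose2[where p = "\<lambda>x y. T x", OF _ a(1) a(1)]) (simp add: T.zero)
    show "(\<lambda>i. Bochner_Integration.simple_bochner_integral M (\<lambda>x. T (s i x))) \<longlonglongrightarrow> T (bochner_integral M f')"
      using a(1) by (simp add: simple_bochner_integral_linear[OF T.linear_axioms] T.tendsto[OF a(3)])
    have K0: "(\<lambda>i. ennreal K * (\<integral>\<^sup>+x. ennreal (norm (f' x - s i x)) \<partial>M)) \<longlonglongrightarrow> 0"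
      using ennreal_tendsto_cmult[OF _ a(2), of "ennreal K"] by simp
    have "(\<integral>\<^sup>+x. ennreal (norm (T (f' x) - T (s i x))) \<partial>M) \<le>
       ennreal K * (\<integral>\<^sup>+x. ennreal (norm (f' x - s i x)) \<partial>M)" for i
    proof -
      have [measurable]: "(\<lambda>x. norm (f' x - s i x)) \<in> borel_measurable M"
        by (intro ps_measurable_norm ps_measurable_diff f' ps_measurable_simple s)
      have "(\<integral>\<^sup>+x. ennreal (norm (T (f' x) - T (s i x))) \<partial>M) \<le> (\<integral>\<^sup>+x. ennreal K * ennreal (norm (f' x - s i x)) \<partial>M)"
        using K' by (intro nn_integral_mono) (auto simp: T.diff[symmetric])
      then show ?thesis by (subst (asm) nn_integral_cmult) auto
    qed
    then show "(\<lambda>i. \<integral>\<^sup>+x. ennreal (norm (T (f' x) - T (s i x))) \<partial>M) \<longlonglongrightarrow> 0"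
      by (intro tendsto_sandwich[OF _ _ tendsto_const K0]) auto
  qed
  then show "bochner_integral M (\<lambda>x. T (f x)) = T (bochner_integral M f)"
    using bochner_integral_cong_AE[OF AE] f'(4) by simp
qed

lemma
  fixes f g :: "'a \<Rightarrow> 'b::banach"
  assumes "bochner_integrable M f" "bochner_integrable M g"
  shows bochner_integrable_diff: "bochner_integrable M (\<lambda>x. f x - g x)"
    and bochner_integral_diff: "bochner_integral M (\<lambda>x. f x - g x) = bochner_integral M f - bochner_integral M g"
  using bochner_integrable_add[OF assms(1) bochner_integrable_bounded_linear[OF bounded_linear_minus[OF bounded_linear_ident] assms(2)]]
    bochner_integral_add[OF assms(1) bochner_integrable_bounded_linear[OF bounded_linear_minus[OF bounded_linear_ident] assms(2)]]
    bochner_integral_bounded_linear[OF bounded_linear_minus[OF bounded_linear_ident] assms(2)]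
  by simp_all

lemma
  fixes f :: "'a \<Rightarrow> 'b::banach"
  assumes "bochner_integrable M f"
  shows bochner_integrable_scaleR: "bochner_integrable M (\<lambda>x. c *\<^sub>R f x)"
    and bochner_integral_scaleR: "bochner_integral M (\<lambda>x. c *\<^sub>R f x) = c *\<^sub>R bochner_integral M f"
  using bochner_integrable_bounded_linear[OF bounded_linear_scaleR_right assms]
    bochner_integral_bounded_linear[OF bounded_linear_scaleR_right assms] .

lemma
  fixes f :: "'a \<Rightarrow> 'b::banach" and T :: "'b \<Rightarrow>\<^sub>L 'c::banach"
  assumes "bochner_integrable M f"
  shows bochner_integrable_blinfun: "bochner_integrable M (\<lambda>x. T (f x))"
    and bochner_integral_blinfun: "bochner_integral M (\<lambda>x. T (f x)) = T (bochner_integral M f)"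
  using bochner_integrable_bounded_linear[OF blinfun.bounded_linear_right assms]
    bochner_integral_bounded_linear[OF blinfun.bounded_linear_right assms] .

lemma
  fixes c :: "'b::banach"
  assumes "integrable M \<phi>"
  shows bochner_integrable_scaleR_const: "bochner_integrable M (\<lambda>x. \<phi> x *\<^sub>R c)"
    and bochner_integral_scaleR_const: "bochner_integral M (\<lambda>x. \<phi> x *\<^sub>R c) = integral\<^sup>L M \<phi> *\<^sub>R c"
  using bochner_integrable_bounded_linear[OF bounded_linear_scaleR_left integrable_imp_bochner_integrable[OF assms]]
    bochner_integral_bounded_linear[OF bounded_linear_scaleR_left integrable_imp_bochner_integrable[OF assms]]
    bochner_integral_eq_lebesgue_integral[OF assms]
  by auto

lemma bochner_integrable_zero: "bochner_integrable M (\<lambda>_. 0)"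
  by (simp add: bochner_integrableI_ps ps_measurable_const)

lemma bochner_integral_zero: "bochner_integral M (\<lambda>_. 0::'b::banach) = 0"
  using norm_bochner_integral_le[of M "\<lambda>_. 0"] by simp

text \<open>The \<open>F i\<close> and \<open>f\<close> need not be Borel. The \<open>L1\<close>
  distance is computed on everywhere measurable representatives and transferred back; one null set
  serves all \<open>i\<close>.\<close>

proposition
  fixes f :: "'a \<Rightarrow> 'b::banach"
  assumes F: "\<And>i::nat. strongly_measurable M (F i)" and w: "w \<in> borel_measurable M" "(\<integral>\<^sup>+x. w x \<partial>M) < \<infinity>"
    and bound: "\<And>i. AE x in M. ennreal (norm (F i x)) \<le> w x" and lim: "AE x in M. (\<lambda>i. F i x) \<longlonglongrightarrow> f x"
  shows bochner_integrable_dominated_convergence: "bochner_integrable M f"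
    and bochner_integrable_dominated_convergence2: "bochner_integrable M (F i)"
    and bochner_integral_dominated_convergence: "(\<lambda>i. bochner_integral M (F i)) \<longlonglongrightarrow> bochner_integral M f"
proof -
  show Fi: "bochner_integrable M (F i)" for i
    using F nn_integral_mono_AE[OF bound] w(2) by (auto simp: bochner_integrable_def intro: order.strict_trans1)
  have f: "strongly_measurable M f"
    by (rule strongly_measurable_LIMSEQ[OF F lim])
  have all: "AE x in M. \<forall>i. ennreal (norm (F i x)) \<le> w x"
    using bound by (simp add: AE_all_countable)
  have f_le: "AE x in M. ennreal (norm (f x)) \<le> w x"
    using lim all
  proof eventually_elim
    case (elim x)
    have "(\<lambda>i. ennreal (norm (F i x))) \<longlonglongrightarrow> ennreal (norm (f x))"
      using elim(1) by (intro tendsto_ennrealI tendsto_norm)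
    from LIMSEQ_le_const2[OF this] elim(2) show ?case
      by blast
  qed
  show fi: "bochner_integrable M f"
    using f nn_integral_mono_AE[OF f_le] w(2) by (auto simp: bochner_integrable_def intro: order.strict_trans1)
  obtain f' where f': "ps_measurable M f'" "AE x in M. f x = f' x"
    using f unfolding strongly_measurable_iff_ps by blast
  obtain G where G: "\<And>i. ps_measurable M (G i)" "\<And>i. AE x in M. F i x = G i x"
    using F unfolding strongly_measurable_iff_ps by metis
  have G': "AE x in M. \<forall>i. F i x = G i x"
    using G(2) by (simp add: AE_all_countable)
  have "(\<lambda>i. \<integral>\<^sup>+x. ennreal (norm (f' x - G i x)) \<partial>M) \<longlonglongrightarrow> 0"
  proof (rule nn_integral_dominated_diff[OF f'(1) G(1) w])
    show "AE x in M. ennreal (norm (G i x)) \<le> w x" for i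
      using G(2)[of i] bound[of i] by eventually_elim simp
    show "AE x in M. (\<lambda>i. G i x) \<longlonglongrightarrow> f' x"
      using G' lim f'(2) by eventually_elim simp
  qed
  moreover have "(\<integral>\<^sup>+x. ennreal (norm (f' x - G i x)) \<partial>M) = (\<integral>\<^sup>+x. ennreal (norm (f x - F i x)) \<partial>M)" for i
    by (rule nn_integral_cong_AE) (use f'(2) G(2)[of i] in eventually_elim, simp)
  ultimately have L1: "(\<lambda>i. \<integral>\<^sup>+x. ennreal (norm (f x - F i x)) \<partial>M) \<longlonglongrightarrow> 0"
    by simp
  have "(\<lambda>i. ennreal (norm (bochner_integral M f - bochner_integral M (F i)))) \<longlonglongrightarrow> 0"
  proof (rule tendsto_sandwich[OF _ _ tendsto_const L1])
    have "ennreal (norm (bochner_integral M f - bochner_integral M (F i))) \<le> (\<integral>\<^sup>+x. ennreal (norm (f x - F i x)) \<partial>M)" for i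
      using norm_bochner_integral_le[of M "\<lambda>x. f x - F i x"] bochner_integral_diff[OF fi Fi[of i]] by simp
    then show "\<forall>\<^sub>F i in sequentially. ennreal (norm (bochner_integral M f - bochner_integral M (F i))) \<le> (\<integral>\<^sup>+x. ennreal (norm (f x - F i x)) \<partial>M)"
      by simp
  qed simp
  then have "(\<lambda>i. ennreal (norm (bochner_integral M f - bochner_integral M (F i)))) \<longlonglongrightarrow> ennreal 0"
    by simp
  then have "(\<lambda>i. norm (bochner_integral M f - bochner_integral M (F i))) \<longlonglongrightarrow> 0"
    by (subst (asm) tendsto_ennreal_iff) auto
  then show "(\<lambda>i. bochner_integral M (F i)) \<longlonglongrightarrow> bochner_integral M f"
    unfolding Lim_null[of _ "bochner_integral M f"] by (subst tendsto_norm_zero_iff[symmetric]) (simp add: norm_minus_commute)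
qed

section \<open>Change of variables and Fubini for the Bochner integral\<close>

lemma
  fixes c :: "'b::banach"
  assumes "A \<in> sets M" "emeasure M A < \<infinity>"
  shows bochner_integrable_indicator: "bochner_integrable M (\<lambda>x. indicat_real A x *\<^sub>R c)"
    and bochner_integral_indicator: "bochner_integral M (\<lambda>x. indicat_real A x *\<^sub>R c) = measure M A *\<^sub>R c"
proof -
  have "integrable M (indicat_real A)"
    using assms by (simp add: integrable_indicator_iff)
  from bochner_integrable_scaleR_const[OF this, of c] bochner_integral_scaleR_const[OF this, of c]
  show "bochner_integrable M (\<lambda>x. indicat_real A x *\<^sub>R c)"
    "bochner_integral M (\<lambda>x. indicat_real A x *\<^sub>R c) = measure M A *\<^sub>R c"
    using assms(1) by (simp_all add: sets.sets_into_space Int_absorb2)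
qed

lemma simple_function_eq_sum_indicator:
  fixes s :: "'a \<Rightarrow> 'b::real_vector"
  assumes s: "simple_function M s" and x: "x \<in> space M"
  shows "s x = (\<Sum>y\<in>s ` space M - {0}. indicat_real (s -` {y} \<inter> space M) x *\<^sub>R y)"
proof -
  have fin: "finite (s ` space M)"
    using s by (simp add: simple_function_def)
  have "(\<Sum>y\<in>s ` space M - {0}. indicat_real (s -` {y} \<inter> space M) x *\<^sub>R y) =
      (\<Sum>y\<in>s ` space M - {0}. if y = s x then y else 0)"
    using x by (intro sum.cong) (auto simp: indicator_def)
  also have "\<dots> = s x"
    using fin x by (subst sum.delta) auto
  finally show ?thesis by simp
qed

text \<open>The limit case supplies domination by \<open>2 * norm (f x)\<close>, so each application
  closes by dominated convergence. All members carry the everywhere notion of measurability, so that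
  they may be composed with measurable maps.\<close>

lemma bochner_induct[consumes 2, case_names base add lim]:
  fixes f :: "'a \<Rightarrow> 'b::banach"
  assumes f: "ps_measurable M f" "(\<integral>\<^sup>+x. ennreal (norm (f x)) \<partial>M) < \<infinity>"
    and base: "\<And>A c. A \<in> sets M \<Longrightarrow> emeasure M A < \<infinity> \<Longrightarrow> Q (\<lambda>x. indicat_real A x *\<^sub>R c)"
    and add: "\<And>f g. bochner_integrable M f \<Longrightarrow> ps_measurable M f \<Longrightarrow> Q f \<Longrightarrow>
      bochner_integrable M g \<Longrightarrow> ps_measurable M g \<Longrightarrow> Q g \<Longrightarrow> Q (\<lambda>x. f x + g x)"
    and lim: "\<And>f s. bochner_integrable M f \<Longrightarrow> ps_measurable M f \<Longrightarrow> (\<And>i::nat. bochner_integrable M (s i)) \<Longrightarrow>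
      (\<And>i. ps_measurable M (s i)) \<Longrightarrow> (\<And>i. Q (s i)) \<Longrightarrow>
      (\<And>x. x \<in> space M \<Longrightarrow> (\<lambda>i. s i x) \<longlonglongrightarrow> f x) \<Longrightarrow> (\<And>i x. x \<in> space M \<Longrightarrow> norm (s i x) \<le> 2 * norm (f x)) \<Longrightarrow> Q f"
  shows "Q f"
proof -
  obtain s where s: "\<And>i::nat. simple_function M (s i)" "\<And>x. x \<in> space M \<Longrightarrow> (\<lambda>i. s i x) \<longlonglongrightarrow> f x"
    "\<And>i x. x \<in> space M \<Longrightarrow> norm (s i x) \<le> 2 * norm (f x)"
    using ps_measurable_dominated[OF f(1)] by blast
  have sbi: "Bochner_Integration.simple_bochner_integrable M (s i)" for i
    by (rule bochner_integral_approx(1)[OF f s])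
  let ?A = "\<lambda>i y. s i -` {y} \<inter> space M"
  \<comment> \<open>Level sets of nonzero values lie in the support of \<open>s i\<close>, which has
    finite measure because \<open>s i\<close> is integrable. The level set of 0 may have infinite
    measure and is left out of the sums.\<close>
  have A: "?A i y \<in> sets M" "emeasure M (?A i y) < \<infinity>" if "y \<noteq> 0" for i y
  proof -
    show "?A i y \<in> sets M"
      using s(1) by (rule simple_functionD)
    have "emeasure M (?A i y) \<le> emeasure M {x \<in> space M. s i x \<noteq> 0}"
    proof (rule emeasure_mono)
      have "{x \<in> space M. s i x \<noteq> 0} = space M - ?A i 0" by auto
      then show "{x \<in> space M. s i x \<noteq> 0} \<in> sets M"
        using simple_functionD(2)[OF s(1), of i "{0}"] by auto
    qed (use that in auto)
    also have "\<dots> < \<infinity>"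
      using sbi[of i] by (auto elim: Bochner_Integration.simple_bochner_integrable.cases simp: less_top)
    finally show "emeasure M (?A i y) < \<infinity>" .
  qed
  have step: "bochner_integrable M (\<lambda>x. \<Sum>y\<in>R. indicat_real (?A i y) x *\<^sub>R y) \<and>
      ps_measurable M (\<lambda>x. \<Sum>y\<in>R. indicat_real (?A i y) x *\<^sub>R y) \<and>
      Q (\<lambda>x. \<Sum>y\<in>R. indicat_real (?A i y) x *\<^sub>R y)" if "finite R" "0 \<notin> R" for i R
    using that
  proof (induction R)
    case empty
    then show ?case
      using base[of "{}" 0] by (simp add: bochner_integrable_zero ps_measurable_const)
  next
    case (insert y R)
    have y: "y \<noteq> 0" using insert by auto
    have 1: "bochner_integrable M (\<lambda>x. indicat_real (?A i y) x *\<^sub>R y)" "Q (\<lambda>x. indicat_real (?A i y) x *\<^sub>R y)"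
      "ps_measurable M (\<lambda>x. indicat_real (?A i y) x *\<^sub>R y)"
      using bochner_integrable_indicator[OF A[OF y]] base[OF A[OF y]] ps_measurable_scaleR[OF borel_measurable_indicator[OF A(1)[OF y]] ps_measurable_const]
      by auto
    from insert have "bochner_integrable M (\<lambda>x. \<Sum>y\<in>R. indicat_real (?A i y) x *\<^sub>R y)"
      "ps_measurable M (\<lambda>x. \<Sum>y\<in>R. indicat_real (?A i y) x *\<^sub>R y)"
      "Q (\<lambda>x. \<Sum>y\<in>R. indicat_real (?A i y) x *\<^sub>R y)" by auto
    with 1 insert show ?case
      using add[OF 1(1,3,2)] bochner_integrable_add[OF 1(1)] ps_measurable_add[OF 1(3)]
      by (simp del: sum_indicator_scaleR)
  qed
  let ?r = "\<lambda>i x. \<Sum>y\<in>s i ` space M - {0}. indicat_real (?A i y) x *\<^sub>R y"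
  have fr: "finite (s i ` space M - {0})" for i
    using s(1) by (simp add: simple_function_def)
  have r: "bochner_integrable M (?r i)" "ps_measurable M (?r i)" "Q (?r i)" for i
    using step[OF fr, of i i] by blast+
  have eq: "?r i x = s i x" if "x \<in> space M" for i x
    by (rule simple_function_eq_sum_indicator[OF s(1) that, symmetric])
  show ?thesis
  proof (rule lim[of f ?r, OF bochner_integrableI_ps[OF f] f(1) r])
    show "(\<lambda>i. ?r i x) \<longlonglongrightarrow> f x" if "x \<in> space M" for x
      unfolding eq[OF that] by (rule s(2)[OF that])
    show "norm (?r i x) \<le> 2 * norm (f x)" if "x \<in> space M" for x i
      unfolding eq[OF that] by (rule s(3)[OF that])
  qed
qed

section \<open>Image measures and densities\<close>

lemma ps_measurable_ennreal_norm:
  fixes f :: "'a \<Rightarrow> 'b::real_normed_vector"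
  shows "ps_measurable M f \<Longrightarrow> (\<lambda>x. ennreal (norm (f x))) \<in> borel_measurable M"
  using ps_measurable_norm[of M f] by simp

text \<open>Integrability transfers in both directions through the integral of the norm, so the
  non-integrable case is settled by the common default 0. The remaining case is induction from the
  measure of a preimage.\<close>

lemma bochner_distr_ps:
  fixes f :: "'a \<Rightarrow> 'b::banach"
  assumes g: "g \<in> measurable M N" and f: "ps_measurable N f"
  shows "bochner_integrable (distr M N g) f \<longleftrightarrow> bochner_integrable M (\<lambda>x. f (g x))" (is ?A)
    and "bochner_integral (distr M N g) f = bochner_integral M (\<lambda>x. f (g x))" (is ?B)
proof -
  have pd: "ps_measurable (distr M N g) h \<longleftrightarrow> ps_measurable N h" for h :: "'a \<Rightarrow> 'b"
    by (rule ps_measurable_cong_sets) simp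
  have eq: "(\<integral>\<^sup>+x. ennreal (norm (h x)) \<partial>distr M N g) = (\<integral>\<^sup>+x. ennreal (norm (h (g x))) \<partial>M)"
    if "ps_measurable N h" for h :: "'a \<Rightarrow> 'b"
    using ps_measurable_ennreal_norm[OF that] g by (subst nn_integral_distr) auto
  have bi: "bochner_integrable (distr M N g) h \<longleftrightarrow> bochner_integrable M (\<lambda>x. h (g x))"
    if "ps_measurable N h" for h :: "'a \<Rightarrow> 'b"
    using that pd eq[OF that] ps_measurable_compose[OF that g]
    by (simp add: bochner_integrable_def ps_imp_strongly_measurable)
  show ?A by (rule bi[OF f])
  show ?B
  proof (cases "bochner_integrable M (\<lambda>x. f (g x))")
    case False
    then show ?thesis using bi[OF f] by (simp add: bochner_integral_def)
  next
    case True
    then have "(\<integral>\<^sup>+x. ennreal (norm (f x)) \<partial>distr M N g) < \<infinity>"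
      using eq[OF f] by (simp add: bochner_integrable_def)
    with f[folded pd] show ?thesis
    proof (induct rule: bochner_induct)
      case (base A c)
      have *: "indicat_real A (g x) = indicat_real (g -` A \<inter> space M) x" if "x \<in> space M" for x
        using that by (auto simp: indicator_def)
      have "bochner_integral M (\<lambda>x. indicat_real A (g x) *\<^sub>R c) = bochner_integral M (\<lambda>x. indicat_real (g -` A \<inter> space M) x *\<^sub>R c)"
        by (rule bochner_integral_cong) (simp add: *)
      also have "\<dots> = measure (distr M N g) A *\<^sub>R c"
        using base g by (subst bochner_integral_indicator) (auto simp: emeasure_distr measure_distr measurable_sets)
      finally show ?case
        using bochner_integral_indicator[OF base] by simp
    next
      case (add h k)
      then have "bochner_integrable M (\<lambda>x. h (g x))" "bochner_integrable M (\<lambda>x. k (g x))"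
        using bi[of h] bi[of k] by (simp_all add: pd)
      with add show ?case by (simp add: bochner_integral_add)
    next
      case (lim f s)
      have fin: "(\<integral>\<^sup>+x. 2 * ennreal (norm (f x)) \<partial>distr M N g) < \<infinity>"
        using lim(1) ps_measurable_ennreal_norm[OF lim(2)] by (subst nn_integral_cmult) (auto simp: bochner_integrable_def ennreal_mult_less_top)
      have bd: "ennreal (norm (s i x)) \<le> 2 * ennreal (norm (f x))" if "x \<in> space N" for i x
        using ennreal_leI[OF lim(7)] that by (simp add: ennreal_mult)
      have fN: "ps_measurable N f" using lim(2) pd by simp
      have gsp: "x \<in> space M \<Longrightarrow> g x \<in> space N" for x
        using g by (rule measurable_space)
      have "(\<lambda>i. bochner_integral (distr M N g) (s i)) \<longlonglongrightarrow> bochner_integral (distr M N g) f"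
        using lim(4,6) fin bd ps_measurable_ennreal_norm[OF lim(2)]
        by (intro bochner_integral_dominated_convergence[where w = "\<lambda>x. 2 * ennreal (norm (f x))"]
              ps_imp_strongly_measurable AE_I2 borel_measurable_times_ennreal) auto
      moreover have "(\<lambda>i. bochner_integral M (\<lambda>x. s i (g x))) \<longlonglongrightarrow> bochner_integral M (\<lambda>x. f (g x))"
      proof (rule bochner_integral_dominated_convergence[where w = "\<lambda>x. 2 * ennreal (norm (f (g x)))"])
        show "strongly_measurable M (\<lambda>x. s i (g x))" for i
          using lim(4)[of i] pd ps_measurable_compose[OF _ g] by (auto intro: ps_imp_strongly_measurable)
        show "(\<lambda>x. 2 * ennreal (norm (f (g x)))) \<in> borel_measurable M"
          using ps_measurable_ennreal_norm[OF ps_measurable_compose[OF fN g]] by simp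
        show "(\<integral>\<^sup>+x. 2 * ennreal (norm (f (g x))) \<partial>M) < \<infinity>"
          using fin g ps_measurable_ennreal_norm[OF fN] by (subst (asm) nn_integral_distr) auto
      qed (use bd gsp lim(6) in auto)
      ultimately show ?case
        using lim(5) LIMSEQ_unique by auto
    qed
  qed
qed

text \<open>Measurability must refer to the image measure: its null sets pull back to null sets of
  \<open>M\<close>, which null sets for another measure on the target need not do.\<close>

lemma bochner_distr:
  fixes f :: "'a \<Rightarrow> 'b::banach"
  assumes g: "g \<in> measurable M N" and f: "strongly_measurable (distr M N g) f"
  shows bochner_integrable_distr: "bochner_integrable (distr M N g) f \<longleftrightarrow> bochner_integrable M (\<lambda>x. f (g x))" (is ?A)
    and bochner_integral_distr: "bochner_integral (distr M N g) f = bochner_integral M (\<lambda>x. f (g x))" (is ?B)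
    and strongly_measurable_distr: "strongly_measurable M (\<lambda>x. f (g x))"
proof -
  obtain f' where f': "ps_measurable (distr M N g) f'" "AE x in distr M N g. f x = f' x"
    using f unfolding strongly_measurable_iff_ps by blast
  have f'': "ps_measurable N f'"
    using f'(1) ps_measurable_cong_sets[of "distr M N g" N f'] by simp
  have AE: "AE x in M. f (g x) = f' (g x)"
    using AE_distrD[OF g f'(2)] .
  show ?A ?B
    using bochner_distr_ps[OF g f''] bochner_integrable_cong_AE[OF f'(2)] bochner_integrable_cong_AE[OF AE]
      bochner_integral_cong_AE[OF f'(2)] bochner_integral_cong_AE[OF AE] by simp_all
  show "strongly_measurable M (\<lambda>x. f (g x))"
    unfolding strongly_measurable_cong_AE[OF AE]
    by (intro ps_imp_strongly_measurable ps_measurable_compose[OF f'' g])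
qed

lemma bochner_density_ps:
  fixes f :: "'a \<Rightarrow> 'b::banach" and \<rho> :: "'a \<Rightarrow> real"
  assumes \<rho>[measurable]: "\<rho> \<in> borel_measurable M" and nn: "\<And>x. 0 \<le> \<rho> x" and f: "ps_measurable M f"
  shows "bochner_integrable (density M \<rho>) f \<longleftrightarrow> bochner_integrable M (\<lambda>x. \<rho> x *\<^sub>R f x)" (is ?A)
    and "bochner_integral (density M \<rho>) f = bochner_integral M (\<lambda>x. \<rho> x *\<^sub>R f x)" (is ?B)
proof -
  have pd: "ps_measurable (density M \<rho>) h \<longleftrightarrow> ps_measurable M h" for h :: "'a \<Rightarrow> 'b"
    by (rule ps_measurable_cong_sets) simp
  have eq: "(\<integral>\<^sup>+x. ennreal (norm (h x)) \<partial>density M \<rho>) = (\<integral>\<^sup>+x. ennreal (norm (\<rho> x *\<^sub>R h x)) \<partial>M)"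
    if "ps_measurable M h" for h :: "'a \<Rightarrow> 'b"
    using ps_measurable_ennreal_norm[OF that] nn
    by (subst nn_integral_density) (auto simp: ennreal_mult)
  have bi: "bochner_integrable (density M \<rho>) h \<longleftrightarrow> bochner_integrable M (\<lambda>x. \<rho> x *\<^sub>R h x)"
    if "ps_measurable M h" for h :: "'a \<Rightarrow> 'b"
    using that pd eq[OF that] ps_measurable_scaleR[OF \<rho> that]
    by (simp add: bochner_integrable_def ps_imp_strongly_measurable)
  show ?A by (rule bi[OF f])
  show ?B
  proof (cases "bochner_integrable M (\<lambda>x. \<rho> x *\<^sub>R f x)")
    case False
    then show ?thesis using bi[OF f] by (simp add: bochner_integral_def)
  next
    case True
    then have "(\<integral>\<^sup>+x. ennreal (norm (f x)) \<partial>density M \<rho>) < \<infinity>"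
      using eq[OF f] by (simp add: bochner_integrable_def)
    with f[folded pd] show ?thesis
    proof (induct rule: bochner_induct)
      case (base A c)
      then have [measurable]: "A \<in> sets M" by simp
      have em: "emeasure (density M \<rho>) A = (\<integral>\<^sup>+x. ennreal (\<rho> x * indicat_real A x) \<partial>M)"
        using nn by (subst emeasure_density) (auto intro!: nn_integral_cong simp: ennreal_indicator ennreal_mult split: split_indicator)
      have int: "integrable M (\<lambda>x. \<rho> x * indicat_real A x)"
        using base(2) nn unfolding em by (intro integrableI_nonneg) auto
      have "bochner_integral M (\<lambda>x. (\<rho> x * indicat_real A x) *\<^sub>R c) = measure (density M \<rho>) A *\<^sub>R c"
        using bochner_integral_scaleR_const[OF int] nn em by (simp add: measure_def integral_eq_nn_integral)
      then show ?case
        using bochner_integral_indicator[OF base] by simp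
    next
      case (add h k)
      then have "bochner_integrable M (\<lambda>x. \<rho> x *\<^sub>R h x)" "bochner_integrable M (\<lambda>x. \<rho> x *\<^sub>R k x)"
        using bi[of h] bi[of k] by (simp_all add: pd)
      with add show ?case by (simp add: bochner_integral_add scaleR_add_right)
    next
      case (lim f s)
      have fin: "(\<integral>\<^sup>+x. 2 * ennreal (norm (f x)) \<partial>density M \<rho>) < \<infinity>"
        using lim(1) ps_measurable_ennreal_norm[OF lim(2)] by (subst nn_integral_cmult) (auto simp: bochner_integrable_def ennreal_mult_less_top)
      have bd: "ennreal (norm (s i x)) \<le> 2 * ennreal (norm (f x))" if "x \<in> space M" for i x
        using ennreal_leI[OF lim(7)] that by (simp add: ennreal_mult)
      have fN: "ps_measurable M f" using lim(2) pd by simp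
      have "(\<lambda>i. bochner_integral (density M \<rho>) (s i)) \<longlonglongrightarrow> bochner_integral (density M \<rho>) f"
        using lim(4,6) fin bd ps_measurable_ennreal_norm[OF lim(2)]
        by (intro bochner_integral_dominated_convergence[where w = "\<lambda>x. 2 * ennreal (norm (f x))"]
              ps_imp_strongly_measurable AE_I2 borel_measurable_times_ennreal) auto
      moreover have "(\<lambda>i. bochner_integral M (\<lambda>x. \<rho> x *\<^sub>R s i x)) \<longlonglongrightarrow> bochner_integral M (\<lambda>x. \<rho> x *\<^sub>R f x)"
      proof (rule bochner_integral_dominated_convergence[where w = "\<lambda>x. ennreal (\<rho> x) * (2 * ennreal (norm (f x)))"])
        show "strongly_measurable M (\<lambda>x. \<rho> x *\<^sub>R s i x)" for i
          using lim(4)[of i] pd ps_measurable_scaleR[OF \<rho>] by (auto intro: ps_imp_strongly_measurable)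
        show "(\<lambda>x. ennreal (\<rho> x) * (2 * ennreal (norm (f x)))) \<in> borel_measurable M"
          using ps_measurable_ennreal_norm[OF fN] by simp
        show "(\<integral>\<^sup>+x. ennreal (\<rho> x) * (2 * ennreal (norm (f x))) \<partial>M) < \<infinity>"
          using fin ps_measurable_ennreal_norm[OF fN] by (subst (asm) nn_integral_density) auto
        show "AE x in M. ennreal (norm (\<rho> x *\<^sub>R s i x)) \<le> ennreal (\<rho> x) * (2 * ennreal (norm (f x)))" for i
          using bd nn by (intro AE_I2) (auto simp: ennreal_mult intro!: mult_left_mono)
        show "AE x in M. (\<lambda>i. \<rho> x *\<^sub>R s i x) \<longlonglongrightarrow> \<rho> x *\<^sub>R f x"
          using lim(6) by (intro AE_I2 tendsto_intros) auto
      qed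
      ultimately show ?case
        using lim(5) LIMSEQ_unique by auto
    qed
  qed
qed

section \<open>Parameter integrals and Fubini\<close>

lemma ps_measurable_indicator_scaleR:
  fixes f :: "'a \<Rightarrow> 'b::real_normed_vector"
  shows "A \<in> sets M \<Longrightarrow> ps_measurable M f \<Longrightarrow> ps_measurable M (\<lambda>x. indicat_real A x *\<^sub>R f x)"
  by (intro ps_measurable_scaleR borel_measurable_indicator)

text \<open>Measurability in \<open>x\<close> is obtained at every point, also where the section is
  not integrable: \<open>J x\<close> decides which case applies, and in the bad case both the
  approximants and the integral are 0.\<close>

lemma ps_measurable_bochner_integral:
  fixes f :: "'a \<times> 'c \<Rightarrow> 'b::banach"
  assumes "sigma_finite_measure N" and f: "ps_measurable (M \<Otimes>\<^sub>M N) f"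
  shows "ps_measurable M (\<lambda>x. bochner_integral N (\<lambda>y. f (x, y)))"
proof -
  interpret N: sigma_finite_measure N by fact
  obtain s where s: "\<And>i::nat. simple_function (M \<Otimes>\<^sub>M N) (s i)" "\<And>x. x \<in> space (M \<Otimes>\<^sub>M N) \<Longrightarrow> (\<lambda>i. s i x) \<longlonglongrightarrow> f x"
    "\<And>i x. x \<in> space (M \<Otimes>\<^sub>M N) \<Longrightarrow> norm (s i x) \<le> 2 * norm (f x)"
    using ps_measurable_dominated[OF f] by blast
  have sec: "ps_measurable N (\<lambda>y. h (x, y))" if "ps_measurable (M \<Otimes>\<^sub>M N) h" "x \<in> space M" for h :: "'a \<times> 'c \<Rightarrow> 'b" and x
    using ps_measurable_compose[OF that(1) measurable_Pair1'[OF that(2)]] .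
  have nf[measurable]: "(\<lambda>x. ennreal (norm (f x))) \<in> borel_measurable (M \<Otimes>\<^sub>M N)"
    using f by (rule ps_measurable_ennreal_norm)
  define J where "J x = (\<integral>\<^sup>+y. ennreal (norm (f (x, y))) \<partial>N)" for x
  have [measurable]: "J \<in> borel_measurable M"
    unfolding J_def by measurable
  define A where "A i z = s i -` {z} \<inter> space (M \<Otimes>\<^sub>M N)" for i z
  have [measurable]: "A i z \<in> sets (M \<Otimes>\<^sub>M N)" for i z
    unfolding A_def using s(1) by (rule simple_functionD)
  \<comment> \<open>The integral of the section of \<open>s i\<close> as an explicit finite sum, so
    that measurability reduces to that of section measures. The value 0 is omitted because its
    section may have infinite measure.\<close>
  define F where "F i x = indicat_real {x \<in> space M. J x < \<infinity>} x *\<^sub>R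
    (\<Sum>z\<in>s i ` space (M \<Otimes>\<^sub>M N) - {0}. measure N (Pair x -` A i z) *\<^sub>R z)" for i x
  show ?thesis
  proof (rule ps_measurable_LIMSEQ)
    show "ps_measurable M (F i)" for i
      unfolding F_def[abs_def] measure_def
      by (intro ps_measurable_indicator_scaleR ps_measurable_sum ps_measurable_scaleR ps_measurable_const
            measurable_compose[OF N.measurable_emeasure_Pair]) measurable
    show "(\<lambda>i. F i x) \<longlonglongrightarrow> bochner_integral N (\<lambda>y. f (x, y))" if x: "x \<in> space M" for x
    proof (cases "J x < \<infinity>")
      case False
      then have "F i x = 0" for i by (simp add: F_def)
      moreover have "bochner_integral N (\<lambda>y. f (x, y)) = 0"
        using False unfolding J_def bochner_integral_def bochner_integrable_def by simp
      ultimately show ?thesis by simp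
    next
      case True
      have xy: "y \<in> space N \<Longrightarrow> (x, y) \<in> space (M \<Otimes>\<^sub>M N)" for y
        using x by (simp add: space_pair_measure)
      have m2: "(\<lambda>y. ennreal (norm (f (x, y)))) \<in> borel_measurable N"
        by (intro ps_measurable_ennreal_norm sec f x)
      have fin: "(\<integral>\<^sup>+y. 2 * ennreal (norm (f (x, y))) \<partial>N) < \<infinity>"
        using True m2 unfolding J_def by (subst nn_integral_cmult) (auto simp: ennreal_mult_less_top)
      have bd: "ennreal (norm (s i (x, y))) \<le> 2 * ennreal (norm (f (x, y)))" if "y \<in> space N" for i y
        using ennreal_leI[OF s(3)[OF xy[OF that], of i]] by (simp add: ennreal_mult)
      have "F i x = bochner_integral N (\<lambda>y. s i (x, y))" for i
      proof -
        have fs: "finite (s i ` space (M \<Otimes>\<^sub>M N))"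
          using s(1) by (simp add: simple_function_def)
        have Am: "Pair x -` A i z \<in> sets N" for z
          by (rule sets_Pair1) measurable
        have Af: "emeasure N (Pair x -` A i z) < \<infinity>" if z: "z \<noteq> 0" for z
        proof -
          have "ennreal (norm z) * emeasure N (Pair x -` A i z) = (\<integral>\<^sup>+y. ennreal (norm z) * indicator (Pair x -` A i z) y \<partial>N)"
            using Am by (simp add: nn_integral_cmult_indicator)
          also have "\<dots> \<le> (\<integral>\<^sup>+y. 2 * ennreal (norm (f (x, y))) \<partial>N)"
            using bd by (intro nn_integral_mono) (auto simp: A_def indicator_def)
          finally have "ennreal (norm z) * emeasure N (Pair x -` A i z) < \<infinity>"
            using fin by (rule order.strict_trans1)
          then show ?thesis
            using z by (auto simp: ennreal_mult_less_top)
        qed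
        have "bochner_integral N (\<lambda>y. s i (x, y)) =
          bochner_integral N (\<lambda>y. \<Sum>z\<in>s i ` space (M \<Otimes>\<^sub>M N) - {0}. indicat_real (Pair x -` A i z) y *\<^sub>R z)"
          by (rule bochner_integral_cong)
             (subst simple_function_eq_sum_indicator[OF s(1) xy], auto simp: A_def indicator_def intro!: sum.cong)
        also have "\<dots> = (\<Sum>z\<in>s i ` space (M \<Otimes>\<^sub>M N) - {0}. measure N (Pair x -` A i z) *\<^sub>R z)"
        proof -
          have "bochner_integrable N (\<lambda>y. \<Sum>z\<in>R. indicat_real (Pair x -` A i z) y *\<^sub>R z) \<and>
            bochner_integral N (\<lambda>y. \<Sum>z\<in>R. indicat_real (Pair x -` A i z) y *\<^sub>R z) =
              (\<Sum>z\<in>R. measure N (Pair x -` A i z) *\<^sub>R z)" if "finite R" "0 \<notin> R" for R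
            using that
          proof (induction R)
            case empty
            then show ?case by (simp add: bochner_integrable_zero bochner_integral_zero)
          next
            case (insert z R)
            then have z: "z \<noteq> 0" by auto
            have "bochner_integrable N (\<lambda>y. \<Sum>z\<in>R. indicat_real (Pair x -` A i z) y *\<^sub>R z)"
              using insert by auto
            note bochner_integrable_add[OF bochner_integrable_indicator[OF Am Af[OF z]] this]
              bochner_integral_add[OF bochner_integrable_indicator[OF Am Af[OF z]] this]
            with insert bochner_integral_indicator[OF Am Af[OF z]] show ?case
              by (simp del: sum_indicator_scaleR)
          qed
          from this[of "s i ` space (M \<Otimes>\<^sub>M N) - {0}"] fs show ?thesis by blast
        qed
        finally show ?thesis
          using True x by (simp add: F_def)
      qed
      moreover have "(\<lambda>i. bochner_integral N (\<lambda>y. s i (x, y))) \<longlonglongrightarrow> bochner_integral N (\<lambda>y. f (x, y))"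
      proof (rule bochner_integral_dominated_convergence[where w = "\<lambda>y. 2 * ennreal (norm (f (x, y)))"])
        show "strongly_measurable N (\<lambda>y. s i (x, y))" for i
          by (intro ps_imp_strongly_measurable sec[OF ps_measurable_simple[OF s(1)] x])
        show "(\<lambda>y. 2 * ennreal (norm (f (x, y)))) \<in> borel_measurable N"
          using m2 by measurable
      qed (use fin bd s(2) xy in auto)
      ultimately show ?thesis by simp
    qed
  qed
qed

text \<open>Indicators reduce to the scalar theorem. The limit case uses dominated convergence
  twice, the outer time with the inner integral of \<open>2 * norm (f (x, y))\<close> as dominating
  function.\<close>

lemma bochner_fubini_ps:
  fixes f :: "'a \<times> 'c \<Rightarrow> 'b::banach"
  assumes "pair_sigma_finite M N" and f: "ps_measurable (M \<Otimes>\<^sub>M N) f" and fin: "(\<integral>\<^sup>+x. ennreal (norm (f x)) \<partial>(M \<Otimes>\<^sub>M N)) < \<infinity>"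
  shows "AE x in M. bochner_integrable N (\<lambda>y. f (x, y))"
    and "bochner_integrable M (\<lambda>x. bochner_integral N (\<lambda>y. f (x, y)))"
    and "bochner_integral M (\<lambda>x. bochner_integral N (\<lambda>y. f (x, y))) = bochner_integral (M \<Otimes>\<^sub>M N) f"
proof -
  interpret pair_sigma_finite M N by fact
  have N: "sigma_finite_measure N" by unfold_locales
  have sec: "ps_measurable N (\<lambda>y. h (x, y))" if "ps_measurable (M \<Otimes>\<^sub>M N) h" "x \<in> space M" for h :: "'a \<times> 'c \<Rightarrow> 'b" and x
    using ps_measurable_compose[OF that(1) measurable_Pair1'[OF that(2)]] .
  have 1: "AE x in M. bochner_integrable N (\<lambda>y. h (x, y)) \<and> (\<integral>\<^sup>+y. ennreal (norm (h (x, y))) \<partial>N) < \<infinity>"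
    if h: "ps_measurable (M \<Otimes>\<^sub>M N) h" "(\<integral>\<^sup>+x. ennreal (norm (h x)) \<partial>(M \<Otimes>\<^sub>M N)) < \<infinity>" for h :: "'a \<times> 'c \<Rightarrow> 'b"
  proof -
    note hm[measurable] = ps_measurable_ennreal_norm[OF h(1)]
    have "(\<integral>\<^sup>+x. \<integral>\<^sup>+y. ennreal (norm (h (x, y))) \<partial>N \<partial>M) \<noteq> \<infinity>"
      using h(2) M2.nn_integral_fst[OF hm] by simp
    then have "AE x in M. (\<integral>\<^sup>+y. ennreal (norm (h (x, y))) \<partial>N) \<noteq> \<infinity>"
      by (intro nn_integral_PInf_AE) measurable
    then show ?thesis
      using AE_space
    proof eventually_elim
      case (elim x)
      have "(\<integral>\<^sup>+y. ennreal (norm (h (x, y))) \<partial>N) < \<infinity>"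
        using elim(1) by (simp add: less_top)
      then show ?case
        using bochner_integrableI_ps[OF sec[OF h(1) elim(2)]] by blast
    qed
  qed
  have 2: "bochner_integrable M (\<lambda>x. bochner_integral N (\<lambda>y. h (x, y)))"
    if h: "ps_measurable (M \<Otimes>\<^sub>M N) h" "(\<integral>\<^sup>+x. ennreal (norm (h x)) \<partial>(M \<Otimes>\<^sub>M N)) < \<infinity>" for h :: "'a \<times> 'c \<Rightarrow> 'b"
  proof (rule bochner_integrableI_ps[OF ps_measurable_bochner_integral[OF N h(1)]])
    note hm[measurable] = ps_measurable_ennreal_norm[OF h(1)]
    have "(\<integral>\<^sup>+x. ennreal (norm (bochner_integral N (\<lambda>y. h (x, y)))) \<partial>M) \<le> (\<integral>\<^sup>+x. \<integral>\<^sup>+y. ennreal (norm (h (x, y))) \<partial>N \<partial>M)"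
      by (intro nn_integral_mono norm_bochner_integral_le)
    also have "\<dots> < \<infinity>"
      using h(2) M2.nn_integral_fst[OF hm] by simp
    finally show "(\<integral>\<^sup>+x. ennreal (norm (bochner_integral N (\<lambda>y. h (x, y)))) \<partial>M) < \<infinity>" .
  qed
  show "AE x in M. bochner_integrable N (\<lambda>y. f (x, y))"
    using 1[OF f fin] by eventually_elim simp
  show "bochner_integrable M (\<lambda>x. bochner_integral N (\<lambda>y. f (x, y)))"
    by (rule 2[OF f fin])
  show "bochner_integral M (\<lambda>x. bochner_integral N (\<lambda>y. f (x, y))) = bochner_integral (M \<Otimes>\<^sub>M N) f"
    using f fin
  proof (induct rule: bochner_induct)
    case (base A c)
    have int: "integrable (M \<Otimes>\<^sub>M N) (indicat_real A)"
      using base by (simp add: integrable_indicator_iff)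
    have "AE x in M. bochner_integral N (\<lambda>y. indicat_real A (x, y) *\<^sub>R c) = (\<integral>y. indicat_real A (x, y) \<partial>N) *\<^sub>R c"
      using AE_integrable_fst'[OF int] by eventually_elim (rule bochner_integral_scaleR_const)
    then have "bochner_integral M (\<lambda>x. bochner_integral N (\<lambda>y. indicat_real A (x, y) *\<^sub>R c)) =
      bochner_integral M (\<lambda>x. (\<integral>y. indicat_real A (x, y) \<partial>N) *\<^sub>R c)"
      by (rule bochner_integral_cong_AE)
    also have "\<dots> = (\<integral>z. indicat_real A z \<partial>(M \<Otimes>\<^sub>M N)) *\<^sub>R c"
      by (subst bochner_integral_scaleR_const[OF integrable_fst'[OF int]]) (simp add: integral_fst'[OF int])
    also have "\<dots> = bochner_integral (M \<Otimes>\<^sub>M N) (\<lambda>z. indicat_real A z *\<^sub>R c)"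
      by (rule bochner_integral_scaleR_const[OF int, symmetric])
    finally show ?case .
  next
    case (add h k)
    then have fin: "(\<integral>\<^sup>+x. ennreal (norm (h x)) \<partial>(M \<Otimes>\<^sub>M N)) < \<infinity>" "(\<integral>\<^sup>+x. ennreal (norm (k x)) \<partial>(M \<Otimes>\<^sub>M N)) < \<infinity>"
      by (simp_all add: bochner_integrable_def)
    have "AE x in M. bochner_integral N (\<lambda>y. h (x, y) + k (x, y)) = bochner_integral N (\<lambda>y. h (x, y)) + bochner_integral N (\<lambda>y. k (x, y))"
      using 1[OF add(2) fin(1)] 1[OF add(5) fin(2)] by eventually_elim (auto intro: bochner_integral_add)
    then have "bochner_integral M (\<lambda>x. bochner_integral N (\<lambda>y. h (x, y) + k (x, y))) =
      bochner_integral M (\<lambda>x. bochner_integral N (\<lambda>y. h (x, y)) + bochner_integral N (\<lambda>y. k (x, y)))"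
      by (rule bochner_integral_cong_AE)
    with add 2[OF add(2) fin(1)] 2[OF add(5) fin(2)] show ?case
      by (simp add: bochner_integral_add)
  next
    case (lim f s)
    then have fin: "(\<integral>\<^sup>+x. ennreal (norm (f x)) \<partial>(M \<Otimes>\<^sub>M N)) < \<infinity>"
      by (simp add: bochner_integrable_def)
    note fm[measurable] = ps_measurable_ennreal_norm[OF lim(2)]
    have fin2: "(\<integral>\<^sup>+x. 2 * ennreal (norm (f x)) \<partial>(M \<Otimes>\<^sub>M N)) < \<infinity>"
      using fin ps_measurable_norm[OF lim(2)] by (subst nn_integral_cmult) (auto simp: ennreal_mult_less_top)
    have bd: "ennreal (norm (s i z)) \<le> 2 * ennreal (norm (f z))" if "z \<in> space (M \<Otimes>\<^sub>M N)" for i z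
      using ennreal_leI[OF lim(7)[OF that]] by (simp add: ennreal_mult)
    have "(\<lambda>i. bochner_integral (M \<Otimes>\<^sub>M N) (s i)) \<longlonglongrightarrow> bochner_integral (M \<Otimes>\<^sub>M N) f"
      using lim(4,6) fin2 bd
      by (intro bochner_integral_dominated_convergence[where w = "\<lambda>x. 2 * ennreal (norm (f x))"]
            ps_imp_strongly_measurable AE_I2) auto
    moreover have "(\<lambda>i. bochner_integral M (\<lambda>x. bochner_integral N (\<lambda>y. s i (x, y)))) \<longlonglongrightarrow>
      bochner_integral M (\<lambda>x. bochner_integral N (\<lambda>y. f (x, y)))"
    proof (rule bochner_integral_dominated_convergence[where w = "\<lambda>x. \<integral>\<^sup>+y. 2 * ennreal (norm (f (x, y))) \<partial>N"])
      show "strongly_measurable M (\<lambda>x. bochner_integral N (\<lambda>y. s i (x, y)))" for i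
        by (intro ps_imp_strongly_measurable ps_measurable_bochner_integral N lim)
      show "(\<lambda>x. \<integral>\<^sup>+y. 2 * ennreal (norm (f (x, y))) \<partial>N) \<in> borel_measurable M"
        by measurable
      show "(\<integral>\<^sup>+x. \<integral>\<^sup>+y. 2 * ennreal (norm (f (x, y))) \<partial>N \<partial>M) < \<infinity>"
        using fin2 by (subst M2.nn_integral_fst) auto
      show "AE x in M. ennreal (norm (bochner_integral N (\<lambda>y. s i (x, y)))) \<le> (\<integral>\<^sup>+y. 2 * ennreal (norm (f (x, y))) \<partial>N)" for i
      proof (rule AE_I2)
        fix x assume x: "x \<in> space M"
        have "(\<integral>\<^sup>+y. ennreal (norm (s i (x, y))) \<partial>N) \<le> (\<integral>\<^sup>+y. 2 * ennreal (norm (f (x, y))) \<partial>N)"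
          using x by (intro nn_integral_mono bd) (simp add: space_pair_measure)
        with norm_bochner_integral_le show "ennreal (norm (bochner_integral N (\<lambda>y. s i (x, y)))) \<le> (\<integral>\<^sup>+y. 2 * ennreal (norm (f (x, y))) \<partial>N)"
          by (rule order.trans)
      qed
      show "AE x in M. (\<lambda>i. bochner_integral N (\<lambda>y. s i (x, y))) \<longlonglongrightarrow> bochner_integral N (\<lambda>y. f (x, y))"
        using 1[OF lim(2) fin] AE_space
      proof eventually_elim
        case (elim x)
        have m2: "(\<lambda>y. ennreal (norm (f (x, y)))) \<in> borel_measurable N"
          by (intro ps_measurable_ennreal_norm sec lim elim)
        show ?case
        proof (rule bochner_integral_dominated_convergence[where w = "\<lambda>y. 2 * ennreal (norm (f (x, y)))"])
          show "(\<integral>\<^sup>+y. 2 * ennreal (norm (f (x, y))) \<partial>N) < \<infinity>"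
            using elim m2 by (subst nn_integral_cmult) (auto simp: ennreal_mult_less_top)
          show "strongly_measurable N (\<lambda>y. s i (x, y))" for i
            by (intro ps_imp_strongly_measurable sec lim elim)
        qed (use bd lim(6) elim m2 in \<open>auto simp: space_pair_measure\<close>)
      qed
    qed
    ultimately show ?case
      using lim(5) LIMSEQ_unique by auto
  qed
qed

lemma bochner_fubini:
  fixes f :: "'a \<times> 'c \<Rightarrow> 'b::banach"
  assumes "pair_sigma_finite M N" and f: "bochner_integrable (M \<Otimes>\<^sub>M N) f"
  shows "AE x in M. bochner_integrable N (\<lambda>y. f (x, y))"
    and "bochner_integrable M (\<lambda>x. bochner_integral N (\<lambda>y. f (x, y)))"
    and "bochner_integral M (\<lambda>x. bochner_integral N (\<lambda>y. f (x, y))) = bochner_integral (M \<Otimes>\<^sub>M N) f"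
proof -
  interpret pair_sigma_finite M N by fact
  obtain f' where f': "ps_measurable (M \<Otimes>\<^sub>M N) f'" "AE x in M \<Otimes>\<^sub>M N. f x = f' x"
    "(\<integral>\<^sup>+x. ennreal (norm (f' x)) \<partial>(M \<Otimes>\<^sub>M N)) < \<infinity>" "bochner_integral (M \<Otimes>\<^sub>M N) f' = bochner_integral (M \<Otimes>\<^sub>M N) f"
    using bochner_integrableE_ps[OF f] by blast
  have AE: "AE x in M. AE y in N. f (x, y) = f' (x, y)"
    by (rule AE_pair[OF f'(2)])
  have 1: "AE x in M. bochner_integral N (\<lambda>y. f (x, y)) = bochner_integral N (\<lambda>y. f' (x, y))"
    using AE by eventually_elim (rule bochner_integral_cong_AE)
  note fub = bochner_fubini_ps[OF assms(1) f'(1,3)]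
  show "AE x in M. bochner_integrable N (\<lambda>y. f (x, y))"
    using AE fub(1) by eventually_elim (simp add: bochner_integrable_cong_AE)
  show "bochner_integrable M (\<lambda>x. bochner_integral N (\<lambda>y. f (x, y)))"
    using fub(2) bochner_integrable_cong_AE[OF 1] by simp
  show "bochner_integral M (\<lambda>x. bochner_integral N (\<lambda>y. f (x, y))) = bochner_integral (M \<Otimes>\<^sub>M N) f"
    using fub(3) bochner_integral_cong_AE[OF 1] f'(4) by simp
qed

text \<open>The coordinate swap maps one product measure to the other, so integrability over
  \<open>M \<Otimes>\<^sub>M N\<close> also serves the reversed order.\<close>

lemma bochner_fubini_swap:
  fixes f :: "'a \<Rightarrow> 'c \<Rightarrow> 'b::banach"
  assumes MN: "pair_sigma_finite M N" and f: "bochner_integrable (M \<Otimes>\<^sub>M N) (\<lambda>(x, y). f x y)"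
  shows "AE y in N. bochner_integrable M (\<lambda>x. f x y)"
    and "bochner_integrable N (\<lambda>y. bochner_integral M (\<lambda>x. f x y))"
    and "bochner_integral N (\<lambda>y. bochner_integral M (\<lambda>x. f x y)) = bochner_integral M (\<lambda>x. bochner_integral N (f x))"
proof -
  interpret pair_sigma_finite M N by fact
  have NM: "pair_sigma_finite N M" by unfold_locales
  have sm: "strongly_measurable (distr (N \<Otimes>\<^sub>M M) (M \<Otimes>\<^sub>M N) (\<lambda>(x, y). (y, x))) (\<lambda>(x, y). f x y)"
    using f distr_pair_swap by (simp add: bochner_integrable_def)
  have sw: "(\<lambda>(x, y). (y, x)) \<in> N \<Otimes>\<^sub>M M \<rightarrow>\<^sub>M M \<Otimes>\<^sub>M N" by measurable
  have d: "distr (N \<Otimes>\<^sub>M M) (M \<Otimes>\<^sub>M N) (\<lambda>(x, y). (y, x)) = M \<Otimes>\<^sub>M N"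
    by (rule distr_pair_swap[symmetric])
  have f': "bochner_integrable (N \<Otimes>\<^sub>M M) (\<lambda>(y, x). f x y)"
    using f bochner_integrable_distr[OF sw sm, unfolded d] by (simp add: case_prod_beta')
  have "bochner_integral (M \<Otimes>\<^sub>M N) (\<lambda>(x, y). f x y) = bochner_integral (N \<Otimes>\<^sub>M M) (\<lambda>(y, x). f x y)"
    using bochner_integral_distr[OF sw sm, unfolded d] by (simp add: case_prod_beta')
  with bochner_fubini[OF NM f'] bochner_fubini[OF MN f]
  show "AE y in N. bochner_integrable M (\<lambda>x. f x y)"
    "bochner_integrable N (\<lambda>y. bochner_integral M (\<lambda>x. f x y))"
    "bochner_integral N (\<lambda>y. bochner_integral M (\<lambda>x. f x y)) = bochner_integral M (\<lambda>x. bochner_integral N (f x))"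
    by simp_all
qed

section \<open>Bounded strongly continuous semigroups\<close>

lemma distr_lborel_affine:
  assumes "\<bar>c\<bar> = 1"
  shows "distr lborel lborel (\<lambda>x. t + c * x) = (lborel :: real measure)"
proof -
  have "lborel = density (distr lborel borel (\<lambda>x. t + c * x)) (\<lambda>_. \<bar>c\<bar>)"
    using lborel_real_affine[of c t] assms by auto
  then show ?thesis
    using assms by (simp add: density_1 cong: distr_cong)
qed

lemma bochner_integral_lborel_affine:
  fixes f :: "real \<Rightarrow> 'b::banach"
  assumes f: "strongly_measurable lborel f" and c: "\<bar>c\<bar> = 1"
  shows "bochner_integrable lborel (\<lambda>x. f (t + c * x)) \<longleftrightarrow> bochner_integrable lborel f"
    and "bochner_integral lborel (\<lambda>x. f (t + c * x)) = bochner_integral lborel f"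
    and "strongly_measurable lborel (\<lambda>x. f (t + c * x))"
proof -
  have m: "(\<lambda>x. t + c * x) \<in> lborel \<rightarrow>\<^sub>M lborel" by measurable
  note * = bochner_distr[OF m, unfolded distr_lborel_affine[OF c], OF f]
  show "bochner_integrable lborel (\<lambda>x. f (t + c * x)) \<longleftrightarrow> bochner_integrable lborel f"
    "bochner_integral lborel (\<lambda>x. f (t + c * x)) = bochner_integral lborel f"
    "strongly_measurable lborel (\<lambda>x. f (t + c * x))"
    using * by auto
qed

lemma bochner_integrable_imp_strongly_measurable:
  "bochner_integrable M f \<Longrightarrow> strongly_measurable M f"
  by (simp add: bochner_integrable_def)

lemma norm_set_bochner_integral_le:
  fixes F :: "real \<Rightarrow> 'b::banach"
  assumes "a \<le> b" "0 \<le> c" and F: "\<And>r. a < r \<Longrightarrow> r \<le> b \<Longrightarrow> norm (F r) \<le> c"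
  shows "norm (set_bochner_integral lborel {a<..b} F) \<le> c * (b - a)"
proof -
  have "ennreal (norm (set_bochner_integral lborel {a<..b} F)) \<le> (\<integral>\<^sup>+r. ennreal (norm (indicat_real {a<..b} r *\<^sub>R F r)) \<partial>lborel)"
    by (rule norm_bochner_integral_le)
  also have "\<dots> \<le> (\<integral>\<^sup>+r. ennreal c * indicator {a<..b} r \<partial>lborel)"
    using F by (intro nn_integral_mono) (auto simp: indicator_def intro: ennreal_leI)
  also have "\<dots> = ennreal c * ennreal (b - a)"
    using assms(1) by (simp add: nn_integral_cmult_indicator)
  finally show ?thesis
    using assms by (simp add: ennreal_mult[symmetric])
qed

lemma set_bochner_integrable_subset:
  fixes F :: "'a \<Rightarrow> 'b::banach"
  assumes F: "set_bochner_integrable M A F" and B: "B \<in> sets M" "B \<subseteq> A"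
  shows "set_bochner_integrable M B F"
proof -
  have eq: "indicat_real B x *\<^sub>R F x = indicat_real B x *\<^sub>R indicat_real A x *\<^sub>R F x" for x
    using B by (auto simp: indicator_def)
  obtain F' where F': "ps_measurable M F'" "AE x in M. indicat_real A x *\<^sub>R F x = F' x"
    using F by (auto simp: bochner_integrable_def strongly_measurable_iff_ps)
  have "AE x in M. indicat_real B x *\<^sub>R F x = indicat_real B x *\<^sub>R F' x"
    using F'(2) by eventually_elim (subst eq, simp)
  then have "strongly_measurable M (\<lambda>x. indicat_real B x *\<^sub>R F x)"
    unfolding strongly_measurable_iff_ps using ps_measurable_indicator_scaleR[OF B(1) F'(1)] by blast
  moreover have "(\<integral>\<^sup>+x. ennreal (norm (indicat_real B x *\<^sub>R F x)) \<partial>M) \<le> (\<integral>\<^sup>+x. ennreal (norm (indicat_real A x *\<^sub>R F x)) \<partial>M)"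
    using B by (intro nn_integral_mono) (auto simp: indicator_def)
  ultimately show ?thesis
    using F by (auto simp: bochner_integrable_def intro: order.strict_trans1)
qed

lemma set_bochner_integral_Un:
  fixes F :: "'a \<Rightarrow> 'b::banach"
  assumes "set_bochner_integrable M A F" "set_bochner_integrable M B F" "A \<inter> B = {}"
  shows "set_bochner_integrable M (A \<union> B) F"
    and "set_bochner_integral M (A \<union> B) F = set_bochner_integral M A F + set_bochner_integral M B F"
proof -
  have eq: "(\<lambda>x. indicat_real (A \<union> B) x *\<^sub>R F x) = (\<lambda>x. indicat_real A x *\<^sub>R F x + indicat_real B x *\<^sub>R F x)"
    using assms(3) by (auto simp: indicator_def fun_eq_iff)
  show "set_bochner_integrable M (A \<union> B) F"
    "set_bochner_integral M (A \<union> B) F = set_bochner_integral M A F + set_bochner_integral M B F"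
    unfolding eq using bochner_integrable_add[OF assms(1,2)] bochner_integral_add[OF assms(1,2)] by auto
qed

lemma set_bochner_integral_split:
  fixes F :: "real \<Rightarrow> 'b::banach"
  assumes "set_bochner_integrable lborel {a<..c} F" "a \<le> b" "b \<le> c"
  shows "set_bochner_integral lborel {a<..c} F = set_bochner_integral lborel {a<..b} F + set_bochner_integral lborel {b<..c} F"
proof -
  have "{a<..c} = {a<..b} \<union> {b<..c}" using assms by auto
  then show ?thesis
    using set_bochner_integral_Un(2)[of lborel "{a<..b}" F "{b<..c}"]
      set_bochner_integrable_subset[OF assms(1)] assms(2,3) by auto
qed

text \<open>Close to \<open>a\<close> the function differs from \<open>L\<close> by less than half
  the tolerance, and so do its averages; the value at \<open>a\<close> itself does not count. It
  serves both the integral formula for orbits and the end of the uniqueness proof.\<close>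

lemma set_bochner_integral_average:
  fixes F :: "real \<Rightarrow> 'b::banach"
  assumes "0 < \<delta>" and int: "set_bochner_integrable lborel {a<..a + \<delta>} F" and lim: "(F \<longlongrightarrow> L) (at_right a)"
  shows "((\<lambda>h. (1 / h) *\<^sub>R set_bochner_integral lborel {a<..a + h} F) \<longlongrightarrow> L) (at_right 0)"
proof (rule tendstoI)
  fix e :: real assume e: "0 < e"
  then have "\<forall>\<^sub>F r in at_right a. dist (F r) L < e / 2"
    using lim by (intro tendstoD) auto
  then obtain b where b: "a < b" "\<And>r. a < r \<Longrightarrow> r < b \<Longrightarrow> dist (F r) L < e / 2"
    unfolding eventually_at_right_field by blast
  have "\<forall>\<^sub>F h in at_right 0. 0 < h \<and> h < min \<delta> (b - a)"
    using b(1) assms(1) eventually_at_right[of 0 1 "\<lambda>h. 0 < h \<and> h < min \<delta> (b - a)"]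
    by (auto intro!: exI[of _ "min \<delta> (b - a)"] simp: eventually_at_right_field)
  then show "\<forall>\<^sub>F h in at_right 0. dist ((1 / h) *\<^sub>R set_bochner_integral lborel {a<..a + h} F) L < e"
  proof eventually_elim
    case (elim h)
    have iF: "set_bochner_integrable lborel {a<..a + h} F"
      using elim by (intro set_bochner_integrable_subset[OF int]) auto
    have iL: "set_bochner_integrable lborel {a<..a + h} (\<lambda>_. L)"
      using elim by (intro bochner_integrable_indicator) auto
    have L: "set_bochner_integral lborel {a<..a + h} (\<lambda>_. L) = h *\<^sub>R L"
      using elim by (subst bochner_integral_indicator) auto
    have "norm (set_bochner_integral lborel {a<..a + h} (\<lambda>r. F r - L)) \<le> e / 2 * (a + h - a)"
      using elim b e by (intro norm_set_bochner_integral_le) (auto simp: dist_norm intro!: less_imp_le)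
    moreover have "set_bochner_integral lborel {a<..a + h} (\<lambda>r. F r - L) = set_bochner_integral lborel {a<..a + h} F - h *\<^sub>R L"
      using bochner_integral_diff[OF iF iL] L by (simp add: scaleR_diff_right)
    ultimately have *: "norm (set_bochner_integral lborel {a<..a + h} F - h *\<^sub>R L) \<le> e / 2 * h"
      by simp
    have "dist ((1 / h) *\<^sub>R set_bochner_integral lborel {a<..a + h} F) L = norm ((1 / h) *\<^sub>R (set_bochner_integral lborel {a<..a + h} F - h *\<^sub>R L))"
      using elim by (simp add: dist_norm scaleR_diff_right)
    also have "\<dots> \<le> e / 2"
      unfolding norm_scaleR using * elim by (simp add: field_simps)
    also have "\<dots> < e" using e by simp
    finally show ?case .
  qed
qed

section \<open>The semigroup and its generator\<close>

locale bounded_C0_semigroup = C0_semigroup P for P :: "real \<Rightarrow> 'b::banach \<Rightarrow>\<^sub>L 'b" +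
  fixes C :: real
  assumes norm_P: "0 \<le> t \<Longrightarrow> norm (P t) \<le> C"
begin

lemma C_nonneg: "0 \<le> C"
  using norm_P[of 0] norm_ge_zero order.trans by blast

lemma norm_P_apply: "0 \<le> t \<Longrightarrow> norm (P t x) \<le> C * norm x"
  by (meson mult_right_mono norm_P norm_blinfun norm_ge_zero order.trans)

lemma P_add: "0 \<le> s \<Longrightarrow> 0 \<le> t \<Longrightarrow> P (s + t) x = P s (P t x)"
  by (simp add: semigroup_add)

lemma P_zero [simp]: "P 0 x = x"
  by (simp add: semigroup_zero)

text \<open>Strong continuity is assumed only at 0 from the right. For two times the smaller one is
  factored out, which leaves \<open>P a (P b x - x)\<close>, and the uniform bound removes
  \<open>P a\<close>.\<close>

lemma continuous_on_P: "continuous_on {0..} (\<lambda>t. P t x)"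
  unfolding continuous_on_iff
proof (intro ballI allI impI)
  fix t e :: real assume t: "t \<in> {0..}" and e: "0 < e"
  \<comment> \<open>\<open>C + 1\<close> instead of \<open>C\<close>, since \<open>C\<close> may be
    0.\<close>
  have "0 < e / (C + 1)" using e C_nonneg by simp
  then have "\<forall>\<^sub>F s in at_right 0. dist (P s x) x < e / (C + 1)"
    using strongly_continuous by (intro tendstoD)
  then obtain d where d: "0 < d" "\<And>s. 0 < s \<Longrightarrow> s < d \<Longrightarrow> dist (P s x) x < e / (C + 1)"
    unfolding eventually_at_right_field by blast
  have key: "norm (P (a + b) x - P a x) < e" if "0 \<le> a" "0 \<le> b" "b < d" for a b
  proof -
    have "norm (P b x - x) \<le> e / (C + 1)"
      using d(2)[of b] that e C_nonneg by (cases "b = 0") (auto simp: dist_norm)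
    then have "norm (P a (P b x - x)) \<le> C * (e / (C + 1))"
      using norm_P_apply[of a "P b x - x"] that C_nonneg by (meson mult_left_mono order.trans)
    also have "\<dots> < e"
      using e C_nonneg by (simp add: field_simps)
    finally show ?thesis
      using that by (simp add: P_add blinfun.diff_right)
  qed
  show "\<exists>d>0. \<forall>s\<in>{0..}. dist s t < d \<longrightarrow> dist (P s x) (P t x) < e"
  proof (intro exI[of _ d] conjI ballI impI d)
    fix s assume s: "s \<in> {0..}" "dist s t < d"
    show "dist (P s x) (P t x) < e"
    proof (cases "t \<le> s")
      case True
      then show ?thesis using key[of t "s - t"] s t by (simp add: dist_norm)
    next
      case False
      then show ?thesis using key[of s "t - s"] s t by (simp add: dist_norm norm_minus_commute)
    qed
  qed
qed

text \<open>\<open>P\<close> is arbitrary at negative times. Truncating with \<open>max 0\<close>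
  extends the orbits continuously to the whole line, where the measurability lemmas apply.\<close>

lemma continuous_on_P_max: "continuous_on UNIV (\<lambda>t. P (max 0 t) x)"
proof -
  have "continuous_on UNIV (\<lambda>t::real. max 0 t)"
    by (intro continuous_intros)
  then show ?thesis
    by (rule continuous_on_compose2[OF continuous_on_P]) auto
qed

lemma ps_measurable_P:
  assumes "r \<in> borel_measurable M" "ps_measurable M f"
  shows "ps_measurable M (\<lambda>z. P (max 0 (r z)) (f z))"
  using ps_measurable_blinfun_apply[OF _ assms(2), of "\<lambda>z. P (max 0 (r z))"]
    ps_measurable_continuous[OF ps_measurable_second_countable[OF assms(1)] continuous_on_P_max] by blast

lemma tendsto_generator:
  assumes "x \<in> generator_dom P"
  shows "((\<lambda>h. (1 / h) *\<^sub>R (P h x - x)) \<longlongrightarrow> generator P x) (at_right 0)"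
  using assms unfolding generator_dom_def generator_def
  by (auto simp: tendsto_Lim)

lemma generatorI:
  assumes "((\<lambda>h. (1 / h) *\<^sub>R (P h x - x)) \<longlongrightarrow> y) (at_right 0)"
  shows "x \<in> generator_dom P" "generator P x = y"
  using assms unfolding generator_dom_def generator_def
  by (auto simp: tendsto_Lim)

lemma
  assumes x: "x \<in> generator_dom P" and t: "0 \<le> t"
  shows P_generator_dom: "P t x \<in> generator_dom P"
    and generator_P: "generator P (P t x) = P t (generator P x)"
proof -
  have "((\<lambda>h. P t ((1 / h) *\<^sub>R (P h x - x))) \<longlongrightarrow> P t (generator P x)) (at_right 0)"
    by (intro tendsto_intros tendsto_generator x)
  moreover have "\<forall>\<^sub>F h in at_right 0. P t ((1 / h) *\<^sub>R (P h x - x)) = (1 / h) *\<^sub>R (P h (P t x) - P t x)"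
  proof -
    have "P t ((1 / h) *\<^sub>R (P h x - x)) = (1 / h) *\<^sub>R (P h (P t x) - P t x)" if "0 < h" for h
      using P_add[of t h x] P_add[of h t x] t that by (simp add: blinfun.scaleR_right blinfun.diff_right add.commute)
    then show ?thesis
      unfolding eventually_at_right_field by (intro exI[of _ 1]) auto
  qed
  ultimately have "((\<lambda>h. (1 / h) *\<^sub>R (P h (P t x) - P t x)) \<longlongrightarrow> P t (generator P x)) (at_right 0)"
    by (rule Lim_transform_eventually)
  from generatorI[OF this] show "P t x \<in> generator_dom P" "generator P (P t x) = P t (generator P x)"
    by auto
qed

lemma generator_diff:
  assumes "x \<in> generator_dom P" "y \<in> generator_dom P"
  shows "x - y \<in> generator_dom P" "generator P (x - y) = generator P x - generator P y"
proof -
  have "((\<lambda>h. (1 / h) *\<^sub>R (P h x - x) - (1 / h) *\<^sub>R (P h y - y)) \<longlongrightarrow> generator P x - generator P y) (at_right 0)"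
    by (intro tendsto_diff tendsto_generator assms)
  then have "((\<lambda>h. (1 / h) *\<^sub>R (P h (x - y) - (x - y))) \<longlongrightarrow> generator P x - generator P y) (at_right 0)"
    by (simp add: blinfun.diff_right algebra_simps)
  from generatorI[OF this] show "x - y \<in> generator_dom P" "generator P (x - y) = generator P x - generator P y"
    by auto
qed

lemma generator_add:
  assumes "x \<in> generator_dom P" "y \<in> generator_dom P"
  shows "x + y \<in> generator_dom P" "generator P (x + y) = generator P x + generator P y"
proof -
  have "((\<lambda>h. (1 / h) *\<^sub>R (P h x - x) + (1 / h) *\<^sub>R (P h y - y)) \<longlongrightarrow> generator P x + generator P y) (at_right 0)"
    by (intro tendsto_add tendsto_generator assms)
  then have "((\<lambda>h. (1 / h) *\<^sub>R (P h (x + y) - (x + y))) \<longlongrightarrow> generator P x + generator P y) (at_right 0)"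
    by (simp add: blinfun.add_right algebra_simps)
  from generatorI[OF this] show "x + y \<in> generator_dom P" "generator P (x + y) = generator P x + generator P y"
    by auto
qed

lemma generator_scaleR:
  assumes "x \<in> generator_dom P"
  shows "c *\<^sub>R x \<in> generator_dom P" "generator P (c *\<^sub>R x) = c *\<^sub>R generator P x"
proof -
  have "((\<lambda>h. c *\<^sub>R ((1 / h) *\<^sub>R (P h x - x))) \<longlongrightarrow> c *\<^sub>R generator P x) (at_right 0)"
    by (intro tendsto_scaleR tendsto_const tendsto_generator assms)
  then have "((\<lambda>h. (1 / h) *\<^sub>R (P h (c *\<^sub>R x) - (c *\<^sub>R x))) \<longlongrightarrow> c *\<^sub>R generator P x) (at_right 0)"
    by (simp add: blinfun.scaleR_right scaleR_diff_right)
  from generatorI[OF this] show "c *\<^sub>R x \<in> generator_dom P" "generator P (c *\<^sub>R x) = c *\<^sub>R generator P x"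
    by auto
qed

lemma generator_zero: "0 \<in> generator_dom P" "generator P 0 = 0"
  using generatorI[of 0 0] by (auto simp: blinfun.zero_right)

lemma set_bochner_integrable_P:
  assumes "0 \<le> a"
  shows "set_bochner_integrable lborel {a<..b} (\<lambda>r. P r x)"
proof -
  have "ps_measurable lborel (\<lambda>r. indicat_real {a<..b} r *\<^sub>R P (max 0 r) x)"
    by (intro ps_measurable_indicator_scaleR ps_measurable_P ps_measurable_const) auto
  moreover have "(\<lambda>r. indicat_real {a<..b} r *\<^sub>R P (max 0 r) x) = (\<lambda>r. indicat_real {a<..b} r *\<^sub>R P r x)"
    using assms by (auto simp: indicator_def max_def)
  moreover have "(\<integral>\<^sup>+r. ennreal (norm (indicat_real {a<..b} r *\<^sub>R P r x)) \<partial>lborel) \<le> (\<integral>\<^sup>+r. ennreal (C * norm x) * indicator {a<..b} r \<partial>lborel)"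
    using assms by (intro nn_integral_mono) (auto simp: indicator_def intro!: ennreal_leI norm_P_apply)
  moreover have "(\<integral>\<^sup>+r. ennreal (C * norm x) * indicator {a<..b} r \<partial>lborel) < \<infinity>"
    by (cases "a \<le> b") (simp_all add: nn_integral_cmult_indicator ennreal_mult_less_top)
  ultimately show ?thesis
    by (intro bochner_integrableI_ps) (auto intro: order.strict_trans1)
qed

text \<open>For \<open>h > 0\<close> the average of the orbit over \<open>(T, T + h]\<close> minus
  that over \<open>(0, h]\<close> equals the integral over \<open>(0, T]\<close> of
  \<open>P r\<close> applied to the difference quotient of \<open>x\<close>. Letting
  \<open>h\<close> tend to 0 evaluates both sides.\<close>

lemma P_minus_id:
  assumes x: "x \<in> generator_dom P" and T: "0 \<le> T"
  shows "P T x - x = set_bochner_integral lborel {0<..T} (\<lambda>r. P r (generator P x))"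
proof (rule tendsto_unique)
  let ?I = "\<lambda>a b. set_bochner_integral lborel {a<..b} (\<lambda>r. P r x)"
  let ?y = "\<lambda>h. (1 / h) *\<^sub>R (P h x - x)"
  show "at_right (0::real) \<noteq> bot" by simp
  have "((\<lambda>h. (1 / h) *\<^sub>R ?I T (T + h) - (1 / h) *\<^sub>R ?I 0 (0 + h)) \<longlongrightarrow> P T x - P 0 x) (at_right 0)"
  proof (intro tendsto_diff set_bochner_integral_average[where \<delta> = 1] set_bochner_integrable_P)
    have "((\<lambda>t. P t x) \<longlongrightarrow> P a x) (at_right a)" if "0 \<le> a" for a
    proof -
      have "((\<lambda>t. P t x) \<longlongrightarrow> P a x) (at a within {0..})"
        using continuous_on_P that by (auto simp: continuous_on_def)
      then show ?thesis
        by (rule tendsto_within_subset) (use that in auto)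
    qed
    from this[OF T] this[of 0] show "((\<lambda>r. P r x) \<longlongrightarrow> P T x) (at_right T)" "((\<lambda>r. P r x) \<longlongrightarrow> P 0 x) (at_right 0)"
      by simp_all
  qed (use T in auto)
  moreover have "\<forall>\<^sub>F h in at_right 0. (1 / h) *\<^sub>R ?I T (T + h) - (1 / h) *\<^sub>R ?I 0 (0 + h) =
      set_bochner_integral lborel {0<..T} (\<lambda>r. P r (?y h))"
  proof -
    have "(1 / h) *\<^sub>R ?I T (T + h) - (1 / h) *\<^sub>R ?I 0 (0 + h) = set_bochner_integral lborel {0<..T} (\<lambda>r. P r (?y h))" if h: "0 < h" for h
    proof -
      \<comment> \<open>The interval \<open>(0, T + h]\<close> is split at \<open>h\<close> and at
        \<open>T\<close>; the piece that starts at \<open>h\<close> is then shifted back by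
        \<open>h\<close>, which brings in \<open>P h x\<close>.\<close>
      have 1: "?I 0 (T + h) = ?I 0 h + ?I h (T + h)" "?I 0 (T + h) = ?I 0 T + ?I T (T + h)"
        using h T by (auto intro!: set_bochner_integral_split set_bochner_integrable_P)
      have eq: "indicat_real {h<..T + h} (h + 1 * r) *\<^sub>R P (h + 1 * r) x = indicat_real {0<..T} r *\<^sub>R P r (P h x)" for r
        using h P_add[of r h x] by (auto simp: indicator_def add.commute)
      have 2: "?I h (T + h) = set_bochner_integral lborel {0<..T} (\<lambda>r. P r (P h x))"
        using bochner_integral_lborel_affine(2)[OF bochner_integrable_imp_strongly_measurable[OF set_bochner_integrable_P[of h "T + h" x]], of 1 h] h
        by (simp only: eq)
      have 3: "indicat_real {0<..T} r *\<^sub>R P r (?y h) =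
         (1 / h) *\<^sub>R (indicat_real {0<..T} r *\<^sub>R P r (P h x) - indicat_real {0<..T} r *\<^sub>R P r x)" for r
        by (simp add: blinfun.scaleR_right blinfun.diff_right scaleR_diff_right)
      have "set_bochner_integral lborel {0<..T} (\<lambda>r. P r (?y h)) = (1 / h) *\<^sub>R (?I h (T + h) - ?I 0 T)"
        unfolding 3 2
        by (subst bochner_integral_scaleR) (auto intro!: bochner_integrable_diff set_bochner_integrable_P bochner_integral_diff)
      also have "?I h (T + h) - ?I 0 T = ?I T (T + h) - ?I 0 h"
        using 1 by (simp add: algebra_simps)
      finally show ?thesis by (simp add: scaleR_diff_right)
    qed
    then show ?thesis
      unfolding eventually_at_right_field by (intro exI[of _ 1]) auto
  qed
  ultimately show "((\<lambda>h. set_bochner_integral lborel {0<..T} (\<lambda>r. P r (?y h))) \<longlongrightarrow> P T x - x) (at_right 0)"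
    using Lim_transform_eventually by fastforce
  show "((\<lambda>h. set_bochner_integral lborel {0<..T} (\<lambda>r. P r (?y h))) \<longlongrightarrow>
      set_bochner_integral lborel {0<..T} (\<lambda>r. P r (generator P x))) (at_right 0)"
  proof (rule Lim_null[THEN iffD2], rule Lim_null_comparison)
    show "((\<lambda>h. C * norm (?y h - generator P x) * (T - 0)) \<longlongrightarrow> 0) (at_right 0)"
      using tendsto_norm_zero[OF Lim_null[THEN iffD1, OF tendsto_generator[OF x]]]
      by (intro tendsto_mult_left_zero tendsto_mult_right_zero)
    show "\<forall>\<^sub>F h in at_right 0. norm (set_bochner_integral lborel {0<..T} (\<lambda>r. P r (?y h)) -
        set_bochner_integral lborel {0<..T} (\<lambda>r. P r (generator P x))) \<le> C * norm (?y h - generator P x) * (T - 0)"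
    proof (rule always_eventually, rule allI)
      fix h
      have D: "set_bochner_integral lborel {0<..T} (\<lambda>r. P r y) - set_bochner_integral lborel {0<..T} (\<lambda>r. P r z) =
        set_bochner_integral lborel {0<..T} (\<lambda>r. P r (y - z))" for y z
        using bochner_integral_diff[OF set_bochner_integrable_P[of 0 T y] set_bochner_integrable_P[of 0 T z]]
        by (simp add: blinfun.diff_right scaleR_diff_right)
      have "set_bochner_integral lborel {0<..T} (\<lambda>r. P r (?y h)) - set_bochner_integral lborel {0<..T} (\<lambda>r. P r (generator P x)) =
        set_bochner_integral lborel {0<..T} (\<lambda>r. P r (?y h - generator P x))"
        by (rule D)
      also have "norm \<dots> \<le> C * norm (?y h - generator P x) * (T - 0)"
        using T C_nonneg by (intro norm_set_bochner_integral_le norm_P_apply) auto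
      finally show "norm (set_bochner_integral lborel {0<..T} (\<lambda>r. P r (?y h)) -
        set_bochner_integral lborel {0<..T} (\<lambda>r. P r (generator P x))) \<le> C * norm (?y h - generator P x) * (T - 0)" .
    qed
  qed
qed

text \<open>Immediate from \<open>P_minus_id\<close>. Uniformity in \<open>h\<close> provides the
  domination of difference quotients in \<open>generator_bochner_integral\<close>.\<close>

lemma norm_P_minus_id_le:
  assumes "x \<in> generator_dom P" "0 < h"
  shows "norm ((1 / h) *\<^sub>R (P h x - x)) \<le> C * norm (generator P x)"
proof -
  have "norm (P h x - x) \<le> C * norm (generator P x) * (h - 0)"
    unfolding P_minus_id[OF assms(1) less_imp_le[OF assms(2)]]
    using assms C_nonneg by (intro norm_set_bochner_integral_le norm_P_apply) auto
  then show ?thesis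
    unfolding norm_scaleR using assms(2) by (simp add: field_simps)
qed

text \<open>A form of Hille's theorem. Instead of closedness of the generator it uses dominated
  convergence of the difference quotients under the integral, along sequences.\<close>

theorem generator_bochner_integral:
  fixes F :: "'c \<Rightarrow> 'b"
  assumes F: "bochner_integrable M F" and dom: "AE z in M. F z \<in> generator_dom P"
    and AF: "bochner_integrable M (\<lambda>z. generator P (F z))"
  shows "bochner_integral M F \<in> generator_dom P"
    and "generator P (bochner_integral M F) = bochner_integral M (\<lambda>z. generator P (F z))"
proof -
  \<comment> \<open>The norm of \<open>generator P (F z)\<close> need not be measurable in
    \<open>z\<close>, so the dominating function is built from a representative.\<close>
  obtain AF' where AF': "ps_measurable M AF'" "AE z in M. generator P (F z) = AF' z"
    "(\<integral>\<^sup>+x. ennreal (norm (AF' x)) \<partial>M) < \<infinity>"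
    using bochner_integrableE_ps[OF AF] by metis
  have *: "((\<lambda>h. (1 / h) *\<^sub>R (P h (bochner_integral M F) - bochner_integral M F)) \<longlongrightarrow> bochner_integral M (\<lambda>z. generator P (F z))) (at_right 0)"
  proof (rule tendsto_at_right_sequentially[of 0 1])
    fix S :: "nat \<Rightarrow> real" assume S: "\<And>n. 0 < S n" "S \<longlonglongrightarrow> 0"
    then have S': "filterlim S (at_right 0) sequentially"
      by (intro tendsto_imp_filterlim_at_right) auto
    have "(\<lambda>n. bochner_integral M (\<lambda>z. (1 / S n) *\<^sub>R (P (S n) (F z) - F z))) \<longlonglongrightarrow> bochner_integral M (\<lambda>z. generator P (F z))"
    proof (rule bochner_integral_dominated_convergence[where w = "\<lambda>z. ennreal C * ennreal (norm (AF' z))"])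
      show "strongly_measurable M (\<lambda>z. (1 / S n) *\<^sub>R (P (S n) (F z) - F z))" for n
        by (intro bochner_integrable_imp_strongly_measurable bochner_integrable_scaleR bochner_integrable_diff bochner_integrable_blinfun F)
      show "(\<lambda>z. ennreal C * ennreal (norm (AF' z))) \<in> borel_measurable M"
        using ps_measurable_norm[OF AF'(1)] by simp
      show "(\<integral>\<^sup>+z. ennreal C * ennreal (norm (AF' z)) \<partial>M) < \<infinity>"
        using AF'(3) ps_measurable_norm[OF AF'(1)] by (simp add: nn_integral_cmult ennreal_mult_less_top)
      show "AE z in M. ennreal (norm ((1 / S n) *\<^sub>R (P (S n) (F z) - F z))) \<le> ennreal C * ennreal (norm (AF' z))" for n
        using dom AF'(2)
      proof eventually_elim
        case (elim z)
        then show ?case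
          using ennreal_leI[OF norm_P_minus_id_le[OF elim(1) S(1)[of n]]] C_nonneg by (simp add: ennreal_mult)
      qed
      show "AE z in M. (\<lambda>n. (1 / S n) *\<^sub>R (P (S n) (F z) - F z)) \<longlonglongrightarrow> generator P (F z)"
        using dom by eventually_elim (rule filterlim_compose[OF tendsto_generator S'])
    qed
    also have "(\<lambda>n. bochner_integral M (\<lambda>z. (1 / S n) *\<^sub>R (P (S n) (F z) - F z))) =
       (\<lambda>n. (1 / S n) *\<^sub>R (P (S n) (bochner_integral M F) - bochner_integral M F))"
      by (simp add: bochner_integral_scaleR[OF bochner_integrable_diff[OF bochner_integrable_blinfun[OF F] F]]
            bochner_integral_diff[OF bochner_integrable_blinfun[OF F] F] bochner_integral_blinfun[OF F])
    finally show "(\<lambda>n. (1 / S n) *\<^sub>R (P (S n) (bochner_integral M F) - bochner_integral M F)) \<longlonglongrightarrow> bochner_integral M (\<lambda>z. generator P (F z))" .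
  qed simp
  from generatorI[OF *] show "bochner_integral M F \<in> generator_dom P"
    "generator P (bochner_integral M F) = bochner_integral M (\<lambda>z. generator P (F z))" by auto
qed

end

lemma bounded_C0_semigroupI:
  assumes "C0_semigroup P" "\<exists>C. \<forall>t>0. norm (P t) \<le> C"
  obtains C where "bounded_C0_semigroup P C"
proof -
  interpret C0_semigroup P by fact
  from assms(2) obtain C where C: "\<And>t. 0 < t \<Longrightarrow> norm (P t) \<le> C" by blast
  \<comment> \<open>The assumed bound covers positive times only; at time 0 the operator is the
    identity, whose norm is at most 1.\<close>
  have "norm (P t) \<le> max C 1" if "0 \<le> t" for t
    using C[of t] that norm_blinfun_id_le semigroup_zero
    by (cases "t = 0") (auto simp: le_max_iff_disj)
  then show ?thesis
    by (intro that[of "max C 1"]) unfold_locales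
qed

section \<open>Uniqueness of moments and Laplace transforms\<close>

lemma integrable_power_unit_interval:
  assumes "finite_measure N" and N: "sets N = sets borel" "AE z in N. z \<in> {0..1}"
  shows "integrable N (\<lambda>z::real. z ^ n)"
proof -
  interpret finite_measure N by fact
  have [measurable]: "(\<lambda>z::real. z ^ n) \<in> borel_measurable N"
    by (simp add: measurable_cong_sets[OF N(1) refl])
  show ?thesis
  proof (rule integrable_const_bound[where B = 1])
    show "AE z in N. norm (z ^ n) \<le> 1"
      using N(2) by eventually_elim (simp add: power_le_one)
  qed measurable
qed

text \<open>Equal moments give equal integrals of polynomials, hence by Bernstein approximation of
  continuous functions, and ramp functions then recover the masses of half-lines.\<close>

theorem Hausdorff_moment_unique:
  fixes N1 N2 :: "real measure"
  assumes N1: "finite_measure N1" "sets N1 = sets borel" "AE z in N1. z \<in> {0..1}"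
    and N2: "finite_measure N2" "sets N2 = sets borel" "AE z in N2. z \<in> {0..1}"
    and moments: "\<And>n::nat. (\<integral>z. z ^ n \<partial>N1) = (\<integral>z. z ^ n \<partial>N2)"
  shows "N1 = N2"
proof -
  interpret N1: finite_measure N1 by fact
  interpret N2: finite_measure N2 by fact
  have bern: "integrable N (\<lambda>z. c * Bernstein n k z)" if "finite_measure N" "sets N = sets borel" "AE z in N. z \<in> {0..1}"
    for N :: "real measure" and c n k
  proof -
    interpret finite_measure N by fact
    have [measurable]: "(\<lambda>z. c * Bernstein n k z) \<in> borel_measurable N"
      unfolding Bernstein_def by (simp add: measurable_cong_sets[OF that(2) refl])
    have le: "norm (c * Bernstein n k z) \<le> \<bar>c\<bar> * real (n choose k)" if "z \<in> {0..1}" for z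
    proof -
      have "z ^ k * (1 - z) ^ (n - k) \<le> 1 * 1"
        using that by (intro mult_mono power_le_one) auto
      then have "\<bar>c\<bar> * (real (n choose k) * (z ^ k * (1 - z) ^ (n - k))) \<le> \<bar>c\<bar> * (real (n choose k) * 1)"
        by (intro mult_left_mono) auto
      then show ?thesis
        using that by (simp add: Bernstein_def abs_mult mult.assoc)
    qed
    have "AE z in N. norm (c * Bernstein n k z) \<le> \<bar>c\<bar> * real (n choose k)"
      using that(3) by eventually_elim (rule le)
    then show ?thesis
      by (rule integrable_const_bound) measurable
  qed
  \<comment> \<open>Bernstein polynomials are multiples of such products, and expanding
    \<open>(1 - z) ^ m\<close> reduces these to moments.\<close>
  have poly: "(\<integral>z. z ^ k * (1 - z) ^ m \<partial>N1) = (\<integral>z. z ^ k * (1 - z) ^ m \<partial>N2)" for k m :: nat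
  proof -
    have "(\<integral>z. z ^ k * (1 - z) ^ m \<partial>N) = (\<Sum>j\<le>m. (of_nat (m choose j) * (-1) ^ (m - j)) * (\<integral>z. z ^ (k + (m - j)) \<partial>N))"
      if N: "finite_measure N" "sets N = sets borel" "AE z in N. z \<in> {0..1}" for N :: "real measure"
    proof -
      have eq: "z ^ k * (1 - z) ^ m = (\<Sum>j\<le>m. (of_nat (m choose j) * (-1) ^ (m - j)) * z ^ (k + (m - j)))" for z :: real
      proof -
        have "(1 - z) ^ m = (\<Sum>j\<le>m. of_nat (m choose j) * 1 ^ j * (- z) ^ (m - j))"
          using binomial_ring[of 1 "- z" m] by simp
        then have "z ^ k * (1 - z) ^ m = (\<Sum>j\<le>m. z ^ k * (of_nat (m choose j) * 1 ^ j * (- z) ^ (m - j)))"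
          by (simp only: sum_distrib_left)
        also have "\<dots> = (\<Sum>j\<le>m. (of_nat (m choose j) * (-1) ^ (m - j)) * z ^ (k + (m - j)))"
          by (intro sum.cong refl) (simp only: power_add power_minus[of z] power_one mult_1_right mult_ac)
        finally show ?thesis .
      qed
      show ?thesis
        unfolding eq
        by (subst Bochner_Integration.integral_sum) (auto intro!: integrable_power_unit_interval[OF N])
    qed
    from this[OF N1] this[OF N2] show ?thesis
      by (simp add: moments)
  qed
  have cont: "(\<integral>z. \<psi> z \<partial>N1) = (\<integral>z. \<psi> z \<partial>N2)" if \<psi>: "continuous_on UNIV \<psi>" for \<psi> :: "real \<Rightarrow> real"
  proof -
    define B where "B n z = (\<Sum>k\<le>n. \<psi> (real k / real n) * Bernstein n k z)" for n z
    have c01: "continuous_on {0..1} \<psi>"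
      using \<psi> continuous_on_subset by blast
    have conv: "(\<lambda>n. \<integral>z. B n z \<partial>N) \<longlonglongrightarrow> (\<integral>z. \<psi> z \<partial>N)"
      if N: "finite_measure N" "sets N = sets borel" "AE z in N. z \<in> {0..1}" for N :: "real measure"
    proof -
      interpret finite_measure N by fact
      have [measurable]: "\<psi> \<in> borel_measurable N"
        using borel_measurable_continuous_onI[OF \<psi>] by (simp add: measurable_cong_sets[OF N(2) refl])
      have "bounded (\<psi> ` {0..1})"
        using compact_continuous_image[OF c01] compact_imp_bounded by blast
      then obtain b where b: "\<And>z. z \<in> {0..1} \<Longrightarrow> norm (\<psi> z) \<le> b"
        unfolding bounded_iff by blast
      have i\<psi>: "integrable N \<psi>"
      proof (rule integrable_const_bound[where B = b])
        show "AE z in N. norm (\<psi> z) \<le> b"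
          using N(3) by eventually_elim (rule b)
      qed measurable
      have iB: "integrable N (B n)" for n
        unfolding B_def[abs_def] by (intro Bochner_Integration.integrable_sum bern N)
      show ?thesis
      proof (rule LIMSEQ_I)
        fix e :: real assume e: "0 < e"
        \<comment> \<open>A uniform error \<open>d\<close> integrated over the total mass stays
          below \<open>e\<close>; the added 1 covers the zero measure.\<close>
        define d where "d = e / (measure N (space N) + 1)"
        have d: "0 < d" using e by (simp add: d_def add_nonneg_pos)
        obtain n0 where n0: "\<And>n z. n0 \<le> n \<Longrightarrow> z \<in> {0..1} \<Longrightarrow> \<bar>\<psi> z - B n z\<bar> < d"
          using Bernstein_Weierstrass[OF c01 d] unfolding B_def by blast
        have "norm ((\<integral>z. B n z \<partial>N) - (\<integral>z. \<psi> z \<partial>N)) < e" if "n0 \<le> n" for n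
        proof -
          have "norm ((\<integral>z. B n z \<partial>N) - (\<integral>z. \<psi> z \<partial>N)) = norm (\<integral>z. B n z - \<psi> z \<partial>N)"
            using iB i\<psi> by simp
          also have "\<dots> \<le> (\<integral>z. norm (B n z - \<psi> z) \<partial>N)"
            by (rule integral_norm_bound)
          also have "\<dots> \<le> (\<integral>z. d \<partial>N)"
          proof (rule integral_mono_AE)
            show "integrable N (\<lambda>z. norm (B n z - \<psi> z))" using iB i\<psi> by auto
            show "AE z in N. norm (B n z - \<psi> z) \<le> d"
              using N(3) by eventually_elim (use n0[OF that] in \<open>force simp: abs_minus_commute intro: less_imp_le\<close>)
          qed simp
          also have "\<dots> = d * measure N (space N)" by simp
          also have "\<dots> < d * (measure N (space N) + 1)"
            using d by simp
          also have "\<dots> = e"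
            by (simp add: d_def add_nonneg_eq_0_iff)
          finally show ?thesis .
        qed
        then show "\<exists>n0. \<forall>n\<ge>n0. norm ((\<integral>z. B n z \<partial>N) - (\<integral>z. \<psi> z \<partial>N)) < e" by blast
      qed
    qed
    have "(\<integral>z. B n z \<partial>N1) = (\<integral>z. B n z \<partial>N2)" for n
    proof -
      have "(\<integral>z. c * Bernstein n k z \<partial>N1) = (\<integral>z. c * Bernstein n k z \<partial>N2)" for c k
        unfolding Bernstein_def by (simp add: mult.assoc poly)
      then show ?thesis
        unfolding B_def Bochner_Integration.integral_sum[OF bern[OF N1]] Bochner_Integration.integral_sum[OF bern[OF N2]]
        by (rule sum.cong[OF refl])
    qed
    then show ?thesis
      using conv[OF N1] conv[OF N2] LIMSEQ_unique by auto
  qed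
  show ?thesis
  proof (rule measure_eqI_lessThan)
    fix x :: real
    show "emeasure N1 {x<..} < \<infinity>"
      by (simp add: less_top[symmetric])
    \<comment> \<open>The ramps vanish up to \<open>x\<close> and beyond it are 1 for all large
      \<open>m\<close>, so they converge to the indicator of the open half-line.\<close>
    have conv: "(\<lambda>m::nat. \<integral>z. min 1 (max 0 (real m * (z - x))) \<partial>N) \<longlonglongrightarrow> measure N {x<..}"
      if N: "finite_measure N" "sets N = sets borel" for N :: "real measure"
    proof -
      interpret finite_measure N by fact
      have sp: "space N = UNIV" using sets_eq_imp_space_eq[OF N(2)] by simp
      have "(\<lambda>m::nat. \<integral>z. min 1 (max 0 (real m * (z - x))) \<partial>N) \<longlonglongrightarrow> (\<integral>z. indicat_real {x<..} z \<partial>N)"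
      proof (rule integral_dominated_convergence[where w = "\<lambda>_. 1"])
        show "indicat_real {x<..} \<in> borel_measurable N" "\<And>m. (\<lambda>z. min 1 (max 0 (real m * (z - x)))) \<in> borel_measurable N"
          by (simp_all add: measurable_cong_sets[OF N(2) refl])
        show "AE z in N. (\<lambda>m. min 1 (max 0 (real m * (z - x)))) \<longlonglongrightarrow> indicat_real {x<..} z"
        proof (rule AE_I2)
          fix z
          show "(\<lambda>m. min 1 (max 0 (real m * (z - x)))) \<longlonglongrightarrow> indicat_real {x<..} z"
          proof (cases "x < z")
            case True
            then obtain m0 where m0: "1 / (z - x) < real m0"
              using reals_Archimedean2 by blast
            have "min 1 (max 0 (real m * (z - x))) = 1" if "m0 \<le> m" for m
            proof -
              have "1 \<le> real m0 * (z - x)" using m0 True by (simp add: field_simps)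
              also have "\<dots> \<le> real m * (z - x)" using that True by (intro mult_right_mono) auto
              finally show ?thesis by simp
            qed
            then have "\<forall>\<^sub>F m in sequentially. min 1 (max 0 (real m * (z - x))) = indicat_real {x<..} z"
              using True by (auto simp: eventually_sequentially)
            then show ?thesis by (rule tendsto_eventually)
          next
            case False
            then have "real m * (z - x) \<le> 0" for m
              by (intro mult_nonneg_nonpos) auto
            then have "min 1 (max 0 (real m * (z - x))) = indicat_real {x<..} z" for m
              using False by (simp add: max_absorb1)
            then show ?thesis by simp
          qed
        qed
      qed (auto simp: abs_if)
      then show ?thesis using sp by simp
    qed
    have "(\<integral>z. min 1 (max 0 (real m * (z - x))) \<partial>N1) = (\<integral>z. min 1 (max 0 (real m * (z - x))) \<partial>N2)" for m :: nat
      by (rule cont) (intro continuous_intros)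
    then have "measure N1 {x<..} = measure N2 {x<..}"
      using conv[OF N1(1,2)] conv[OF N2(1,2)] LIMSEQ_unique by auto
    then show "emeasure N1 {x<..} = emeasure N2 {x<..}"
      by (simp add: N1.emeasure_eq_measure N2.emeasure_eq_measure)
  qed (use N1 N2 in auto)
qed

text \<open>The substitution \<open>z = exp (- t)\<close> turns the transform at
  \<open>1 + n\<close> into an \<open>n\<close>-th moment on \<open>[0, 1]\<close>, so integer
  arguments suffice. The 1 in \<open>1 + n\<close> pays for the weight \<open>exp (- t)\<close> that
  makes the measures finite.\<close>

theorem laplace_transform_unique:
  fixes f1 f2 :: "real \<Rightarrow> ennreal"
  assumes [measurable]: "f1 \<in> borel_measurable borel" "f2 \<in> borel_measurable borel"
    and eq: "\<And>\<theta>. 0 < \<theta> \<Longrightarrow> (\<integral>\<^sup>+t. ennreal (exp (- \<theta> * t)) * (f1 t * indicator {0<..} t) \<partial>lborel) =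
      (\<integral>\<^sup>+t. ennreal (exp (- \<theta> * t)) * (f2 t * indicator {0<..} t) \<partial>lborel)"
    and fin: "(\<integral>\<^sup>+t. ennreal (exp (- t)) * (f1 t * indicator {0<..} t) \<partial>lborel) < \<infinity>"
  shows "AE t in lborel. 0 < t \<longrightarrow> f1 t = f2 t"
proof -
  define h where "h f t = ennreal (exp (- t)) * (f t * indicator {0<..} t)" for f :: "real \<Rightarrow> ennreal" and t
  define N where "N f = distr (density lborel (h f)) borel (\<lambda>t. exp (- t))" for f
  have [measurable]: "h f \<in> borel_measurable borel" if "f \<in> borel_measurable borel" for f
    unfolding h_def[abs_def] using that by measurable
  have fin2: "(\<integral>\<^sup>+t. h f2 t \<partial>lborel) < \<infinity>"
    using fin eq[of 1] by (simp add: h_def)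
  have fin1: "(\<integral>\<^sup>+t. h f1 t \<partial>lborel) < \<infinity>"
    using fin by (simp add: h_def)
  have F: "finite_measure (N f)" if "f \<in> borel_measurable borel" "(\<integral>\<^sup>+t. h f t \<partial>lborel) < \<infinity>" for f
    unfolding N_def using that
    by (intro finite_measure.finite_measure_distr finite_measureI) (auto simp: emeasure_density)
  have AE: "AE z in N f. z \<in> {0..1}" if "f \<in> borel_measurable borel" for f
    unfolding N_def using that
    by (subst AE_distr_iff) (auto simp: AE_density h_def indicator_def)
  have nnm: "(\<integral>\<^sup>+z. ennreal (z ^ n) \<partial>N f) = (\<integral>\<^sup>+t. ennreal (exp (- (1 + real n) * t)) * (f t * indicator {0<..} t) \<partial>lborel)"
    if [measurable]: "f \<in> borel_measurable borel" for f n
  proof -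
    have p: "ennreal (exp (- t)) * ennreal (exp (- t) ^ n) = ennreal (exp (- (1 + real n) * t))" for t
      by (simp add: ennreal_mult[symmetric] exp_of_nat_mult[symmetric] exp_add[symmetric] algebra_simps)
    have "h f t * ennreal (exp (- t) ^ n) = ennreal (exp (- (1 + real n) * t)) * (f t * indicator {0<..} t)" for t
      unfolding h_def p[symmetric] by (simp only: mult_ac)
    then show ?thesis
      unfolding N_def by (simp add: nn_integral_distr nn_integral_density)
  qed
  have m: "(\<integral>z. z ^ n \<partial>N f) = enn2real (\<integral>\<^sup>+z. ennreal (z ^ n) \<partial>N f)" if "f \<in> borel_measurable borel" for f n
  proof (rule integral_eq_nn_integral)
    show "AE z in N f. 0 \<le> z ^ n"
      using AE[OF that] by eventually_elim simp
  qed (simp add: N_def)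
  have "N f1 = N f2"
  proof (rule Hausdorff_moment_unique[OF F _ AE F _ AE])
    show "(\<integral>z. z ^ n \<partial>N f1) = (\<integral>z. z ^ n \<partial>N f2)" for n
      unfolding m[OF assms(1)] m[OF assms(2)] nnm[OF assms(1)] nnm[OF assms(2)]
      by (subst eq) auto
  qed (use fin1 fin2 in \<open>auto simp: N_def\<close>)
  \<comment> \<open>\<open>- ln\<close> inverts the substitution and recovers the weighted
    densities, from which the positive finite weight cancels.\<close>
  then have "distr (N f1) borel (\<lambda>z. - ln z) = distr (N f2) borel (\<lambda>z. - ln z)" by simp
  moreover have "distr (N f) borel (\<lambda>z. - ln z) = density lborel (h f)" for f
    unfolding N_def by (subst distr_distr) (auto simp: comp_def distr_id2)
  ultimately have "density lborel (h f1) = density lborel (h f2)" by simp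
  moreover have "sigma_finite_measure (density lborel (h f1))"
    using fin1 by (intro finite_measure.axioms(1) finite_measureI) (auto simp: emeasure_density)
  ultimately have "AE t in lborel. h f1 t = h f2 t"
    by (subst (asm) sigma_finite_density_unique) auto
  then show ?thesis
    by eventually_elim (auto simp: h_def ennreal_mult_cancel_left)
qed

section \<open>Laplace transform of a convolution\<close>

lemma nn_integral_lborel_shift:
  fixes f :: "real \<Rightarrow> ennreal"
  assumes "f \<in> borel_measurable borel"
  shows "(\<integral>\<^sup>+x. f (x - s) \<partial>lborel) = (\<integral>\<^sup>+x. f x \<partial>lborel)"
  using nn_integral_real_affine[of f 1 "- s"] assms by simp

lemma nn_integral_lborel_reflect:
  fixes f :: "real \<Rightarrow> ennreal"
  assumes "f \<in> borel_measurable borel"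
  shows "(\<integral>\<^sup>+x. f (s - x) \<partial>lborel) = (\<integral>\<^sup>+x. f x \<partial>lborel)"
  using nn_integral_real_affine[of f "- 1" s] assms by simp

text \<open>The exponential splits into a factor in \<open>t - s\<close> and one in
  \<open>s\<close>; Tonelli and translation invariance do the rest. Integration over the whole line
  suits kernels extended by 0 to negative arguments.\<close>

lemma laplace_transform_convolution:
  fixes a b :: "real \<Rightarrow> ennreal"
  assumes [measurable]: "a \<in> borel_measurable borel" "b \<in> borel_measurable borel"
  shows "(\<integral>\<^sup>+t. ennreal (exp (- \<theta> * t)) * (\<integral>\<^sup>+s. a (t - s) * b s \<partial>lborel) \<partial>lborel) =
    (\<integral>\<^sup>+t. ennreal (exp (- \<theta> * t)) * a t \<partial>lborel) * (\<integral>\<^sup>+t. ennreal (exp (- \<theta> * t)) * b t \<partial>lborel)"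
proof -
  let ?e = "\<lambda>t. ennreal (exp (- \<theta> * t))"
  have e: "?e t = ?e (t - s) * ?e s" for t s
    by (simp add: ennreal_mult[symmetric] exp_add[symmetric] algebra_simps)
  have ee: "?e t * (a (t - s) * b s) = (?e (t - s) * a (t - s)) * (?e s * b s)" for t s
    unfolding e[of t s] by (simp only: mult_ac)
  have "(\<integral>\<^sup>+t. ?e t * (\<integral>\<^sup>+s. a (t - s) * b s \<partial>lborel) \<partial>lborel) = (\<integral>\<^sup>+t. \<integral>\<^sup>+s. (?e (t - s) * a (t - s)) * (?e s * b s) \<partial>lborel \<partial>lborel)"
    unfolding ee[symmetric] by (intro nn_integral_cong nn_integral_cmult[symmetric]) measurable
  also have "\<dots> = (\<integral>\<^sup>+s. \<integral>\<^sup>+t. (?e (t - s) * a (t - s)) * (?e s * b s) \<partial>lborel \<partial>lborel)"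
    by (rule lborel_pair.Fubini') measurable
  also have "\<dots> = (\<integral>\<^sup>+s. (\<integral>\<^sup>+t. ?e t * a t \<partial>lborel) * (?e s * b s) \<partial>lborel)"
  proof (rule nn_integral_cong)
    fix s :: real
    have "(\<integral>\<^sup>+t. (?e (t - s) * a (t - s)) * (?e s * b s) \<partial>lborel) = (\<integral>\<^sup>+t. ?e (t - s) * a (t - s) \<partial>lborel) * (?e s * b s)"
      by (rule nn_integral_multc) measurable
    then show "(\<integral>\<^sup>+t. (?e (t - s) * a (t - s)) * (?e s * b s) \<partial>lborel) = (\<integral>\<^sup>+t. ?e t * a t \<partial>lborel) * (?e s * b s)"
      using nn_integral_lborel_shift[of "\<lambda>t. ?e t * a t" s] by simp
  qed
  also have "\<dots> = (\<integral>\<^sup>+t. ?e t * a t \<partial>lborel) * (\<integral>\<^sup>+t. ?e t * b t \<partial>lborel)"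
    by (rule nn_integral_cmult) measurable
  finally show ?thesis .
qed

section \<open>Densities of the subordinator and of its inverse\<close>

lemma nn_integral_exp_Ioo:
  assumes "0 < \<theta>" "0 \<le> x"
  shows "(\<integral>\<^sup>+t. ennreal (exp (- (\<theta> * t))) * indicator {0<..<x} t \<partial>lborel) = ennreal ((1 - exp (- (\<theta> * x))) / \<theta>)"
proof -
  have "(\<integral>\<^sup>+t. ennreal (exp (- (\<theta> * t))) * indicator {0<..<x} t \<partial>lborel) = (\<integral>\<^sup>+t. ennreal (exp (- (\<theta> * t))) * indicator {0..x} t \<partial>lborel)"
    by (rule nn_integral_cong_AE)
       (use AE_lborel_singleton[of 0] AE_lborel_singleton[of x] in eventually_elim, auto simp: indicator_def)
  also have "\<dots> = ennreal ((- exp (- (\<theta> * x)) / \<theta>) - (- exp (- (\<theta> * 0)) / \<theta>))"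
    using assms by (intro nn_integral_FTC_Icc) (auto intro!: derivative_eq_intros)
  finally show ?thesis
    by (simp add: diff_divide_distrib)
qed

lemma nn_integral_exp_Ioi:
  assumes "0 < \<theta>"
  shows "(\<integral>\<^sup>+t. ennreal (exp (- (\<theta> * t))) * indicator {0<..} t \<partial>lborel) = ennreal (1 / \<theta>)"
proof -
  have "(\<integral>\<^sup>+t. ennreal (exp (- (\<theta> * t))) * indicator {0<..} t \<partial>lborel) = (\<integral>\<^sup>+t. ennreal (exp (- (\<theta> * t))) * indicator {0..} t \<partial>lborel)"
    by (rule nn_integral_cong_AE) (use AE_lborel_singleton[of 0] in eventually_elim, auto simp: indicator_def)
  also have "\<dots> = ennreal (0 - (- exp (- (\<theta> * 0)) / \<theta>))"
  proof (intro nn_integral_FTC_atLeast)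
    have "filterlim (\<lambda>x. - \<theta> * x) at_bot at_top"
      using assms by (intro filterlim_tendsto_neg_mult_at_bot[OF tendsto_const _ filterlim_ident]) auto
    then have "((\<lambda>x. exp (- (\<theta> * x))) \<longlongrightarrow> 0) at_top"
      by (intro filterlim_compose[OF exp_at_bot]) simp
    from tendsto_divide[OF tendsto_minus[OF this] tendsto_const, of \<theta>]
    show "((\<lambda>x. - exp (- (\<theta> * x)) / \<theta>) \<longlongrightarrow> 0) at_top"
      using assms by simp
  qed (use assms in \<open>auto intro!: derivative_eq_intros\<close>)
  finally show ?thesis by simp
qed

locale subordinator_density = driftless_subordinator M S \<nu>
  for M :: "'a measure" and S and \<nu> +
  fixes pbar :: "real \<Rightarrow> real \<Rightarrow> real"
  assumes infinite: "emeasure \<nu> {0<..} = \<infinity>"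
    and density: "\<And>r. 0 < r \<Longrightarrow> distributed M lborel (S r) (\<lambda>x. ennreal (pbar r x))"
    and density_nonneg: "\<And>r x. 0 < r \<Longrightarrow> 0 \<le> pbar r x"
    and density_measurable:
      "(\<lambda>(r, x). pbar r x) \<in> borel_measurable (restrict_space borel ({0<..} \<times> UNIV))"
begin

declare levy_measure_sets [measurable_cong]

section \<open>The Levy measure, its exponent and its tail\<close>

lemma space_levy_measure: "space \<nu> = UNIV"
  using sets_eq_imp_space_eq[OF levy_measure_sets] by simp

lemma AE_levy_measure_pos: "AE x in \<nu>. 0 < x"
  using levy_measure_support by (intro AE_I[of _ _ "{..0}"]) (auto simp: levy_measure_sets)

lemma one_minus_exp_le:
  assumes "0 < \<theta>" "0 < (x::real)"
  shows "1 - exp (- (\<theta> * x)) \<le> max 1 \<theta> * min 1 x"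
proof (cases "x \<le> 1")
  case True
  have "1 - exp (- (\<theta> * x)) \<le> \<theta> * x"
    using exp_ge_add_one_self[of "- \<theta> * x"] by simp
  also have "\<dots> \<le> max 1 \<theta> * x"
    using assms by (intro mult_right_mono) auto
  finally show ?thesis using True by (simp add: min_absorb2)
next
  case False
  have "1 - exp (- (\<theta> * x)) \<le> 1" by simp
  then show ?thesis using False by (simp add: le_max_iff_disj min_absorb1)
qed

lemma integrable_one_minus_exp:
  assumes "0 < \<theta>"
  shows "integrable \<nu> (\<lambda>x. 1 - exp (- (\<theta> * x)))"
proof (rule integrableI_bounded)
  have "(\<integral>\<^sup>+x. ennreal (norm (1 - exp (- (\<theta> * x)))) \<partial>\<nu>) \<le> (\<integral>\<^sup>+x. ennreal (max 1 \<theta>) * ennreal (min 1 x) \<partial>\<nu>)"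
  proof (rule nn_integral_mono_AE)
    show "AE x in \<nu>. ennreal (norm (1 - exp (- (\<theta> * x)))) \<le> ennreal (max 1 \<theta>) * ennreal (min 1 x)"
      using AE_levy_measure_pos
    proof eventually_elim
      case (elim x)
      then show ?case
        using one_minus_exp_le[OF assms elim] assms by (simp add: ennreal_mult[symmetric] ennreal_leI)
    qed
  qed
  also have "\<dots> < \<infinity>"
    using levy_measure_min by (subst nn_integral_cmult) (auto simp: ennreal_mult_less_top)
  finally show "(\<integral>\<^sup>+x. ennreal (norm (1 - exp (- (\<theta> * x)))) \<partial>\<nu>) < \<infinity>" .
qed measurable

lemma laplace_exponent_nn_integral:
  assumes "0 < \<theta>"
  shows "(\<integral>\<^sup>+x. ennreal (1 - exp (- (\<theta> * x))) \<partial>\<nu>) = ennreal (laplace_exponent \<nu> \<theta>)"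
proof -
  have "laplace_exponent \<nu> \<theta> = (\<integral>x. 1 - exp (- (\<theta> * x)) \<partial>\<nu>)"
    by (simp add: laplace_exponent_def)
  moreover have "AE x in \<nu>. 0 \<le> 1 - exp (- (\<theta> * x))"
    using AE_levy_measure_pos by eventually_elim (use assms in auto)
  ultimately show ?thesis
    using nn_integral_eq_integral[OF integrable_one_minus_exp[OF assms]] by simp
qed

text \<open>Otherwise \<open>1 - exp (- (\<theta> * x))\<close> would be 0 almost everywhere and
  \<open>\<nu>\<close> would not charge the positive half-line, contrary to its infinite mass there.
  Positivity makes \<open>exp (- (r * \<phi>(\<theta>)))\<close> integrable over positive
  \<open>r\<close>, as \<open>laplace_q\<close> requires.\<close>

lemma laplace_exponent_pos:
  assumes "0 < \<theta>"
  shows "0 < laplace_exponent \<nu> \<theta>"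
proof (rule ccontr)
  assume "\<not> 0 < laplace_exponent \<nu> \<theta>"
  then have "(\<integral>\<^sup>+x. ennreal (1 - exp (- (\<theta> * x))) \<partial>\<nu>) = 0"
    unfolding laplace_exponent_nn_integral[OF assms] by (simp add: ennreal_neg)
  then have "AE x in \<nu>. ennreal (1 - exp (- (\<theta> * x))) = 0"
    by (subst (asm) nn_integral_0_iff_AE) measurable
  with AE_levy_measure_pos have "AE x in \<nu>. x \<notin> {0<..}"
    by eventually_elim (use assms in auto)
  then have "emeasure \<nu> {0<..} = 0"
    by (subst (asm) AE_iff_measurable[where N = "{0<..}"]) (auto simp: levy_measure_sets space_levy_measure)
  then show False using infinite by simp
qed

text \<open>Markov's inequality for \<open>min 1 x\<close> with threshold
  \<open>min 1 c\<close>.\<close>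

lemma emeasure_levy_tail:
  assumes "0 < c"
  shows "emeasure \<nu> {c<..} < \<infinity>"
proof -
  have "ennreal (min 1 c) * emeasure \<nu> {c<..} = (\<integral>\<^sup>+x. ennreal (min 1 c) * indicator {c<..} x \<partial>\<nu>)"
    by (subst nn_integral_cmult_indicator) (auto simp: levy_measure_sets)
  also have "\<dots> \<le> (\<integral>\<^sup>+x. ennreal (min 1 x) \<partial>\<nu>)"
    by (intro nn_integral_mono) (auto simp: indicator_def intro!: ennreal_leI)
  also have "\<dots> < \<infinity>" by (rule levy_measure_min)
  finally show ?thesis
    using assms by (auto simp: ennreal_mult_less_top)
qed

sublocale levy: sigma_finite_measure \<nu>
proof
  show "\<exists>A. countable A \<and> A \<subseteq> sets \<nu> \<and> \<Union>A = space \<nu> \<and> (\<forall>a\<in>A. emeasure \<nu> a \<noteq> \<infinity>)"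
  proof (intro exI[of _ "insert {..0} (range (\<lambda>n. {1 / real (Suc n)<..}))"] conjI ballI)
    show "\<Union> (insert {..0} (range (\<lambda>n. {1 / real (Suc n)<..}))) = space \<nu>"
    proof -
      have "x \<in> \<Union> (insert {..0} (range (\<lambda>n. {1 / real (Suc n)<..})))" for x :: real
      proof (cases "x \<le> 0")
        case False
        then obtain n where "1 / real (Suc n) < x"
          using nat_approx_posE[of x] by auto
        then show ?thesis by blast
      qed simp
      then show ?thesis
        unfolding space_levy_measure by blast
    qed
    fix a assume "a \<in> insert {..0} (range (\<lambda>n. {1 / real (Suc n)<..}))"
    then show "emeasure \<nu> a \<noteq> \<infinity>"
      using levy_measure_support emeasure_levy_tail by (auto simp: less_top)
  qed (auto simp: levy_measure_sets)
qed

text \<open>The tail with values in \<open>ennreal\<close>, set to 0 at nonpositive arguments, where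
  \<open>emeasure \<nu> {\<tau><..}\<close> would be infinite. Convolutions can then run over the
  whole line.\<close>

definition W :: "real \<Rightarrow> ennreal" where
  "W \<tau> = (if 0 < \<tau> then emeasure \<nu> {\<tau><..} else 0)"

lemma W_eq_levy_tail: "W \<tau> = (if 0 < \<tau> then ennreal (levy_tail \<nu> \<tau>) else 0)"
  using emeasure_levy_tail[of \<tau>] by (auto simp: W_def levy_tail_def emeasure_eq_ennreal_measure less_top)

lemma W_measurable [measurable]: "W \<in> borel_measurable borel"
proof -
  define Q :: "(real \<times> real) set" where "Q = {z \<in> space (borel \<Otimes>\<^sub>M \<nu>). fst z < snd z}"
  have "Q \<in> sets (borel \<Otimes>\<^sub>M \<nu>)"
    unfolding Q_def by measurable
  then have [measurable]: "(\<lambda>\<tau>. emeasure \<nu> (Pair \<tau> -` Q)) \<in> borel_measurable borel"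
    by (rule levy.measurable_emeasure_Pair)
  have "(\<lambda>\<tau>. if 0 < \<tau> then emeasure \<nu> (Pair \<tau> -` Q) else 0) \<in> borel_measurable borel"
    by measurable
  also have "(\<lambda>\<tau>. if 0 < \<tau> then emeasure \<nu> (Pair \<tau> -` Q) else 0) = W"
    by (rule ext) (auto simp: W_def Q_def space_pair_measure space_levy_measure intro!: arg_cong[where f = "emeasure \<nu>"])
  finally show ?thesis .
qed

lemma levy_tail_measurable [measurable]: "(\<lambda>\<tau>. indicat_real {0<..} \<tau> * levy_tail \<nu> \<tau>) \<in> borel_measurable borel"
proof -
  have "(\<lambda>\<tau>. enn2real (W \<tau>)) \<in> borel_measurable borel" by measurable
  also have "(\<lambda>\<tau>. enn2real (W \<tau>)) = (\<lambda>\<tau>. indicat_real {0<..} \<tau> * levy_tail \<nu> \<tau>)"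
    by (auto simp: W_eq_levy_tail levy_tail_def fun_eq_iff)
  finally show ?thesis .
qed

text \<open>Tonelli reduces the claim to the integral of \<open>exp (- (\<theta> * t))\<close> over
  \<open>{0<..<x}\<close>, which is \<open>(1 - exp (- (\<theta> * x))) / \<theta>\<close>.\<close>

lemma laplace_W:
  assumes "0 < \<theta>"
  shows "(\<integral>\<^sup>+t. ennreal (exp (- (\<theta> * t))) * W t \<partial>lborel) = ennreal (laplace_exponent \<nu> \<theta> / \<theta>)"
proof -
  interpret pair_sigma_finite lborel \<nu> by unfold_locales
  have "(\<integral>\<^sup>+t. ennreal (exp (- (\<theta> * t))) * W t \<partial>lborel) =
    (\<integral>\<^sup>+t. (\<integral>\<^sup>+x. ennreal (exp (- (\<theta> * t))) * (indicator {0<..} t * indicator {t<..} x) \<partial>\<nu>) \<partial>lborel)"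
    by (intro nn_integral_cong) (auto simp: W_def nn_integral_cmult_indicator levy_measure_sets indicator_def[of "{0<..}"])
  also have "\<dots> = (\<integral>\<^sup>+x. (\<integral>\<^sup>+t. ennreal (exp (- (\<theta> * t))) * (indicator {0<..} t * indicator {t<..} x) \<partial>lborel) \<partial>\<nu>)"
    by (intro Fubini'[symmetric]) (simp add: greaterThan_def indicator_def, measurable)
  also have "\<dots> = (\<integral>\<^sup>+x. ennreal (1 / \<theta>) * ennreal (1 - exp (- (\<theta> * x))) \<partial>\<nu>)"
  proof (rule nn_integral_cong_AE, use AE_levy_measure_pos in eventually_elim)
    case (elim x)
    have "(\<integral>\<^sup>+t. ennreal (exp (- (\<theta> * t))) * (indicator {0<..} t * indicator {t<..} x) \<partial>lborel) =
      (\<integral>\<^sup>+t. ennreal (exp (- (\<theta> * t))) * indicator {0<..<x} t \<partial>lborel)"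
      by (intro nn_integral_cong) (auto simp: indicator_def)
    then show ?case
      using assms elim by (simp add: nn_integral_exp_Ioo ennreal_mult[symmetric])
  qed
  also have "\<dots> = ennreal (laplace_exponent \<nu> \<theta> / \<theta>)"
    using assms laplace_exponent_pos[OF assms]
    by (simp add: nn_integral_cmult laplace_exponent_nn_integral ennreal_mult[symmetric])
  finally show ?thesis .
qed

section \<open>Paths off a null set and joint measurability\<close>

definition good_path :: "'a \<Rightarrow> bool" where
  "good_path \<omega> \<longleftrightarrow> S 0 \<omega> = 0 \<and> mono_on {0..} (\<lambda>t. S t \<omega>) \<and> (\<forall>t\<ge>0. continuous (at_right t) (\<lambda>s. S s \<omega>))"

text \<open>The set of paths that are not good need not be measurable, so one null set containing it
  is fixed.\<close>

definition bad :: "'a set" where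
  "bad = (SOME N. N \<in> null_sets M \<and> {\<omega> \<in> space M. \<not> good_path \<omega>} \<subseteq> N)"

lemma bad: "bad \<in> null_sets M" "\<omega> \<in> space M \<Longrightarrow> \<omega> \<notin> bad \<Longrightarrow> good_path \<omega>"
proof -
  have "AE \<omega> in M. good_path \<omega>"
    using start nondecreasing cadlag unfolding good_path_def by eventually_elim auto
  then have "\<exists>N. N \<in> null_sets M \<and> {\<omega> \<in> space M. \<not> good_path \<omega>} \<subseteq> N"
    unfolding eventually_ae_filter by blast
  from someI_ex[OF this] show "bad \<in> null_sets M" "\<omega> \<in> space M \<Longrightarrow> \<omega> \<notin> bad \<Longrightarrow> good_path \<omega>"
    unfolding bad_def by auto
qed

lemma AE_not_bad: "AE \<omega> in M. \<omega> \<notin> bad"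
  using bad(1) by (rule AE_not_in)

lemma good_path_nonneg: "good_path \<omega> \<Longrightarrow> 0 \<le> r \<Longrightarrow> 0 \<le> S r \<omega>"
  unfolding good_path_def by (metis atLeast_iff mono_onD order.refl)

lemma AE_S_nonneg: "0 \<le> r \<Longrightarrow> AE \<omega> in M. 0 \<le> S r \<omega>"
  using AE_not_bad AE_space by eventually_elim (rule good_path_nonneg[OF bad(2)])

text \<open>The paths of \<open>S'\<close> are those of \<open>S\<close> off a null set, and \<open>S'\<close> is jointly measurable although \<open>M\<close>
  need not be complete.\<close>

definition S' :: "real \<Rightarrow> 'a \<Rightarrow> real" where
  "S' r \<omega> = (if \<omega> \<in> bad \<or> r \<le> 0 then 0 else S r \<omega>)"

text \<open>Right-continuity expresses the process at \<open>r\<close> as a limit along grid points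
  to the right of \<open>r\<close>. Each approximation uses only countably many of the variables
  \<open>S s\<close>, which makes it jointly measurable.\<close>

lemma S'_measurable [measurable]: "(\<lambda>(r, \<omega>). S' r \<omega>) \<in> borel_measurable (borel \<Otimes>\<^sub>M M)"
proof -
  have [measurable]: "bad \<in> sets M" using bad(1) by auto
  define T where "T n z = (if snd z \<in> bad \<or> fst z \<le> 0 then 0
    else S ((real (nat \<lfloor>fst z * real (Suc n)\<rfloor>) + 1) / real (Suc n)) (snd z))" for n and z :: "real \<times> 'a"
  have [measurable]: "(\<lambda>z. S ((real i + 1) / real (Suc n)) (snd z)) \<in> borel_measurable (borel \<Otimes>\<^sub>M M)" for i n :: nat
    by (rule measurable_compose[OF measurable_snd measurable_X]) simp
  have "T n \<in> borel_measurable (borel \<Otimes>\<^sub>M M)" for n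
  proof -
    have "(\<lambda>z. S ((real (nat \<lfloor>fst z * real (Suc n)\<rfloor>) + 1) / real (Suc n)) (snd z)) \<in> borel_measurable (borel \<Otimes>\<^sub>M M)"
      by (rule measurable_compose_countable[where g = "\<lambda>z. nat \<lfloor>fst z * real (Suc n)\<rfloor>" and f = "\<lambda>i z. S ((real i + 1) / real (Suc n)) (snd z)"]) measurable
    then show ?thesis
      unfolding T_def[abs_def] by measurable
  qed
  then show ?thesis
  proof (rule borel_measurable_LIMSEQ_metric)
    fix z :: "real \<times> 'a" assume z: "z \<in> space (borel \<Otimes>\<^sub>M M)"
    obtain r \<omega> where [simp]: "z = (r, \<omega>)" by (cases z)
    have "(\<lambda>n. T n z) \<longlonglongrightarrow> S' r \<omega>"
    proof (cases "\<omega> \<in> bad \<or> r \<le> 0")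
      case True
      then show ?thesis by (auto simp: T_def S'_def)
    next
      case False
      then have r: "0 < r" and "good_path \<omega>"
        using z bad(2) by (auto simp: space_pair_measure)
      then have "continuous (at_right r) (\<lambda>s. S s \<omega>)"
        unfolding good_path_def by auto
      then have lim: "((\<lambda>s. S s \<omega>) \<longlongrightarrow> S r \<omega>) (at_right r)"
        by (simp add: continuous_within)
      \<comment> \<open>The added 1 puts the grid point strictly to the right of \<open>r\<close>,
        as \<open>at_right r\<close> requires.\<close>
      define c where "c n = (real (nat \<lfloor>r * real (Suc n)\<rfloor>) + 1) / real (Suc n)" for n
      have c: "r < c n" "c n \<le> r + 1 / real (Suc n)" for n
      proof -
        have "0 \<le> \<lfloor>r * real (Suc n)\<rfloor>" using r by simp
        then have *: "real (nat \<lfloor>r * real (Suc n)\<rfloor>) = of_int \<lfloor>r * real (Suc n)\<rfloor>" by simp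
        have "r * real (Suc n) < real (nat \<lfloor>r * real (Suc n)\<rfloor>) + 1" unfolding * by linarith
        then show "r < c n" unfolding c_def by (simp add: pos_less_divide_eq del: of_nat_Suc)
        have "real (nat \<lfloor>r * real (Suc n)\<rfloor>) \<le> r * real (Suc n)" unfolding * by linarith
        then show "c n \<le> r + 1 / real (Suc n)" unfolding c_def by (simp add: field_simps del: of_nat_Suc)
      qed
      have "c \<longlonglongrightarrow> r"
      proof (rule tendsto_sandwich[of "\<lambda>_. r" _ _ "\<lambda>n. r + 1 / real (Suc n)"])
        show "(\<lambda>n. r + 1 / real (Suc n)) \<longlonglongrightarrow> r"
          using tendsto_add[OF tendsto_const LIMSEQ_inverse_real_of_nat, of r] by (simp add: inverse_eq_divide)
      qed (use c in \<open>auto intro!: always_eventually less_imp_le\<close>)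
      then have "filterlim c (at_right r) sequentially"
        using c by (intro tendsto_imp_filterlim_at_right) auto
      from filterlim_compose[OF lim this] show ?thesis
        using False by (simp add: T_def S'_def c_def)
    qed
    then show "(\<lambda>n. T n z) \<longlonglongrightarrow> (case z of (r, \<omega>) \<Rightarrow> S' r \<omega>)" by simp
  qed
qed

text \<open>The given version of the density may be nonzero at \<open>x \<le> 0\<close> on a null
  set and is arbitrary for \<open>r \<le> 0\<close>. Cutting off both lets integrals run over the
  whole line.\<close>

definition p :: "real \<Rightarrow> real \<Rightarrow> real" where
  "p r x = (if 0 < r \<and> 0 < x then pbar r x else 0)"

lemma p_nonneg: "0 \<le> p r x"
  by (simp add: p_def density_nonneg)

lemma p_zero: "r \<le> 0 \<Longrightarrow> p r x = 0" "x \<le> 0 \<Longrightarrow> p r x = 0"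
  by (auto simp: p_def)

lemma p_measurable [measurable]: "(\<lambda>(r, x). p r x) \<in> borel_measurable (borel \<Otimes>\<^sub>M borel)"
proof -
  have "(\<lambda>z. indicator ({0<..} \<times> UNIV) z *\<^sub>R (case z of (r, x) \<Rightarrow> pbar r x)) \<in> borel_measurable (borel :: (real \<times> real) measure)"
    using density_measurable by (subst (asm) borel_measurable_restrict_space_iff) (auto intro!: borel_open open_Times)
  then have [measurable]: "(\<lambda>z. indicator ({0<..} \<times> UNIV) z *\<^sub>R (case z of (r, x) \<Rightarrow> pbar r x)) \<in> borel_measurable (borel \<Otimes>\<^sub>M borel :: (real \<times> real) measure)"
    by (simp add: borel_prod)
  have "(\<lambda>z. indicator {0<..} (snd z) *\<^sub>R (indicator ({0<..} \<times> UNIV) z *\<^sub>R (case z of (r, x) \<Rightarrow> pbar r x))) \<in> borel_measurable (borel \<Otimes>\<^sub>M borel :: (real \<times> real) measure)"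
    by measurable
  also have "(\<lambda>z. indicator {0<..} (snd z) *\<^sub>R (indicator ({0<..} \<times> UNIV) z *\<^sub>R (case z of (r, x) \<Rightarrow> pbar r x))) = (\<lambda>(r, x). p r x)"
    by (auto simp: p_def indicator_def fun_eq_iff)
  finally show ?thesis .
qed

text \<open>\<open>S r\<close> is almost surely nonnegative, so its density vanishes almost
  everywhere on the negative half-line; the point 0 is null.\<close>

lemma AE_pbar_eq_p:
  assumes r: "0 < r"
  shows "AE x in lborel. pbar r x = p r x"
proof -
  have "AE x in lborel. 0 < ennreal (pbar r x) \<longrightarrow> 0 \<le> x"
    using distributed_AE2[OF density[OF r], of "\<lambda>x. 0 \<le> x"] AE_S_nonneg[of r] r by simp
  with AE_lborel_singleton[of 0] show ?thesis
    by eventually_elim (use density_nonneg[OF r] r in \<open>auto simp: p_def intro: antisym\<close>)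
qed

lemma nn_integral_S:
  assumes r: "0 < r" and [measurable]: "g \<in> borel_measurable borel"
  shows "(\<integral>\<^sup>+x. ennreal (p r x) * g x \<partial>lborel) = (\<integral>\<^sup>+\<omega>. g (S r \<omega>) \<partial>M)"
    "(\<integral>\<^sup>+x. ennreal (p r x) * g x \<partial>lborel) = (\<integral>\<^sup>+\<omega>. g (S' r \<omega>) \<partial>M)"
proof -
  have "(\<integral>\<^sup>+x. ennreal (p r x) * g x \<partial>lborel) = (\<integral>\<^sup>+x. ennreal (pbar r x) * g x \<partial>lborel)"
    by (rule nn_integral_cong_AE) (use AE_pbar_eq_p[OF r] in eventually_elim, simp)
  also have "\<dots> = (\<integral>\<^sup>+\<omega>. g (S r \<omega>) \<partial>M)"
    by (rule distributed_nn_integral[OF density[OF r]]) simp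
  finally show *: "(\<integral>\<^sup>+x. ennreal (p r x) * g x \<partial>lborel) = (\<integral>\<^sup>+\<omega>. g (S r \<omega>) \<partial>M)" .
  also have "\<dots> = (\<integral>\<^sup>+\<omega>. g (S' r \<omega>) \<partial>M)"
    by (rule nn_integral_cong_AE) (use AE_not_bad in eventually_elim, use r in \<open>simp add: S'_def\<close>)
  finally show "(\<integral>\<^sup>+x. ennreal (p r x) * g x \<partial>lborel) = (\<integral>\<^sup>+\<omega>. g (S' r \<omega>) \<partial>M)" .
qed

lemma laplace_p:
  assumes r: "0 < r" and \<theta>: "0 < \<theta>"
  shows "(\<integral>\<^sup>+x. ennreal (exp (- (\<theta> * x))) * ennreal (p r x) \<partial>lborel) = ennreal (exp (- (r * laplace_exponent \<nu> \<theta>)))"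
proof -
  have [measurable]: "S r \<in> borel_measurable M" using r by (intro measurable_X) simp
  have "(\<integral>\<^sup>+x. ennreal (exp (- (\<theta> * x))) * ennreal (p r x) \<partial>lborel) = (\<integral>\<^sup>+\<omega>. ennreal (exp (- (\<theta> * S r \<omega>))) \<partial>M)"
    using nn_integral_S(1)[OF r, of "\<lambda>x. ennreal (exp (- (\<theta> * x)))"] by (simp add: mult.commute)
  also have "\<dots> = ennreal (expectation (\<lambda>\<omega>. exp (- (\<theta> * S r \<omega>))))"
  proof (rule nn_integral_eq_integral)
    show "integrable M (\<lambda>\<omega>. exp (- (\<theta> * S r \<omega>)))"
    proof (rule integrable_const_bound[where B = 1])
      show "AE \<omega> in M. norm (exp (- (\<theta> * S r \<omega>))) \<le> 1"
        using AE_S_nonneg[of r] r \<theta> by auto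
    qed measurable
  qed simp
  also have "\<dots> = ennreal (exp (- (r * laplace_exponent \<nu> \<theta>)))"
    using laplace_transform[of r \<theta>] r \<theta> by simp
  finally show ?thesis .
qed

text \<open>Density of the potential measure of the subordinator, that is of the expected time spent
  in a set.\<close>

definition q :: "real \<Rightarrow> ennreal" where
  "q t = (\<integral>\<^sup>+r. ennreal (p r t) \<partial>lborel)"

lemma q_measurable [measurable]: "q \<in> borel_measurable borel"
  unfolding q_def[abs_def] by measurable

lemma laplace_q:
  assumes \<theta>: "0 < \<theta>"
  shows "(\<integral>\<^sup>+t. ennreal (exp (- (\<theta> * t))) * q t \<partial>lborel) = ennreal (1 / laplace_exponent \<nu> \<theta>)"
proof -
  have "(\<integral>\<^sup>+t. ennreal (exp (- (\<theta> * t))) * q t \<partial>lborel) = (\<integral>\<^sup>+t. \<integral>\<^sup>+r. ennreal (exp (- (\<theta> * t))) * ennreal (p r t) \<partial>lborel \<partial>lborel)"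
    unfolding q_def by (intro nn_integral_cong nn_integral_cmult[symmetric]) measurable
  also have "\<dots> = (\<integral>\<^sup>+r. \<integral>\<^sup>+t. ennreal (exp (- (\<theta> * t))) * ennreal (p r t) \<partial>lborel \<partial>lborel)"
    by (rule lborel_pair.Fubini') measurable
  also have "\<dots> = (\<integral>\<^sup>+r. ennreal (exp (- (laplace_exponent \<nu> \<theta> * r))) * indicator {0<..} r \<partial>lborel)"
    by (intro nn_integral_cong) (auto simp: indicator_def laplace_p[OF _ \<theta>] p_zero mult.commute[of _ "laplace_exponent \<nu> \<theta>"])
  also have "\<dots> = ennreal (1 / laplace_exponent \<nu> \<theta>)"
    by (rule nn_integral_exp_Ioi[OF laplace_exponent_pos[OF \<theta>]])
  finally show ?thesis .
qed

lemma AE_q_finite: "AE t in lborel. q t < \<infinity>"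
proof -
  have "AE t in lborel. ennreal (exp (- t)) * q t \<noteq> \<infinity>"
    by (rule nn_integral_PInf_AE) (use laplace_q[of 1] in \<open>simp_all\<close>)
  then show ?thesis
    by eventually_elim (auto simp: ennreal_mult_eq_top_iff less_top)
qed

lemma q_zero: "t \<le> 0 \<Longrightarrow> q t = 0"
  by (simp add: q_def p_zero)

text \<open>On \<open>{..T}\<close> the factor \<open>exp T * exp (- t)\<close> is at least 1, so
  finiteness follows from the transform at 1. This local integrability supports the estimates for
  \<open>G\<close>.\<close>

lemma nn_integral_q_finite: "(\<integral>\<^sup>+t. q t * indicator {..T} t \<partial>lborel) < \<infinity>"
proof -
  have "(\<integral>\<^sup>+t. q t * indicator {..T} t \<partial>lborel) \<le> (\<integral>\<^sup>+t. ennreal (exp T) * (ennreal (exp (- t)) * q t) \<partial>lborel)"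
  proof (intro nn_integral_mono)
    fix t
    show "q t * indicator {..T} t \<le> ennreal (exp T) * (ennreal (exp (- t)) * q t)"
    proof (cases "t \<le> T")
      case True
      then have "1 * q t \<le> ennreal (exp T * exp (- t)) * q t"
        by (intro mult_right_mono) (auto simp: exp_add[symmetric] simp flip: ennreal_1 intro!: ennreal_leI)
      then show ?thesis using True by (simp add: ennreal_mult mult.assoc)
    qed simp
  qed
  also have "\<dots> < \<infinity>"
    using laplace_q[of 1] by (subst nn_integral_cmult) (auto simp: ennreal_mult_less_top)
  finally show ?thesis .
qed

text \<open>For almost every \<open>t\<close>, \<open>k \<cdot> t\<close> turns out to be the density of \<open>E t\<close>: the Laplace transforms in \<open>t\<close> of both sides of
  \<open>P(t < S r) = \<integral>\<rho><r. k \<rho> t\<close> agree, since that of \<open>k \<rho>\<close> is \<open>\<phi>(\<theta>) exp (- \<rho> \<phi>(\<theta>)) / \<theta>\<close>.\<close>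

definition k :: "real \<Rightarrow> real \<Rightarrow> ennreal" where
  "k r t = (\<integral>\<^sup>+s. W (t - s) * ennreal (p r s) \<partial>lborel)"

lemma k_measurable [measurable]: "(\<lambda>(r, t). k r t) \<in> borel_measurable (borel \<Otimes>\<^sub>M borel)"
  unfolding k_def[abs_def] by measurable

lemma k_zero: "r \<le> 0 \<Longrightarrow> k r t = 0" "t \<le> 0 \<Longrightarrow> k r t = 0"
proof -
  have *: "W (t - s) * ennreal (p r s) = 0" if "t \<le> 0" for s
    using that by (cases "s \<le> 0") (auto simp: p_zero W_def)
  have "(\<integral>\<^sup>+s. W (t - s) * ennreal (p r s) \<partial>lborel) = (\<integral>\<^sup>+(s::real). 0 \<partial>lborel)" if "t \<le> 0"
    by (intro nn_integral_cong *[OF that])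
  then show "t \<le> 0 \<Longrightarrow> k r t = 0" by (simp add: k_def)
qed (simp add: k_def p_zero)

lemma laplace_k:
  assumes "0 < r" "0 < \<theta>"
  shows "(\<integral>\<^sup>+t. ennreal (exp (- (\<theta> * t))) * k r t \<partial>lborel) =
    ennreal (laplace_exponent \<nu> \<theta> / \<theta>) * ennreal (exp (- (r * laplace_exponent \<nu> \<theta>)))"
  unfolding k_def
  using laplace_transform_convolution[of W "\<lambda>s. ennreal (p r s)" \<theta>] laplace_W[OF assms(2)] laplace_p[OF assms]
  by simp

text \<open>Both transforms equal \<open>(1 - exp (- (r * \<phi>(\<theta>)))) / \<theta>\<close>.
  The null set in \<open>t\<close> depends on \<open>r\<close>, because uniqueness of transforms
  compares one pair of functions at a time.\<close>

lemma survival_eq_k: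
  assumes r: "0 < r"
  shows "AE t in lborel. 0 < t \<longrightarrow> emeasure M {\<omega> \<in> space M. t < S' r \<omega>} = (\<integral>\<^sup>+\<rho>. k \<rho> t * indicator {..<r} \<rho> \<partial>lborel)"
proof (rule laplace_transform_unique)
  interpret LM: pair_sigma_finite lborel M by unfold_locales
  have [measurable]: "(\<lambda>\<omega>. S' r \<omega>) \<in> borel_measurable M"
    by measurable
  have [measurable]: "{z \<in> space (borel \<Otimes>\<^sub>M M). fst z < S' r (snd z)} \<in> sets (borel \<Otimes>\<^sub>M M)"
    by measurable
  have em: "emeasure M {\<omega> \<in> space M. t < S' r \<omega>} = (\<integral>\<^sup>+\<omega>. indicator {t<..} (S' r \<omega>) \<partial>M)" for t
  proof -
    have "(\<integral>\<^sup>+\<omega>. indicator {t<..} (S' r \<omega>) \<partial>M) = (\<integral>\<^sup>+\<omega>. indicator {\<omega> \<in> space M. t < S' r \<omega>} \<omega> \<partial>M)"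
      by (intro nn_integral_cong) (auto simp: indicator_def)
    also have "\<dots> = emeasure M {\<omega> \<in> space M. t < S' r \<omega>}"
      by (rule nn_integral_indicator) measurable
    finally show ?thesis by simp
  qed
  have em_m: "(\<lambda>t. emeasure M {\<omega> \<in> space M. t < S' r \<omega>}) \<in> borel_measurable borel"
    unfolding em by (simp add: greaterThan_def indicator_def) measurable
  then show "(\<lambda>t. emeasure M {\<omega> \<in> space M. t < S' r \<omega>}) \<in> borel_measurable borel" .
  show "(\<lambda>t. \<integral>\<^sup>+\<rho>. k \<rho> t * indicator {..<r} \<rho> \<partial>lborel) \<in> borel_measurable borel"
    by measurable
  \<comment> \<open>Tonelli integrates the exponential over \<open>t\<close> up to
    \<open>S r \<omega>\<close> first; what remains is the Laplace transform of
    \<open>S r\<close>.\<close>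
  have 1: "(\<integral>\<^sup>+t. ennreal (exp (- (\<theta> * t))) * (emeasure M {\<omega> \<in> space M. t < S' r \<omega>} * indicator {0<..} t) \<partial>lborel) =
     ennreal ((1 - exp (- (r * laplace_exponent \<nu> \<theta>))) / \<theta>)" if \<theta>: "0 < \<theta>" for \<theta>
  proof -
    have "(\<integral>\<^sup>+t. ennreal (exp (- (\<theta> * t))) * (emeasure M {\<omega> \<in> space M. t < S' r \<omega>} * indicator {0<..} t) \<partial>lborel) =
      (\<integral>\<^sup>+t. (\<integral>\<^sup>+\<omega>. ennreal (exp (- (\<theta> * t))) * (indicator {t<..} (S' r \<omega>) * indicator {0<..} t) \<partial>M) \<partial>lborel)"
      unfolding em by (subst nn_integral_cmult) (auto simp: nn_integral_multc)
    also have "\<dots> = (\<integral>\<^sup>+\<omega>. (\<integral>\<^sup>+t. ennreal (exp (- (\<theta> * t))) * (indicator {t<..} (S' r \<omega>) * indicator {0<..} t) \<partial>lborel) \<partial>M)"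
      by (intro LM.Fubini'[symmetric]) (simp add: greaterThan_def indicator_def, measurable)
    also have "\<dots> = (\<integral>\<^sup>+\<omega>. ennreal ((1 - exp (- (\<theta> * S r \<omega>))) / \<theta>) \<partial>M)"
    proof (rule nn_integral_cong_AE, use AE_not_bad AE_S_nonneg[OF less_imp_le[OF r]] in eventually_elim)
      case (elim \<omega>)
      have "(\<integral>\<^sup>+t. ennreal (exp (- (\<theta> * t))) * (indicator {t<..} (S' r \<omega>) * indicator {0<..} t) \<partial>lborel) =
        (\<integral>\<^sup>+t. ennreal (exp (- (\<theta> * t))) * indicator {0<..<S r \<omega>} t \<partial>lborel)"
        using elim r by (intro nn_integral_cong) (auto simp: indicator_def S'_def)
      then show ?case using elim \<theta> by (simp add: nn_integral_exp_Ioo)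
    qed
    also have "\<dots> = ennreal ((1 - exp (- (r * laplace_exponent \<nu> \<theta>))) / \<theta>)"
    proof -
      have [measurable]: "S r \<in> borel_measurable M" using r by (intro measurable_X) simp
      have int: "integrable M (\<lambda>\<omega>. exp (- (\<theta> * S r \<omega>)))"
      proof (rule integrable_const_bound[where B = 1])
        show "AE \<omega> in M. norm (exp (- (\<theta> * S r \<omega>))) \<le> 1"
          using AE_S_nonneg[of r] r \<theta> by auto
      qed measurable
      have "(\<integral>\<^sup>+\<omega>. ennreal ((1 - exp (- (\<theta> * S r \<omega>))) / \<theta>) \<partial>M) = ennreal (expectation (\<lambda>\<omega>. (1 - exp (- (\<theta> * S r \<omega>))) / \<theta>))"
      proof (rule nn_integral_eq_integral)
        show "AE \<omega> in M. 0 \<le> (1 - exp (- (\<theta> * S r \<omega>))) / \<theta>"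
          using AE_S_nonneg[of r] r \<theta> by auto
      qed (use int in auto)
      moreover have "expectation (\<lambda>\<omega>. (1 - exp (- (\<theta> * S r \<omega>))) / \<theta>) = (1 - exp (- (r * laplace_exponent \<nu> \<theta>))) / \<theta>"
        using int laplace_transform[of r \<theta>] r \<theta> by (simp add: prob_space)
      ultimately show ?thesis by (simp only:)
    qed
    finally show ?thesis .
  qed
  \<comment> \<open>By \<open>laplace_k\<close> the transform of \<open>k \<rho>\<close> is
    \<open>\<phi>(\<theta>) / \<theta>\<close> times an exponential in \<open>\<rho>\<close>;
    integrating over positive \<open>\<rho>\<close> below \<open>r\<close> cancels
    \<open>\<phi>(\<theta>)\<close>.\<close>
  have 2: "(\<integral>\<^sup>+t. ennreal (exp (- (\<theta> * t))) * ((\<integral>\<^sup>+\<rho>. k \<rho> t * indicator {..<r} \<rho> \<partial>lborel) * indicator {0<..} t) \<partial>lborel) =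
     ennreal ((1 - exp (- (r * laplace_exponent \<nu> \<theta>))) / \<theta>)" if \<theta>: "0 < \<theta>" for \<theta>
  proof -
    note \<phi> = laplace_exponent_pos[OF \<theta>]
    have "(\<integral>\<^sup>+t. ennreal (exp (- (\<theta> * t))) * ((\<integral>\<^sup>+\<rho>. k \<rho> t * indicator {..<r} \<rho> \<partial>lborel) * indicator {0<..} t) \<partial>lborel) =
      (\<integral>\<^sup>+t. (\<integral>\<^sup>+\<rho>. (ennreal (exp (- (\<theta> * t))) * k \<rho> t) * indicator {..<r} \<rho> \<partial>lborel) \<partial>lborel)"
    proof (rule nn_integral_cong)
      fix t
      have "(\<integral>\<^sup>+\<rho>. k \<rho> t * indicator {..<r} \<rho> \<partial>lborel) * indicator {0<..} t = (\<integral>\<^sup>+\<rho>. k \<rho> t * indicator {..<r} \<rho> \<partial>lborel)"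
        by (cases "0 < t") (auto simp: k_zero)
      then show "ennreal (exp (- (\<theta> * t))) * ((\<integral>\<^sup>+\<rho>. k \<rho> t * indicator {..<r} \<rho> \<partial>lborel) * indicator {0<..} t) =
        (\<integral>\<^sup>+\<rho>. (ennreal (exp (- (\<theta> * t))) * k \<rho> t) * indicator {..<r} \<rho> \<partial>lborel)"
        by (simp add: nn_integral_cmult[symmetric] mult.assoc)
    qed
    also have "\<dots> = (\<integral>\<^sup>+\<rho>. (\<integral>\<^sup>+t. (ennreal (exp (- (\<theta> * t))) * k \<rho> t) * indicator {..<r} \<rho> \<partial>lborel) \<partial>lborel)"
      by (rule lborel_pair.Fubini') measurable
    also have "\<dots> = (\<integral>\<^sup>+\<rho>. ennreal (laplace_exponent \<nu> \<theta> / \<theta>) * (ennreal (exp (- (laplace_exponent \<nu> \<theta> * \<rho>))) * indicator {0<..<r} \<rho>) \<partial>lborel)"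
    proof (rule nn_integral_cong)
      fix \<rho>
      show "(\<integral>\<^sup>+t. (ennreal (exp (- (\<theta> * t))) * k \<rho> t) * indicator {..<r} \<rho> \<partial>lborel) =
        ennreal (laplace_exponent \<nu> \<theta> / \<theta>) * (ennreal (exp (- (laplace_exponent \<nu> \<theta> * \<rho>))) * indicator {0<..<r} \<rho>)"
        using \<theta> by (cases "0 < \<rho>") (auto simp: nn_integral_multc laplace_k k_zero indicator_def mult.commute[of "laplace_exponent \<nu> \<theta>"])
    qed
    also have "\<dots> = ennreal ((1 - exp (- (r * laplace_exponent \<nu> \<theta>))) / \<theta>)"
      using r \<phi> \<theta> nn_integral_exp_Ioo[OF \<phi>, of r]
      by (simp add: nn_integral_cmult ennreal_mult[symmetric] mult.commute[of r "laplace_exponent \<nu> \<theta>"])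
    finally show ?thesis .
  qed
  show "(\<integral>\<^sup>+t. ennreal (exp (- \<theta> * t)) * (emeasure M {\<omega> \<in> space M. t < S' r \<omega>} * indicator {0<..} t) \<partial>lborel) =
    (\<integral>\<^sup>+t. ennreal (exp (- \<theta> * t)) * ((\<integral>\<^sup>+\<rho>. k \<rho> t * indicator {..<r} \<rho> \<partial>lborel) * indicator {0<..} t) \<partial>lborel)" if "0 < \<theta>" for \<theta>
    using 1[OF that] 2[OF that] by simp
  show "(\<integral>\<^sup>+t. ennreal (exp (- t)) * (emeasure M {\<omega> \<in> space M. t < S' r \<omega>} * indicator {0<..} t) \<partial>lborel) < \<infinity>"
    using 1[of 1] by simp
qed

end

section \<open>The inverse subordinator\<close>

context subordinator_density
begin

text \<open>The exceptions to \<open>Q\<close> lie in a measurable null set, to which the law of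
  \<open>S r\<close> gives no mass as it has a density.\<close>

lemma AE_S'_not_null:
  assumes "0 < r" "AE x in lborel. Q x"
  shows "AE \<omega> in M. Q (S' r \<omega>)"
proof -
  from assms(2) obtain N where N: "{x \<in> space lborel. \<not> Q x} \<subseteq> N" "emeasure lborel N = 0" "N \<in> sets lborel"
    by (rule AE_E)
  have [measurable]: "N \<in> sets borel" using N(3) by simp
  have "(\<integral>\<^sup>+\<omega>. indicator N (S' r \<omega>) \<partial>M) = (\<integral>\<^sup>+x. ennreal (p r x) * indicator N x \<partial>lborel)"
    by (rule nn_integral_S(2)[OF assms(1), symmetric]) measurable
  also have "\<dots> = (\<integral>\<^sup>+(x::real). 0 \<partial>lborel)"
  proof (rule nn_integral_cong_AE)
    have "AE x in lborel. x \<notin> N"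
      using N by (intro AE_not_in) (auto simp: null_sets_def)
    then show "AE x in lborel. ennreal (p r x) * indicator N x = 0"
      by eventually_elim simp
  qed
  finally have "(\<integral>\<^sup>+\<omega>. indicator N (S' r \<omega>) \<partial>M) = 0" by simp
  then have "AE \<omega> in M. indicator N (S' r \<omega>) = (0::ennreal)"
    by (subst (asm) nn_integral_0_iff_AE) measurable
  then show ?thesis
    by eventually_elim (use N(1) in \<open>auto simp: indicator_def split: if_splits\<close>)
qed

text \<open>The time \<open>S\<close> spends below \<open>t\<close> equals the inverse subordinator almost surely, and is evidently measurable.\<close>

definition occ :: "real \<Rightarrow> 'a \<Rightarrow> ennreal" where
  "occ t \<omega> = (\<integral>\<^sup>+r. indicator {0<..} r * indicator {..t} (S' r \<omega>) \<partial>lborel)"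

definition E :: "real \<Rightarrow> 'a \<Rightarrow> real" where
  "E t \<omega> = enn2real (occ t \<omega>)"

lemma occ_measurable [measurable]: "occ t \<in> borel_measurable M"
proof -
  have "(\<lambda>\<omega>. \<integral>\<^sup>+r. indicator {0<..} r * indicator {..t} (S' r \<omega>) \<partial>lborel) \<in> borel_measurable M"
    by measurable
  then show ?thesis by (simp add: occ_def[abs_def])
qed

lemma E_measurable [measurable]: "E t \<in> borel_measurable M"
  unfolding E_def[abs_def] by measurable

lemma E_nonneg: "0 \<le> E t \<omega>"
  by (simp add: E_def)

text \<open>Exponential Markov inequality: the probability of \<open>S r \<le> t\<close> is at most
  \<open>exp t * exp (- (r * \<phi>(1)))\<close>, which is integrable over positive
  \<open>r\<close>.\<close>

lemma nn_integral_occ: "(\<integral>\<^sup>+\<omega>. occ t \<omega> \<partial>M) < \<infinity>"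
proof -
  interpret LM: pair_sigma_finite lborel M by unfold_locales
  have "(\<integral>\<^sup>+\<omega>. occ t \<omega> \<partial>M) = (\<integral>\<^sup>+r. \<integral>\<^sup>+\<omega>. indicator {0<..} r * indicator {..t} (S' r \<omega>) \<partial>M \<partial>lborel)"
    unfolding occ_def by (rule LM.Fubini') measurable
  also have "\<dots> \<le> (\<integral>\<^sup>+r. ennreal (exp t) * (ennreal (exp (- (laplace_exponent \<nu> 1 * r))) * indicator {0<..} r) \<partial>lborel)"
  proof (rule nn_integral_mono)
    fix r :: real
    show "(\<integral>\<^sup>+\<omega>. indicator {0<..} r * indicator {..t} (S' r \<omega>) \<partial>M) \<le>
      ennreal (exp t) * (ennreal (exp (- (laplace_exponent \<nu> 1 * r))) * indicator {0<..} r)"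
    proof (cases "0 < r")
      case True
      have "(\<integral>\<^sup>+\<omega>. indicator {..t} (S' r \<omega>) \<partial>M) = (\<integral>\<^sup>+x. ennreal (p r x) * indicator {..t} x \<partial>lborel)"
        by (rule nn_integral_S(2)[OF True, symmetric]) measurable
      also have "\<dots> \<le> (\<integral>\<^sup>+x. ennreal (exp t) * (ennreal (exp (- (1 * x))) * ennreal (p r x)) \<partial>lborel)"
      proof (rule nn_integral_mono)
        fix x
        show "ennreal (p r x) * indicator {..t} x \<le> ennreal (exp t) * (ennreal (exp (- (1 * x))) * ennreal (p r x))"
        proof (cases "x \<le> t")
          case True
          then have "p r x * 1 \<le> p r x * exp (t - x)"
            by (intro mult_left_mono p_nonneg) auto
          then show ?thesis
            using True by (simp add: ennreal_mult[symmetric] p_nonneg exp_diff exp_minus field_simps ennreal_leI)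
        qed simp
      qed
      also have "\<dots> = ennreal (exp t) * ennreal (exp (- (r * laplace_exponent \<nu> 1)))"
        using laplace_p[OF True, of 1] by (subst nn_integral_cmult) auto
      finally show ?thesis
        using True by (simp add: mult.commute[of r])
    qed simp
  qed
  also have "\<dots> = ennreal (exp t) * ennreal (1 / laplace_exponent \<nu> 1)"
    using nn_integral_exp_Ioi[OF laplace_exponent_pos[of 1]] by (subst nn_integral_cmult) auto
  also have "\<dots> < \<infinity>" by (simp add: ennreal_mult_less_top)
  finally show ?thesis .
qed

lemma AE_occ_finite: "AE \<omega> in M. occ t \<omega> < \<infinity>"
proof -
  have "AE \<omega> in M. occ t \<omega> \<noteq> \<infinity>"
    using nn_integral_occ[of t] by (intro nn_integral_PInf_AE) auto
  then show ?thesis by eventually_elim (simp add: less_top)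
qed

text \<open>Along a nondecreasing path the positive times \<open>r\<close> with
  \<open>S r \<omega> \<le> t\<close> fill the interval from 0 to the infimum, with or without its
  right end point, so their length is the infimum. Nothing is claimed at
  \<open>r = E t \<omega>\<close>.\<close>

lemma inverse_subordinator_path:
  assumes \<omega>: "\<omega> \<in> space M" "\<omega> \<notin> bad" "occ t \<omega> < \<infinity>"
  shows "inverse_subordinator S t \<omega> = E t \<omega>"
    and "0 < r \<Longrightarrow> r < E t \<omega> \<Longrightarrow> S' r \<omega> \<le> t"
    and "E t \<omega> < r \<Longrightarrow> t < S' r \<omega>"
proof -
  let ?A = "{s. 0 < s \<and> t < S s \<omega>}" and ?e = "inverse_subordinator S t \<omega>"
  have e: "?e = Inf ?A" by (simp add: inverse_subordinator_def)
  have S': "S' r \<omega> = S r \<omega>" if "0 < r" for r using that \<omega> by (simp add: S'_def)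
  have good: "good_path \<omega>" using bad(2) \<omega> by blast
  have mono: "S s \<omega> \<le> S r \<omega>" if "0 \<le> s" "s \<le> r" for s r
    using good that mono_onD[of "{0..}" "\<lambda>t. S t \<omega>" s r] by (auto simp: good_path_def)
  \<comment> \<open>A path that never exceeds \<open>t\<close> would make
    \<open>occ t \<omega>\<close> infinite; excluding it also avoids the unspecified infimum of the
    empty set.\<close>
  have ne: "?A \<noteq> {}"
  proof
    assume "?A = {}"
    then have "S r \<omega> \<le> t" if "0 < r" for r
      using that by (metis (mono_tags, lifting) empty_iff mem_Collect_eq not_less)
    then have "indicator {0<..} r * indicator {..t} (S' r \<omega>) = (indicator {0<..} r :: ennreal)" for r
      using S'[of r] by (cases "0 < r") auto
    then have "occ t \<omega> = emeasure lborel {0::real<..}"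
      by (simp add: occ_def)
    also have "emeasure lborel {0::real<..} = \<infinity>"
    proof (rule ccontr)
      assume "emeasure lborel {0::real<..} \<noteq> \<infinity>"
      then obtain c where c: "emeasure lborel {0::real<..} = ennreal c" "0 \<le> c"
        by (cases "emeasure lborel {0::real<..}") auto
      have "ennreal (c + 1) = emeasure lborel {0<..c + 1}" using c by simp
      also have "\<dots> \<le> emeasure lborel {0::real<..}" by (intro emeasure_mono) auto
      finally show False using c by (simp add: ennreal_le_iff)
    qed
    finally show False using \<omega> by simp
  qed
  have bdd: "bdd_below ?A" by (auto intro: bdd_belowI[of _ 0])
  have e0: "0 \<le> ?e" unfolding e using ne by (intro cInf_greatest) auto
  have lo: "S' r \<omega> \<le> t" if "0 < r" "r < ?e" for r
  proof (rule ccontr)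
    assume "\<not> S' r \<omega> \<le> t"
    then have "?e \<le> r" unfolding e using that S' bdd by (intro cInf_lower) auto
    then show False using that by simp
  qed
  have hi: "t < S' r \<omega>" if re: "?e < r" for r
  proof -
    obtain s where "s \<in> ?A" "s < r"
      using cInf_less_iff[OF ne bdd, of r] re[unfolded e] by blast
    then show ?thesis using mono[of s r] S'[of r] by auto
  qed
  have "occ t \<omega> = (\<integral>\<^sup>+r. indicator {0<..<?e} r \<partial>lborel)"
    unfolding occ_def
  proof (rule nn_integral_cong_AE, use AE_lborel_singleton[of ?e] in eventually_elim)
    case (elim r)
    then show ?case
      using lo[of r] hi[of r] by (cases "r < ?e") (auto simp: indicator_def)
  qed
  then have "occ t \<omega> = ennreal ?e" using e0 by simp
  then show E: "?e = E t \<omega>" using e0 by (simp add: E_def)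
  show "0 < r \<Longrightarrow> r < E t \<omega> \<Longrightarrow> S' r \<omega> \<le> t" "E t \<omega> < r \<Longrightarrow> t < S' r \<omega>"
    using lo hi E by auto
qed

lemma AE_E_path:
  "AE \<omega> in M. inverse_subordinator S t \<omega> = E t \<omega> \<and> (\<forall>r. 0 < r \<longrightarrow> r < E t \<omega> \<longrightarrow> S' r \<omega> \<le> t) \<and> (\<forall>r. E t \<omega> < r \<longrightarrow> t < S' r \<omega>)"
  using AE_not_bad AE_occ_finite[of t] AE_space by eventually_elim (use inverse_subordinator_path in blast)

text \<open>Almost surely \<open>E t < r\<close> implies \<open>t < S' r\<close>, which implies
  \<open>E t \<le> r\<close>. The mass that the candidate density gives to \<open>{..<r}\<close>
  thus lies between those that the law gives to the open and to the closed half-line. Rational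
  \<open>r\<close> keep a single null set in \<open>t\<close>, and rationals decreasing to a point
  close the gap.\<close>

lemma law_E:
  "AE t in lborel. 0 < t \<longrightarrow> distr M borel (E t) = density lborel (\<lambda>r. k r t)"
proof -
  have "AE t in lborel. \<forall>n::rat. 0 < n \<longrightarrow> 0 < t \<longrightarrow>
    emeasure M {\<omega> \<in> space M. t < S' (of_rat n) \<omega>} = (\<integral>\<^sup>+\<rho>. k \<rho> t * indicator {..<of_rat n} \<rho> \<partial>lborel)"
  proof (subst AE_all_countable, rule allI)
    fix n :: rat
    show "AE t in lborel. 0 < n \<longrightarrow> 0 < t \<longrightarrow>
      emeasure M {\<omega> \<in> space M. t < S' (of_rat n) \<omega>} = (\<integral>\<^sup>+\<rho>. k \<rho> t * indicator {..<of_rat n} \<rho> \<partial>lborel)"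
      using survival_eq_k[of "of_rat n"] by (cases "0 < n") auto
  qed
  then show ?thesis
  proof eventually_elim
    case (elim t)
    show ?case
    proof
      assume t: "0 < t"
      let ?D = "density lborel (\<lambda>r. k r t)" and ?N = "distr M borel (E t)"
      interpret N: prob_space ?N by (rule prob_space_distr) measurable
      have D: "emeasure ?D {..<real_of_rat n} = emeasure M {\<omega> \<in> space M. t < S' (of_rat n) \<omega>}" if "0 < n" for n
        using elim that t by (subst emeasure_density) auto
      have le: "emeasure ?N {..<real_of_rat n} \<le> emeasure ?D {..<real_of_rat n}"
        and ge: "emeasure ?D {..<real_of_rat n} \<le> emeasure ?N {..real_of_rat n}" if n: "0 < n" for n
      proof -
        have [measurable]: "S' (of_rat n) \<in> borel_measurable M" by measurable
        have "emeasure ?N {..<real_of_rat n} = emeasure M {\<omega> \<in> space M. E t \<omega> < of_rat n}"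
          by (subst emeasure_distr) (auto intro!: arg_cong[where f = "emeasure M"])
        also have "\<dots> \<le> emeasure M {\<omega> \<in> space M. t < S' (of_rat n) \<omega>}"
        proof (rule emeasure_mono_AE)
          show "AE \<omega> in M. \<omega> \<in> {\<omega> \<in> space M. E t \<omega> < of_rat n} \<longrightarrow> \<omega> \<in> {\<omega> \<in> space M. t < S' (of_rat n) \<omega>}"
            using AE_E_path[of t] by eventually_elim auto
        qed measurable
        finally show "emeasure ?N {..<real_of_rat n} \<le> emeasure ?D {..<real_of_rat n}" unfolding D[OF n] .
        have "emeasure M {\<omega> \<in> space M. t < S' (of_rat n) \<omega>} \<le> emeasure M {\<omega> \<in> space M. E t \<omega> \<le> of_rat n}"
        proof (rule emeasure_mono_AE)
          show "AE \<omega> in M. \<omega> \<in> {\<omega> \<in> space M. t < S' (of_rat n) \<omega>} \<longrightarrow> \<omega> \<in> {\<omega> \<in> space M. E t \<omega> \<le> of_rat n}"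
            using AE_E_path[of t] by eventually_elim (use n in \<open>force simp: not_le[symmetric]\<close>)
        qed measurable
        also have "\<dots> = emeasure ?N {..real_of_rat n}"
          by (subst emeasure_distr) (auto intro!: arg_cong[where f = "emeasure M"])
        finally show "emeasure ?D {..<real_of_rat n} \<le> emeasure ?N {..real_of_rat n}" unfolding D[OF n] .
      qed
      \<comment> \<open>Total mass 1 of the candidate is not known beforehand. It follows from the
        same inequalities as \<open>r\<close> grows, and it allows passing to complements at the
        end.\<close>
      have D1: "emeasure ?D UNIV = 1"
      proof (rule LIMSEQ_unique)
        have UN: "(\<Union>i::nat. {..<real (Suc i)}) = UNIV"
        proof (rule set_eqI)
          fix x :: real
          obtain i :: nat where "x < real i" using reals_Archimedean2 by blast
          then have "x < real (Suc i)" by simp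
          then show "x \<in> (\<Union>i::nat. {..<real (Suc i)}) \<longleftrightarrow> x \<in> UNIV" by blast
        qed
        have "(\<lambda>i::nat. emeasure m {..<real (Suc i)}) \<longlonglongrightarrow> emeasure m (\<Union>i::nat. {..<real (Suc i)})" if "sets m = sets borel" for m
        proof (rule Lim_emeasure_incseq)
          show "range (\<lambda>i::nat. {..<real (Suc i)}) \<subseteq> sets m"
            unfolding that by auto
          show "incseq (\<lambda>i::nat. {..<real (Suc i)})"
            unfolding incseq_def by (auto intro: order.strict_trans2)
        qed
        note lim = this[unfolded UN]
        show "(\<lambda>i::nat. emeasure ?D {..<real (Suc i)}) \<longlonglongrightarrow> emeasure ?D UNIV"
          by (rule lim) simp
        have N1: "emeasure ?N UNIV = 1" using N.emeasure_space_1 by simp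
        have "(\<lambda>i::nat. emeasure ?N {..<real (Suc i)}) \<longlonglongrightarrow> 1"
          using lim[of ?N] N1 by simp
        then show "(\<lambda>i::nat. emeasure ?D {..<real (Suc i)}) \<longlonglongrightarrow> 1"
        proof (rule tendsto_sandwich[rotated 2, OF _ tendsto_const])
          have of_rat_Suc: "real_of_rat (of_nat (Suc i)) = real (Suc i)" "(0::rat) < of_nat (Suc i)" for i
            by (simp_all del: of_nat_Suc)
          have "emeasure ?N {..<real (Suc i)} \<le> emeasure ?D {..<real (Suc i)}" for i
            using le[of "of_nat (Suc i)", unfolded of_rat_Suc(1)] of_rat_Suc(2) by blast
          then show "\<forall>\<^sub>F i in sequentially. emeasure ?N {..<real (Suc i)} \<le> emeasure ?D {..<real (Suc i)}"
            by (intro always_eventually allI)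
          have "emeasure ?D {..<real (Suc i)} \<le> 1" for i
            using ge[of "of_nat (Suc i)", unfolded of_rat_Suc(1)] of_rat_Suc(2) N.emeasure_le_1 order.trans by blast
          then show "\<forall>\<^sub>F i in sequentially. emeasure ?D {..<real (Suc i)} \<le> 1" by simp
        qed
      qed
      interpret D: prob_space ?D by (rule prob_spaceI) (simp add: D1)
      have cdf: "emeasure ?D {..x} = emeasure ?N {..x}" for x
      proof (cases "0 \<le> x")
        case False
        have "emeasure ?N {..x} = emeasure M {\<omega> \<in> space M. E t \<omega> \<le> x}"
          by (subst emeasure_distr) (auto intro!: arg_cong[where f = "emeasure M"])
        also have "{\<omega> \<in> space M. E t \<omega> \<le> x} = {}"
          using False E_nonneg[of t] by (auto intro: order.trans)
        finally have "emeasure ?N {..x} = 0" by simp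
        moreover have "emeasure ?D {..x} = (\<integral>\<^sup>+(r::real). 0 \<partial>lborel)"
        proof (subst emeasure_density)
          show "(\<integral>\<^sup>+r. k r t * indicator {..x} r \<partial>lborel) = (\<integral>\<^sup>+(r::real). 0 \<partial>lborel)"
            using False by (intro nn_integral_cong) (auto simp: k_zero indicator_def)
        qed measurable
        ultimately show ?thesis by simp
      next
        case True
        have "\<exists>n::rat. x < of_rat n \<and> of_rat n < x + 1 / real (Suc i)" for i
          using of_rat_dense[of x "x + 1 / real (Suc i)"] by auto
        then obtain n where n: "\<And>i. x < real_of_rat (n i)" "\<And>i. real_of_rat (n i) < x + 1 / real (Suc i)"
          by metis
        \<comment> \<open>Running minima make the chosen rationals decrease to \<open>x\<close>, as
          continuity from above requires.\<close>
        define m where "m i = Min (n ` {..i})" for i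
        have m: "x < real_of_rat (m i)" "real_of_rat (m i) < x + 1 / real (Suc i)" for i
        proof -
          have "m i \<in> n ` {..i}" unfolding m_def by (intro Min_in) auto
          then show "x < real_of_rat (m i)" using n(1) by auto
          have "m i \<le> n i" unfolding m_def by (intro Min_le) auto
          then have "real_of_rat (m i) \<le> real_of_rat (n i)" by (simp add: of_rat_less_eq)
          then show "real_of_rat (m i) < x + 1 / real (Suc i)" using n(2)[of i] by simp
        qed
        have m_dec: "decseq m" unfolding m_def decseq_def by (auto intro!: Min_antimono)
        have m0: "0 < m i" for i
        proof -
          have "0 < real_of_rat (m i)" using m(1)[of i] True by linarith
          then show ?thesis by (simp only: zero_less_of_rat_iff)
        qed
        have lim_m: "y \<le> x" if "\<And>i. y \<le> real_of_rat (m i)" for y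
        proof (rule field_le_epsilon)
          fix d :: real assume "0 < d"
          then obtain i where "1 / real (Suc i) < d" using nat_approx_posE by blast
          then show "y \<le> x + d" using that[of i] m(2)[of i] by linarith
        qed
        have I1: "(\<Inter>i. {..<real_of_rat (m i)}) = {..x}"
        proof (rule set_eqI)
          fix y
          show "y \<in> (\<Inter>i. {..<real_of_rat (m i)}) \<longleftrightarrow> y \<in> {..x}"
            using lim_m[of y] order.strict_trans1[OF _ m(1), of y] by (auto intro: less_imp_le)
        qed
        have I2: "(\<Inter>i. {..real_of_rat (m i)}) = {..x}"
        proof (rule set_eqI)
          fix y
          show "y \<in> (\<Inter>i. {..real_of_rat (m i)}) \<longleftrightarrow> y \<in> {..x}"
            using lim_m[of y] order.strict_trans1[OF _ m(1), of y] by (auto intro: less_imp_le)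
        qed
        have dm: "real_of_rat (m j) \<le> real_of_rat (m i)" if "i \<le> j" for i j
          using decseqD[OF m_dec that] by (simp add: of_rat_less_eq)
        have L1: "(\<lambda>i. emeasure ?D {..<real_of_rat (m i)}) \<longlonglongrightarrow> emeasure ?D {..x}"
          unfolding I1[symmetric] using dm order.strict_trans2 by (intro Lim_emeasure_decseq) (auto simp: decseq_def)
        have L2: "(\<lambda>i. emeasure ?N {..real_of_rat (m i)}) \<longlonglongrightarrow> emeasure ?N {..x}"
          unfolding I2[symmetric] using dm order.trans by (intro Lim_emeasure_decseq) (auto simp: decseq_def)
        have "emeasure ?N {..x} \<le> emeasure ?D {..<real_of_rat (m i)}" for i
          using m(1)[of i] by (intro order.trans[OF emeasure_mono le[OF m0]]) auto
        then have "emeasure ?N {..x} \<le> emeasure ?D {..x}"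
          by (intro LIMSEQ_le_const[OF L1]) auto
        moreover have "emeasure ?D {..x} \<le> emeasure ?N {..x}"
          using ge[OF m0] by (intro LIMSEQ_le[OF L1 L2]) auto
        ultimately show ?thesis by (rule antisym[rotated])
      qed
      show "?N = ?D"
      proof (rule measure_eqI_lessThan)
        fix x :: real
        show "emeasure ?N {x<..} < \<infinity>" by (simp add: less_top[symmetric])
        have "{x<..} = UNIV - {..x}" by auto
        then show "emeasure ?N {x<..} = emeasure ?D {x<..}"
          using emeasure_compl[of "{..x}" ?N] emeasure_compl[of "{..x}" ?D] cdf[of x] D1 N.emeasure_space_1 by simp
      qed simp_all
    qed
  qed
qed

end

section \<open>The operators \<open>G\<close> and \<open>Q\<close>\<close>

locale fractional_cauchy = subordinator_density M S \<nu> pbar + bounded_C0_semigroup P C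
  for M :: "'a measure" and S and \<nu> and pbar and P :: "real \<Rightarrow> 'b::banach \<Rightarrow>\<^sub>L 'b" and C
begin

sublocale LM: pair_sigma_finite lborel M
  by unfold_locales

text \<open>For each fixed \<open>r\<close> the law of \<open>S' r\<close> ignores null sets;
  exchanging the two almost-everywhere quantifiers gives almost every path at almost every time. It
  permits changing \<open>f\<close> on a null set inside the path integral.\<close>

lemma AE_path:
  assumes "AE x in lborel. R x"
  shows "AE \<omega> in M. AE r in lborel. 0 < r \<longrightarrow> R (S' r \<omega>)"
proof -
  from assms obtain N where N: "{x \<in> space lborel. \<not> R x} \<subseteq> N" "emeasure lborel N = 0" "N \<in> sets lborel"
    by (rule AE_E)
  have [measurable]: "N \<in> sets borel" using N(3) by simp
  have N0: "AE x in lborel. x \<notin> N"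
    using N by (intro AE_not_in) (auto simp: null_sets_def)
  have "AE r in lborel. AE \<omega> in M. 0 < r \<longrightarrow> S' r \<omega> \<notin> N"
  proof (rule AE_I2)
    fix r :: real
    show "AE \<omega> in M. 0 < r \<longrightarrow> S' r \<omega> \<notin> N"
      using AE_S'_not_null[OF _ N0, of r] by (cases "0 < r") auto
  qed
  then have "AE \<omega> in M. AE r in lborel. 0 < r \<longrightarrow> S' r \<omega> \<notin> N"
    by (subst (asm) LM.AE_commute) measurable
  then show ?thesis
  proof eventually_elim
    case (elim \<omega>)
    then show ?case by eventually_elim (use N(1) in auto)
  qed
qed

text \<open>The one-time laws, applied for each fixed \<open>r\<close>, identify the image of time
  times probability under the space-time path. The indicator removes nonpositive times, where
  \<open>p\<close> vanishes too.\<close>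

lemma distr_S'_pair:
  "distr (density (lborel \<Otimes>\<^sub>M M) (\<lambda>z. ennreal (indicat_real {0<..} (fst z)))) (lborel \<Otimes>\<^sub>M lborel) (\<lambda>z. (fst z, S' (fst z) (snd z))) =
   density (lborel \<Otimes>\<^sub>M lborel) (\<lambda>z. ennreal (p (fst z) (snd z)))" (is "distr ?D ?L ?\<phi> = ?R")
proof (rule measure_eqI)
  fix A assume "A \<in> sets (distr ?D ?L ?\<phi>)"
  then have A[measurable]: "A \<in> sets (lborel \<Otimes>\<^sub>M lborel)" by simp
  have [measurable]: "?\<phi> \<in> (lborel \<Otimes>\<^sub>M M) \<rightarrow>\<^sub>M (lborel \<Otimes>\<^sub>M lborel)" by measurable
  have "emeasure (distr ?D ?L ?\<phi>) A = (\<integral>\<^sup>+z. indicator A z \<partial>distr ?D ?L ?\<phi>)"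
    using A by (intro nn_integral_indicator[symmetric]) simp
  also have "\<dots> = (\<integral>\<^sup>+z. indicator A (?\<phi> z) \<partial>?D)"
    by (rule nn_integral_distr) measurable
  also have "\<dots> = (\<integral>\<^sup>+z. ennreal (indicat_real {0<..} (fst z)) * indicator A (?\<phi> z) \<partial>(lborel \<Otimes>\<^sub>M M))"
    by (subst nn_integral_density) auto
  also have "\<dots> = (\<integral>\<^sup>+r. \<integral>\<^sup>+\<omega>. ennreal (indicat_real {0<..} r) * indicator A (r, S' r \<omega>) \<partial>M \<partial>lborel)"
    by (subst nn_integral_fst[symmetric]) auto
  also have "\<dots> = (\<integral>\<^sup>+r. \<integral>\<^sup>+x. ennreal (p r x) * indicator A (r, x) \<partial>lborel \<partial>lborel)"
  proof (rule nn_integral_cong)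
    fix r :: real
    show "(\<integral>\<^sup>+\<omega>. ennreal (indicat_real {0<..} r) * indicator A (r, S' r \<omega>) \<partial>M) = (\<integral>\<^sup>+x. ennreal (p r x) * indicator A (r, x) \<partial>lborel)"
    proof (cases "0 < r")
      case True
      have "(\<lambda>x. indicator A (r, x) :: ennreal) \<in> borel_measurable borel"
        by measurable
      from nn_integral_S(2)[OF True this] True show ?thesis by simp
    qed (simp add: p_zero)
  qed
  also have "\<dots> = (\<integral>\<^sup>+z. ennreal (p (fst z) (snd z)) * indicator A z \<partial>(lborel \<Otimes>\<^sub>M lborel))"
    by (subst lborel.nn_integral_fst[symmetric]) auto
  also have "\<dots> = emeasure ?R A"
    by (rule emeasure_density[symmetric, OF _ A]) measurable
  finally show "emeasure (distr ?D ?L ?\<phi>) A = emeasure ?R A" .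
qed simp

text \<open>The bridge from probability to operators: expected integrals along the path become
  double integrals against \<open>p\<close>. Fubini is applied on both sides of the change of
  variables in \<open>distr_S'_pair\<close>.\<close>

lemma bochner_integral_along_path:
  fixes H :: "real \<times> real \<Rightarrow> 'b"
  assumes H: "ps_measurable (lborel \<Otimes>\<^sub>M lborel) H"
    and fin: "(\<integral>\<^sup>+z. ennreal (p (fst z) (snd z)) * ennreal (norm (H z)) \<partial>(lborel \<Otimes>\<^sub>M lborel)) < \<infinity>"
  shows "AE \<omega> in M. set_bochner_integrable lborel {0<..} (\<lambda>r. H (r, S' r \<omega>))"
    and "bochner_integrable M (\<lambda>\<omega>. set_bochner_integral lborel {0<..} (\<lambda>r. H (r, S' r \<omega>)))"
    and "bochner_integrable lborel (\<lambda>x. bochner_integral lborel (\<lambda>r. p r x *\<^sub>R H (r, x)))"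
    and "bochner_integral M (\<lambda>\<omega>. set_bochner_integral lborel {0<..} (\<lambda>r. H (r, S' r \<omega>))) =
      bochner_integral lborel (\<lambda>x. bochner_integral lborel (\<lambda>r. p r x *\<^sub>R H (r, x)))"
proof -
  let ?D = "density (lborel \<Otimes>\<^sub>M M) (\<lambda>z. ennreal (indicat_real {0<..} (fst z)))" and ?L = "lborel \<Otimes>\<^sub>M lborel :: (real \<times> real) measure"
  let ?\<phi> = "\<lambda>z. (fst z, S' (fst z) (snd z))"
  have \<phi>[measurable]: "?\<phi> \<in> (lborel \<Otimes>\<^sub>M M) \<rightarrow>\<^sub>M ?L" by measurable
  then have \<phi>D: "?\<phi> \<in> ?D \<rightarrow>\<^sub>M ?L" by simp
  have H\<phi>: "ps_measurable (lborel \<Otimes>\<^sub>M M) (\<lambda>z. H (?\<phi> z))"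
    by (rule ps_measurable_compose[OF H \<phi>])
  have pm: "(\<lambda>z. p (fst z) (snd z)) \<in> borel_measurable ?L" by measurable
  have im: "(\<lambda>z. indicat_real {0<..} (fst z :: real)) \<in> borel_measurable (lborel \<Otimes>\<^sub>M M)"
    by (rule measurable_compose[OF measurable_fst borel_measurable_indicator]) simp
  note d1 = bochner_density_ps[OF pm _ H] and d2 = bochner_density_ps[OF im _ H\<phi>] and d3 = bochner_distr_ps[OF \<phi>D H, unfolded distr_S'_pair]
  have pH: "bochner_integrable ?L (\<lambda>z. p (fst z) (snd z) *\<^sub>R H z)"
  proof (rule bochner_integrableI_ps[OF ps_measurable_scaleR[OF pm H]])
    show "(\<integral>\<^sup>+z. ennreal (norm (p (fst z) (snd z) *\<^sub>R H z)) \<partial>?L) < \<infinity>"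
      using fin by (simp add: p_nonneg ennreal_mult)
  qed
  then have iM: "bochner_integrable (lborel \<Otimes>\<^sub>M M) (\<lambda>(r, \<omega>). indicat_real {0<..} r *\<^sub>R H (r, S' r \<omega>))"
    using d1(1) d2(1) d3(1) by (simp add: p_nonneg case_prod_beta')
  have pH': "bochner_integrable (lborel \<Otimes>\<^sub>M lborel) (\<lambda>(r, x). p r x *\<^sub>R H (r, x))"
    using pH by (simp add: case_prod_beta')
  note A = bochner_fubini_swap[OF LM.pair_sigma_finite_axioms iM] and B = bochner_fubini_swap[OF lborel_pair.pair_sigma_finite_axioms pH']
  show "AE \<omega> in M. set_bochner_integrable lborel {0<..} (\<lambda>r. H (r, S' r \<omega>))"
    "bochner_integrable M (\<lambda>\<omega>. set_bochner_integral lborel {0<..} (\<lambda>r. H (r, S' r \<omega>)))"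
    "bochner_integrable lborel (\<lambda>x. bochner_integral lborel (\<lambda>r. p r x *\<^sub>R H (r, x)))"
    using A(1,2) B(2) by auto
  have "bochner_integral (lborel \<Otimes>\<^sub>M M) (\<lambda>(r, \<omega>). indicat_real {0<..} r *\<^sub>R H (r, S' r \<omega>)) = bochner_integral ?L (\<lambda>(r, x). p r x *\<^sub>R H (r, x))"
    using d1(2) d2(2) d3(2) by (simp add: p_nonneg case_prod_beta')
  then show "bochner_integral M (\<lambda>\<omega>. set_bochner_integral lborel {0<..} (\<lambda>r. H (r, S' r \<omega>))) =
      bochner_integral lborel (\<lambda>x. bochner_integral lborel (\<lambda>r. p r x *\<^sub>R H (r, x)))"
    using A(3) B(3) bochner_fubini(3)[OF LM.pair_sigma_finite_axioms iM] bochner_fubini(3)[OF lborel_pair.pair_sigma_finite_axioms pH'] by simp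
qed

text \<open>The case \<open>q t = \<infinity>\<close>, where the integral need not converge, occurs only on a null set of \<open>t\<close>.\<close>

definition G :: "real \<Rightarrow> 'b \<Rightarrow>\<^sub>L 'b" where
  "G t = (if q t < \<infinity> then Blinfun (\<lambda>x. bochner_integral lborel (\<lambda>r. p r t *\<^sub>R P (max 0 r) x)) else 0)"

lemma p_measurable1: "(\<lambda>r. p r t) \<in> borel_measurable borel"
  by measurable

lemma norm_P_max: "norm (P (max 0 r) x) \<le> C * norm x"
  by (rule norm_P_apply) simp

lemma nn_integral_pP_le:
  "(\<integral>\<^sup>+r. ennreal (norm (p r t *\<^sub>R P (max 0 r) x)) \<partial>lborel) \<le> ennreal C * ennreal (norm x) * q t"
proof -
  have "(\<integral>\<^sup>+r. ennreal (norm (p r t *\<^sub>R P (max 0 r) x)) \<partial>lborel) \<le> (\<integral>\<^sup>+r. ennreal C * ennreal (norm x) * ennreal (p r t) \<partial>lborel)"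
    using norm_P_max C_nonneg
    by (intro nn_integral_mono) (auto simp: p_nonneg ennreal_mult[symmetric] mult.commute[of _ "p _ _"] intro!: ennreal_leI mult_left_mono)
  also have "\<dots> = ennreal C * ennreal (norm x) * q t"
    unfolding q_def using p_measurable1 by (intro nn_integral_cmult) simp
  finally show ?thesis .
qed

lemma bochner_integrable_pP:
  assumes "q t < \<infinity>"
  shows "bochner_integrable lborel (\<lambda>r. p r t *\<^sub>R P (max 0 r) x)"
proof (rule bochner_integrableI_ps)
  show "ps_measurable lborel (\<lambda>r. p r t *\<^sub>R P (max 0 r) x)"
    using p_measurable1 by (intro ps_measurable_scaleR ps_measurable_P ps_measurable_const) auto
  show "(\<integral>\<^sup>+r. ennreal (norm (p r t *\<^sub>R P (max 0 r) x)) \<partial>lborel) < \<infinity>"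
    using assms by (intro order.strict_trans1[OF nn_integral_pP_le]) (simp add: ennreal_mult_less_top)
qed

lemma norm_integral_pP_le:
  assumes "q t < \<infinity>"
  shows "norm (bochner_integral lborel (\<lambda>r. p r t *\<^sub>R P (max 0 r) x)) \<le> C * enn2real (q t) * norm x"
proof -
  have "ennreal (norm (bochner_integral lborel (\<lambda>r. p r t *\<^sub>R P (max 0 r) x))) \<le> ennreal C * ennreal (norm x) * q t"
    using norm_bochner_integral_le nn_integral_pP_le by (rule order.trans)
  also have "\<dots> = ennreal (C * enn2real (q t) * norm x)"
    using assms C_nonneg by (cases "q t") (auto simp: ennreal_mult mult_ac)
  finally show ?thesis
    using C_nonneg by (simp add: ennreal_le_iff)
qed

lemma G_apply:
  assumes "q t < \<infinity>"
  shows "G t x = bochner_integral lborel (\<lambda>r. p r t *\<^sub>R P (max 0 r) x)"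
proof -
  have "bounded_linear (\<lambda>x. bochner_integral lborel (\<lambda>r. p r t *\<^sub>R P (max 0 r) x))"
  proof (rule bounded_linear_intro[where K = "C * enn2real (q t)"])
    show "bochner_integral lborel (\<lambda>r. p r t *\<^sub>R P (max 0 r) (x + y)) =
      bochner_integral lborel (\<lambda>r. p r t *\<^sub>R P (max 0 r) x) + bochner_integral lborel (\<lambda>r. p r t *\<^sub>R P (max 0 r) y)" for x y
      by (subst bochner_integral_add[symmetric]) (auto intro!: bochner_integrable_pP assms simp: blinfun.add_right scaleR_add_right)
    show "bochner_integral lborel (\<lambda>r. p r t *\<^sub>R P (max 0 r) (c *\<^sub>R x)) = c *\<^sub>R bochner_integral lborel (\<lambda>r. p r t *\<^sub>R P (max 0 r) x)" for c x
    proof -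
      have "p r t *\<^sub>R P (max 0 r) (c *\<^sub>R x) = c *\<^sub>R (p r t *\<^sub>R P (max 0 r) x)" for r
        by (simp add: blinfun.scaleR_right)
      then show ?thesis
        using bochner_integral_scaleR[OF bochner_integrable_pP[OF assms]] by (simp only:)
    qed
    show "norm (bochner_integral lborel (\<lambda>r. p r t *\<^sub>R P (max 0 r) x)) \<le> norm x * (C * enn2real (q t))" for x
      using norm_integral_pP_le[OF assms, of x] by (simp add: mult_ac)
  qed
  then show ?thesis
    using assms by (simp add: G_def bounded_linear_Blinfun_apply)
qed

text \<open>Valid at every \<open>t\<close>, since \<open>G t = 0\<close> where \<open>q t\<close>
  is infinite.\<close>

lemma norm_G_apply: "ennreal (norm (G t x)) \<le> ennreal C * q t * ennreal (norm x)"
proof (cases "q t < \<infinity>")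
  case True
  have "ennreal (norm (G t x)) \<le> ennreal (C * enn2real (q t) * norm x)"
    unfolding G_apply[OF True] by (intro ennreal_leI norm_integral_pP_le True)
  also have "\<dots> = ennreal C * q t * ennreal (norm x)"
    using True C_nonneg by (cases "q t") (auto simp: ennreal_mult)
  finally show ?thesis .
qed (simp add: G_def)

lemma G_zero: "t \<le> 0 \<Longrightarrow> G t = 0"
proof (rule blinfun_eqI)
  fix x assume "t \<le> 0"
  then show "blinfun_apply (G t) x = blinfun_apply 0 x"
    using norm_G_apply[of t x] by (simp add: q_zero)
qed

lemma ps_measurable_G: "ps_measurable lborel (\<lambda>t. G t x)"
proof -
  have "ps_measurable (lborel \<Otimes>\<^sub>M lborel) (\<lambda>z. p (snd z) (fst z) *\<^sub>R P (max 0 (snd z)) x)"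
    by (intro ps_measurable_scaleR ps_measurable_P ps_measurable_const) measurable
  from ps_measurable_bochner_integral[OF lborel.sigma_finite_measure_axioms this]
  have "ps_measurable lborel (\<lambda>t. indicat_real {t. q t < \<infinity>} t *\<^sub>R bochner_integral lborel (\<lambda>r. p r t *\<^sub>R P (max 0 r) x))"
    by (intro ps_measurable_indicator_scaleR) simp_all
  also have "(\<lambda>t. indicat_real {t. q t < \<infinity>} t *\<^sub>R bochner_integral lborel (\<lambda>r. p r t *\<^sub>R P (max 0 r) x)) = (\<lambda>t. G t x)"
  proof (rule ext)
    fix t show "indicat_real {t. q t < \<infinity>} t *\<^sub>R bochner_integral lborel (\<lambda>r. p r t *\<^sub>R P (max 0 r) x) = G t x"
      by (cases "q t < \<infinity>") (simp_all add: G_apply, simp add: G_def)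
  qed
  finally show ?thesis .
qed

text \<open>Each \<open>P r\<close> with \<open>r \<ge> 0\<close> preserves the domain and commutes
  with the generator; \<open>generator_bochner_integral\<close> carries this through the integral
  over \<open>r\<close>.\<close>

lemma G_generator:
  assumes x: "x \<in> generator_dom P"
  shows "G t x \<in> generator_dom P" and "generator P (G t x) = G t (generator P x)"
proof -
  have *: "p r t *\<^sub>R P (max 0 r) x \<in> generator_dom P" "generator P (p r t *\<^sub>R P (max 0 r) x) = p r t *\<^sub>R P (max 0 r) (generator P x)" for r
    using generator_scaleR[OF P_generator_dom[OF x, of "max 0 r"]] generator_P[OF x, of "max 0 r"] by auto
  have "G t x \<in> generator_dom P \<and> generator P (G t x) = G t (generator P x)"
  proof (cases "q t < \<infinity>")
    case True
    show ?thesis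
      unfolding G_apply[OF True]
      using generator_bochner_integral[OF bochner_integrable_pP[OF True], of x] bochner_integrable_pP[OF True] * by simp
  qed (simp add: G_def generator_zero)
  then show "G t x \<in> generator_dom P" "generator P (G t x) = G t (generator P x)" by auto
qed

text \<open>At \<open>t \<le> 0\<close> the value is 0 rather than the identity, which agrees with
  the convolution of \<open>w\<close> and \<open>G\<close> there.\<close>

definition Q :: "real \<Rightarrow> 'b \<Rightarrow>\<^sub>L 'b" where
  "Q t = (if 0 < t then Blinfun (\<lambda>x. bochner_integral M (\<lambda>\<omega>. P (E t \<omega>) x)) else 0)"

lemma bochner_integrable_PE: "bochner_integrable M (\<lambda>\<omega>. P (E t \<omega>) x)"
proof (rule bochner_integrableI_ps)
  have "ps_measurable M (\<lambda>\<omega>. P (max 0 (E t \<omega>)) x)"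
    by (intro ps_measurable_P ps_measurable_const) measurable
  then show "ps_measurable M (\<lambda>\<omega>. P (E t \<omega>) x)"
    using E_nonneg by (simp add: max_absorb2)
  have "(\<integral>\<^sup>+\<omega>. ennreal (norm (P (E t \<omega>) x)) \<partial>M) \<le> (\<integral>\<^sup>+\<omega>. ennreal (C * norm x) \<partial>M)"
    using E_nonneg by (intro nn_integral_mono ennreal_leI norm_P_apply)
  also have "\<dots> < \<infinity>" by (simp add: emeasure_space_1)
  finally show "(\<integral>\<^sup>+\<omega>. ennreal (norm (P (E t \<omega>) x)) \<partial>M) < \<infinity>" .
qed

lemma norm_integral_PE_le: "norm (bochner_integral M (\<lambda>\<omega>. P (E t \<omega>) x)) \<le> C * norm x"
proof -
  have "ennreal (norm (bochner_integral M (\<lambda>\<omega>. P (E t \<omega>) x))) \<le> (\<integral>\<^sup>+\<omega>. ennreal (norm (P (E t \<omega>) x)) \<partial>M)"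
    by (rule norm_bochner_integral_le)
  also have "\<dots> \<le> (\<integral>\<^sup>+\<omega>. ennreal (C * norm x) \<partial>M)"
    using E_nonneg by (intro nn_integral_mono ennreal_leI norm_P_apply)
  finally show ?thesis
    using C_nonneg by (simp add: emeasure_space_1)
qed

lemma Q_apply:
  assumes "0 < t"
  shows "Q t x = bochner_integral M (\<lambda>\<omega>. P (E t \<omega>) x)"
proof -
  have "bounded_linear (\<lambda>x. bochner_integral M (\<lambda>\<omega>. P (E t \<omega>) x))"
  proof (rule bounded_linear_intro[where K = C])
    show "bochner_integral M (\<lambda>\<omega>. P (E t \<omega>) (x + y)) = bochner_integral M (\<lambda>\<omega>. P (E t \<omega>) x) + bochner_integral M (\<lambda>\<omega>. P (E t \<omega>) y)" for x y
      by (subst bochner_integral_add[symmetric]) (auto intro!: bochner_integrable_PE simp: blinfun.add_right)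
    show "bochner_integral M (\<lambda>\<omega>. P (E t \<omega>) (c *\<^sub>R x)) = c *\<^sub>R bochner_integral M (\<lambda>\<omega>. P (E t \<omega>) x)" for c x
      by (subst bochner_integral_scaleR[symmetric]) (auto intro!: bochner_integrable_PE simp: blinfun.scaleR_right)
    show "norm (bochner_integral M (\<lambda>\<omega>. P (E t \<omega>) x)) \<le> norm x * C" for x
      using norm_integral_PE_le[of t x] by (simp add: mult_ac)
  qed
  then show ?thesis
    using assms by (simp add: Q_def bounded_linear_Blinfun_apply)
qed

lemma Q_zero: "t \<le> 0 \<Longrightarrow> Q t = 0"
  by (simp add: Q_def)

lemma norm_Q_apply: "norm (Q t x) \<le> C * norm x"
  using norm_integral_PE_le[of t x] C_nonneg by (cases "0 < t") (auto simp: Q_apply Q_zero)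

lemma Q_generator:
  assumes x: "x \<in> generator_dom P" and t: "0 < t"
  shows "Q t x \<in> generator_dom P" and "generator P (Q t x) = Q t (generator P x)"
  unfolding Q_apply[OF t]
  using generator_bochner_integral[OF bochner_integrable_PE, of t x] bochner_integrable_PE
    P_generator_dom[OF x E_nonneg] generator_P[OF x E_nonneg] by simp_all

section \<open>The kernel \<open>w\<close> and the identity \<open>w * G = Q\<close>\<close>

definition w :: "real \<Rightarrow> real" where
  "w \<tau> = indicat_real {0<..} \<tau> * levy_tail \<nu> \<tau>"

lemma w_measurable [measurable]: "w \<in> borel_measurable borel"
  unfolding w_def[abs_def] by (rule levy_tail_measurable)

lemma w_nonneg: "0 \<le> w \<tau>"
  by (simp add: w_def levy_tail_def)

lemma ennreal_w: "ennreal (w \<tau>) = W \<tau>"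
  by (simp add: w_def W_eq_levy_tail)

lemma nn_integral_w_finite: "(\<integral>\<^sup>+t. ennreal (w t) * indicator {..T} t \<partial>lborel) < \<infinity>"
proof -
  have "(\<integral>\<^sup>+t. ennreal (w t) * indicator {..T} t \<partial>lborel) \<le> (\<integral>\<^sup>+t. ennreal (exp T) * (ennreal (exp (- (1 * t))) * W t) \<partial>lborel)"
  proof (intro nn_integral_mono)
    fix t
    show "ennreal (w t) * indicator {..T} t \<le> ennreal (exp T) * (ennreal (exp (- (1 * t))) * W t)"
    proof (cases "t \<le> T")
      case True
      then have "1 * w t \<le> (exp T * exp (- t)) * w t"
        by (intro mult_right_mono w_nonneg) (simp add: exp_add[symmetric])
      then show ?thesis using True by (simp add: ennreal_w[symmetric] ennreal_mult[symmetric] w_nonneg mult.assoc ennreal_leI)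
    qed simp
  qed
  also have "\<dots> < \<infinity>"
    using laplace_W[of 1] by (subst nn_integral_cmult) (auto simp: ennreal_mult_less_top)
  finally show ?thesis .
qed

lemma w_conv_q:
  "(\<integral>\<^sup>+t. ennreal (w (\<tau> - t)) * q t \<partial>lborel) = (\<integral>\<^sup>+r. k r \<tau> \<partial>lborel)"
proof -
  have "(\<integral>\<^sup>+t. ennreal (w (\<tau> - t)) * q t \<partial>lborel) = (\<integral>\<^sup>+t. \<integral>\<^sup>+r. W (\<tau> - t) * ennreal (p r t) \<partial>lborel \<partial>lborel)"
    unfolding q_def ennreal_w using p_measurable1 by (intro nn_integral_cong nn_integral_cmult[symmetric]) simp
  also have "\<dots> = (\<integral>\<^sup>+r. k r \<tau> \<partial>lborel)"
    unfolding k_def by (rule lborel_pair.Fubini') measurable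
  finally show ?thesis .
qed

lemma AE_law_E: "AE \<tau> in lborel. 0 < \<tau> \<longrightarrow> distr M borel (E \<tau>) = density lborel (\<lambda>r. k r \<tau>) \<and> (\<integral>\<^sup>+r. k r \<tau> \<partial>lborel) = 1"
  using law_E
proof eventually_elim
  case (elim \<tau>)
  show ?case
  proof
    assume "0 < \<tau>"
    then have eq: "distr M borel (E \<tau>) = density lborel (\<lambda>r. k r \<tau>)" using elim by simp
    have "prob_space (distr M borel (E \<tau>))" by (rule prob_space_distr) measurable
    then have "emeasure (density lborel (\<lambda>r. k r \<tau>)) UNIV = 1"
      using prob_space.emeasure_space_1 eq by fastforce
    then have "(\<integral>\<^sup>+r. k r \<tau> \<partial>lborel) = 1"
      by (subst (asm) emeasure_density) auto
    with eq show "distr M borel (E \<tau>) = density lborel (\<lambda>r. k r \<tau>) \<and> (\<integral>\<^sup>+r. k r \<tau> \<partial>lborel) = 1" by blast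
  qed
qed

text \<open>By \<open>w_conv_q\<close> the left side is the integral of \<open>k r \<tau>\<close>
  over \<open>r\<close>, which is 1 for almost every positive \<open>\<tau>\<close> and 0 otherwise.
  Up to the factor \<open>C\<close> it bounds the norm of \<open>w * G\<close>.\<close>

lemma AE_w_conv_q_le: "AE \<tau> in lborel. (\<integral>\<^sup>+t. ennreal (w (\<tau> - t)) * q t \<partial>lborel) \<le> 1"
  using AE_law_E
proof eventually_elim
  case (elim \<tau>)
  show ?case
    unfolding w_conv_q using elim by (cases "0 < \<tau>") (auto simp: k_zero)
qed

text \<open>The expectation of \<open>P\<close> at \<open>E \<tau>\<close> is an integral against
  \<open>k r \<tau>\<close>; writing \<open>k\<close> as the convolution of \<open>w\<close> and
  \<open>p\<close> and exchanging the integrals over \<open>r\<close> and \<open>t\<close> leaves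
  \<open>G\<close>. The quantifier over \<open>y\<close> stands inside because \<open>y\<close> will
  later depend on the integration variable.\<close>

lemma AE_w_conv_G:
  "AE \<tau> in lborel. \<forall>y. bochner_integral lborel (\<lambda>t. w (\<tau> - t) *\<^sub>R G t y) = Q \<tau> y"
  using AE_law_E
proof eventually_elim
  case (elim \<tau>)
  show ?case
  proof
    fix y
    show "bochner_integral lborel (\<lambda>t. w (\<tau> - t) *\<^sub>R G t y) = Q \<tau> y"
    proof (cases "0 < \<tau>")
      case False
      have "w (\<tau> - t) *\<^sub>R G t y = 0" for t
        using False by (cases "0 < t") (auto simp: w_def G_zero)
      then have "(\<lambda>t. w (\<tau> - t) *\<^sub>R G t y) = (\<lambda>_. 0)" by (rule ext)
      then show ?thesis
        using False by (simp only: Q_zero bochner_integral_zero) (simp add: Q_zero)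
    next
      case True
      then have law: "distr M borel (E \<tau>) = density lborel (\<lambda>r. k r \<tau>)" and one: "(\<integral>\<^sup>+r. k r \<tau> \<partial>lborel) = 1"
        using elim by auto
      have km: "(\<lambda>r. k r \<tau>) \<in> borel_measurable borel" by measurable
      have AEk: "AE r in lborel. k r \<tau> \<noteq> \<infinity>"
        by (rule nn_integral_PInf_AE) (use one km in auto)
      \<comment> \<open>The change to a density is set up for real densities;
        \<open>k r \<tau>\<close> is finite for almost every \<open>r\<close> because its integral
        is 1.\<close>
      have law': "distr M borel (E \<tau>) = density lborel (\<lambda>r. ennreal (enn2real (k r \<tau>)))"
        unfolding law
      proof (rule density_cong)
        show "AE r in lborel. k r \<tau> = ennreal (enn2real (k r \<tau>))"
          using AEk by eventually_elim (simp add: less_top)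
      qed (use km in auto)
      have psP: "ps_measurable borel (\<lambda>r. P (max 0 r) y)"
        by (intro ps_measurable_P ps_measurable_const) simp
      then have psP': "ps_measurable lborel (\<lambda>r. P (max 0 r) y)"
        using ps_measurable_cong_sets[of lborel borel "\<lambda>r. P (max 0 r) y"] by simp
      have "Q \<tau> y = bochner_integral M (\<lambda>\<omega>. P (max 0 (E \<tau> \<omega>)) y)"
        using True E_nonneg by (simp add: Q_apply max_absorb2)
      also have "\<dots> = bochner_integral (distr M borel (E \<tau>)) (\<lambda>r. P (max 0 r) y)"
        by (rule bochner_distr_ps(2)[OF E_measurable psP, symmetric])
      also have "\<dots> = bochner_integral lborel (\<lambda>r. enn2real (k r \<tau>) *\<^sub>R P (max 0 r) y)"
        unfolding law' by (rule bochner_density_ps(2)[OF _ _ psP']) (use km in auto)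
      finally have Q: "Q \<tau> y = bochner_integral lborel (\<lambda>r. enn2real (k r \<tau>) *\<^sub>R P (max 0 r) y)" .
      let ?F = "\<lambda>(r, t). (w (\<tau> - t) * p r t) *\<^sub>R P (max 0 r) y"
      have F: "bochner_integrable (lborel \<Otimes>\<^sub>M lborel) ?F"
      proof (rule bochner_integrableI_ps)
        show ps: "ps_measurable (lborel \<Otimes>\<^sub>M lborel) ?F"
          unfolding case_prod_beta'
          by (intro ps_measurable_scaleR ps_measurable_P ps_measurable_const) measurable
        have "(\<integral>\<^sup>+z. ennreal (norm (?F z)) \<partial>(lborel \<Otimes>\<^sub>M lborel)) = (\<integral>\<^sup>+r. \<integral>\<^sup>+t. ennreal (norm (?F (r, t))) \<partial>lborel \<partial>lborel)"
          by (rule lborel.nn_integral_fst[symmetric]) (rule ps_measurable_ennreal_norm[OF ps])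
        also have "\<dots> \<le> (\<integral>\<^sup>+r. \<integral>\<^sup>+t. (W (\<tau> - t) * ennreal (p r t)) * ennreal (C * norm y) \<partial>lborel \<partial>lborel)"
          using norm_P_max by (intro nn_integral_mono)
            (auto simp: w_nonneg p_nonneg ennreal_w[symmetric] C_nonneg abs_mult intro!: ennreal_leI mult_left_mono simp flip: ennreal_mult)
        also have "\<dots> = (\<integral>\<^sup>+r. k r \<tau> * ennreal (C * norm y) \<partial>lborel)"
          unfolding k_def by (intro nn_integral_cong nn_integral_multc) measurable
        also have "\<dots> = ennreal (C * norm y)"
          using one by (simp add: nn_integral_multc)
        finally show "(\<integral>\<^sup>+z. ennreal (norm (?F z)) \<partial>(lborel \<Otimes>\<^sub>M lborel)) < \<infinity>"
          by (rule order.strict_trans1) simp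
      qed
      have 1: "AE r in lborel. bochner_integral lborel (\<lambda>t. (w (\<tau> - t) * p r t) *\<^sub>R P (max 0 r) y) = enn2real (k r \<tau>) *\<^sub>R P (max 0 r) y"
        using AEk
      proof eventually_elim
        case (elim r)
        have k': "(\<integral>\<^sup>+t. ennreal (w (\<tau> - t) * p r t) \<partial>lborel) = k r \<tau>"
          unfolding k_def by (simp add: ennreal_mult w_nonneg p_nonneg ennreal_w)
        have m: "(\<lambda>t. w (\<tau> - t) * p r t) \<in> borel_measurable lborel" by measurable
        have "integrable lborel (\<lambda>t. w (\<tau> - t) * p r t)"
          using elim k' m by (intro integrableI_nonneg) (auto simp: w_nonneg p_nonneg less_top)
        moreover have "(\<integral>t. w (\<tau> - t) * p r t \<partial>lborel) = enn2real (k r \<tau>)"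
          using m by (subst integral_eq_nn_integral) (auto simp: w_nonneg p_nonneg k')
        ultimately show ?case
          by (simp add: bochner_integral_scaleR_const)
      qed
      have 2: "AE t in lborel. bochner_integral lborel (\<lambda>r. (w (\<tau> - t) * p r t) *\<^sub>R P (max 0 r) y) = w (\<tau> - t) *\<^sub>R G t y"
        using AE_q_finite
      proof eventually_elim
        case (elim t)
        show ?case
          using bochner_integral_scaleR[OF bochner_integrable_pP[OF elim], of "w (\<tau> - t)" y]
          by (simp add: G_apply[OF elim] ac_simps)
      qed
      have "bochner_integral lborel (\<lambda>t. w (\<tau> - t) *\<^sub>R G t y) =
        bochner_integral lborel (\<lambda>t. bochner_integral lborel (\<lambda>r. (w (\<tau> - t) * p r t) *\<^sub>R P (max 0 r) y))"
        by (rule bochner_integral_cong_AE) (use 2 in eventually_elim, simp)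
      also have "\<dots> = bochner_integral lborel (\<lambda>r. bochner_integral lborel (\<lambda>t. (w (\<tau> - t) * p r t) *\<^sub>R P (max 0 r) y))"
        by (rule bochner_fubini_swap(3)[OF lborel_pair.pair_sigma_finite_axioms F])
      also have "\<dots> = Q \<tau> y"
        unfolding Q by (rule bochner_integral_cong_AE[OF 1])
      finally show ?thesis .
    qed
  qed
qed

text \<open>Integrating over \<open>r\<close> first turns \<open>p\<close> into \<open>q\<close>, so
  the bound is \<open>b\<close> times the integral of \<open>q\<close> up to
  \<open>T\<close>.\<close>

lemma kernel_nn_integral_finite:
  assumes "0 \<le> b" and H: "\<And>r x. norm (H (r, x)) \<le> b * indicat_real {..<T} x" "ps_measurable (lborel \<Otimes>\<^sub>M lborel) H"
  shows "(\<integral>\<^sup>+z. ennreal (p (fst z) (snd z)) * ennreal (norm (H z)) \<partial>(lborel \<Otimes>\<^sub>M lborel)) < \<infinity>"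
proof -
  have "(\<integral>\<^sup>+z. ennreal (p (fst z) (snd z)) * ennreal (norm (H z)) \<partial>(lborel \<Otimes>\<^sub>M lborel)) =
    (\<integral>\<^sup>+x. \<integral>\<^sup>+r. ennreal (p r x) * ennreal (norm (H (r, x))) \<partial>lborel \<partial>lborel)"
    using ps_measurable_norm[OF H(2)] by (subst lborel_pair.nn_integral_snd[symmetric]) (auto simp: case_prod_beta')
  also have "\<dots> \<le> (\<integral>\<^sup>+x. \<integral>\<^sup>+r. ennreal (p r x) * ennreal (b * indicat_real {..<T} x) \<partial>lborel \<partial>lborel)"
    using H(1) by (intro nn_integral_mono mult_left_mono ennreal_leI) auto
  also have "\<dots> = (\<integral>\<^sup>+x. q x * ennreal (b * indicat_real {..<T} x) \<partial>lborel)"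
    unfolding q_def using p_measurable1 by (intro nn_integral_cong nn_integral_multc) simp
  also have "\<dots> \<le> (\<integral>\<^sup>+x. ennreal b * (q x * indicator {..T} x) \<partial>lborel)"
    by (intro nn_integral_mono) (auto simp: indicator_def mult.commute)
  also have "\<dots> = ennreal b * (\<integral>\<^sup>+x. q x * indicator {..T} x \<partial>lborel)"
    by (rule nn_integral_cmult) measurable
  also have "\<dots> < \<infinity>"
    using nn_integral_q_finite[of T] by (simp add: ennreal_mult_less_top)
  finally show ?thesis .
qed

lemma integral_G_generator:
  assumes x: "x \<in> generator_dom P" and T: "0 < T"
  shows "bochner_integral lborel (\<lambda>t. indicat_real {0<..} (T - t) *\<^sub>R G t (generator P x)) = Q T x - x"
proof -
  \<comment> \<open>The interval of times up to \<open>E T\<close> is replaced by the times at which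
    the path lies strictly below \<open>T\<close>. By \<open>AE_path\<close> the path equals
    \<open>T\<close> only on a null set of times, almost surely, so the strict inequality is
    harmless.\<close>
  define H where "H = (\<lambda>(r, s). indicat_real {..<T} s *\<^sub>R P (max 0 r) (generator P x))"
  have Hps: "ps_measurable (lborel \<Otimes>\<^sub>M lborel) H"
    unfolding H_def case_prod_beta'
    by (intro ps_measurable_scaleR ps_measurable_P ps_measurable_const) measurable
  have Hb: "norm (H (r, s)) \<le> (C * norm (generator P x)) * indicat_real {..<T} s" for r s
    using norm_P_max by (auto simp: H_def indicator_def)
  note tr = bochner_integral_along_path[OF Hps kernel_nn_integral_finite[OF _ Hb Hps]]
  have "Q T x - x = bochner_integral M (\<lambda>\<omega>. P (E T \<omega>) x - x)"
    using bochner_integral_diff[OF bochner_integrable_PE, of "\<lambda>_. x" T x]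
      bochner_integral_scaleR_const[of M "\<lambda>_. 1" x] bochner_integrable_scaleR_const[of M "\<lambda>_. 1" x] T
    by (simp add: Q_apply prob_space)
  also have "\<dots> = bochner_integral M (\<lambda>\<omega>. set_bochner_integral lborel {0<..} (\<lambda>r. H (r, S' r \<omega>)))"
  proof (rule bochner_integral_cong_AE)
    have "AE x in lborel. x \<noteq> T" by (rule AE_lborel_singleton)
    from AE_path[OF this] AE_E_path[of T]
    show "AE \<omega> in M. P (E T \<omega>) x - x = set_bochner_integral lborel {0<..} (\<lambda>r. H (r, S' r \<omega>))"
    proof eventually_elim
      case (elim \<omega>)
      then have h: "\<And>r. 0 < r \<Longrightarrow> r < E T \<omega> \<Longrightarrow> S' r \<omega> \<le> T" "\<And>r. E T \<omega> < r \<Longrightarrow> T < S' r \<omega>"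
        by auto
      have "AE r in lborel. indicat_real {0<..E T \<omega>} r *\<^sub>R P r (generator P x) = indicat_real {0<..} r *\<^sub>R H (r, S' r \<omega>)"
        using elim(1) AE_lborel_singleton[of "E T \<omega>"]
      proof eventually_elim
        case (elim r)
        consider "r \<le> 0" | "0 < r" "r < E T \<omega>" | "E T \<omega> < r"
          using elim(2) by linarith
        then show ?case
        proof cases
          case 2
          then have "S' r \<omega> < T" using h(1)[OF 2] elim(1) by simp
          then show ?thesis using 2 by (simp add: H_def)
        next
          case 3
          then show ?thesis using h(2)[OF 3] by (simp add: H_def)
        qed simp
      qed
      then show ?case
        unfolding P_minus_id[OF x E_nonneg] by (rule bochner_integral_cong_AE)
    qed
  qed
  also have "\<dots> = bochner_integral lborel (\<lambda>s. bochner_integral lborel (\<lambda>r. p r s *\<^sub>R H (r, s)))"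
    using tr(4) C_nonneg by simp
  also have "\<dots> = bochner_integral lborel (\<lambda>t. indicat_real {0<..} (T - t) *\<^sub>R G t (generator P x))"
  proof (rule bochner_integral_cong_AE, use AE_q_finite in eventually_elim)
    case (elim s)
    have "bochner_integral lborel (\<lambda>r. p r s *\<^sub>R H (r, s)) = bochner_integral lborel (\<lambda>r. indicat_real {..<T} s *\<^sub>R p r s *\<^sub>R P (max 0 r) (generator P x))"
      by (intro bochner_integral_cong) (simp add: H_def)
    also have "\<dots> = indicat_real {..<T} s *\<^sub>R G s (generator P x)"
      unfolding G_apply[OF elim] by (rule bochner_integral_scaleR[OF bochner_integrable_pP[OF elim]])
    finally show ?case by (simp add: indicator_def)
  qed
  finally show ?thesis by simp
qed

end

section \<open>Continuity of translation in \<open>L\<^sup>1\<close>\<close>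

lemma AE_lborel_reflect:
  assumes "AE x in lborel. R (x::real)"
  shows "AE s in lborel. R (t - s)"
proof -
  have "AE x in distr lborel lborel (\<lambda>x. t + (- 1) * x). R x"
    using assms by (subst distr_lborel_affine) simp_all
  from AE_distrD[OF _ this] show ?thesis by simp
qed

text \<open>Holds for arbitrary \<open>f\<close>: for \<open>c \<noteq> 0\<close> both functions are
  integrable or neither is, and then the default 0 matches.\<close>

lemma bochner_integral_scaleR_right:
  fixes f :: "'a \<Rightarrow> 'b::banach"
  shows "bochner_integral M (\<lambda>x. c *\<^sub>R f x) = c *\<^sub>R bochner_integral M f"
proof (cases "c = 0")
  case True
  then show ?thesis by (simp add: bochner_integral_zero)
next
  case False
  show ?thesis
  proof (cases "bochner_integrable M f")
    case True
    then show ?thesis by (rule bochner_integral_scaleR)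
  next
    case no: False
    have "\<not> bochner_integrable M (\<lambda>x. c *\<^sub>R f x)"
    proof
      assume "bochner_integrable M (\<lambda>x. c *\<^sub>R f x)"
      from bochner_integrable_scaleR[OF this, of "1 / c"] no False show False by simp
    qed
    then show ?thesis using no by (simp add: bochner_integral_def)
  qed
qed

text \<open>Sequential form, because dominated convergence is sequential.\<close>

definition L1_translation_continuous :: "(real \<Rightarrow> 'b::real_normed_vector) \<Rightarrow> bool" where
  "L1_translation_continuous h \<longleftrightarrow>
     (\<forall>\<tau>. \<tau> \<longlonglongrightarrow> (0::real) \<longrightarrow> (\<lambda>j::nat. \<integral>\<^sup>+s. ennreal (norm (h (\<tau> j + s) - h s)) \<partial>lborel) \<longlonglongrightarrow> 0)"

lemma nn_integral_lborel_translate: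
  assumes "f \<in> borel_measurable borel"
  shows "(\<integral>\<^sup>+x. f (s + x) \<partial>lborel) = (\<integral>\<^sup>+x. f x \<partial>(lborel :: real measure))"
  using nn_integral_lborel_shift[OF assms, of "- s"] by (simp add: add.commute)

lemma ps_measurable_lborel_compose:
  assumes "ps_measurable lborel h" "\<sigma> \<in> borel_measurable N"
  shows "ps_measurable N (\<lambda>z. h (\<sigma> z))"
  by (rule ps_measurable_compose[OF assms(1)]) (use assms(2) in simp)

text \<open>Three-epsilon argument, in which translation invariance makes the two approximation
  errors equal.\<close>

lemma L1_translation_continuous_approx:
  assumes h: "ps_measurable lborel h"
    and approx: "\<And>e::real. 0 < e \<Longrightarrow> \<exists>h'. ps_measurable lborel h' \<and> L1_translation_continuous h' \<and>
      (\<integral>\<^sup>+s. ennreal (norm (h s - h' s)) \<partial>lborel) \<le> ennreal e"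
  shows "L1_translation_continuous h"
  unfolding L1_translation_continuous_def
proof (intro allI impI)
  fix \<tau> :: "nat \<Rightarrow> real" assume \<tau>: "\<tau> \<longlonglongrightarrow> 0"
  show "(\<lambda>j. \<integral>\<^sup>+s. ennreal (norm (h (\<tau> j + s) - h s)) \<partial>lborel) \<longlonglongrightarrow> 0"
  proof (rule order_tendstoI)
    fix a :: ennreal assume "0 < a"
    obtain e where e: "0 < e" "ennreal e < a"
    proof (cases a)
      case (real r)
      then have "0 < r / 2" "ennreal (r / 2) < a"
        using \<open>0 < a\<close> by (auto simp: ennreal_less_iff)
      then show ?thesis by (rule that)
    next
      case top
      then show ?thesis by (intro that[of 1]) simp_all
    qed
    then have "0 < e / 3" by simp
    from approx[OF this] obtain h' where h': "ps_measurable lborel h'" "L1_translation_continuous h'"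
      "(\<integral>\<^sup>+s. ennreal (norm (h s - h' s)) \<partial>lborel) \<le> ennreal (e / 3)" by blast
    have dm: "(\<lambda>s. ennreal (norm (h s - h' s))) \<in> borel_measurable borel"
      using ps_measurable_ennreal_norm[OF ps_measurable_diff[OF h h'(1)]] by simp
    have "(\<lambda>j. \<integral>\<^sup>+s. ennreal (norm (h' (\<tau> j + s) - h' s)) \<partial>lborel) \<longlonglongrightarrow> 0"
      using h'(2) \<tau> unfolding L1_translation_continuous_def by blast
    moreover have "0 < ennreal (e / 3)" using e by simp
    ultimately have "\<forall>\<^sub>F j in sequentially. (\<integral>\<^sup>+s. ennreal (norm (h' (\<tau> j + s) - h' s)) \<partial>lborel) < ennreal (e / 3)"
      by (rule order_tendstoD(2))
    then show "\<forall>\<^sub>F j in sequentially. (\<integral>\<^sup>+s. ennreal (norm (h (\<tau> j + s) - h s)) \<partial>lborel) < a"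
    proof eventually_elim
      case (elim j)
      have h'm: "(\<lambda>s. ennreal (norm (h' (\<tau> j + s) - h' s))) \<in> borel_measurable lborel"
        by (intro ps_measurable_ennreal_norm ps_measurable_diff ps_measurable_lborel_compose[OF h'(1)]) auto
      have "(\<integral>\<^sup>+s. ennreal (norm (h (\<tau> j + s) - h s)) \<partial>lborel) \<le>
        (\<integral>\<^sup>+s. (ennreal (norm (h (\<tau> j + s) - h' (\<tau> j + s))) + ennreal (norm (h s - h' s))) + ennreal (norm (h' (\<tau> j + s) - h' s)) \<partial>lborel)"
      proof (rule nn_integral_mono)
        fix s
        have "norm (h (\<tau> j + s) - h s) \<le> (norm (h (\<tau> j + s) - h' (\<tau> j + s)) + norm (h s - h' s)) + norm (h' (\<tau> j + s) - h' s)"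
          using norm_triangle_ineq[of "(h (\<tau> j + s) - h' (\<tau> j + s)) - (h s - h' s)" "h' (\<tau> j + s) - h' s"]
            norm_triangle_ineq4[of "h (\<tau> j + s) - h' (\<tau> j + s)" "h s - h' s"] by simp
        then show "ennreal (norm (h (\<tau> j + s) - h s)) \<le>
          (ennreal (norm (h (\<tau> j + s) - h' (\<tau> j + s))) + ennreal (norm (h s - h' s))) + ennreal (norm (h' (\<tau> j + s) - h' s))"
          by (simp add: ennreal_leI flip: ennreal_plus)
      qed
      also have "\<dots> = ((\<integral>\<^sup>+s. ennreal (norm (h (\<tau> j + s) - h' (\<tau> j + s))) \<partial>lborel) + (\<integral>\<^sup>+s. ennreal (norm (h s - h' s)) \<partial>lborel)) +
        (\<integral>\<^sup>+s. ennreal (norm (h' (\<tau> j + s) - h' s)) \<partial>lborel)"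
      proof -
        have m1: "(\<lambda>s. ennreal (norm (h (\<tau> j + s) - h' (\<tau> j + s)))) \<in> borel_measurable lborel"
          by (intro ps_measurable_ennreal_norm ps_measurable_diff ps_measurable_lborel_compose[OF h'(1)] ps_measurable_lborel_compose[OF h]) auto
        have m2: "(\<lambda>s. ennreal (norm (h s - h' s))) \<in> borel_measurable lborel" using dm by simp
        show ?thesis
          by (subst nn_integral_add[OF borel_measurable_add[OF m1 m2] h'm], subst nn_integral_add[OF m1 m2]) simp
      qed
      also have "(\<integral>\<^sup>+s. ennreal (norm (h (\<tau> j + s) - h' (\<tau> j + s))) \<partial>lborel) = (\<integral>\<^sup>+s. ennreal (norm (h s - h' s)) \<partial>lborel)"
        by (rule nn_integral_lborel_translate[OF dm])
      also have "(\<integral>\<^sup>+s. ennreal (norm (h s - h' s)) \<partial>lborel) + (\<integral>\<^sup>+s. ennreal (norm (h s - h' s)) \<partial>lborel) +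
          (\<integral>\<^sup>+s. ennreal (norm (h' (\<tau> j + s) - h' s)) \<partial>lborel) \<le> ennreal (e / 3) + ennreal (e / 3) + ennreal (e / 3)"
        using h'(3) elim by (intro add_mono) auto
      also have "\<dots> = ennreal e"
        using e by (simp flip: ennreal_plus)
      also have "\<dots> < a" by (rule e)
      finally show ?case .
    qed
  qed simp
qed

lemma L1_translation_continuous_limit:
  assumes h: "ps_measurable lborel h" and s: "\<And>i::nat. ps_measurable lborel (s i)" "\<And>i. L1_translation_continuous (s i)"
    and conv: "(\<lambda>i. \<integral>\<^sup>+x. ennreal (norm (h x - s i x)) \<partial>lborel) \<longlonglongrightarrow> 0"
  shows "L1_translation_continuous h"
proof (rule L1_translation_continuous_approx[OF h])
  fix e :: real assume "0 < e"
  then have "0 < ennreal e" by simp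
  from order_tendstoD(2)[OF conv this] obtain i where "(\<integral>\<^sup>+x. ennreal (norm (h x - s i x)) \<partial>lborel) < ennreal e"
    unfolding eventually_sequentially by blast
  then show "\<exists>h'. ps_measurable lborel h' \<and> L1_translation_continuous h' \<and> (\<integral>\<^sup>+x. ennreal (norm (h x - h' x)) \<partial>lborel) \<le> ennreal e"
    using s by (intro exI[of _ "s i"]) auto
qed

text \<open>Dominated convergence: the shifts are bounded by some \<open>B\<close>, so all
  translates vanish outside \<open>{- (B + R)..B + R}\<close>.\<close>

lemma L1_translation_continuous_cont:
  fixes h :: "real \<Rightarrow> 'b::real_normed_vector"
  assumes h: "continuous_on UNIV h" and supp: "\<And>s. R < \<bar>s\<bar> \<Longrightarrow> h s = 0" and b: "\<And>s. norm (h s) \<le> b"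
  shows "L1_translation_continuous h"
  unfolding L1_translation_continuous_def
proof (intro allI impI)
  fix \<tau> :: "nat \<Rightarrow> real" assume \<tau>: "\<tau> \<longlonglongrightarrow> 0"
  have hp: "ps_measurable lborel h"
    using ps_measurable_continuous[OF ps_measurable_second_countable[of "\<lambda>x. x" lborel] h] by simp
  have b0: "0 \<le> b" using b[of 0] norm_ge_zero order.trans by blast
  obtain B where B: "\<And>j. \<bar>\<tau> j\<bar> \<le> B"
    using convergent_imp_Bseq[OF convergentI[OF \<tau>]] unfolding Bseq_def by auto
  have lim: "(\<lambda>j. h (\<tau> j + s)) \<longlonglongrightarrow> h s" for s
  proof -
    have "(\<lambda>j. \<tau> j + s) \<longlonglongrightarrow> 0 + s" by (intro tendsto_add \<tau> tendsto_const)
    from continuous_on_tendsto_compose[OF h this] show ?thesis by simp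
  qed
  have "(\<lambda>j. \<integral>\<^sup>+s. ennreal (norm (h (\<tau> j + s) - h s)) \<partial>lborel) \<longlonglongrightarrow> (\<integral>\<^sup>+(s::real). 0 \<partial>lborel)"
  proof (rule nn_integral_dominated_convergence[where w = "\<lambda>s. ennreal (2 * b) * indicator {- (B + R)..B + R} s"])
    show "(\<lambda>s. ennreal (norm (h (\<tau> j + s) - h s))) \<in> borel_measurable lborel" for j
      by (intro ps_measurable_ennreal_norm ps_measurable_diff ps_measurable_lborel_compose[OF hp]) auto
    show "AE s in lborel. ennreal (norm (h (\<tau> j + s) - h s)) \<le> ennreal (2 * b) * indicator {- (B + R)..B + R} s" for j
    proof (rule AE_I2)
      fix s
      show "ennreal (norm (h (\<tau> j + s) - h s)) \<le> ennreal (2 * b) * indicator {- (B + R)..B + R} s"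
      proof (cases "s \<in> {- (B + R)..B + R}")
        case True
        have "norm (h (\<tau> j + s) - h s) \<le> 2 * b"
          using norm_triangle_ineq4[of "h (\<tau> j + s)" "h s"] b[of "\<tau> j + s"] b[of s] by simp
        then show ?thesis using True by (simp add: ennreal_leI)
      next
        case False
        then have "R < \<bar>s\<bar>" "R < \<bar>\<tau> j + s\<bar>"
          using B[of j] by auto
        then show ?thesis using supp by simp
      qed
    qed
    show "(\<integral>\<^sup>+s. ennreal (2 * b) * indicator {- (B + R)..B + R} s \<partial>lborel) < \<infinity>"
      by (cases "- (B + R) \<le> B + R") (simp_all add: nn_integral_cmult_indicator ennreal_mult_less_top)
    show "AE s in lborel. (\<lambda>j. ennreal (norm (h (\<tau> j + s) - h s))) \<longlonglongrightarrow> 0"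
    proof (rule AE_I2)
      fix s
      have "(\<lambda>j. ennreal (norm (h (\<tau> j + s) - h s))) \<longlonglongrightarrow> ennreal (norm (h s - h s))"
        by (intro tendsto_ennrealI tendsto_norm tendsto_diff lim tendsto_const)
      then show "(\<lambda>j. ennreal (norm (h (\<tau> j + s) - h s))) \<longlonglongrightarrow> 0" by simp
    qed
  qed simp_all
  then show "(\<lambda>j. \<integral>\<^sup>+s. ennreal (norm (h (\<tau> j + s) - h s)) \<partial>lborel) \<longlonglongrightarrow> 0" by simp
qed

text \<open>The predicate \<open>measurable_on\<close> supplies continuous functions that converge
  off a negligible set. They are clamped to \<open>[0, 1]\<close> and multiplied by a hat function
  that is 1 on \<open>{- R..R}\<close> and 0 beyond radius \<open>R + 1\<close>.\<close>

lemma indicator_limit_of_continuous: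
  assumes A: "A \<in> sets borel" "A \<subseteq> {- R..R :: real}" and R: "0 \<le> R"
  obtains g where "\<And>n::nat. continuous_on UNIV (g n)" "\<And>n s. R + 1 < \<bar>s\<bar> \<Longrightarrow> g n s = (0::real)" "\<And>n s. \<bar>g n s\<bar> \<le> 1"
    "AE s in lborel. (\<lambda>n. g n s) \<longlonglongrightarrow> indicat_real A s"
proof -
  have "indicat_real A \<in> borel_measurable lebesgue"
    using A(1) by (intro borel_measurable_indicator) auto
  then have "(indicat_real A) measurable_on UNIV"
    using measurable_on_iff_borel_measurable[of UNIV "indicat_real A"] by (simp add: lebesgue_on_UNIV_eq)
  then obtain N g where N: "negligible N" and g: "\<And>n::nat. continuous_on UNIV (g n)" "\<And>s. s \<notin> N \<Longrightarrow> (\<lambda>n. g n s) \<longlonglongrightarrow> indicat_real A s"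
    unfolding measurable_on_def by auto
  have "AE s in lebesgue. s \<notin> N"
    using N by (intro AE_not_in) (simp add: negligible_iff_null_sets)
  then have N': "AE s in lborel. s \<notin> N"
    by (simp add: AE_completion_iff)
  define cut where "cut s = max 0 (min 1 (R + 1 - \<bar>s\<bar>))" for s :: real
  define \<gamma> where "\<gamma> n s = max 0 (min 1 (g n s)) * cut s" for n s
  show ?thesis
  proof
    show "continuous_on UNIV (\<gamma> n)" for n
      unfolding \<gamma>_def[abs_def] cut_def by (intro continuous_intros g)
    show "\<gamma> n s = 0" if "R + 1 < \<bar>s\<bar>" for n s
      using that by (simp add: \<gamma>_def cut_def)
    show "\<bar>\<gamma> n s\<bar> \<le> 1" for n s
    proof -
      have "max 0 (min 1 (g n s)) * cut s \<le> 1 * 1" "0 \<le> max 0 (min 1 (g n s)) * cut s"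
        by (intro mult_mono mult_nonneg_nonneg; simp add: cut_def)+
      then show ?thesis by (simp add: \<gamma>_def)
    qed
    show "AE s in lborel. (\<lambda>n. \<gamma> n s) \<longlonglongrightarrow> indicat_real A s"
      using N'
    proof eventually_elim
      case (elim s)
      have "(\<lambda>n. \<gamma> n s) \<longlonglongrightarrow> max 0 (min 1 (indicat_real A s)) * cut s"
        unfolding \<gamma>_def by (intro tendsto_intros g(2) elim)
      moreover have "max 0 (min 1 (indicat_real A s)) * cut s = indicat_real A s"
      proof (cases "s \<in> A")
        case True
        then have "s \<in> {- R..R}" by (rule subsetD[OF A(2)])
        then have "\<bar>s\<bar> \<le> R" by auto
        then show ?thesis by (simp add: cut_def True)
      qed simp
      ultimately show ?case by (simp only:)
    qed
  qed
qed

lemma L1_translation_continuous_indicator: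
  fixes c :: "'b::real_normed_vector"
  assumes A: "A \<in> sets borel" "A \<subseteq> {- R..R :: real}" and R: "0 \<le> R"
  shows "L1_translation_continuous (\<lambda>s. indicat_real A s *\<^sub>R c)"
proof -
  obtain g where g: "\<And>n::nat. continuous_on UNIV (g n)" "\<And>n s. R + 1 < \<bar>s\<bar> \<Longrightarrow> g n s = (0::real)" "\<And>n s. \<bar>g n s\<bar> \<le> 1"
    "AE s in lborel. (\<lambda>n. g n s) \<longlonglongrightarrow> indicat_real A s"
    using indicator_limit_of_continuous[OF assms] by blast
  have gm: "g n \<in> borel_measurable lborel" for n
    using borel_measurable_continuous_onI[OF g(1)] by simp
  have ps: "ps_measurable lborel (\<lambda>s. indicat_real A s *\<^sub>R c)" "\<And>n. ps_measurable lborel (\<lambda>s. g n s *\<^sub>R c)"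
    using A(1) gm by (auto intro!: ps_measurable_scaleR ps_measurable_const)
  show ?thesis
  proof (rule L1_translation_continuous_limit[OF ps])
    show "L1_translation_continuous (\<lambda>s. g n s *\<^sub>R c)" for n
    proof (rule L1_translation_continuous_cont[where R = "R + 1" and b = "norm c"])
      show "continuous_on UNIV (\<lambda>s. g n s *\<^sub>R c)" by (intro continuous_intros g)
      show "norm (g n s *\<^sub>R c) \<le> norm c" for s
        using mult_right_mono[OF g(3), of "norm c"] by simp
    qed (simp add: g(2))
    show "(\<lambda>n. \<integral>\<^sup>+s. ennreal (norm (indicat_real A s *\<^sub>R c - g n s *\<^sub>R c)) \<partial>lborel) \<longlonglongrightarrow> 0"
    proof (rule nn_integral_dominated_diff[OF ps, where w = "\<lambda>s. ennreal (norm c) * indicator {- (R + 1)..R + 1} s"])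
      show "AE s in lborel. ennreal (norm (g n s *\<^sub>R c)) \<le> ennreal (norm c) * indicator {- (R + 1)..R + 1} s" for n
      proof (rule AE_I2)
        fix s
        show "ennreal (norm (g n s *\<^sub>R c)) \<le> ennreal (norm c) * indicator {- (R + 1)..R + 1} s"
        proof (cases "s \<in> {- (R + 1)..R + 1}")
          case True
          then show ?thesis
            using mult_right_mono[OF g(3), of "norm c" n s] by (simp add: ennreal_leI)
        next
          case False
          then have "R + 1 < \<bar>s\<bar>" by auto
          then show ?thesis by (simp add: g(2))
        qed
      qed
      show "AE s in lborel. (\<lambda>n. g n s *\<^sub>R c) \<longlonglongrightarrow> indicat_real A s *\<^sub>R c"
        using g(4) by eventually_elim (intro tendsto_intros)
      show "(\<integral>\<^sup>+s. ennreal (norm c) * indicator {- (R + 1)..R + 1} s \<partial>lborel) < \<infinity>"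
        using R by (simp add: nn_integral_cmult_indicator ennreal_mult_less_top)
    qed simp
  qed
qed

theorem L1_translation_continuous_bounded_support:
  fixes h :: "real \<Rightarrow> 'b::banach"
  assumes h: "ps_measurable lborel h" "(\<integral>\<^sup>+s. ennreal (norm (h s)) \<partial>lborel) < \<infinity>"
    and supp: "\<And>s. R < \<bar>s\<bar> \<Longrightarrow> h s = 0" and R: "0 \<le> R"
  shows "L1_translation_continuous h"
proof -
  have I: "{- R..R} \<in> sets lborel" by simp
  \<comment> \<open>The indicator is built into the induction claim because the sets in the base
    case need not be bounded; on \<open>h\<close> itself it has no effect.\<close>
  have "L1_translation_continuous (\<lambda>s. indicat_real {- R..R} s *\<^sub>R h s)"
    using h
  proof (induct rule: bochner_induct)
    case (base A c)
    have eq: "(\<lambda>s. indicat_real {- R..R} s *\<^sub>R indicat_real A s *\<^sub>R c) = (\<lambda>s. indicat_real (A \<inter> {- R..R}) s *\<^sub>R c)"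
      by (auto simp: indicator_def fun_eq_iff)
    show ?case
      unfolding eq using base R by (intro L1_translation_continuous_indicator) auto
  next
    case (add f g)
    show ?case
      unfolding L1_translation_continuous_def
    proof (intro allI impI)
      fix \<tau> :: "nat \<Rightarrow> real" assume \<tau>: "\<tau> \<longlonglongrightarrow> 0"
      let ?f = "\<lambda>s. indicat_real {- R..R} s *\<^sub>R f s" and ?g = "\<lambda>s. indicat_real {- R..R} s *\<^sub>R g s"
      have ps: "ps_measurable lborel ?f" "ps_measurable lborel ?g"
        using add by (auto intro!: ps_measurable_indicator_scaleR)
      have m: "(\<lambda>s. ennreal (norm (?f (\<tau> j + s) - ?f s))) \<in> borel_measurable lborel"
        "(\<lambda>s. ennreal (norm (?g (\<tau> j + s) - ?g s))) \<in> borel_measurable lborel" for j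
        by (intro ps_measurable_ennreal_norm ps_measurable_diff ps_measurable_lborel_compose[OF ps(1)] ps_measurable_lborel_compose[OF ps(2)]; simp)+
      have "(\<lambda>j. \<integral>\<^sup>+s. ennreal (norm (?f (\<tau> j + s) - ?f s)) \<partial>lborel) \<longlonglongrightarrow> 0" "(\<lambda>j. \<integral>\<^sup>+s. ennreal (norm (?g (\<tau> j + s) - ?g s)) \<partial>lborel) \<longlonglongrightarrow> 0"
        using add(3,6) \<tau> unfolding L1_translation_continuous_def by blast+
      from tendsto_add[OF this]
      have sum0: "(\<lambda>j. (\<integral>\<^sup>+s. ennreal (norm (?f (\<tau> j + s) - ?f s)) \<partial>lborel) + (\<integral>\<^sup>+s. ennreal (norm (?g (\<tau> j + s) - ?g s)) \<partial>lborel)) \<longlonglongrightarrow> 0"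
        by simp
      show "(\<lambda>j. \<integral>\<^sup>+s. ennreal (norm (indicat_real {- R..R} (\<tau> j + s) *\<^sub>R (f (\<tau> j + s) + g (\<tau> j + s)) - indicat_real {- R..R} s *\<^sub>R (f s + g s))) \<partial>lborel) \<longlonglongrightarrow> 0"
      proof (rule tendsto_sandwich[OF _ _ tendsto_const sum0])
        have "(\<integral>\<^sup>+s. ennreal (norm (indicat_real {- R..R} (\<tau> j + s) *\<^sub>R (f (\<tau> j + s) + g (\<tau> j + s)) - indicat_real {- R..R} s *\<^sub>R (f s + g s))) \<partial>lborel) \<le>
          (\<integral>\<^sup>+s. ennreal (norm (?f (\<tau> j + s) - ?f s)) + ennreal (norm (?g (\<tau> j + s) - ?g s)) \<partial>lborel)" for j
        proof (rule nn_integral_mono)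
          fix s
          have "norm (indicat_real {- R..R} (\<tau> j + s) *\<^sub>R (f (\<tau> j + s) + g (\<tau> j + s)) - indicat_real {- R..R} s *\<^sub>R (f s + g s)) \<le>
            norm (?f (\<tau> j + s) - ?f s) + norm (?g (\<tau> j + s) - ?g s)"
            unfolding scaleR_add_right by (rule norm_diff_triangle_ineq)
          then show "ennreal (norm (indicat_real {- R..R} (\<tau> j + s) *\<^sub>R (f (\<tau> j + s) + g (\<tau> j + s)) - indicat_real {- R..R} s *\<^sub>R (f s + g s))) \<le>
            ennreal (norm (?f (\<tau> j + s) - ?f s)) + ennreal (norm (?g (\<tau> j + s) - ?g s))"
            by (intro ennreal_le_add norm_ge_zero)
        qed
        then show "\<forall>\<^sub>F j in sequentially. (\<integral>\<^sup>+s. ennreal (norm (indicat_real {- R..R} (\<tau> j + s) *\<^sub>R (f (\<tau> j + s) + g (\<tau> j + s)) - indicat_real {- R..R} s *\<^sub>R (f s + g s))) \<partial>lborel) \<le>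
          (\<integral>\<^sup>+s. ennreal (norm (?f (\<tau> j + s) - ?f s)) \<partial>lborel) + (\<integral>\<^sup>+s. ennreal (norm (?g (\<tau> j + s) - ?g s)) \<partial>lborel)"
          unfolding nn_integral_add[OF m] by (intro always_eventually allI)
      qed simp
    qed
  next
    case (lim f s)
    have fm: "(\<lambda>x. ennreal (norm (f x))) \<in> borel_measurable lborel"
      by (rule ps_measurable_ennreal_norm[OF lim(2)])
    show ?case
    proof (rule L1_translation_continuous_limit[OF ps_measurable_indicator_scaleR[OF I lim(2)] ps_measurable_indicator_scaleR[OF I lim(4)] lim(5)])
      show "(\<lambda>i. \<integral>\<^sup>+x. ennreal (norm (indicat_real {- R..R} x *\<^sub>R f x - indicat_real {- R..R} x *\<^sub>R s i x)) \<partial>lborel) \<longlonglongrightarrow> 0"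
      proof (rule nn_integral_dominated_diff[OF ps_measurable_indicator_scaleR[OF I lim(2)] ps_measurable_indicator_scaleR[OF I lim(4)], where w = "\<lambda>x. 2 * ennreal (norm (f x))"])
        show "(\<lambda>x. 2 * ennreal (norm (f x))) \<in> borel_measurable lborel" using fm by measurable
        show "(\<integral>\<^sup>+x. 2 * ennreal (norm (f x)) \<partial>lborel) < \<infinity>"
          using lim(1) fm by (subst nn_integral_cmult) (auto simp: bochner_integrable_def ennreal_mult_less_top)
        show "AE x in lborel. ennreal (norm (indicat_real {- R..R} x *\<^sub>R s i x)) \<le> 2 * ennreal (norm (f x))" for i
        proof (rule AE_I2)
          fix x :: real
          have "ennreal (norm (s i x)) \<le> 2 * ennreal (norm (f x))"
            using ennreal_leI[OF lim(7)[of x i]] by (simp add: ennreal_mult)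
          then show "ennreal (norm (indicat_real {- R..R} x *\<^sub>R s i x)) \<le> 2 * ennreal (norm (f x))"
            by (cases "x \<in> {- R..R}") auto
        qed
        show "AE x in lborel. (\<lambda>i. indicat_real {- R..R} x *\<^sub>R s i x) \<longlonglongrightarrow> indicat_real {- R..R} x *\<^sub>R f x"
          by (intro AE_I2 tendsto_scaleR tendsto_const lim(6)) simp
      qed
    qed
  qed
  moreover have "(\<lambda>s. indicat_real {- R..R} s *\<^sub>R h s) = h"
    using supp by (auto simp: fun_eq_iff indicator_def abs_le_iff not_le)
  ultimately show ?thesis by simp
qed

text \<open>The weight is integrable but may be unbounded. Where it is at most \<open>N\<close> the
  convergence of \<open>e\<close> is used, elsewhere the bound \<open>b\<close> against a small tail
  of the weight. With a weight built from \<open>q\<close> this yields continuity of convolutions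
  with \<open>G\<close>.\<close>

lemma weighted_L1_convergence:
  fixes e :: "nat \<Rightarrow> real \<Rightarrow> ennreal"
  assumes \<kappa>[measurable]: "\<kappa> \<in> borel_measurable lborel" and \<kappa>_fin: "(\<integral>\<^sup>+s. \<kappa> s \<partial>lborel) < \<infinity>"
    and e[measurable]: "\<And>j. e j \<in> borel_measurable lborel" and b: "\<And>j s. e j s \<le> ennreal b"
    and lim: "(\<lambda>j. \<integral>\<^sup>+s. e j s \<partial>lborel) \<longlonglongrightarrow> 0"
  shows "(\<lambda>j. \<integral>\<^sup>+s. \<kappa> s * e j s \<partial>lborel) \<longlonglongrightarrow> 0"
proof -
  have AEk: "AE s in lborel. \<kappa> s \<noteq> \<infinity>"
    using \<kappa>_fin by (intro nn_integral_PInf_AE) auto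
  have tail: "(\<lambda>N::nat. \<integral>\<^sup>+s. \<kappa> s * indicator {s. of_nat N < \<kappa> s} s \<partial>lborel) \<longlonglongrightarrow> (\<integral>\<^sup>+(s::real). 0 \<partial>lborel)"
  proof (rule nn_integral_dominated_convergence[where w = \<kappa>])
    show "AE s in lborel. (\<lambda>N. \<kappa> s * indicator {s. of_nat N < \<kappa> s} s) \<longlonglongrightarrow> 0"
      using AEk
    proof eventually_elim
      case (elim s)
      then obtain n :: nat where n: "\<kappa> s \<le> of_nat n"
        using ennreal_Ex_less_of_nat[of "\<kappa> s"] by (auto simp: less_top intro: less_imp_le)
      have "\<kappa> s * indicator {s. of_nat N < \<kappa> s} s = 0" if "n \<le> N" for N
        using order.trans[OF n, of "of_nat N"] that by (simp add: not_less)
      then show ?case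
        by (intro tendsto_eventually) (auto simp: eventually_sequentially)
    qed
    show "AE s in lborel. \<kappa> s * indicator {s. of_nat N < \<kappa> s} s \<le> \<kappa> s" for N :: nat
      by (auto simp: indicator_def)
  qed (use \<kappa>_fin in auto)
  have le: "(\<integral>\<^sup>+s. \<kappa> s * e j s \<partial>lborel) \<le> of_nat N * (\<integral>\<^sup>+s. e j s \<partial>lborel) + ennreal b * (\<integral>\<^sup>+s. \<kappa> s * indicator {s. of_nat N < \<kappa> s} s \<partial>lborel)" for j and N :: nat
  proof -
    have "(\<integral>\<^sup>+s. \<kappa> s * e j s \<partial>lborel) \<le> (\<integral>\<^sup>+s. of_nat N * e j s + ennreal b * (\<kappa> s * indicator {s. of_nat N < \<kappa> s} s) \<partial>lborel)"
    proof (rule nn_integral_mono)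
      fix s
      show "\<kappa> s * e j s \<le> of_nat N * e j s + ennreal b * (\<kappa> s * indicator {s. of_nat N < \<kappa> s} s)"
      proof (cases "of_nat N < \<kappa> s")
        case True
        have "\<kappa> s * e j s \<le> \<kappa> s * ennreal b" by (intro mult_left_mono b) simp
        then show ?thesis using True by (simp add: mult.commute add_increasing)
      next
        case False
        then have "\<kappa> s * e j s \<le> of_nat N * e j s" by (intro mult_right_mono) auto
        then show ?thesis by (simp add: add_increasing2)
      qed
    qed
    also have "\<dots> = of_nat N * (\<integral>\<^sup>+s. e j s \<partial>lborel) + ennreal b * (\<integral>\<^sup>+s. \<kappa> s * indicator {s. of_nat N < \<kappa> s} s \<partial>lborel)"
      by (subst nn_integral_add) (auto simp: nn_integral_cmult)
    finally show ?thesis .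
  qed
  show ?thesis
  proof (rule order_tendstoI)
    fix a :: ennreal assume a: "0 < a"
    have "(\<lambda>N::nat. ennreal b * (\<integral>\<^sup>+s. \<kappa> s * indicator {s. of_nat N < \<kappa> s} s \<partial>lborel)) \<longlonglongrightarrow> 0"
      using ennreal_tendsto_cmult[OF _ tail, of "ennreal b"] by simp
    from order_tendstoD(2)[OF this a] obtain N :: nat where
      N: "ennreal b * (\<integral>\<^sup>+s. \<kappa> s * indicator {s. of_nat N < \<kappa> s} s \<partial>lborel) < a"
      unfolding eventually_sequentially by blast
    have "(\<lambda>j. of_nat N * (\<integral>\<^sup>+s. e j s \<partial>lborel) + ennreal b * (\<integral>\<^sup>+s. \<kappa> s * indicator {s. of_nat N < \<kappa> s} s \<partial>lborel)) \<longlonglongrightarrow>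
      of_nat N * 0 + ennreal b * (\<integral>\<^sup>+s. \<kappa> s * indicator {s. of_nat N < \<kappa> s} s \<partial>lborel)"
      by (intro tendsto_add ennreal_tendsto_cmult lim tendsto_const) (simp add: ennreal_of_nat_eq_real_of_nat)
    then have "(\<lambda>j. of_nat N * (\<integral>\<^sup>+s. e j s \<partial>lborel) + ennreal b * (\<integral>\<^sup>+s. \<kappa> s * indicator {s. of_nat N < \<kappa> s} s \<partial>lborel)) \<longlonglongrightarrow>
      ennreal b * (\<integral>\<^sup>+s. \<kappa> s * indicator {s. of_nat N < \<kappa> s} s \<partial>lborel)" by simp
    from order_tendstoD(2)[OF this N]
    show "\<forall>\<^sub>F j in sequentially. (\<integral>\<^sup>+s. \<kappa> s * e j s \<partial>lborel) < a"
      by eventually_elim (rule order.strict_trans1[OF le])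
  qed simp
qed

section \<open>Convolution with \<open>G\<close>\<close>

context fractional_cauchy
begin

definition conv :: "(real \<Rightarrow> 'b) \<Rightarrow> real \<Rightarrow> 'b" where
  "conv h t = bochner_integral lborel (\<lambda>s. G (t - s) (h s))"

text \<open>The scalar convolution of \<open>a\<close> with \<open>G\<close>, applied to a fixed
  vector: \<open>a = w\<close> leads to \<open>Q\<close>, and \<open>a = one\<close> to the time
  integral of \<open>G\<close>.\<close>

definition kconv :: "(real \<Rightarrow> real) \<Rightarrow> real \<Rightarrow> 'b \<Rightarrow> 'b" where
  "kconv a \<tau> y = bochner_integral lborel (\<lambda>t. a (\<tau> - t) *\<^sub>R G t y)"

lemma ps_measurable_G_apply:
  assumes "ps_measurable lborel h" "\<tau> \<in> borel_measurable N" "\<sigma> \<in> borel_measurable N"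
  shows "ps_measurable N (\<lambda>z. G (\<tau> z) (h (\<sigma> z)))"
  by (rule ps_measurable_blinfun_apply[OF ps_measurable_lborel_compose[OF ps_measurable_G assms(2)] ps_measurable_lborel_compose[OF assms(1,3)]])

lemma conv_zero:
  assumes "\<And>s. s \<le> 0 \<Longrightarrow> h s = 0" "t \<le> 0"
  shows "conv h t = 0"
proof -
  have "G (t - s) (h s) = 0" for s
    using assms by (cases "s \<le> 0") (simp_all add: G_zero blinfun.zero_right)
  then show ?thesis
    by (simp add: conv_def bochner_integral_zero)
qed

lemma conv_reflect:
  assumes "ps_measurable lborel h"
  shows "conv h t = bochner_integral lborel (\<lambda>s. G s (h (t - s)))"
    and "bochner_integrable lborel (\<lambda>s. G (t - s) (h s)) \<longleftrightarrow> bochner_integrable lborel (\<lambda>s. G s (h (t - s)))"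
proof -
  have ps: "ps_measurable lborel (\<lambda>s. G s (h (t - s)))"
    by (intro ps_measurable_G_apply assms) measurable
  note r = bochner_integral_lborel_affine[OF ps_imp_strongly_measurable[OF ps], of "- 1" t]
  show "conv h t = bochner_integral lborel (\<lambda>s. G s (h (t - s)))"
    "bochner_integrable lborel (\<lambda>s. G (t - s) (h s)) \<longleftrightarrow> bochner_integrable lborel (\<lambda>s. G s (h (t - s)))"
    using r by (simp_all add: conv_def)
qed

lemma nn_integral_G_bounded:
  assumes h: "ps_measurable lborel h" "\<And>s. norm (h s) \<le> b" "\<And>s. s \<le> 0 \<Longrightarrow> h s = 0"
  shows "(\<integral>\<^sup>+s. ennreal (norm (G s (h (t - s)))) \<partial>lborel) \<le> ennreal (C * b) * (\<integral>\<^sup>+s. q s * indicator {..t} s \<partial>lborel)"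
proof -
  have b: "0 \<le> b" using h(2)[of 0] norm_ge_zero order.trans by blast
  have "(\<integral>\<^sup>+s. ennreal (norm (G s (h (t - s)))) \<partial>lborel) \<le> (\<integral>\<^sup>+s. ennreal (C * b) * (q s * indicator {..t} s) \<partial>lborel)"
  proof (rule nn_integral_mono)
    fix s
    show "ennreal (norm (G s (h (t - s)))) \<le> ennreal (C * b) * (q s * indicator {..t} s)"
    proof (cases "s \<le> t")
      case True
      have "ennreal (norm (G s (h (t - s)))) \<le> ennreal C * q s * ennreal (norm (h (t - s)))"
        by (rule norm_G_apply)
      also have "\<dots> \<le> ennreal C * q s * ennreal b"
        by (intro mult_left_mono ennreal_leI h) simp
      finally show ?thesis using True C_nonneg b by (simp add: ennreal_mult mult_ac)
    next
      case False
      then show ?thesis using h(3)[of "t - s"] by (simp add: blinfun.zero_right)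
    qed
  qed
  also have "\<dots> = ennreal (C * b) * (\<integral>\<^sup>+s. q s * indicator {..t} s \<partial>lborel)"
    by (rule nn_integral_cmult) measurable
  finally show ?thesis .
qed

lemma bochner_integrable_G_bounded:
  assumes h: "ps_measurable lborel h" "\<And>s. norm (h s) \<le> b" "\<And>s. s \<le> 0 \<Longrightarrow> h s = 0"
  shows "bochner_integrable lborel (\<lambda>s. G s (h (t - s)))" "bochner_integrable lborel (\<lambda>s. G (t - s) (h s))"
proof -
  show *: "bochner_integrable lborel (\<lambda>s. G s (h (t - s)))"
  proof (rule bochner_integrableI_ps)
    show "ps_measurable lborel (\<lambda>s. G s (h (t - s)))"
      by (intro ps_measurable_G_apply h) measurable
    show "(\<integral>\<^sup>+s. ennreal (norm (G s (h (t - s)))) \<partial>lborel) < \<infinity>"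
    proof (rule order.strict_trans1)
      show "(\<integral>\<^sup>+s. ennreal (norm (G s (h (t - s)))) \<partial>lborel) \<le> ennreal (C * b) * (\<integral>\<^sup>+s. q s * indicator {..t} s \<partial>lborel)"
        by (rule nn_integral_G_bounded[OF h])
      show "ennreal (C * b) * (\<integral>\<^sup>+s. q s * indicator {..t} s \<partial>lborel) < \<infinity>"
        using nn_integral_q_finite[of t] by (simp add: ennreal_mult_less_top)
    qed
  qed
  show "bochner_integrable lborel (\<lambda>s. G (t - s) (h s))"
    using conv_reflect(2)[OF h(1), of t] * by simp
qed

lemma norm_conv_le:
  assumes h: "ps_measurable lborel h" "\<And>s. norm (h s) \<le> b" "\<And>s. s \<le> 0 \<Longrightarrow> h s = 0"
  shows "ennreal (norm (conv h t)) \<le> ennreal (C * b) * (\<integral>\<^sup>+s. q s * indicator {..t} s \<partial>lborel)"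
  unfolding conv_reflect(1)[OF h(1)]
  using norm_bochner_integral_le nn_integral_G_bounded[OF h] by (rule order.trans)

text \<open>\<open>G\<close> is controlled only in norm, through \<open>q\<close>, so the increment
  is moved to the data: after reflection the difference is \<open>G s\<close> applied to a
  difference of translates of \<open>h\<close>, and these are close in \<open>L1\<close>.\<close>

lemma continuous_on_conv:
  assumes h: "ps_measurable lborel h" "\<And>s. norm (h s) \<le> b" "\<And>s. s \<notin> {0<..T} \<Longrightarrow> h s = 0" and T: "0 \<le> T"
  shows "continuous_on {..T} (conv h)"
proof (rule continuous_on_sequentiallyI)
  fix t :: "nat \<Rightarrow> real" and t0 assume t: "\<forall>n. t n \<in> {..T}" "t0 \<in> {..T}" "t \<longlonglongrightarrow> t0"
  have h0: "\<And>s. s \<le> 0 \<Longrightarrow> h s = 0" using h(3) by simp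
  have b: "0 \<le> b" using h(2)[of 0] norm_ge_zero order.trans by blast
  have hfin: "(\<integral>\<^sup>+s. ennreal (norm (h s)) \<partial>lborel) < \<infinity>"
  proof -
    have "(\<integral>\<^sup>+s. ennreal (norm (h s)) \<partial>lborel) \<le> (\<integral>\<^sup>+s. ennreal b * indicator {0<..T} s \<partial>lborel)"
      using h(2,3) by (intro nn_integral_mono) (auto simp: indicator_def intro: ennreal_leI)
    also have "\<dots> < \<infinity>"
      using T by (simp add: nn_integral_cmult_indicator ennreal_mult_less_top)
    finally show ?thesis .
  qed
  let ?hr = "\<lambda>s. h (t0 - s)"
  have L1: "(\<lambda>j. \<integral>\<^sup>+s. ennreal (norm (h (t j - s) - h (t0 - s))) \<partial>lborel) \<longlonglongrightarrow> 0"
  proof -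
    have "L1_translation_continuous h"
    proof (rule L1_translation_continuous_bounded_support[OF h(1) hfin _ T])
      show "h s = 0" if "T < \<bar>s\<bar>" for s
        using that T by (intro h(3)) auto
    qed
    moreover have "(\<lambda>j. t j - t0) \<longlonglongrightarrow> 0"
      using t(3) by (simp add: LIM_zero_iff)
    ultimately have "(\<lambda>j. \<integral>\<^sup>+s. ennreal (norm (h ((t j - t0) + s) - h s)) \<partial>lborel) \<longlonglongrightarrow> 0"
      unfolding L1_translation_continuous_def by blast
    moreover have "(\<integral>\<^sup>+s. ennreal (norm (h ((t j - t0) + s) - h s)) \<partial>lborel) = (\<integral>\<^sup>+s. ennreal (norm (h (t j - s) - h (t0 - s))) \<partial>lborel)" for j
    proof -
      have "(\<lambda>s. ennreal (norm (h ((t j - t0) + s) - h s))) \<in> borel_measurable lborel"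
        by (intro ps_measurable_ennreal_norm ps_measurable_diff ps_measurable_lborel_compose[OF h(1)]) auto
      then have "(\<lambda>s. ennreal (norm (h ((t j - t0) + s) - h s))) \<in> borel_measurable borel" by simp
      from nn_integral_lborel_reflect[OF this, of t0] show ?thesis by (simp add: algebra_simps)
    qed
    ultimately show ?thesis by simp
  qed
  have W: "(\<lambda>j. \<integral>\<^sup>+s. (ennreal C * (q s * indicator {..T} s)) * ennreal (norm (h (t j - s) - h (t0 - s))) \<partial>lborel) \<longlonglongrightarrow> 0"
  proof (rule weighted_L1_convergence[OF _ _ _ _ L1])
    show "(\<integral>\<^sup>+s. ennreal C * (q s * indicator {..T} s) \<partial>lborel) < \<infinity>"
      using nn_integral_q_finite[of T] by (subst nn_integral_cmult) (auto simp: ennreal_mult_less_top)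
    show "(\<lambda>s. ennreal (norm (h (t j - s) - h (t0 - s)))) \<in> borel_measurable lborel" for j
      by (intro ps_measurable_ennreal_norm ps_measurable_diff ps_measurable_lborel_compose[OF h(1)]) auto
    show "ennreal (norm (h (t j - s) - h (t0 - s))) \<le> ennreal (2 * b)" for j s
      using norm_triangle_ineq4[of "h (t j - s)" "h (t0 - s)"] h(2)[of "t j - s"] h(2)[of "t0 - s"]
      by (intro ennreal_leI) simp
  qed measurable
  have le: "ennreal (norm (conv h (t j) - conv h t0)) \<le>
    (\<integral>\<^sup>+s. (ennreal C * (q s * indicator {..T} s)) * ennreal (norm (h (t j - s) - h (t0 - s))) \<partial>lborel)" for j
  proof -
    have "conv h (t j) - conv h t0 = bochner_integral lborel (\<lambda>s. G s (h (t j - s) - h (t0 - s)))"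
      unfolding conv_reflect(1)[OF h(1)] blinfun.diff_right
      by (rule bochner_integral_diff[symmetric]; rule bochner_integrable_G_bounded(1)[OF h(1,2) h0])
    also have "ennreal (norm \<dots>) \<le> (\<integral>\<^sup>+s. ennreal (norm (G s (h (t j - s) - h (t0 - s)))) \<partial>lborel)"
      by (rule norm_bochner_integral_le)
    also have "\<dots> \<le> (\<integral>\<^sup>+s. (ennreal C * (q s * indicator {..T} s)) * ennreal (norm (h (t j - s) - h (t0 - s))) \<partial>lborel)"
    proof (rule nn_integral_mono)
      fix s
      show "ennreal (norm (G s (h (t j - s) - h (t0 - s)))) \<le> (ennreal C * (q s * indicator {..T} s)) * ennreal (norm (h (t j - s) - h (t0 - s)))"
      proof (cases "s \<le> T")
        case True
        then show ?thesis using norm_G_apply by simp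
      next
        case False
        moreover have "t j \<le> T" "t0 \<le> T" using t(1,2) by auto
        ultimately show ?thesis using h0[of "t j - s"] h0[of "t0 - s"] by (simp add: blinfun.zero_right)
      qed
    qed
    finally show ?thesis .
  qed
  have "(\<lambda>j. ennreal (norm (conv h (t j) - conv h t0))) \<longlonglongrightarrow> ennreal 0"
    using tendsto_sandwich[OF _ _ tendsto_const W, of "\<lambda>j. ennreal (norm (conv h (t j) - conv h t0))"] le by simp
  then have "(\<lambda>j. norm (conv h (t j) - conv h t0)) \<longlonglongrightarrow> 0"
    by (subst (asm) tendsto_ennreal_iff) auto
  then show "(\<lambda>j. conv h (t j)) \<longlonglongrightarrow> conv h t0"
    by (simp add: Lim_null[of _ "conv h t0"] tendsto_norm_zero_iff)
qed

text \<open>Associativity in both forms, \<open>a * (G * h) = (a * G) * h = G * (a * h)\<close>,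
  from one bound in terms of \<open>C\<close>, \<open>c\<close> and the \<open>L1\<close> norm of
  \<open>h\<close>. The constant \<open>c\<close> is 1 for \<open>w\<close>, and the integral of
  \<open>q\<close> over \<open>{..T0}\<close> for \<open>one\<close>.\<close>

lemma
  fixes a :: "real \<Rightarrow> real" and c :: ennreal
  assumes a[measurable]: "a \<in> borel_measurable borel" and a0: "\<And>\<tau>. 0 \<le> a \<tau>"
    and aq: "AE \<tau> in lborel. \<tau> < T0 \<longrightarrow> (\<integral>\<^sup>+t. ennreal (a (\<tau> - t)) * q t \<partial>lborel) \<le> c" and c: "c < \<infinity>"
    and h: "ps_measurable lborel h" and hfin: "(\<integral>\<^sup>+s. ennreal (norm (h s)) \<partial>lborel) < \<infinity>"
    and h0: "\<And>s. s \<le> 0 \<Longrightarrow> h s = 0" and T: "T \<le> T0"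
  shows bochner_integrable_kconv: "bochner_integrable lborel (\<lambda>s. kconv a (T - s) (h s))"
    and bochner_integral_G_conv: "(\<And>t. 0 < t \<Longrightarrow> bochner_integrable lborel (\<lambda>s. a (T - t - s) *\<^sub>R h s)) \<Longrightarrow>
      bochner_integral lborel (\<lambda>t. G t (bochner_integral lborel (\<lambda>s. a (T - t - s) *\<^sub>R h s))) =
      bochner_integral lborel (\<lambda>s. kconv a (T - s) (h s))"
    and bochner_integrable_conv: "bochner_integrable lborel (\<lambda>\<tau>. a (T - \<tau>) *\<^sub>R conv h \<tau>)"
    and bochner_integral_conv: "bochner_integral lborel (\<lambda>\<tau>. a (T - \<tau>) *\<^sub>R conv h \<tau>) =
      bochner_integral lborel (\<lambda>s. kconv a (T - s) (h s))"
    and AE_bochner_integrable_conv: "AE \<tau> in lborel. bochner_integrable lborel (\<lambda>s. a (T - \<tau>) *\<^sub>R G (\<tau> - s) (h s))"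
proof -
  have hm: "(\<lambda>s. ennreal (norm (h s))) \<in> borel_measurable lborel"
    by (rule ps_measurable_ennreal_norm[OF h])
  have bound: "(\<integral>\<^sup>+s. \<integral>\<^sup>+t. ennreal (norm (a (T - s - t) *\<^sub>R G t (h s))) \<partial>lborel \<partial>lborel) < \<infinity>"
  proof -
    have "(\<integral>\<^sup>+s. \<integral>\<^sup>+t. ennreal (norm (a (T - s - t) *\<^sub>R G t (h s))) \<partial>lborel \<partial>lborel) \<le>
      (\<integral>\<^sup>+s. (ennreal C * c) * ennreal (norm (h s)) \<partial>lborel)"
    \<comment> \<open>The data vanish at \<open>s \<le> 0\<close>, so the kernel bound is used only
      at arguments \<open>T - s < T0\<close>.\<close>
    proof (rule nn_integral_mono_AE, use AE_lborel_reflect[OF aq, of T] in eventually_elim)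
      case (elim s)
      show ?case
      proof (cases "s \<le> 0")
        case True
        then show ?thesis by (simp add: h0 blinfun.zero_right)
      next
        case False
        then have *: "(\<integral>\<^sup>+t. ennreal (a (T - s - t)) * q t \<partial>lborel) \<le> c" using elim T by simp
        have "(\<integral>\<^sup>+t. ennreal (norm (a (T - s - t) *\<^sub>R G t (h s))) \<partial>lborel) \<le>
          (\<integral>\<^sup>+t. (ennreal C * ennreal (norm (h s))) * (ennreal (a (T - s - t)) * q t) \<partial>lborel)"
        proof (rule nn_integral_mono)
          fix t
          have "ennreal (norm (a (T - s - t) *\<^sub>R G t (h s))) = ennreal (a (T - s - t)) * ennreal (norm (G t (h s)))"
            by (simp add: ennreal_mult a0)
          also have "\<dots> \<le> ennreal (a (T - s - t)) * (ennreal C * q t * ennreal (norm (h s)))"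
            by (intro mult_left_mono norm_G_apply) simp
          finally show "ennreal (norm (a (T - s - t) *\<^sub>R G t (h s))) \<le> (ennreal C * ennreal (norm (h s))) * (ennreal (a (T - s - t)) * q t)"
            by (simp add: mult_ac)
        qed
        also have "\<dots> = (ennreal C * ennreal (norm (h s))) * (\<integral>\<^sup>+t. ennreal (a (T - s - t)) * q t \<partial>lborel)"
          by (rule nn_integral_cmult) measurable
        also have "\<dots> \<le> (ennreal C * ennreal (norm (h s))) * c"
          by (intro mult_left_mono *) simp
        finally show ?thesis by (simp add: mult_ac)
      qed
    qed
    also have "\<dots> = (ennreal C * c) * (\<integral>\<^sup>+s. ennreal (norm (h s)) \<partial>lborel)"
      by (rule nn_integral_cmult[OF hm])
    also have "\<dots> < \<infinity>" using hfin c by (simp add: ennreal_mult_less_top)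
    finally show ?thesis .
  qed
  note pair = lborel_pair.pair_sigma_finite_axioms
  have "bochner_integrable (lborel \<Otimes>\<^sub>M lborel) (\<lambda>z. a (T - fst z - snd z) *\<^sub>R G (snd z) (h (fst z)))"
  proof (rule bochner_integrableI_ps)
    show ps: "ps_measurable (lborel \<Otimes>\<^sub>M lborel) (\<lambda>z. a (T - fst z - snd z) *\<^sub>R G (snd z) (h (fst z)))"
      by (intro ps_measurable_scaleR ps_measurable_G_apply h) measurable
    show "(\<integral>\<^sup>+z. ennreal (norm (a (T - fst z - snd z) *\<^sub>R G (snd z) (h (fst z)))) \<partial>(lborel \<Otimes>\<^sub>M lborel)) < \<infinity>"
      using bound by (subst lborel.nn_integral_fst[OF ps_measurable_ennreal_norm[OF ps], symmetric]) simp
  qed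
  then have I1: "bochner_integrable (lborel \<Otimes>\<^sub>M lborel) (\<lambda>(s, t). a (T - s - t) *\<^sub>R G t (h s))"
    by (simp add: case_prod_beta')
  show "bochner_integrable lborel (\<lambda>s. kconv a (T - s) (h s))"
    using bochner_fubini(2)[OF pair I1] by (simp add: kconv_def)
  show "bochner_integral lborel (\<lambda>t. G t (bochner_integral lborel (\<lambda>s. a (T - t - s) *\<^sub>R h s))) =
      bochner_integral lborel (\<lambda>s. kconv a (T - s) (h s))"
    if int: "\<And>t. 0 < t \<Longrightarrow> bochner_integrable lborel (\<lambda>s. a (T - t - s) *\<^sub>R h s)"
  proof -
    have "G t (bochner_integral lborel (\<lambda>s. a (T - t - s) *\<^sub>R h s)) = bochner_integral lborel (\<lambda>s. a (T - s - t) *\<^sub>R G t (h s))" for t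
    proof (cases "0 < t")
      case True
      show ?thesis
        by (subst bochner_integral_blinfun[OF int[OF True], symmetric]) (simp add: blinfun.scaleR_right algebra_simps)
    qed (simp add: G_zero bochner_integral_zero)
    then show ?thesis
      using bochner_fubini_swap(3)[OF pair I1] by (simp add: kconv_def)
  qed
  \<comment> \<open>The same double integral in the variables \<open>s\<close> and
    \<open>\<tau> = s + t\<close>; exchanging the order here makes \<open>conv h\<close> the inner
    integral.\<close>
  have psA: "ps_measurable (lborel \<Otimes>\<^sub>M lborel) (\<lambda>z. a (T - snd z) *\<^sub>R G (snd z - fst z) (h (fst z)))"
    by (intro ps_measurable_scaleR ps_measurable_G_apply h) measurable
  have shift: "(\<lambda>t. a (T - (s + 1 * t)) *\<^sub>R G ((s + 1 * t) - s) (h s)) = (\<lambda>t. a (T - s - t) *\<^sub>R G t (h s))" for s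
    by (simp add: algebra_simps)
  have psB: "ps_measurable lborel (\<lambda>\<tau>. a (T - \<tau>) *\<^sub>R G (\<tau> - s) (h s))" for s
  proof (rule ps_measurable_scaleR)
    show "ps_measurable lborel (\<lambda>\<tau>. G (\<tau> - s) (h s))"
      by (rule ps_measurable_G_apply[OF ps_measurable_const]) measurable
  qed measurable
  have "bochner_integrable (lborel \<Otimes>\<^sub>M lborel) (\<lambda>z. a (T - snd z) *\<^sub>R G (snd z - fst z) (h (fst z)))"
  proof (rule bochner_integrableI_ps[OF psA])
    have eq: "(\<integral>\<^sup>+\<tau>. ennreal (norm (a (T - \<tau>) *\<^sub>R G (\<tau> - s) (h s))) \<partial>lborel) = (\<integral>\<^sup>+t. ennreal (norm (a (T - s - t) *\<^sub>R G t (h s))) \<partial>lborel)" for s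
      using nn_integral_lborel_translate[of "\<lambda>\<tau>. ennreal (norm (a (T - \<tau>) *\<^sub>R G (\<tau> - s) (h s)))" s] ps_measurable_ennreal_norm[OF psB[of s]]
      by (simp add: algebra_simps)
    show "(\<integral>\<^sup>+z. ennreal (norm (a (T - snd z) *\<^sub>R G (snd z - fst z) (h (fst z)))) \<partial>(lborel \<Otimes>\<^sub>M lborel)) < \<infinity>"
      using bound by (subst lborel.nn_integral_fst[OF ps_measurable_ennreal_norm[OF psA], symmetric]) (simp only: fst_conv snd_conv eq)
  qed
  then have I2: "bochner_integrable (lborel \<Otimes>\<^sub>M lborel) (\<lambda>(s, \<tau>). a (T - \<tau>) *\<^sub>R G (\<tau> - s) (h s))"
    by (simp add: case_prod_beta')
  note F = bochner_fubini_swap[OF pair I2]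
  have inner: "bochner_integral lborel (\<lambda>s. a (T - \<tau>) *\<^sub>R G (\<tau> - s) (h s)) = a (T - \<tau>) *\<^sub>R conv h \<tau>" for \<tau>
    unfolding conv_def by (rule bochner_integral_scaleR_right)
  show "bochner_integrable lborel (\<lambda>\<tau>. a (T - \<tau>) *\<^sub>R conv h \<tau>)"
    using F(2) by (simp only: inner)
  have "bochner_integral lborel (\<lambda>\<tau>. a (T - \<tau>) *\<^sub>R G (\<tau> - s) (h s)) = kconv a (T - s) (h s)" for s
    using bochner_integral_lborel_affine(2)[OF ps_imp_strongly_measurable[OF psB], of 1 s s] unfolding shift kconv_def by simp
  then show "bochner_integral lborel (\<lambda>\<tau>. a (T - \<tau>) *\<^sub>R conv h \<tau>) = bochner_integral lborel (\<lambda>s. kconv a (T - s) (h s))"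
    using F(3) by (simp only: inner)
  show "AE \<tau> in lborel. bochner_integrable lborel (\<lambda>s. a (T - \<tau>) *\<^sub>R G (\<tau> - s) (h s))"
    by (rule F(1))
qed

text \<open>The Heaviside function: convolution with it is integration from 0, for data that vanish
  at nonpositive times.\<close>

definition one :: "real \<Rightarrow> real" where
  "one = indicat_real {0<..}"

lemma one_kernel:
  "one \<in> borel_measurable borel" "0 \<le> one \<tau>"
  "AE \<tau> in lborel. \<tau> < T0 \<longrightarrow> (\<integral>\<^sup>+t. ennreal (one (\<tau> - t)) * q t \<partial>lborel) \<le> (\<integral>\<^sup>+t. q t * indicator {..T0} t \<partial>lborel)"
proof -
  show "AE \<tau> in lborel. \<tau> < T0 \<longrightarrow> (\<integral>\<^sup>+t. ennreal (one (\<tau> - t)) * q t \<partial>lborel) \<le> (\<integral>\<^sup>+t. q t * indicator {..T0} t \<partial>lborel)"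
  proof (intro AE_I2 impI nn_integral_mono)
    fix \<tau> t assume "\<tau> < T0"
    then show "ennreal (one (\<tau> - t)) * q t \<le> q t * indicator {..T0} t"
      by (cases "t < \<tau>") (auto simp: one_def)
  qed
qed (simp_all add: one_def)

lemma w_kernel:
  "AE \<tau> in lborel. \<tau> < T0 \<longrightarrow> (\<integral>\<^sup>+t. ennreal (w (\<tau> - t)) * q t \<partial>lborel) \<le> 1"
  using AE_w_conv_q_le by eventually_elim simp

lemma kconv_one:
  assumes "x \<in> generator_dom P" "0 < \<tau>"
  shows "kconv one \<tau> (generator P x) = Q \<tau> x - x"
  using integral_G_generator[OF assms] by (simp add: kconv_def one_def)

lemma kconv_one_zero:
  assumes "\<tau> \<le> 0"
  shows "kconv one \<tau> x = 0"
proof -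
  have "one (\<tau> - t) *\<^sub>R G t x = 0" for t
    using assms by (cases "0 < t") (auto simp: one_def G_zero)
  then show ?thesis by (simp only: kconv_def bochner_integral_zero)
qed

lemma AE_kconv_w: "AE \<tau> in lborel. \<forall>y. kconv w \<tau> y = Q \<tau> y"
  unfolding kconv_def by (rule AE_w_conv_G)

text \<open>Measurability in \<open>t\<close> is inherited from \<open>w * G\<close>, which agrees
  with \<open>Q\<close> almost everywhere; this avoids joint measurability of
  \<open>E\<close>.\<close>

lemma strongly_measurable_Q: "strongly_measurable lborel (\<lambda>t. Q t x)"
proof -
  have "ps_measurable (lborel \<Otimes>\<^sub>M lborel) (\<lambda>z. w (fst z - snd z) *\<^sub>R G (snd z) ((\<lambda>_. x) (snd z)))"
    by (intro ps_measurable_scaleR ps_measurable_G_apply ps_measurable_const) measurable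
  from ps_measurable_bochner_integral[OF lborel.sigma_finite_measure_axioms this]
  have "ps_measurable lborel (\<lambda>\<tau>. kconv w \<tau> x)" by (simp add: kconv_def)
  moreover have "AE \<tau> in lborel. Q \<tau> x = kconv w \<tau> x"
    using AE_kconv_w by eventually_elim simp
  ultimately show ?thesis
    unfolding strongly_measurable_iff_ps by blast
qed

text \<open>The null set of \<open>AE_kconv_w\<close> does not depend on the vector, so after the
  substitution of \<open>T - s\<close> for the time the identity may be used at
  \<open>y = h s\<close>.\<close>

lemma bochner_integral_w_conv:
  assumes h: "ps_measurable lborel h" "(\<integral>\<^sup>+s. ennreal (norm (h s)) \<partial>lborel) < \<infinity>" "\<And>s. s \<le> 0 \<Longrightarrow> h s = 0"
  shows "bochner_integrable lborel (\<lambda>s. Q (T - s) (h s))"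
    and "bochner_integrable lborel (\<lambda>\<tau>. w (T - \<tau>) *\<^sub>R conv h \<tau>)"
    and "bochner_integral lborel (\<lambda>\<tau>. w (T - \<tau>) *\<^sub>R conv h \<tau>) = bochner_integral lborel (\<lambda>s. Q (T - s) (h s))"
proof -
  have AE: "AE s in lborel. kconv w (T - s) (h s) = Q (T - s) (h s)"
    using AE_lborel_reflect[OF AE_kconv_w, of T] by eventually_elim simp
  show "bochner_integrable lborel (\<lambda>s. Q (T - s) (h s))"
    "bochner_integrable lborel (\<lambda>\<tau>. w (T - \<tau>) *\<^sub>R conv h \<tau>)"
    "bochner_integral lborel (\<lambda>\<tau>. w (T - \<tau>) *\<^sub>R conv h \<tau>) = bochner_integral lborel (\<lambda>s. Q (T - s) (h s))"
    using bochner_integrable_kconv[OF w_measurable w_nonneg w_kernel[of T] _ h order.refl]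
      bochner_integrable_conv[OF w_measurable w_nonneg w_kernel[of T] _ h order.refl]
      bochner_integral_conv[OF w_measurable w_nonneg w_kernel[of T] _ h order.refl]
      bochner_integrable_cong_AE[OF AE] bochner_integral_cong_AE[OF AE] by simp_all
qed

lemma bochner_integral_one_conv:
  assumes h: "ps_measurable lborel h" "(\<integral>\<^sup>+s. ennreal (norm (h s)) \<partial>lborel) < \<infinity>" "\<And>s. s \<le> 0 \<Longrightarrow> h s = 0"
  shows "bochner_integrable lborel (\<lambda>s. kconv one (T - s) (h s))"
    and "bochner_integrable lborel (\<lambda>\<tau>. one (T - \<tau>) *\<^sub>R conv h \<tau>)"
    and "bochner_integral lborel (\<lambda>\<tau>. one (T - \<tau>) *\<^sub>R conv h \<tau>) = bochner_integral lborel (\<lambda>s. kconv one (T - s) (h s))"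
    and "AE \<tau> in lborel. \<tau> < T \<longrightarrow> bochner_integrable lborel (\<lambda>s. G (\<tau> - s) (h s))"
proof -
  note k = one_kernel(1,2) one_kernel(3)[of T] nn_integral_q_finite[of T]
  show "bochner_integrable lborel (\<lambda>s. kconv one (T - s) (h s))"
    by (rule bochner_integrable_kconv[OF k h order.refl])
  show "bochner_integrable lborel (\<lambda>\<tau>. one (T - \<tau>) *\<^sub>R conv h \<tau>)"
    by (rule bochner_integrable_conv[OF k h order.refl])
  show "bochner_integral lborel (\<lambda>\<tau>. one (T - \<tau>) *\<^sub>R conv h \<tau>) = bochner_integral lborel (\<lambda>s. kconv one (T - s) (h s))"
    by (rule bochner_integral_conv[OF k h order.refl])
  show "AE \<tau> in lborel. \<tau> < T \<longrightarrow> bochner_integrable lborel (\<lambda>s. G (\<tau> - s) (h s))"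
  proof -
    have "AE \<tau> in lborel. bochner_integrable lborel (\<lambda>s. one (T - \<tau>) *\<^sub>R G (\<tau> - s) (h s))"
      by (rule AE_bochner_integrable_conv[OF k h order.refl])
    then show ?thesis
    proof eventually_elim
      case (elim \<tau>)
      then show ?case by (cases "\<tau> < T") (simp_all add: one_def)
    qed
  qed
qed

end

section \<open>Existence of the strong solution\<close>

lemma strongly_measurable_indicator_scaleR:
  fixes f :: "'a \<Rightarrow> 'b::real_normed_vector"
  assumes "A \<in> sets M" "strongly_measurable M f"
  shows "strongly_measurable M (\<lambda>x. indicat_real A x *\<^sub>R f x)"
proof -
  obtain f' where f': "ps_measurable M f'" "AE x in M. f x = f' x"
    using assms(2) unfolding strongly_measurable_iff_ps by blast
  have "AE x in M. indicat_real A x *\<^sub>R f x = indicat_real A x *\<^sub>R f' x"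
    using f'(2) by eventually_elim simp
  then show ?thesis
    unfolding strongly_measurable_iff_ps using ps_measurable_indicator_scaleR[OF assms(1) f'(1)] by blast
qed

lemma set_bochner_integrable_representative:
  fixes f :: "'a \<Rightarrow> 'b::banach"
  assumes f: "set_bochner_integrable M A f" and A: "A \<in> sets M"
  obtains F where "ps_measurable M F" "(\<integral>\<^sup>+x. ennreal (norm (F x)) \<partial>M) < \<infinity>" "\<And>x. x \<notin> A \<Longrightarrow> F x = 0"
    "AE x in M. x \<in> A \<longrightarrow> f x = F x"
proof -
  obtain F where F: "ps_measurable M F" "AE x in M. indicat_real A x *\<^sub>R f x = F x" "(\<integral>\<^sup>+x. ennreal (norm (F x)) \<partial>M) < \<infinity>"
    using bochner_integrableE_ps[OF f] by blast
  show ?thesis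
  proof
    show "ps_measurable M (\<lambda>x. indicat_real A x *\<^sub>R F x)"
      by (rule ps_measurable_indicator_scaleR[OF A F(1)])
    have "(\<integral>\<^sup>+x. ennreal (norm (indicat_real A x *\<^sub>R F x)) \<partial>M) \<le> (\<integral>\<^sup>+x. ennreal (norm (F x)) \<partial>M)"
      by (intro nn_integral_mono ennreal_leI) (auto simp: indicator_def)
    then show "(\<integral>\<^sup>+x. ennreal (norm (indicat_real A x *\<^sub>R F x)) \<partial>M) < \<infinity>"
      using F(3) by (rule order.strict_trans1)
    show "AE x in M. x \<in> A \<longrightarrow> f x = indicat_real A x *\<^sub>R F x"
      using F(2) by eventually_elim auto
  qed simp
qed

text \<open>\<open>v\<close> may have no limit at 0, so its argument is kept at or above
  \<open>min T (1 / real (Suc n))\<close>; each fixed \<open>t\<close> in the interval is eventually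
  unaffected.\<close>

lemma ps_measurable_continuous_on_Ioc:
  fixes v :: "real \<Rightarrow> 'b::real_normed_vector"
  assumes v: "continuous_on {0<..T} v" and T: "0 < T"
  shows "ps_measurable lborel (\<lambda>t. indicat_real {0<..T} t *\<^sub>R v t)"
proof -
  define c where "c n t = max (min T (1 / real (Suc n))) (min T t)" for n :: nat and t :: real
  have c: "c n t \<in> {0<..T}" for n t
    using T by (auto simp: c_def less_max_iff_disj)
  have cc: "continuous_on UNIV (c n)" for n
    unfolding c_def[abs_def] by (intro continuous_intros)
  have vc: "continuous_on UNIV (\<lambda>t. v (c n t))" for n
    using c by (intro continuous_on_compose2[OF v cc]) auto
  have id: "ps_measurable lborel (\<lambda>t::real. t)"
    by (intro ps_measurable_second_countable) simp
  show ?thesis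
  proof (rule ps_measurable_LIMSEQ)
    show "ps_measurable lborel (\<lambda>t. indicat_real {0<..T} t *\<^sub>R v (c n t))" for n
      by (intro ps_measurable_indicator_scaleR ps_measurable_continuous[OF id vc]) simp
    show "(\<lambda>n. indicat_real {0<..T} t *\<^sub>R v (c n t)) \<longlonglongrightarrow> indicat_real {0<..T} t *\<^sub>R v t" for t
    proof (cases "t \<in> {0<..T}")
      case True
      then obtain n0 where n0: "1 / real (Suc n0) < t" using nat_approx_posE[of t] by auto
      have ct: "c n t = t" if "n0 \<le> n" for n
      proof -
        have "1 / real (Suc n) \<le> 1 / real (Suc n0)" using that by (intro divide_left_mono) auto
        then show ?thesis using n0 True by (simp add: c_def min_def max_def)
      qed
      have "\<forall>\<^sub>F n in sequentially. indicat_real {0<..T} t *\<^sub>R v (c n t) = indicat_real {0<..T} t *\<^sub>R v t"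
        using eventually_ge_at_top[of n0] by eventually_elim (simp add: ct)
      then show ?thesis by (rule tendsto_eventually)
    qed simp
  qed
qed

locale fractional_cauchy_problem = fractional_cauchy M S \<nu> pbar P C
  for M :: "'a measure" and S and \<nu> and pbar and P :: "real \<Rightarrow> 'b::banach \<Rightarrow>\<^sub>L 'b" and C +
  fixes T0 K :: real and g :: 'b and f :: "real \<Rightarrow> 'b"
  assumes T0: "0 < T0" and g_dom: "g \<in> generator_dom P"
    and f_meas: "set_strongly_measurable lborel {0<..T0} f"
    and f_dom: "AE t in lborel. t \<in> {0<..T0} \<longrightarrow> f t \<in> generator_dom P"
    and Af: "set_bochner_integrable lborel {0<..T0} (\<lambda>t. generator P (f t))"
    and f_bound: "AE t in lborel. t \<in> {0<..T0} \<longrightarrow> norm (f t) \<le> K"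
begin

text \<open>The convolution lemmas ask for bounds and zeros at every time, so a version of
  \<open>f\<close> with these properties is fixed. With \<open>\<bar>K\<bar>\<close> in place of
  \<open>K\<close> the value 0 satisfies the bound whatever the sign of \<open>K\<close>.\<close>

definition fs :: "real \<Rightarrow> 'b" where
  "fs = (SOME F. ps_measurable lborel F \<and> (\<forall>s. norm (F s) \<le> \<bar>K\<bar>) \<and> (\<forall>s. s \<notin> {0<..T0} \<longrightarrow> F s = 0) \<and>
     (AE s in lborel. s \<in> {0<..T0} \<longrightarrow> f s = F s))"

lemma fs: "ps_measurable lborel fs" "norm (fs s) \<le> \<bar>K\<bar>" "s \<notin> {0<..T0} \<Longrightarrow> fs s = 0"
    "AE s in lborel. s \<in> {0<..T0} \<longrightarrow> f s = fs s"
proof -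
  obtain F where F: "ps_measurable lborel F" "AE s in lborel. indicat_real {0<..T0} s *\<^sub>R f s = F s"
    using f_meas unfolding strongly_measurable_iff_ps by blast
  \<comment> \<open>Cutting where \<open>F\<close> exceeds \<open>\<bar>K\<bar>\<close> changes it
    only on a null set and turns the almost everywhere bound into a pointwise one.\<close>
  define B where "B = {0<..T0} \<inter> {s. norm (F s) \<le> \<bar>K\<bar>}"
  have "{s \<in> space lborel. norm (F s) \<le> \<bar>K\<bar>} \<in> sets lborel"
    using ps_measurable_norm[OF F(1)] by measurable
  then have B: "B \<in> sets lborel" by (simp add: B_def)
  have "ps_measurable lborel (\<lambda>s. indicat_real B s *\<^sub>R F s) \<and> (\<forall>s. norm (indicat_real B s *\<^sub>R F s) \<le> \<bar>K\<bar>) \<and>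
     (\<forall>s. s \<notin> {0<..T0} \<longrightarrow> indicat_real B s *\<^sub>R F s = 0) \<and> (AE s in lborel. s \<in> {0<..T0} \<longrightarrow> f s = indicat_real B s *\<^sub>R F s)"
  proof (intro conjI)
    show "ps_measurable lborel (\<lambda>s. indicat_real B s *\<^sub>R F s)"
      by (rule ps_measurable_indicator_scaleR[OF B F(1)])
    show "AE s in lborel. s \<in> {0<..T0} \<longrightarrow> f s = indicat_real B s *\<^sub>R F s"
      using F(2) f_bound by eventually_elim (auto simp: B_def indicator_def)
  qed (auto simp: B_def indicator_def)
  then have "\<exists>F. ps_measurable lborel F \<and> (\<forall>s. norm (F s) \<le> \<bar>K\<bar>) \<and> (\<forall>s. s \<notin> {0<..T0} \<longrightarrow> F s = 0) \<and>
     (AE s in lborel. s \<in> {0<..T0} \<longrightarrow> f s = F s)" by blast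
  from someI_ex[OF this] show "ps_measurable lborel fs" "norm (fs s) \<le> \<bar>K\<bar>" "s \<notin> {0<..T0} \<Longrightarrow> fs s = 0"
    "AE s in lborel. s \<in> {0<..T0} \<longrightarrow> f s = fs s"
    unfolding fs_def by blast+
qed

text \<open>Chosen independently of \<open>fs\<close>; the two are related only almost everywhere,
  as \<open>AE_fs_generator\<close> records.\<close>

definition fA :: "real \<Rightarrow> 'b" where
  "fA = (SOME F. ps_measurable lborel F \<and> (\<integral>\<^sup>+x. ennreal (norm (F x)) \<partial>lborel) < \<infinity> \<and> (\<forall>s. s \<notin> {0<..T0} \<longrightarrow> F s = 0) \<and>
     (AE s in lborel. s \<in> {0<..T0} \<longrightarrow> generator P (f s) = F s))"

lemma fA: "ps_measurable lborel fA" "(\<integral>\<^sup>+x. ennreal (norm (fA x)) \<partial>lborel) < \<infinity>" "s \<notin> {0<..T0} \<Longrightarrow> fA s = 0"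
    "AE s in lborel. s \<in> {0<..T0} \<longrightarrow> generator P (f s) = fA s"
proof -
  have I: "{0<..T0} \<in> sets lborel" by simp
  obtain F where "ps_measurable lborel F" "(\<integral>\<^sup>+x. ennreal (norm (F x)) \<partial>lborel) < \<infinity>" "\<And>x. x \<notin> {0<..T0} \<Longrightarrow> F x = 0"
    "AE x in lborel. x \<in> {0<..T0} \<longrightarrow> generator P (f x) = F x"
    by (rule set_bochner_integrable_representative[OF Af I]) (rule that)
  then have "\<exists>F. ps_measurable lborel F \<and> (\<integral>\<^sup>+x. ennreal (norm (F x)) \<partial>lborel) < \<infinity> \<and> (\<forall>s. s \<notin> {0<..T0} \<longrightarrow> F s = 0) \<and>
     (AE s in lborel. s \<in> {0<..T0} \<longrightarrow> generator P (f s) = F s)" by blast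
  from someI_ex[OF this] show "ps_measurable lborel fA" "(\<integral>\<^sup>+x. ennreal (norm (fA x)) \<partial>lborel) < \<infinity>" "s \<notin> {0<..T0} \<Longrightarrow> fA s = 0"
    "AE s in lborel. s \<in> {0<..T0} \<longrightarrow> generator P (f s) = fA s"
    unfolding fA_def by blast+
qed

lemma AE_fs_generator: "AE s in lborel. fs s \<in> generator_dom P \<and> generator P (fs s) = fA s"
  using fs(4) fA(4) f_dom
proof eventually_elim
  case (elim s)
  then show ?case
    using fs(3)[of s] fA(3)[of s] generator_zero by (cases "s \<in> {0<..T0}") auto
qed

lemma nn_integral_bounded_Ioc:
  fixes F :: "real \<Rightarrow> 'b"
  assumes "\<And>s. norm (F s) \<le> b" "\<And>s. s \<notin> {0<..T0} \<Longrightarrow> F s = 0"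
  shows "(\<integral>\<^sup>+s. ennreal (norm (F s)) \<partial>lborel) < \<infinity>"
proof -
  have "(\<integral>\<^sup>+s. ennreal (norm (F s)) \<partial>lborel) \<le> (\<integral>\<^sup>+s. ennreal b * indicator {0<..T0} s \<partial>lborel)"
    using assms by (intro nn_integral_mono) (auto simp: indicator_def intro: ennreal_leI)
  also have "\<dots> < \<infinity>"
    using T0 by (simp add: nn_integral_cmult_indicator ennreal_mult_less_top)
  finally show ?thesis .
qed

lemma fs_fin: "(\<integral>\<^sup>+s. ennreal (norm (fs s)) \<partial>lborel) < \<infinity>"
  using fs by (intro nn_integral_bounded_Ioc)

definition ga :: "real \<Rightarrow> 'b" where
  "ga s = indicat_real {0<..T0} s *\<^sub>R generator P g"

lemma ga: "ps_measurable lborel ga" "norm (ga s) \<le> norm (generator P g)" "s \<notin> {0<..T0} \<Longrightarrow> ga s = 0"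
proof -
  show "ps_measurable lborel ga"
    unfolding ga_def[abs_def] by (intro ps_measurable_indicator_scaleR ps_measurable_const) simp
qed (auto simp: ga_def indicator_def)

lemma ga_fin: "(\<integral>\<^sup>+s. ennreal (norm (ga s)) \<partial>lborel) < \<infinity>"
  using ga by (intro nn_integral_bounded_Ioc)

definition h :: "real \<Rightarrow> 'b" where
  "h s = fs s + ga s"

lemma h: "ps_measurable lborel h" "norm (h s) \<le> \<bar>K\<bar> + norm (generator P g)" "s \<notin> {0<..T0} \<Longrightarrow> h s = 0"
proof -
  show "ps_measurable lborel h"
    unfolding h_def[abs_def] by (intro ps_measurable_add fs ga)
  show "norm (h s) \<le> \<bar>K\<bar> + norm (generator P g)"
    unfolding h_def using fs(2)[of s] ga(2)[of s] by (intro norm_triangle_le) simp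
qed (simp add: h_def fs ga)

lemma h_fin: "(\<integral>\<^sup>+s. ennreal (norm (h s)) \<partial>lborel) < \<infinity>"
  using h by (intro nn_integral_bounded_Ioc)

lemma data_zero: "s \<le> 0 \<Longrightarrow> fs s = 0" "s \<le> 0 \<Longrightarrow> fA s = 0" "s \<le> 0 \<Longrightarrow> ga s = 0" "s \<le> 0 \<Longrightarrow> h s = 0"
  by (simp_all add: fs fA ga h)

lemma conv_fA_zero: "t \<le> 0 \<Longrightarrow> conv fA t = 0" and conv_h_zero: "t \<le> 0 \<Longrightarrow> conv h t = 0"
  by (rule conv_zero; simp add: data_zero)+

lemma G_fs_integrable: "bochner_integrable lborel (\<lambda>s. G (t - s) (fs s))"
  by (rule bochner_integrable_G_bounded(2)[OF fs(1,2)]) (rule data_zero)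

lemma AE_G_fA_integrable: "AE t in lborel. t < T0 \<longrightarrow> bochner_integrable lborel (\<lambda>s. G (t - s) (fA s))"
  by (rule bochner_integral_one_conv(4)[OF fA(1,2)]) (rule data_zero)

definition U :: "real \<Rightarrow> 'b" where
  "U t = Q t g + conv fs t"

text \<open>Convolving \<open>G\<close> with the constant \<open>generator P g\<close> produces
  \<open>Q t g - g\<close>. A single convolution with bounded data thus carries boundedness,
  continuity and the initial value.\<close>

lemma conv_h:
  assumes t: "t \<in> {0<..T0}"
  shows "conv h t = U t - g"
proof -
  have "conv ga t = kconv one t (generator P g)"
    unfolding conv_reflect(1)[OF ga(1)] kconv_def
  proof (rule bochner_integral_cong)
    fix s
    show "G s (ga (t - s)) = one (t - s) *\<^sub>R G s (generator P g)"
      using t by (cases "0 < s") (auto simp: G_zero ga_def one_def indicator_def blinfun.zero_right)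
  qed
  also have "\<dots> = Q t g - g"
    using t by (intro kconv_one g_dom) simp
  finally have "conv ga t = Q t g - g" .
  moreover have "conv h t = conv fs t + conv ga t"
    unfolding conv_def h_def blinfun.add_right
    by (rule bochner_integral_add; rule G_fs_integrable bochner_integrable_G_bounded(2)[OF ga(1,2) data_zero(3)])
  ultimately show ?thesis by (simp add: U_def)
qed

section \<open>The two representations of the solution\<close>

lemma first_representation:
  assumes t: "t \<in> {0<..T0}"
  defines "F \<equiv> \<lambda>\<omega> r. indicat_real {r. S r \<omega> < t} r *\<^sub>R P r (f (t - S r \<omega>))"
  shows "bochner_integrable M (\<lambda>\<omega>. P (inverse_subordinator S t \<omega>) g)"
    and "AE \<omega> in M. set_bochner_integrable lborel {0<..} (F \<omega>)"
    and "bochner_integrable M (\<lambda>\<omega>. set_bochner_integral lborel {0<..} (F \<omega>))"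
    and "bochner_integral M (\<lambda>\<omega>. P (inverse_subordinator S t \<omega>) g) = Q t g"
    and "bochner_integral M (\<lambda>\<omega>. set_bochner_integral lborel {0<..} (F \<omega>)) = conv fs t"
proof -
  have AE1: "AE \<omega> in M. P (inverse_subordinator S t \<omega>) g = P (E t \<omega>) g"
    using AE_E_path[of t] by eventually_elim simp
  show "bochner_integrable M (\<lambda>\<omega>. P (inverse_subordinator S t \<omega>) g)"
    "bochner_integral M (\<lambda>\<omega>. P (inverse_subordinator S t \<omega>) g) = Q t g"
    using bochner_integrable_cong_AE[OF AE1] bochner_integral_cong_AE[OF AE1] bochner_integrable_PE t by (auto simp: Q_apply)
  \<comment> \<open>The integrand as a function of time and path value, with \<open>fs\<close> in
    place of \<open>f\<close>; \<open>max 0\<close> makes it measurable on the whole plane.\<close>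
  define H where "H = (\<lambda>z. indicat_real {..<t} (snd z) *\<^sub>R P (max 0 (fst z)) (fs (t - snd z)))"
  have Hps: "ps_measurable (lborel \<Otimes>\<^sub>M lborel) H"
  proof -
    have "ps_measurable (lborel \<Otimes>\<^sub>M lborel) (\<lambda>z::real \<times> real. fs (t - snd z))"
      by (rule ps_measurable_lborel_compose[OF fs(1)]) measurable
    then show ?thesis
      unfolding H_def by (intro ps_measurable_scaleR ps_measurable_P) measurable
  qed
  have Hb: "norm (H (r, x)) \<le> (C * \<bar>K\<bar>) * indicat_real {..<t} x" for r x
  proof -
    have "norm (P (max 0 r) (fs (t - x))) \<le> C * \<bar>K\<bar>"
      using norm_P_max[of r "fs (t - x)"] mult_left_mono[OF fs(2)[of "t - x"] C_nonneg] by (rule order.trans)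
    then show ?thesis by (simp add: H_def indicator_def)
  qed
  have "0 \<le> C * \<bar>K\<bar>" using C_nonneg by simp
  note tr = bochner_integral_along_path[OF Hps kernel_nn_integral_finite[OF this Hb Hps]]
  \<comment> \<open>\<open>f\<close> and \<open>fs\<close> differ on a null set of times, which
    \<open>t - S' r \<omega>\<close> avoids for almost every \<open>r\<close> along almost every
    path.\<close>
  have "AE x in lborel. t - x \<in> {0<..T0} \<longrightarrow> f (t - x) = fs (t - x)"
    by (rule AE_lborel_reflect[OF fs(4)])
  from AE_path[OF this] AE_not_bad AE_space
  have AE2: "AE \<omega> in M. AE r in lborel. indicat_real {0<..} r *\<^sub>R F \<omega> r = indicat_real {0<..} r *\<^sub>R H (r, S' r \<omega>)"
  proof eventually_elim
    case (elim \<omega>)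
    from elim(1) show ?case
    proof eventually_elim
      case (elim r)
      show ?case
      proof (cases "0 < r")
        case True
        then have S': "S' r \<omega> = S r \<omega>" using \<open>\<omega> \<notin> bad\<close> by (simp add: S'_def)
        have "0 \<le> S r \<omega>"
          using True by (intro good_path_nonneg[OF bad(2)] \<open>\<omega> \<notin> bad\<close> \<open>\<omega> \<in> space M\<close>) simp
        then show ?thesis
          using True elim t by (auto simp: F_def H_def S' indicator_def max_def)
      qed simp
    qed
  qed
  have AE3: "AE \<omega> in M. set_bochner_integral lborel {0<..} (F \<omega>) = set_bochner_integral lborel {0<..} (\<lambda>r. H (r, S' r \<omega>))"
    using AE2 by eventually_elim (rule bochner_integral_cong_AE)
  show "AE \<omega> in M. set_bochner_integrable lborel {0<..} (F \<omega>)"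
    using AE2 tr(1)
  proof eventually_elim
    case (elim \<omega>)
    then show ?case using bochner_integrable_cong_AE[OF elim(1)] by blast
  qed
  show "bochner_integrable M (\<lambda>\<omega>. set_bochner_integral lborel {0<..} (F \<omega>))"
    using tr(2) bochner_integrable_cong_AE[OF AE3] by simp
  have "bochner_integral M (\<lambda>\<omega>. set_bochner_integral lborel {0<..} (F \<omega>)) =
    bochner_integral lborel (\<lambda>x. bochner_integral lborel (\<lambda>r. p r x *\<^sub>R H (r, x)))"
    using tr(4) bochner_integral_cong_AE[OF AE3] by simp
  also have "\<dots> = bochner_integral lborel (\<lambda>x. G x (fs (t - x)))"
  proof (rule bochner_integral_cong_AE, use AE_q_finite in eventually_elim)
    case (elim x)
    have "bochner_integral lborel (\<lambda>r. p r x *\<^sub>R H (r, x)) = bochner_integral lborel (\<lambda>r. indicat_real {..<t} x *\<^sub>R p r x *\<^sub>R P (max 0 r) (fs (t - x)))"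
      by (intro bochner_integral_cong) (simp add: H_def)
    also have "\<dots> = indicat_real {..<t} x *\<^sub>R G x (fs (t - x))"
      unfolding G_apply[OF elim] by (rule bochner_integral_scaleR[OF bochner_integrable_pP[OF elim]])
    finally show ?case
      using data_zero(1)[of "t - x"] by (cases "x < t") (simp_all add: blinfun.zero_right)
  qed
  also have "\<dots> = conv fs t"
    by (rule conv_reflect(1)[OF fs(1), symmetric])
  finally show "bochner_integral M (\<lambda>\<omega>. set_bochner_integral lborel {0<..} (F \<omega>)) = conv fs t" .
qed

lemma second_representation:
  assumes t: "t \<in> {0<..T0}"
  defines "F \<equiv> \<lambda>s r. pbar r (t - s) *\<^sub>R P r (f s)"
  shows "AE s in lborel. s \<in> {0<..<t} \<longrightarrow> set_bochner_integrable lborel {0<..} (F s)"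
    and "set_bochner_integrable lborel {0<..<t} (\<lambda>s. set_bochner_integral lborel {0<..} (F s))"
    and "set_bochner_integral lborel {0<..<t} (\<lambda>s. set_bochner_integral lborel {0<..} (F s)) = conv fs t"
proof -
  \<comment> \<open>For \<open>s < t\<close> the argument \<open>t - s\<close> is positive, so
    \<open>p\<close> and \<open>pbar\<close> agree at all positive \<open>r\<close>.\<close>
  have eq: "(\<lambda>r. indicat_real {0<..} r *\<^sub>R F s r) = (\<lambda>r. p r (t - s) *\<^sub>R P (max 0 r) (f s))" if "s < t" for s
    using that by (auto simp: fun_eq_iff F_def p_def indicator_def max_def)
  have qf: "AE s in lborel. q (t - s) < \<infinity>"
    by (rule AE_lborel_reflect[OF AE_q_finite])
  then show "AE s in lborel. s \<in> {0<..<t} \<longrightarrow> set_bochner_integrable lborel {0<..} (F s)"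
    by eventually_elim (use eq bochner_integrable_pP in auto)
  have AE: "AE s in lborel. indicat_real {0<..<t} s *\<^sub>R set_bochner_integral lborel {0<..} (F s) = G (t - s) (fs s)"
    using qf fs(4)
  proof eventually_elim
    case (elim s)
    consider "s \<le> 0" | "t \<le> s" | "0 < s" "s < t" by linarith
    then show ?case
    proof cases
      case 3
      then show ?thesis using elim t by (simp add: eq G_apply)
    qed (simp_all add: data_zero G_zero blinfun.zero_right)
  qed
  show "set_bochner_integrable lborel {0<..<t} (\<lambda>s. set_bochner_integral lborel {0<..} (F s))"
    using bochner_integrable_cong_AE[OF AE] G_fs_integrable by simp
  show "set_bochner_integral lborel {0<..<t} (\<lambda>s. set_bochner_integral lborel {0<..} (F s)) = conv fs t"
    using bochner_integral_cong_AE[OF AE] by (simp add: conv_def)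
qed

section \<open>The generator on the solution and the integrated equation\<close>

definition V :: "real \<Rightarrow> 'b" where
  "V t = Q t (generator P g) + conv fA t"

text \<open>The generator passes inside the convolution by
  \<open>generator_bochner_integral\<close>. The integrability this requires is known only for
  almost every \<open>t\<close> below \<open>T0\<close>, hence the almost everywhere claim.\<close>

lemma AE_U_generator:
  "AE t in lborel. t \<in> {0<..T0} \<longrightarrow> U t \<in> generator_dom P \<and> generator P (U t) = V t"
  using AE_G_fA_integrable AE_lborel_singleton[of T0]
proof eventually_elim
  case (elim t)
  show ?case
  proof
    assume t: "t \<in> {0<..T0}"
    then have int: "bochner_integrable lborel (\<lambda>s. G (t - s) (fA s))" using elim by simp
    have AE: "AE s in lborel. G (t - s) (fs s) \<in> generator_dom P" "AE s in lborel. generator P (G (t - s) (fs s)) = G (t - s) (fA s)"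
      using AE_fs_generator by (eventually_elim, auto simp: G_generator)+
    have int': "bochner_integrable lborel (\<lambda>s. generator P (G (t - s) (fs s)))"
      using int bochner_integrable_cong_AE[OF AE(2)] by simp
    have "conv fs t \<in> generator_dom P" "generator P (conv fs t) = conv fA t"
      unfolding conv_def
      using generator_bochner_integral[OF G_fs_integrable AE(1) int'] bochner_integral_cong_AE[OF AE(2)]
      by simp_all
    then show "U t \<in> generator_dom P \<and> generator P (U t) = V t"
      unfolding U_def V_def using generator_add Q_generator[OF g_dom, of t] t by auto
  qed
qed

lemma Q_ga_integrable:
  assumes "T \<le> T0"
  shows "set_bochner_integrable lborel {0<..<T} (\<lambda>t. Q t (generator P g))"
  unfolding bochner_integrable_def
proof
  show "set_strongly_measurable lborel {0<..<T} (\<lambda>t. Q t (generator P g))"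
    by (intro strongly_measurable_indicator_scaleR strongly_measurable_Q) simp
  show "(\<integral>\<^sup>+t. ennreal (norm (indicat_real {0<..<T} t *\<^sub>R Q t (generator P g))) \<partial>lborel) < \<infinity>"
    using norm_Q_apply assms C_nonneg
    by (intro nn_integral_bounded_Ioc[where b = "C * norm (generator P g)"]) (auto simp: indicator_def)
qed

lemma V_integrable: "set_bochner_integrable lborel {0<..T0} V"
proof -
  have AE: "AE t in lborel. indicat_real {0<..T0} t *\<^sub>R V t =
    indicat_real {0<..<T0} t *\<^sub>R Q t (generator P g) + one (T0 - t) *\<^sub>R conv fA t"
    using AE_lborel_singleton[of T0]
  proof eventually_elim
    case (elim t)
    then show ?case
      using conv_fA_zero[of t] by (cases "0 < t") (auto simp: V_def one_def indicator_def)
  qed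
  show ?thesis
    unfolding bochner_integrable_cong_AE[OF AE]
    by (intro bochner_integrable_add Q_ga_integrable bochner_integral_one_conv(2)[OF fA(1,2) data_zero(2)] order.refl)
qed

lemma strong_solution_U:
  assumes u: "\<And>t. t \<in> {0<..T0} \<Longrightarrow> u t = U t"
  shows "strong_solution (levy_tail \<nu>) P T0 g f u"
proof -
  have uc: "u t - g = conv h t" if "t \<in> {0<..T0}" for t
    using u[OF that] conv_h[OF that] by simp
  have cont: "continuous_on {..T0} (conv h)"
    using h T0 by (intro continuous_on_conv) auto
  have "bounded (u ` {0<..T0})"
  proof -
    define B where "B = enn2real (ennreal (C * (\<bar>K\<bar> + norm (generator P g))) * (\<integral>\<^sup>+s. q s * indicator {..T0} s \<partial>lborel))"
    have "norm (u t) \<le> B + norm g" if t: "t \<in> {0<..T0}" for t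
    proof -
      have "ennreal (norm (conv h t)) \<le> ennreal (C * (\<bar>K\<bar> + norm (generator P g))) * (\<integral>\<^sup>+s. q s * indicator {..t} s \<partial>lborel)"
        by (rule norm_conv_le[OF h(1,2) data_zero(4)])
      also have "\<dots> \<le> ennreal (C * (\<bar>K\<bar> + norm (generator P g))) * (\<integral>\<^sup>+s. q s * indicator {..T0} s \<partial>lborel)"
        using t by (intro mult_left_mono nn_integral_mono) (auto simp: indicator_def)
      also have "\<dots> = ennreal B"
        using nn_integral_q_finite[of T0] by (simp add: B_def ennreal_mult_less_top)
      finally have "norm (conv h t) \<le> B"
        by (simp add: B_def)
      moreover have "u t = conv h t + g"
        using uc[OF t] by (simp add: algebra_simps)
      ultimately show ?thesis
        using norm_triangle_ineq[of "conv h t" g] by simp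
    qed
    then show ?thesis unfolding bounded_iff by blast
  qed
  moreover have "continuous_on {0<..T0} u"
  proof -
    have "continuous_on {0<..T0} (\<lambda>t. conv h t + g)"
      by (intro continuous_intros continuous_on_subset[OF cont]) auto
    then show ?thesis
      by (rule continuous_on_eq) (use uc in \<open>simp flip: uc\<close>)
  qed
  moreover have "((\<lambda>t. norm (u t - g)) \<longlongrightarrow> 0) (at_right 0)"
  proof -
    have "(conv h \<longlongrightarrow> conv h 0) (at 0 within {..T0})"
      using cont T0 by (auto simp: continuous_on_def)
    then have "(conv h \<longlongrightarrow> conv h 0) (at 0 within {0..T0})"
      by (rule tendsto_within_subset) auto
    moreover have "conv h 0 = 0"
      by (rule conv_h_zero) simp
    ultimately have "((\<lambda>t. norm (conv h t)) \<longlongrightarrow> 0) (at_right 0)"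
      using T0 by (simp add: at_within_Icc_at_right tendsto_norm_zero)
    moreover have "\<forall>\<^sub>F t in at_right 0. norm (conv h t) = norm (u t - g)"
      unfolding eventually_at_right_field using uc T0 by (intro exI[of _ T0]) auto
    ultimately show ?thesis
      by (rule Lim_transform_eventually)
  qed
  moreover have gen: "AE t in lborel. t \<in> {0<..T0} \<longrightarrow> u t \<in> generator_dom P \<and> generator P (u t) = V t"
    using AE_U_generator by eventually_elim (auto simp: u)
  then have "AE t in lborel. t \<in> {0<..T0} \<longrightarrow> u t \<in> generator_dom P"
    by eventually_elim simp
  moreover have "set_bochner_integrable lborel {0<..T0} (\<lambda>t. generator P (u t))"
  proof -
    have "AE t in lborel. indicat_real {0<..T0} t *\<^sub>R generator P (u t) = indicat_real {0<..T0} t *\<^sub>R V t"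
      using gen by eventually_elim (auto simp: indicator_def)
    from bochner_integrable_cong_AE[OF this] V_integrable show ?thesis by simp
  qed
  moreover have "set_bochner_integrable lborel {0<..<T} (\<lambda>t. levy_tail \<nu> (T - t) *\<^sub>R (u t - g)) \<and>
        set_bochner_integral lborel {0<..<T} (\<lambda>t. levy_tail \<nu> (T - t) *\<^sub>R (u t - g)) =
        set_bochner_integral lborel {0<..<T} (\<lambda>t. f t + generator P (u t))" if T: "T \<in> {0<..T0}" for T
  proof -
    \<comment> \<open>\<open>w (T - t)\<close> vanishes from \<open>T\<close> on and
      \<open>conv h\<close> at nonpositive times, so the integral over the interval is a convolution
      over the whole line.\<close>
    have eq: "(\<lambda>t. indicat_real {0<..<T} t *\<^sub>R levy_tail \<nu> (T - t) *\<^sub>R (u t - g)) = (\<lambda>t. w (T - t) *\<^sub>R conv h t)"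
    proof (rule ext)
      fix t
      show "indicat_real {0<..<T} t *\<^sub>R levy_tail \<nu> (T - t) *\<^sub>R (u t - g) = w (T - t) *\<^sub>R conv h t"
        using conv_h_zero[of t] uc[of t] T by (cases "0 < t"; cases "t < T") (auto simp: w_def)
    qed
    note wc = bochner_integral_w_conv[OF h(1) h_fin data_zero(4), of T]
    note Qf = bochner_integral_w_conv(1)[OF fs(1) fs_fin data_zero(1), of T] and Qg = bochner_integral_w_conv(1)[OF ga(1) ga_fin data_zero(3), of T]
    note oc = bochner_integral_one_conv[OF fA(1,2) data_zero(2), of T]
    have ofs: "bochner_integrable lborel (\<lambda>t. one (T - t) *\<^sub>R fs t)"
    proof (rule bochner_integrableI_ps)
      show "ps_measurable lborel (\<lambda>t. one (T - t) *\<^sub>R fs t)"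
        by (intro ps_measurable_scaleR fs measurable_compose[OF _ one_kernel(1)]) measurable
      show "(\<integral>\<^sup>+t. ennreal (norm (one (T - t) *\<^sub>R fs t)) \<partial>lborel) < \<infinity>"
        using fs by (intro nn_integral_bounded_Ioc[where b = "\<bar>K\<bar>"]) (auto simp: one_def indicator_def)
    qed
    have hs: "(\<lambda>s. Q (T - s) (h s)) = (\<lambda>s. Q (T - s) (fs s) + Q (T - s) (ga s))"
      by (simp add: h_def blinfun.add_right)
    have "bochner_integral lborel (\<lambda>t. w (T - t) *\<^sub>R conv h t) = bochner_integral lborel (\<lambda>s. Q (T - s) (fs s) + Q (T - s) (ga s))"
      using wc(3) unfolding hs .
    also have "\<dots> = bochner_integral lborel (\<lambda>s. Q (T - s) (fs s)) + bochner_integral lborel (\<lambda>s. Q (T - s) (ga s))"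
      by (rule bochner_integral_add[OF Qf Qg])
    \<comment> \<open>Since almost every \<open>fs s\<close> lies in the domain,
      \<open>kconv_one\<close> replaces \<open>Q (T - s) (fs s)\<close> by \<open>fs s\<close> plus
      the time integral of \<open>G\<close> on its generator.\<close>
    also have "bochner_integral lborel (\<lambda>s. Q (T - s) (fs s)) = bochner_integral lborel (\<lambda>s. one (T - s) *\<^sub>R fs s + kconv one (T - s) (fA s))"
    proof (rule bochner_integral_cong_AE, use AE_fs_generator in eventually_elim)
      case (elim s)
      then show ?case
        using kconv_one[of "fs s" "T - s"] kconv_one_zero[of "T - s" "fA s"]
        by (cases "s < T") (auto simp: one_def Q_zero)
    qed
    also have "\<dots> = bochner_integral lborel (\<lambda>s. one (T - s) *\<^sub>R fs s) + bochner_integral lborel (\<lambda>t. one (T - t) *\<^sub>R conv fA t)"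
      using bochner_integral_add[OF ofs oc(1)] oc(3) by simp
    \<comment> \<open>\<open>generator P g\<close> need not lie in the domain, so
      \<open>kconv_one\<close> is not applied to it; reflection about \<open>T\<close> alone
      produces the corresponding part of \<open>V\<close>.\<close>
    also have "bochner_integral lborel (\<lambda>s. Q (T - s) (ga s)) = set_bochner_integral lborel {0<..<T} (\<lambda>t. Q t (generator P g))"
    proof -
      have sm: "strongly_measurable lborel (\<lambda>t. indicat_real {0<..<T} t *\<^sub>R Q t (generator P g))"
        using Q_ga_integrable[of T] T by (simp add: bochner_integrable_def)
      have "Q (T - s) (ga s) = indicat_real {0<..<T} (T + (- 1) * s) *\<^sub>R Q (T + (- 1) * s) (generator P g)" for s
        using T by (cases "s < T") (auto simp: ga_def indicator_def Q_zero blinfun.zero_right)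
      then show ?thesis
        using bochner_integral_lborel_affine(2)[OF sm, of "- 1" T] by simp
    qed
    also have "bochner_integral lborel (\<lambda>s. one (T - s) *\<^sub>R fs s) + bochner_integral lborel (\<lambda>t. one (T - t) *\<^sub>R conv fA t) +
        set_bochner_integral lborel {0<..<T} (\<lambda>t. Q t (generator P g)) =
      bochner_integral lborel (\<lambda>t. one (T - t) *\<^sub>R fs t + one (T - t) *\<^sub>R conv fA t + indicat_real {0<..<T} t *\<^sub>R Q t (generator P g))"
      using bochner_integral_add[OF bochner_integrable_add[OF ofs oc(2)] Q_ga_integrable, of T] bochner_integral_add[OF ofs oc(2)] T by simp
    also have "\<dots> = set_bochner_integral lborel {0<..<T} (\<lambda>t. f t + generator P (u t))"
    proof (rule bochner_integral_cong_AE, use gen fs(4) in eventually_elim)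
      case (elim t)
      show ?case
        using elim T conv_fA_zero[of t] data_zero(1)[of t]
        by (cases "0 < t"; cases "t < T") (auto simp: V_def one_def)
    qed
    finally show ?thesis
      unfolding eq using wc(2) by blast
  qed
  ultimately show ?thesis
    unfolding strong_solution_def by blast
qed

end

section \<open>Uniqueness of the strong solution\<close>

context fractional_cauchy_problem
begin

text \<open>\<open>d\<close> is bounded and vanishes at nonpositive times, so only the integral of
  \<open>w\<close> over \<open>{..\<tau>}\<close> counts. It lets \<open>G t\<close> pass inside the
  convolution with \<open>w\<close>.\<close>

lemma w_translate_integrable:
  assumes d: "ps_measurable lborel d" "\<And>s. norm (d s) \<le> b" "\<And>s. s \<le> 0 \<Longrightarrow> d s = 0"
  shows "bochner_integrable lborel (\<lambda>s. w (\<tau> - s) *\<^sub>R d s)"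
proof (rule bochner_integrableI_ps)
  have b: "0 \<le> b" using d(2)[of 0] norm_ge_zero order.trans by blast
  show "ps_measurable lborel (\<lambda>s. w (\<tau> - s) *\<^sub>R d s)"
    by (intro ps_measurable_scaleR d) measurable
  have "(\<integral>\<^sup>+s. ennreal (norm (w (\<tau> - s) *\<^sub>R d s)) \<partial>lborel) \<le> (\<integral>\<^sup>+s. ennreal b * (ennreal (w (\<tau> - s)) * indicator {..\<tau>} (\<tau> - s)) \<partial>lborel)"
  proof (rule nn_integral_mono)
    fix s
    show "ennreal (norm (w (\<tau> - s) *\<^sub>R d s)) \<le> ennreal b * (ennreal (w (\<tau> - s)) * indicator {..\<tau>} (\<tau> - s))"
    proof (cases "s \<le> 0")
      case True
      then show ?thesis by (simp add: d(3))
    next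
      case False
      then show ?thesis
        using mult_left_mono[OF d(2)[of s] w_nonneg[of "\<tau> - s"]] b
        by (simp add: w_nonneg ennreal_mult[symmetric] ennreal_leI mult.commute)
    qed
  qed
  also have "\<dots> = (\<integral>\<^sup>+s. ennreal b * (ennreal (w s) * indicator {..\<tau>} s) \<partial>lborel)"
    using nn_integral_lborel_reflect[of "\<lambda>s. ennreal b * (ennreal (w s) * indicator {..\<tau>} s)" \<tau>] by simp
  also have "\<dots> = ennreal b * (\<integral>\<^sup>+s. ennreal (w s) * indicator {..\<tau>} s \<partial>lborel)"
    by (rule nn_integral_cmult) measurable
  also have "\<dots> < \<infinity>"
    using nn_integral_w_finite[of \<tau>] by (simp add: ennreal_mult_less_top)
  finally show "(\<integral>\<^sup>+s. ennreal (norm (w (\<tau> - s) *\<^sub>R d s)) \<partial>lborel) < \<infinity>" .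
qed

lemma one_translate_integrable:
  assumes e: "ps_measurable lborel e" "(\<integral>\<^sup>+s. ennreal (norm (e s)) \<partial>lborel) < \<infinity>"
  shows "bochner_integrable lborel (\<lambda>s. one (\<tau> - s) *\<^sub>R e s)"
proof (rule bochner_integrableI_ps)
  show "ps_measurable lborel (\<lambda>s. one (\<tau> - s) *\<^sub>R e s)"
    by (intro ps_measurable_scaleR e measurable_compose[OF _ one_kernel(1)]) measurable
  have "(\<integral>\<^sup>+s. ennreal (norm (one (\<tau> - s) *\<^sub>R e s)) \<partial>lborel) \<le> (\<integral>\<^sup>+s. ennreal (norm (e s)) \<partial>lborel)"
    by (intro nn_integral_mono ennreal_leI) (auto simp: one_def indicator_def)
  then show "(\<integral>\<^sup>+s. ennreal (norm (one (\<tau> - s) *\<^sub>R e s)) \<partial>lborel) < \<infinity>"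
    using e(2) by (rule order.strict_trans1)
qed

lemma homogeneous_solution_zero:
  assumes d: "ps_measurable lborel d" "\<And>s. norm (d s) \<le> b" "\<And>s. s \<notin> {0<..T0} \<Longrightarrow> d s = 0"
    and cont: "continuous_on {0<..T0} d"
    and e: "ps_measurable lborel e" "(\<integral>\<^sup>+s. ennreal (norm (e s)) \<partial>lborel) < \<infinity>" "\<And>s. s \<notin> {0<..T0} \<Longrightarrow> e s = 0"
    and gen: "AE s in lborel. d s \<in> generator_dom P \<and> generator P (d s) = e s"
    and eq: "\<And>T. T \<in> {0<..T0} \<Longrightarrow> bochner_integral lborel (\<lambda>s. w (T - s) *\<^sub>R d s) = bochner_integral lborel (\<lambda>s. one (T - s) *\<^sub>R e s)"
    and t: "t \<in> {0<..T0}"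
  shows "d t = 0"
proof -
  have d0: "\<And>s. s \<le> 0 \<Longrightarrow> d s = 0" and e0: "\<And>s. s \<le> 0 \<Longrightarrow> e s = 0"
    using d(3) e(3) by simp_all
  have dfin: "(\<integral>\<^sup>+s. ennreal (norm (d s)) \<partial>lborel) < \<infinity>"
    by (rule nn_integral_bounded_Ioc[OF d(2,3)])
  \<comment> \<open>The equation is used at all \<open>T - t\<close> with \<open>t > 0\<close>, also
    at nonpositive arguments, where both sides vanish.\<close>
  have eq': "bochner_integral lborel (\<lambda>s. w (T - s) *\<^sub>R d s) = bochner_integral lborel (\<lambda>s. one (T - s) *\<^sub>R e s)" if "T \<le> T0" for T
  proof (cases "0 < T")
    case True
    then show ?thesis using eq[of T] that by simp
  next
    case False
    have "w (T - s) *\<^sub>R d s = 0" "one (T - s) *\<^sub>R e s = 0" for s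
      using False d0[of s] e0[of s] by (cases "s \<le> 0"; simp add: w_def one_def)+
    then show ?thesis by (simp only:)
  qed
  have zero: "bochner_integral lborel (\<lambda>s. one (T - s) *\<^sub>R d s) = 0" if T: "T \<in> {0<..T0}" for T
  proof -
    have iw: "bochner_integral lborel (\<lambda>t. G t (bochner_integral lborel (\<lambda>s. w (T - t - s) *\<^sub>R d s))) = bochner_integral lborel (\<lambda>s. kconv w (T - s) (d s))"
      by (rule bochner_integral_G_conv[OF w_measurable w_nonneg w_kernel[of T0] _ d(1) dfin])
         (use d0 T in \<open>auto intro!: w_translate_integrable[OF d(1,2)]\<close>)
    have io: "bochner_integral lborel (\<lambda>t. G t (bochner_integral lborel (\<lambda>s. one (T - t - s) *\<^sub>R e s))) = bochner_integral lborel (\<lambda>s. kconv one (T - s) (e s))"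
      by (rule bochner_integral_G_conv[OF one_kernel(1,2) one_kernel(3)[of T0] nn_integral_q_finite e(1,2)])
         (use e0 T in \<open>auto intro!: one_translate_integrable[OF e(1,2)]\<close>)
    \<comment> \<open>\<open>G t\<close> is applied to the equation at \<open>T - t\<close>;
      integrated over \<open>t\<close>, this is the convolution of both sides with
      \<open>G\<close>.\<close>
    have "G t (bochner_integral lborel (\<lambda>s. w (T - t - s) *\<^sub>R d s)) = G t (bochner_integral lborel (\<lambda>s. one (T - t - s) *\<^sub>R e s))" for t
      using eq'[of "T - t"] T by (cases "0 < t") (simp_all add: G_zero)
    then have same: "bochner_integral lborel (\<lambda>s. kconv w (T - s) (d s)) = bochner_integral lborel (\<lambda>s. kconv one (T - s) (e s))"
      using iw io by simp
    have AEw: "AE s in lborel. kconv w (T - s) (d s) = Q (T - s) (d s)"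
      using AE_lborel_reflect[OF AE_kconv_w, of T] by eventually_elim simp
    have AEo: "AE s in lborel. kconv one (T - s) (e s) = Q (T - s) (d s) - one (T - s) *\<^sub>R d s"
      using gen
    proof eventually_elim
      case (elim s)
      then show ?case
        using kconv_one[of "d s" "T - s"] kconv_one_zero[of "T - s" "e s"]
        by (cases "s < T") (auto simp: one_def Q_zero)
    qed
    \<comment> \<open>Integrability is what permits cancelling this integral from both
      sides.\<close>
    have iQ: "bochner_integrable lborel (\<lambda>s. Q (T - s) (d s))"
      by (rule bochner_integral_w_conv(1)[OF d(1) dfin d0])
    have "bochner_integral lborel (\<lambda>s. Q (T - s) (d s)) = bochner_integral lborel (\<lambda>s. Q (T - s) (d s) - one (T - s) *\<^sub>R d s)"
      using same bochner_integral_cong_AE[OF AEw] bochner_integral_cong_AE[OF AEo] by simp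
    also have "\<dots> = bochner_integral lborel (\<lambda>s. Q (T - s) (d s)) - bochner_integral lborel (\<lambda>s. one (T - s) *\<^sub>R d s)"
      by (rule bochner_integral_diff[OF iQ one_translate_integrable[OF d(1) dfin]])
    finally show ?thesis by simp
  qed
  have int: "set_bochner_integrable lborel {0<..T} d" for T
  proof (rule bochner_integrableI_ps[OF ps_measurable_indicator_scaleR[OF _ d(1)]])
    have "(\<integral>\<^sup>+s. ennreal (norm (indicat_real {0<..T} s *\<^sub>R d s)) \<partial>lborel) \<le> (\<integral>\<^sup>+s. ennreal (norm (d s)) \<partial>lborel)"
      by (intro nn_integral_mono ennreal_leI) (simp add: indicator_def)
    then show "(\<integral>\<^sup>+s. ennreal (norm (indicat_real {0<..T} s *\<^sub>R d s)) \<partial>lborel) < \<infinity>"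
      using dfin by (rule order.strict_trans1)
  qed simp
  have zero': "set_bochner_integral lborel {0<..T} d = 0" if T: "T \<in> {0<..T0}" for T
  proof -
    have "AE s in lborel. indicat_real {0<..T} s *\<^sub>R d s = one (T - s) *\<^sub>R d s"
      using AE_lborel_singleton[of T]
    proof eventually_elim
      case (elim s)
      then show ?case using d0[of s] by (cases "0 < s") (auto simp: one_def indicator_def)
    qed
    from bochner_integral_cong_AE[OF this] zero[OF T] show ?thesis by simp
  qed
  \<comment> \<open>By subtraction the integral of \<open>d\<close> over each
    \<open>(a, a + \<eta>]\<close> is 0, while its averages tend to \<open>d a\<close> by
    continuity. This needs room to the right of \<open>a\<close>.\<close>
  have dz: "d a = 0" if a: "0 < a" "a < T0" for a
  proof (rule tendsto_unique)
    have intv: "set_bochner_integral lborel {a<..a + \<eta>} d = 0" if "0 < \<eta>" "\<eta> \<le> T0 - a" for \<eta>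
    proof -
      have "set_bochner_integral lborel {0<..a + \<eta>} d = set_bochner_integral lborel {0<..a} d + set_bochner_integral lborel {a<..a + \<eta>} d"
        using a that by (intro set_bochner_integral_split int) auto
      then show ?thesis using zero'[of "a + \<eta>"] zero'[of a] a that by simp
    qed
    have "(d \<longlongrightarrow> d a) (at a within {0<..T0})"
      using cont a by (auto simp: continuous_on_def)
    then have "(d \<longlongrightarrow> d a) (at a within {a..T0})"
      by (rule tendsto_within_subset) (use a in auto)
    then have "(d \<longlongrightarrow> d a) (at_right a)"
      using a by (simp add: at_within_Icc_at_right)
    then show "((\<lambda>\<eta>. (1 / \<eta>) *\<^sub>R set_bochner_integral lborel {a<..a + \<eta>} d) \<longlongrightarrow> d a) (at_right 0)"
      using a by (intro set_bochner_integral_average[of "T0 - a"] set_bochner_integrable_subset[OF int[of T0]]) auto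
    have "\<forall>\<^sub>F \<eta> in at_right 0. 0 = (1 / \<eta>) *\<^sub>R set_bochner_integral lborel {a<..a + \<eta>} d"
      unfolding eventually_at_right_field using intv a by (intro exI[of _ "T0 - a"]) auto
    then show "((\<lambda>\<eta>. (1 / \<eta>) *\<^sub>R set_bochner_integral lborel {a<..a + \<eta>} d) \<longlongrightarrow> 0) (at_right 0)"
      by (rule Lim_transform_eventually[OF tendsto_const])
  qed simp
  show ?thesis
  proof (cases "t < T0")
    case True
    then show ?thesis using dz[of t] t by simp
  next
    \<comment> \<open>There are no times to the right of \<open>T0\<close>, so the end point is
      reached by continuity from the left.\<close>
    case False
    then have tT: "t = T0" using t by simp
    have cl: "closure {T0 / 2<..<T0} = {T0 / 2..T0}"
      using T0 by simp
    have "continuous_on (closure {T0 / 2<..<T0}) d"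
      unfolding cl using T0 by (intro continuous_on_subset[OF cont]) auto
    from continuous_constant_on_closure[OF this, of 0 T0] show ?thesis
      unfolding tT cl using dz T0 by simp
  qed
qed

text \<open>The difference of two solutions satisfies the homogeneous equation. Solutions are
  prescribed on the time interval only, so the difference is set to 0 elsewhere before
  convolving.\<close>

lemma strong_solution_unique:
  assumes v: "strong_solution (levy_tail \<nu>) P T0 g f v" "strong_solution (levy_tail \<nu>) P T0 g f v'" and t: "t \<in> {0<..T0}"
  shows "v t = v' t"
proof -
  have V: "bounded (x ` {0<..T0})" "continuous_on {0<..T0} x" "AE t in lborel. t \<in> {0<..T0} \<longrightarrow> x t \<in> generator_dom P"
    "set_bochner_integrable lborel {0<..T0} (\<lambda>t. generator P (x t))"
    "\<And>T. T \<in> {0<..T0} \<Longrightarrow> set_bochner_integrable lborel {0<..<T} (\<lambda>t. levy_tail \<nu> (T - t) *\<^sub>R (x t - g))"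
    "\<And>T. T \<in> {0<..T0} \<Longrightarrow> set_bochner_integral lborel {0<..<T} (\<lambda>t. levy_tail \<nu> (T - t) *\<^sub>R (x t - g)) =
        set_bochner_integral lborel {0<..<T} (\<lambda>t. f t + generator P (x t))"
    if "strong_solution (levy_tail \<nu>) P T0 g f x" for x
    using that unfolding strong_solution_def by blast+
  note V1 = V[OF v(1)] and V2 = V[OF v(2)]
  have cont: "continuous_on {0<..T0} (\<lambda>t. v t - v' t)"
    by (intro continuous_intros V1 V2)
  define d where "d t = indicat_real {0<..T0} t *\<^sub>R (v t - v' t)" for t
  obtain b1 b2 where b: "\<And>t. t \<in> {0<..T0} \<Longrightarrow> norm (v t) \<le> b1" "\<And>t. t \<in> {0<..T0} \<Longrightarrow> norm (v' t) \<le> b2"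
    using V1(1) V2(1) unfolding bounded_iff by blast
  have d: "ps_measurable lborel d" "\<And>s. s \<notin> {0<..T0} \<Longrightarrow> d s = 0"
    unfolding d_def[abs_def] using ps_measurable_continuous_on_Ioc[OF cont T0] by simp_all
  have d_b: "norm (d s) \<le> \<bar>b1\<bar> + \<bar>b2\<bar>" for s
  proof (cases "s \<in> {0<..T0}")
    case True
    then show ?thesis
      using norm_triangle_ineq4[of "v s" "v' s"] b[OF True] by (simp add: d_def)
  qed (simp add: d_def)
  have d_cont: "continuous_on {0<..T0} d"
    using cont by (rule continuous_on_eq) (simp add: d_def)
  have I: "{0<..T0} \<in> sets lborel" by simp
  have "set_bochner_integrable lborel {0<..T0} (\<lambda>t. generator P (v t) - generator P (v' t))"
    using bochner_integrable_diff[OF V1(4) V2(4)] by (simp add: scaleR_diff_right)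
  from set_bochner_integrable_representative[OF this I]
  obtain e where e: "ps_measurable lborel e" "(\<integral>\<^sup>+s. ennreal (norm (e s)) \<partial>lborel) < \<infinity>" "\<And>s. s \<notin> {0<..T0} \<Longrightarrow> e s = 0"
    "AE s in lborel. s \<in> {0<..T0} \<longrightarrow> generator P (v s) - generator P (v' s) = e s" by blast
  have gen: "AE s in lborel. d s \<in> generator_dom P \<and> generator P (d s) = e s"
    using V1(3) V2(3) e(4)
  proof eventually_elim
    case (elim s)
    then show ?case
      using generator_zero generator_diff[of "v s" "v' s"] e(3)[of s] by (cases "s \<in> {0<..T0}") (auto simp: d_def)
  qed
  have eq: "bochner_integral lborel (\<lambda>s. w (T - s) *\<^sub>R d s) = bochner_integral lborel (\<lambda>s. one (T - s) *\<^sub>R e s)" if T: "T \<in> {0<..T0}" for T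
  proof -
    \<comment> \<open>\<open>f\<close> is integrable since it is bounded on a finite interval; the
      two right-hand sides can then be subtracted under one integral, which removes
      \<open>f\<close>.\<close>
    have fint: "set_bochner_integrable lborel {0<..T0} f"
    proof -
      have "AE s in lborel. indicat_real {0<..T0} s *\<^sub>R f s = fs s"
        using fs(4)
      proof eventually_elim
        case (elim s)
        then show ?case using fs(3)[of s] by (cases "s \<in> {0<..T0}") simp_all
      qed
      then show ?thesis
        using bochner_integrableI_ps[OF fs(1) fs_fin] by (rule bochner_integrable_cong_AE[THEN iffD2])
    qed
    have sub: "set_bochner_integrable lborel {0<..<T} F" if "set_bochner_integrable lborel {0<..T0} F" for F :: "real \<Rightarrow> 'b"
      using T by (intro set_bochner_integrable_subset[OF that]) auto
    have fv: "set_bochner_integrable lborel {0<..<T} (\<lambda>t. f t + generator P (x t))"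
      if "set_bochner_integrable lborel {0<..T0} (\<lambda>t. generator P (x t))" for x
      using bochner_integrable_add[OF sub[OF fint] sub[OF that]] by (simp add: scaleR_add_right)
    have "(\<lambda>s. w (T - s) *\<^sub>R d s) = (\<lambda>s. indicat_real {0<..<T} s *\<^sub>R levy_tail \<nu> (T - s) *\<^sub>R (v s - g) - indicat_real {0<..<T} s *\<^sub>R levy_tail \<nu> (T - s) *\<^sub>R (v' s - g))"
    proof (rule ext)
      fix s
      show "w (T - s) *\<^sub>R d s = indicat_real {0<..<T} s *\<^sub>R levy_tail \<nu> (T - s) *\<^sub>R (v s - g) - indicat_real {0<..<T} s *\<^sub>R levy_tail \<nu> (T - s) *\<^sub>R (v' s - g)"
        using T by (cases "0 < s"; cases "s < T") (auto simp: w_def d_def simp flip: scaleR_diff_right)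
    qed
    then have "bochner_integral lborel (\<lambda>s. w (T - s) *\<^sub>R d s) =
      set_bochner_integral lborel {0<..<T} (\<lambda>t. f t + generator P (v t)) - set_bochner_integral lborel {0<..<T} (\<lambda>t. f t + generator P (v' t))"
      using bochner_integral_diff[OF V1(5)[OF T] V2(5)[OF T]] V1(6)[OF T] V2(6)[OF T] by simp
    also have "\<dots> = bochner_integral lborel (\<lambda>t. indicat_real {0<..<T} t *\<^sub>R (f t + generator P (v t)) - indicat_real {0<..<T} t *\<^sub>R (f t + generator P (v' t)))"
      by (rule bochner_integral_diff[OF fv[OF V1(4)] fv[OF V2(4)], symmetric])
    also have "\<dots> = bochner_integral lborel (\<lambda>s. one (T - s) *\<^sub>R e s)"
    proof (rule bochner_integral_cong_AE, use e(4) in eventually_elim)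
      case (elim s)
      then show ?case
        using T e(3)[of s] by (cases "0 < s"; cases "s < T") (auto simp: one_def)
    qed
    finally show ?thesis .
  qed
  have "d t = 0"
    by (rule homogeneous_solution_zero[OF d(1) d_b d(2) d_cont e(1-3) gen eq t])
  then show ?thesis using t by (simp add: d_def)
qed

end

theorem theorem1p1:
  fixes M :: "'a measure" and S :: "real \<Rightarrow> 'a \<Rightarrow> real" and \<nu> :: "real measure"
    and pbar :: "real \<Rightarrow> real \<Rightarrow> real"
    and P :: "real \<Rightarrow> 'b::banach \<Rightarrow>\<^sub>L 'b"
    and T\<^sub>0 K :: real and g :: 'b and f u :: "real \<Rightarrow> 'b"
  assumes "driftless_subordinator M S \<nu>"
    and "emeasure \<nu> {0<..} = \<infinity>"
    and density: "\<And>r. 0 < r \<Longrightarrow> distributed M lborel (S r) (\<lambda>x. ennreal (pbar r x))"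
    and density_nonneg: "\<And>r x. 0 < r \<Longrightarrow> 0 \<le> pbar r x"
    and density_bounded: "\<And>r. 0 < r \<Longrightarrow> \<exists>C. \<forall>x. pbar r x \<le> C"
    and density_measurable:
      "(\<lambda>(r, x). pbar r x) \<in> borel_measurable (restrict_space borel ({0<..} \<times> UNIV))"
    and "C0_semigroup P"
    and uniformly_bounded: "\<exists>C. \<forall>t>0. norm (P t) \<le> C"
    and "0 < T\<^sub>0"
    and "g \<in> generator_dom P"
    and "set_strongly_measurable lborel {0<..T\<^sub>0} f"
    and "AE t in lborel. t \<in> {0<..T\<^sub>0} \<longrightarrow> f t \<in> generator_dom P"
    and "set_bochner_integrable lborel {0<..T\<^sub>0} (\<lambda>t. generator P (f t))"
    and "AE t in lborel. t \<in> {0<..T\<^sub>0} \<longrightarrow> norm (f t) \<le> K"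
    and u_def: "\<And>t. t \<in> {0<..T\<^sub>0} \<Longrightarrow>
      u t = bochner_integral M (\<lambda>\<omega>. P (inverse_subordinator S t \<omega>) g) +
            bochner_integral M (\<lambda>\<omega>. set_bochner_integral lborel {0<..}
              (\<lambda>r. indicat_real {r. S r \<omega> < t} r *\<^sub>R P r (f (t - S r \<omega>))))"
  shows
    \<comment> \<open>the integrals defining \<open>u t\<close> converge in the Banach space\<close>
    "(\<forall>t\<in>{0<..T\<^sub>0}.
        bochner_integrable M (\<lambda>\<omega>. P (inverse_subordinator S t \<omega>) g) \<and>
        (AE \<omega> in M. set_bochner_integrable lborel {0<..}
           (\<lambda>r. indicat_real {r. S r \<omega> < t} r *\<^sub>R P r (f (t - S r \<omega>)))) \<and>
        bochner_integrable M (\<lambda>\<omega>. set_bochner_integral lborel {0<..}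
           (\<lambda>r. indicat_real {r. S r \<omega> < t} r *\<^sub>R P r (f (t - S r \<omega>))))) \<and>
     \<comment> \<open>the second representation of \<open>u\<close>\<close>
     (\<forall>t\<in>{0<..T\<^sub>0}.
        (AE s in lborel. s \<in> {0<..<t} \<longrightarrow>
           set_bochner_integrable lborel {0<..} (\<lambda>r. pbar r (t - s) *\<^sub>R P r (f s))) \<and>
        set_bochner_integrable lborel {0<..<t}
          (\<lambda>s. set_bochner_integral lborel {0<..} (\<lambda>r. pbar r (t - s) *\<^sub>R P r (f s))) \<and>
        u t = bochner_integral M (\<lambda>\<omega>. P (inverse_subordinator S t \<omega>) g) +
              set_bochner_integral lborel {0<..<t}
                (\<lambda>s. set_bochner_integral lborel {0<..} (\<lambda>r. pbar r (t - s) *\<^sub>R P r (f s)))) \<and>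
     \<comment> \<open>existence and uniqueness\<close>
     strong_solution (levy_tail \<nu>) P T\<^sub>0 g f u \<and>
     (\<forall>v. strong_solution (levy_tail \<nu>) P T\<^sub>0 g f v \<longrightarrow> (\<forall>t\<in>{0<..T\<^sub>0}. v t = u t))"
proof -
  obtain C where "bounded_C0_semigroup P C"
    using bounded_C0_semigroupI[OF assms(7) uniformly_bounded] .
  then interpret bounded_C0_semigroup P C .
  interpret driftless_subordinator M S \<nu> by fact
  interpret fractional_cauchy_problem M S \<nu> pbar P C T\<^sub>0 K g f
    by unfold_locales (fact assms)+
  \<comment> \<open>Identifies the probabilistic formula with \<open>U\<close>, to which the
    existence result applies.\<close>
  have u: "u t = U t" if t: "t \<in> {0<..T\<^sub>0}" for t
    using u_def[OF t] first_representation(4,5)[OF t] by (simp add: U_def)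
  have sol: "strong_solution (levy_tail \<nu>) P T\<^sub>0 g f u"
    by (rule strong_solution_U[OF u])
  show ?thesis
  proof (intro conjI ballI allI impI)
    fix t assume t: "t \<in> {0<..T\<^sub>0}"
    show "bochner_integrable M (\<lambda>\<omega>. P (inverse_subordinator S t \<omega>) g)"
      by (rule first_representation(1)[OF t])
    show "AE \<omega> in M. set_bochner_integrable lborel {0<..}
           (\<lambda>r. indicat_real {r. S r \<omega> < t} r *\<^sub>R P r (f (t - S r \<omega>)))"
      by (rule first_representation(2)[OF t])
    show "bochner_integrable M (\<lambda>\<omega>. set_bochner_integral lborel {0<..}
           (\<lambda>r. indicat_real {r. S r \<omega> < t} r *\<^sub>R P r (f (t - S r \<omega>))))"
      by (rule first_representation(3)[OF t])
    show "AE s in lborel. s \<in> {0<..<t} \<longrightarrow>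
           set_bochner_integrable lborel {0<..} (\<lambda>r. pbar r (t - s) *\<^sub>R P r (f s))"
      by (rule second_representation(1)[OF t])
    show "set_bochner_integrable lborel {0<..<t}
          (\<lambda>s. set_bochner_integral lborel {0<..} (\<lambda>r. pbar r (t - s) *\<^sub>R P r (f s)))"
      by (rule second_representation(2)[OF t])
    show "u t = bochner_integral M (\<lambda>\<omega>. P (inverse_subordinator S t \<omega>) g) +
              set_bochner_integral lborel {0<..<t}
                (\<lambda>s. set_bochner_integral lborel {0<..} (\<lambda>r. pbar r (t - s) *\<^sub>R P r (f s)))"
      using u[OF t] first_representation(4)[OF t] second_representation(3)[OF t] by (simp add: U_def)
    show "v t = u t" if "strong_solution (levy_tail \<nu>) P T\<^sub>0 g f v" for v
      by (rule strong_solution_unique[OF that sol t])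
  qed (rule sol)
qed

end
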